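(* Let $\mathbb{D}=(\mathbb{R}/L\mathbb{Z})^d$, let $\rho$ be a probability density on $\mathbb{D}$ bounded away from zero with $\rho\in W^{s,\infty}$ for some $s>2$, and let $x^1,\dots,x^M\in\mathbb{D}$ be sample points. There exist constants $Z_0,C_9,C_{10}>0$, depending only on $d,L,s,\|\log\rho\|_{W^{s,\infty}},\varepsilon_0$, such that if $\zeta=Z_0\varepsilon^{1/2}$ and $$\delta:=\|\mathcal{K}^M_{\varepsilon/2}-\mathcal{K}_{\varepsilon/2}\|_{H^\infty(\mathbb{D}_\zeta)\to C^0(\mathbb{D})}\le C_9,$$ then for all $0<\varepsilon\le\varepsilon_0$ and $n\in\mathbb{N}$, $$\|\mathcal P^M_\varepsilon-\mathcal P_\varepsilon\|_{\zeta},\quad\|\mathcal G^M_\varepsilon-\mathcal G_\varepsilon\|_{0\to\zeta},\quad\|\mathcal H^M_\varepsilon-\mathcal H_\varepsilon\|_{\zeta\to0}\ \le\ C_{10}\,\delta,$$ and $$\|\mathcal Q^M_{\varepsilon,n}-\mathcal Q_{\varepsilon,n}\|_0\le C_{10}\,\delta\,n.$$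
   Context: $\varepsilon_0>0$ is a fixed upper limit on $\varepsilon$. $W^{s,\infty}$ is the space of $\phi\in L^\infty(\mathbb{D})$ with $\|\phi\|_{W^{s,\infty}}=\|J^{s/2}\phi\|_{L^\infty}<\infty$, $J=I-\Delta$. $g_\varepsilon(x)=(2\pi\varepsilon)^{-d/2}e^{-\|x\|^2/2\varepsilon}$, $g_{\varepsilon,L}(x)=\sum_{\mathbf j\in\mathbb{Z}^d}g_\varepsilon(x+L\mathbf j)$ (extended analytically to complex arguments); $(\mathcal C_\varepsilon\phi)(x)=\int_{\mathbb{D}}g_{\varepsilon,L}(y-x)\phi(y)\,dy$; $$\mathcal K_\varepsilon\phi=\mathcal C_\varepsilon(\rho\phi),\qquad(\mathcal{K}^M_\varepsilon\phi)(x)=\frac1M\sum_{i=1}^Mg_{\varepsilon,L}(x-x^i)\phi(x^i).$$ For $\zeta>0$, $\mathbb{D}_\zeta=\{x+iz:x\in\mathbb{D},z\in[-\zeta,\zeta]^d\}$ and $H^\infty(\mathbb{D}_\zeta)$ is the space of functions continuous on $\mathbb{D}_\zeta$ and analytic in its interior, with norm $\|\phi\|_\zeta=\sup_{\mathbb{D}_\zeta}|\phi|$. For operators, $\|\cdot\|_\zeta$, $\|\cdot\|_0$, $\|\cdot\|_{0\to\zeta}$, $\|\cdot\|_{\zeta\to0}$ are the operator norms on $H^\infty(\mathbb{D}_\zeta)$, on $C^0(\mathbb{D})$, from $C^0(\mathbb{D})$ to $H^\infty(\mathbb{D}_\zeta)$, and from $H^\infty(\mathbb{D}_\zeta)$ to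 $C^0(\mathbb{D})$. A superscript $(M)$ means that the definition is made both without the superscript and with superscript $M$. The Sinkhorn weight $U^{(M)}_\varepsilon>0$ is the unique positive function with $U^{(M)}_\varepsilon\cdot(\mathcal K^{(M)}_\varepsilon U^{(M)}_\varepsilon)\equiv1$; $Y^{(M)}_\varepsilon=\mathcal K^{(M)}_{\varepsilon/2}U^{(M)}_\varepsilon$; and $$\mathcal P^{(M)}_\varepsilon\phi=U^{(M)}_\varepsilon\mathcal K^{(M)}_\varepsilon(U^{(M)}_\varepsilon\phi),\quad\mathcal G^{(M)}_\varepsilon\phi=U^{(M)}_\varepsilon\mathcal C_{\varepsilon/2}(Y^{(M)}_\varepsilon\phi),\quad\mathcal H^{(M)}_\varepsilon\phi=(Y^{(M)}_\varepsilon)^{-1}\mathcal K^{(M)}_{\varepsilon/2}(U^{(M)}_\varepsilon\phi),$$ $\mathcal Q^{(M)}_{\varepsilon,n}=(\mathcal H^{(M)}_\varepsilon\mathcal G^{(M)}_\varepsilon)^n$. *)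

theory Defs
  imports "HOL-Probability.Probability"
begin

text \<open>
  The dimension \<open>d\<close> is \<open>CARD('d)\<close>. A function on the torus
  \<open>\<real>\<^sup>d / L \<int>\<^sup>d\<close> is an \<open>L\<close>-periodic function on \<^typ>\<open>real ^ 'd\<close>, and a point
  of the torus is given by any of its representatives.
\<close>

definition cvec :: "real ^ 'd \<Rightarrow> complex ^ 'd" where
  "cvec x = (\<chi> k. complex_of_real (x $ k))"

definition re_vec :: "complex ^ 'd \<Rightarrow> real ^ 'd" where
  "re_vec w = (\<chi> k. Re (w $ k))"

definition latt :: "real \<Rightarrow> int ^ 'd \<Rightarrow> real ^ 'd" where
  "latt L j = (\<chi> k. L * real_of_int (j $ k))"

definition cell :: "real \<Rightarrow> (real ^ 'd) set" where
  "cell L = {y. \<forall>k. 0 \<le> y $ k \<and> y $ k < L}"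

definition periodic :: "real \<Rightarrow> (real ^ 'd \<Rightarrow> 'b) \<Rightarrow> bool" where
  "periodic L f \<longleftrightarrow> (\<forall>x j. f (x + latt L j) = f x)"


section \<open>Bessel potential spaces on the torus\<close>

definition Linf :: "real \<Rightarrow> (real ^ 'd \<Rightarrow> complex) set" where
  "Linf L = {f. periodic L f \<and> f \<in> borel_measurable borel \<and>
                (\<exists>B. AE x in lborel. norm (f x) \<le> B)}"

definition Linf_norm :: "(real ^ 'd \<Rightarrow> complex) \<Rightarrow> ennreal" where
  "Linf_norm f = esssup lborel (\<lambda>x. ennreal (norm (f x)))"

definition fourier_coeff :: "real \<Rightarrow> (real ^ 'd \<Rightarrow> complex) \<Rightarrow> int ^ 'd \<Rightarrow> complex" where
  "fourier_coeff L f k = complex_of_real (1 / L ^ CARD('d)) *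
     (LINT y:cell L|lborel.
        f y * exp (- (2 * of_real pi * \<i> / of_real L) * (\<Sum>l\<in>UNIV. of_int (k $ l) * of_real (y $ l))))"

text \<open>
  \<open>J_pow L s \<phi> \<psi>\<close> says that the distribution \<open>J\<^bsup>s/2\<^esup> \<phi>\<close>, with \<open>J = I - \<Delta>\<close>, is the
  bounded function \<open>\<psi>\<close>. The eigenvalue of \<open>J\<close> on the mode
  \<open>exp (2 \<pi> i k \<bullet> x / L)\<close> is \<open>1 + (2 \<pi> / L)\<^sup>2 |k|\<^sup>2\<close>.
\<close>

definition J_pow :: "real \<Rightarrow> real \<Rightarrow> (real ^ 'd \<Rightarrow> complex) \<Rightarrow> (real ^ 'd \<Rightarrow> complex) \<Rightarrow> bool" where
  "J_pow L s \<phi> \<psi> \<longleftrightarrow> \<phi> \<in> Linf L \<and> \<psi> \<in> Linf L \<and>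
     (\<forall>k. fourier_coeff L \<psi> k =
        complex_of_real ((1 + (2 * pi / L)\<^sup>2 * (\<Sum>l\<in>UNIV. (real_of_int (k $ l))\<^sup>2)) powr (s / 2))
        * fourier_coeff L \<phi> k)"

text \<open>
  \<open>\<psi>\<close> is determined up to a null set by \<open>\<phi>\<close>, so the infimum below is over equal values,
  or over the empty set when \<open>J\<^bsup>s/2\<^esup> \<phi>\<close> is not a bounded function; the norm is then \<open>\<infinity>\<close>.
\<close>

definition W_norm :: "real \<Rightarrow> real \<Rightarrow> (real ^ 'd \<Rightarrow> complex) \<Rightarrow> ennreal" where
  "W_norm L s \<phi> = (INF \<psi>\<in>{\<psi>. J_pow L s \<phi> \<psi>}. Linf_norm \<psi>)"

definition W_space :: "real \<Rightarrow> real \<Rightarrow> (real ^ 'd \<Rightarrow> complex) set" where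
  "W_space L s = {\<phi> \<in> Linf L. W_norm L s \<phi> < \<infinity>}"

definition torus_density :: "real \<Rightarrow> (real ^ 'd \<Rightarrow> real) \<Rightarrow> bool" where
  "torus_density L \<rho> \<longleftrightarrow> periodic L \<rho> \<and> \<rho> \<in> borel_measurable borel \<and>
     (AE x in lborel. 0 \<le> \<rho> x) \<and> (LINT y:cell L|lborel. \<rho> y) = 1"


section \<open>The spaces \<open>H\<^sup>\<infinity>(D\<^sub>\<zeta>)\<close> and operator norms\<close>

text \<open>
  \<open>strip \<zeta>\<close> is the lift of \<open>D\<^sub>\<zeta>\<close> to \<open>\<complex>\<^sup>d\<close>. Elements of \<open>H\<^sup>\<infinity>(D\<^sub>\<zeta>)\<close> are represented by
  functions on all of \<open>\<complex>\<^sup>d\<close> of which only the values on \<open>strip \<zeta>\<close> matter. Since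
  \<open>strip 0\<close> is the set of real points and has empty interior, \<open>Hinf L 0\<close> is \<open>C\<^sup>0(D)\<close>.
\<close>

definition strip :: "real \<Rightarrow> (complex ^ 'd) set" where
  "strip \<zeta> = {w. \<forall>k. \<bar>Im (w $ k)\<bar> \<le> \<zeta>}"

definition holo_at :: "(complex ^ 'd \<Rightarrow> complex) \<Rightarrow> complex ^ 'd \<Rightarrow> bool" where
  "holo_at \<phi> w \<longleftrightarrow> (\<exists>\<phi>'. (\<phi> has_derivative \<phi>') (at w) \<and> (\<forall>c v. \<phi>' (c *s v) = c * \<phi>' v))"

definition Hinf :: "real \<Rightarrow> real \<Rightarrow> (complex ^ 'd \<Rightarrow> complex) set" where
  "Hinf L \<zeta> = {\<phi>. (\<forall>w\<in>strip \<zeta>. \<forall>j. \<phi> (w + cvec (latt L j)) = \<phi> w) \<and>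
                  continuous_on (strip \<zeta>) \<phi> \<and>
                  (\<forall>w\<in>interior (strip \<zeta>). holo_at \<phi> w)}"

definition Hnorm :: "real \<Rightarrow> (complex ^ 'd \<Rightarrow> complex) \<Rightarrow> ennreal" where
  "Hnorm \<zeta> \<phi> = (SUP w\<in>strip \<zeta>. ennreal (norm (\<phi> w)))"

type_synonym 'd cop = "(complex ^ 'd \<Rightarrow> complex) \<Rightarrow> complex ^ 'd \<Rightarrow> complex"

text \<open>
  Norm of \<open>T\<close> as an operator from \<open>H\<^sup>\<infinity>(D\<^sub>a)\<close> to \<open>H\<^sup>\<infinity>(D\<^sub>b)\<close>; it is \<open>\<infinity>\<close> if \<open>T\<close> does not map
  the first space into the second.
\<close>

definition op_norm :: "real \<Rightarrow> real \<Rightarrow> real \<Rightarrow> ('d::finite) cop \<Rightarrow> ennreal" where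
  "op_norm L a b T =
     (if \<forall>\<phi>\<in>Hinf L a. T \<phi> \<in> Hinf L b
      then (SUP \<phi>\<in>{\<phi> \<in> Hinf L a. Hnorm a \<phi> \<le> 1}. Hnorm b (T \<phi>)) else \<infinity>)"


section \<open>Kernel operators\<close>

definition gauss :: "real \<Rightarrow> complex ^ 'd \<Rightarrow> complex" where
  "gauss \<epsilon> w = complex_of_real ((2 * pi * \<epsilon>) powr (- real CARD('d) / 2)) *
     exp (- (\<Sum>k\<in>UNIV. (w $ k)\<^sup>2) / of_real (2 * \<epsilon>))"

definition gauss_per :: "real \<Rightarrow> real \<Rightarrow> complex ^ 'd \<Rightarrow> complex" where
  "gauss_per L \<epsilon> w = (\<Sum>\<^sub>\<infinity>j. gauss \<epsilon> (w + cvec (latt L j)))"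

text \<open>
  All operators below use their argument at real points only, and produce a function of a
  complex argument through the analytic extension of the kernel.
\<close>

definition C_op :: "real \<Rightarrow> real \<Rightarrow> ('d::finite) cop" where
  "C_op L \<epsilon> \<phi> w = (LINT y:cell L|lborel. gauss_per L \<epsilon> (cvec y - w) * \<phi> (cvec y))"

definition K_op :: "real \<Rightarrow> (real ^ 'd \<Rightarrow> real) \<Rightarrow> real \<Rightarrow> ('d::finite) cop" where
  "K_op L \<rho> \<epsilon> \<phi> = C_op L \<epsilon> (\<lambda>w. complex_of_real (\<rho> (re_vec w)) * \<phi> w)"

definition KM_op :: "real \<Rightarrow> nat \<Rightarrow> (nat \<Rightarrow> real ^ 'd) \<Rightarrow> real \<Rightarrow> ('d::finite) cop" where
  "KM_op L M x \<epsilon> \<phi> w =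
     1 / of_nat M * (\<Sum>i = 1..M. gauss_per L \<epsilon> (w - cvec (x i)) * \<phi> (cvec (x i)))"


section \<open>Sinkhorn weights and the normalised operators\<close>

text \<open>
  The remaining definitions are made for a family \<open>K :: real \<Rightarrow> 'd cop\<close> indexed by \<open>\<epsilon>\<close>, to be
  instantiated with \<^term>\<open>K_op L \<rho>\<close> (no superscript) and \<^term>\<open>KM_op L M x\<close>
  (superscript \<open>M\<close>).

  \<open>sinkhorn\<close> is the weight on the torus itself. Its analytic extension to complex arguments is
  \<open>1 / (K\<^sub>\<epsilon> U\<^sub>\<epsilon>)\<close>, which is how \<open>U_wt\<close> is defined; the two agree at real points.
  No regularity of \<open>u\<close> is imposed: the equation itself excludes non-integrable \<open>u\<close> (whose
  integral is \<open>0\<close> by convention) and makes \<open>u\<close> the reciprocal of a continuous function.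
\<close>

definition sinkhorn :: "real \<Rightarrow> (real \<Rightarrow> ('d::finite) cop) \<Rightarrow> real \<Rightarrow> real ^ 'd \<Rightarrow> real" where
  "sinkhorn L K \<epsilon> = (THE u. periodic L u \<and> (\<forall>x. 0 < u x) \<and>
     (\<forall>x. complex_of_real (u x) * K \<epsilon> (\<lambda>w. complex_of_real (u (re_vec w))) (cvec x) = 1))"

definition U_wt :: "real \<Rightarrow> (real \<Rightarrow> ('d::finite) cop) \<Rightarrow> real \<Rightarrow> complex ^ 'd \<Rightarrow> complex" where
  "U_wt L K \<epsilon> w = 1 / K \<epsilon> (\<lambda>v. complex_of_real (sinkhorn L K \<epsilon> (re_vec v))) w"

definition Y_wt :: "real \<Rightarrow> (real \<Rightarrow> ('d::finite) cop) \<Rightarrow> real \<Rightarrow> complex ^ 'd \<Rightarrow> complex" where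
  "Y_wt L K \<epsilon> = K (\<epsilon> / 2) (U_wt L K \<epsilon>)"

definition P_op :: "real \<Rightarrow> (real \<Rightarrow> ('d::finite) cop) \<Rightarrow> real \<Rightarrow> 'd cop" where
  "P_op L K \<epsilon> \<phi> w = U_wt L K \<epsilon> w * K \<epsilon> (\<lambda>v. U_wt L K \<epsilon> v * \<phi> v) w"

definition G_op :: "real \<Rightarrow> (real \<Rightarrow> ('d::finite) cop) \<Rightarrow> real \<Rightarrow> 'd cop" where
  "G_op L K \<epsilon> \<phi> w = U_wt L K \<epsilon> w * C_op L (\<epsilon> / 2) (\<lambda>v. Y_wt L K \<epsilon> v * \<phi> v) w"

definition H_op :: "real \<Rightarrow> (real \<Rightarrow> ('d::finite) cop) \<Rightarrow> real \<Rightarrow> 'd cop" where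
  "H_op L K \<epsilon> \<phi> w = inverse (Y_wt L K \<epsilon> w) * K (\<epsilon> / 2) (\<lambda>v. U_wt L K \<epsilon> v * \<phi> v) w"

definition Q_op :: "real \<Rightarrow> (real \<Rightarrow> ('d::finite) cop) \<Rightarrow> real \<Rightarrow> nat \<Rightarrow> 'd cop" where
  "Q_op L K \<epsilon> n = (H_op L K \<epsilon> \<circ> G_op L K \<epsilon>) ^^ n"

end

theory Submission
  imports Defs
begin

text \<open>
  Put \<open>a = \<rho> U\<close> and \<open>b = 1 / U\<close> for the Sinkhorn weight \<open>U\<close> of \<open>\<rho>\<close>, so that \<open>b = C\<^sub>\<epsilon> a\<close> and \<open>a b = \<rho>\<close>.
  Because \<open>s > 2\<close>, the function \<open>log \<rho>\<close> differs from its heat average by \<open>O(\<epsilon>)\<close>, and the inequalities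
  of Jensen and Cauchy--Schwarz give \<open>a \<le> exp (\<epsilon> B) C\<^bsub>2 \<epsilon>\<^esub> a\<close>. Iterated up to time \<open>\<epsilon>\<^sub>0\<close>, this bounds
  \<open>a\<close>, and with it \<open>b\<close>, \<open>1 / a\<close> and \<open>1 / b\<close>, uniformly in \<open>\<epsilon>\<close>. A Gaussian average \<open>b\<close> of such a
  function has no zero on a strip of width \<open>Z\<^sub>0 \<epsilon>\<^bsup>1/2\<^esup>\<close>.

  The two weights are compared along the segment of measures from \<open>\<rho>\<close> to the empirical measure. As long as the
  reciprocal \<open>b\<^sub>t\<close> of the weight \<open>U\<^sub>t\<close> satisfies \<open>|b\<^sub>t / b - 1| \<le> 1 / 2\<close> on the strip, \<open>U\<^sub>t\<close> is bounded
  and analytic there, so the sampling error acting on it is \<open>O(\<delta>)\<close>. The function \<open>m = \<rho> (U\<^sub>t - U)\<close> then solves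
  an equation that is coercive because the Gaussian is positive definite, and a localised energy estimate bounds
  \<open>C\<^sub>\<epsilon> |m|\<close> by \<open>O(\<delta>)\<close>. This improves the bound \<open>1 / 2\<close> to \<open>O(\<delta>) \<le> 1 / 4\<close>, and \<open>b\<^sub>t\<close> is continuous in \<open>t\<close>, so the
  bound propagates to \<open>t = 1\<close>. The operator estimates follow by telescoping; since \<open>H G\<close> is a
  Markov operator, errors of its powers grow at most linearly.
\<close>

section \<open>Gaussian integrals\<close>

text \<open>The constants must not depend on \<epsilon>, while pointwise bounds of the torus kernel
  degenerate as \<epsilon> tends to 0. Two kinds of estimate are kept apart. Bounds through
  \<open>gmin\<close> and \<open>gmax\<close> serve only for existence, uniqueness and continuity
  along the segment, apart from \<open>gmax\<close> at the fixed time
  \<open>2 * \<epsilon>0\<close>. Bounds that enter the constants are obtained on R^d: an average of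
  a periodic function over the torus unfolds to a Gaussian average over R^d, and rescaling by the
  square root of \<epsilon> makes it one at \<epsilon> = 1. The localised energy estimate concerns
  functions on R^d and cannot be run against the empirical measure, which has no density. The
  equation of the perturbed weight is read against \<rho> instead, and the difference of the
  measures becomes a forcing term. That term is controlled only at time \<epsilon>/2, at real points
  and for arguments analytic on the strip. One more average over time \<epsilon>/2 carries it to
  time \<epsilon> and into the strip; the analyticity of the weight itself is what has to be
  bootstrapped.\<close>

lemma borel_measurable_vec_lambda [measurable (raw)]:
  assumes "\<And>k. f k \<in> M \<rightarrow>\<^sub>M (borel :: 'b::euclidean_space measure)"
  shows "(\<lambda>x. \<chi> k::'d::finite. f k x) \<in> M \<rightarrow>\<^sub>M borel"
  using assms by (subst borel_measurable_euclidean_space) (auto simp: Basis_vec_def inner_axis)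

text \<open>\<open>lborel\<close> on a vector type is defined through \<open>Basis\<close>; as the
  image of a product over the index type it admits Fubini one coordinate at a time.\<close>

lemma lborel_vec_eq:
  "(lborel :: (real ^ 'd::finite) measure) = distr (\<Pi>\<^sub>M k\<in>UNIV. lborel) borel (\<lambda>f. \<chi> k. f k)"
proof (rule lborel_eqI)
  interpret product_sigma_finite "\<lambda>_::'d. lborel :: real measure" ..
  have m: "(\<lambda>f. \<chi> k. f k) \<in> (\<Pi>\<^sub>M k\<in>(UNIV::'d set). (lborel :: real measure)) \<rightarrow>\<^sub>M borel"
    by measurable
  fix l u :: "real ^ 'd"
  assume le: "\<And>b. b \<in> Basis \<Longrightarrow> l \<bullet> b \<le> u \<bullet> b"
  have le': "l $ k \<le> u $ k" for k
    using le[of "axis k 1"] by (simp add: inner_axis axis_in_Basis_iff)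
  have box: "(\<lambda>f. \<chi> k. f k) -` box l u \<inter> space (\<Pi>\<^sub>M k\<in>(UNIV::'d set). (lborel :: real measure))
      = (\<Pi>\<^sub>E k\<in>UNIV. {l $ k <..< u $ k})"
    by (auto simp: space_PiM mem_box_cart PiE_def Pi_def)
  have inj: "inj (\<lambda>k::'d. axis k (1::real))"
    by (auto simp: inj_def axis_eq_axis)
  have B: "(Basis :: (real ^ 'd) set) = range (\<lambda>k. axis k 1)"
    by (auto simp: Basis_vec_def)
  have "(\<Prod>b\<in>Basis. (u - l) \<bullet> b) = (\<Prod>k\<in>UNIV. u $ k - l $ k)"
    unfolding B by (subst prod.reindex[OF inj]) (simp add: inner_axis)
  then show "emeasure (distr (\<Pi>\<^sub>M k\<in>UNIV. lborel) borel (\<lambda>f. \<chi> k. f k)) (box l u) =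
      ennreal (\<Prod>b\<in>Basis. (u - l) \<bullet> b)"
    by (simp add: emeasure_distr[OF m] box emeasure_PiM le' prod_ennreal)
qed simp

lemma
  fixes f :: "'d::finite \<Rightarrow> real \<Rightarrow> 'b::{real_normed_field,banach,second_countable_topology}"
  assumes f: "\<And>k. integrable lborel (f k)"
  shows integrable_lborel_vec_prod: "integrable lborel (\<lambda>x::real^'d. \<Prod>k\<in>UNIV. f k (x $ k))"
    and integral_lborel_vec_prod: "(LINT x::real^'d|lborel. (\<Prod>k\<in>UNIV. f k (x $ k))) = (\<Prod>k\<in>UNIV. LINT t|lborel. f k t)"
proof -
  interpret product_sigma_finite "\<lambda>_::'d. lborel :: real measure" ..
  have m: "(\<lambda>f. \<chi> k. f k) \<in> (\<Pi>\<^sub>M k\<in>(UNIV::'d set). (lborel :: real measure)) \<rightarrow>\<^sub>M borel"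
    by measurable
  have [measurable]: "f k \<in> borel_measurable borel" for k
    using borel_measurable_integrable[OF f[of k]] by simp
  have b: "(\<lambda>x::real^'d. \<Prod>k\<in>UNIV. f k (x $ k)) \<in> borel_measurable borel"
    by measurable
  show "integrable lborel (\<lambda>x::real^'d. \<Prod>k\<in>UNIV. f k (x $ k))"
    unfolding lborel_vec_eq integrable_distr_eq[OF m b]
    using product_integrable_prod[of UNIV f] f by simp
  show "(LINT x::real^'d|lborel. (\<Prod>k\<in>UNIV. f k (x $ k))) = (\<Prod>k\<in>UNIV. LINT t|lborel. f k t)"
    unfolding lborel_vec_eq integral_distr[OF m b]
    using product_integral_prod[of UNIV f] f by simp
qed

definition rgauss :: "real \<Rightarrow> real ^ 'd::finite \<Rightarrow> real" where
  "rgauss \<epsilon> x = (2 * pi * \<epsilon>) powr (- real CARD('d) / 2) * exp (- (\<Sum>k\<in>UNIV. (x $ k)\<^sup>2) / (2 * \<epsilon>))"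

lemma rgauss_pos: "0 < \<epsilon> \<Longrightarrow> 0 < rgauss \<epsilon> x"
  by (simp add: rgauss_def)

lemma rgauss_minus [simp]: "rgauss \<epsilon> (- x) = rgauss \<epsilon> x"
  by (simp add: rgauss_def)

lemma rgauss_norm: "rgauss \<epsilon> (x :: real ^ 'd::finite) = (2 * pi * \<epsilon>) powr (- real CARD('d) / 2) * exp (- (norm x)\<^sup>2 / (2 * \<epsilon>))"
  by (simp add: rgauss_def norm_vec_def L2_set_def sum_nonneg)

lemma borel_measurable_rgauss [measurable (raw)]:
  assumes [measurable]: "e \<in> borel_measurable M" "f \<in> borel_measurable M"
  shows "(\<lambda>x. rgauss (e x) (f x)) \<in> borel_measurable M"
  unfolding rgauss_norm by measurable

lemma continuous_rgauss [continuous_intros]: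
  assumes "continuous_on A f" "0 < \<epsilon>"
  shows "continuous_on A (\<lambda>x. rgauss \<epsilon> (f x))"
  unfolding rgauss_norm using assms by (intro continuous_intros) auto

lemma powr_half_card: "0 < a \<Longrightarrow> a powr (- real CARD('d::finite) / 2) = (\<Prod>k\<in>(UNIV::'d set). 1 / sqrt a)"
proof -
  assume a: "0 < a"
  have "a powr (- real CARD('d) / 2) = (a powr (- (1/2))) powr real CARD('d)"
    by (simp add: powr_powr)
  also have "\<dots> = (a powr (- (1/2))) ^ CARD('d)"
    using a by (subst powr_realpow) auto
  also have "a powr (- (1/2)) = 1 / sqrt a"
    using a by (simp only: powr_minus powr_half_sqrt less_imp_le inverse_eq_divide)
  finally show ?thesis by simp
qed

lemma rgauss_prod:
  assumes "0 < \<epsilon>"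
  shows "rgauss \<epsilon> (x :: real ^ 'd::finite) = (\<Prod>k\<in>UNIV. normal_density 0 (sqrt \<epsilon>) (x $ k))"
proof -
  have "(\<Prod>k\<in>UNIV. normal_density 0 (sqrt \<epsilon>) (x $ k)) =
     (\<Prod>k\<in>(UNIV::'d set). 1 / sqrt (2 * pi * \<epsilon>)) * (\<Prod>k\<in>UNIV. exp (- (x $ k)\<^sup>2 / (2 * \<epsilon>)))"
    unfolding prod.distrib[symmetric] using assms by (simp add: normal_density_def)
  also have "(\<Prod>k\<in>UNIV. exp (- (x $ k)\<^sup>2 / (2 * \<epsilon>))) = exp (\<Sum>k\<in>UNIV. - (x $ k)\<^sup>2 / (2 * \<epsilon>))"
    by (simp add: exp_sum)
  also have "(\<Sum>k\<in>UNIV. - (x $ k)\<^sup>2 / (2 * \<epsilon>)) = - (\<Sum>k\<in>UNIV. (x $ k)\<^sup>2) / (2 * \<epsilon>)"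
    by (simp add: sum_negf sum_divide_distrib)
  finally show ?thesis
    using assms powr_half_card[of "2 * pi * \<epsilon>", where 'd='d] by (simp add: rgauss_def)
qed

text \<open>Rescaling by the square root of \<epsilon> reduces this to the characteristic function
  of the standard normal distribution.\<close>

lemma normal_density_char:
  assumes e: "0 < \<epsilon>"
  shows "integrable lborel (\<lambda>t. normal_density 0 (sqrt \<epsilon>) t *\<^sub>R exp (\<i> * (\<xi> * t)))"
    and "(LINT t|lborel. normal_density 0 (sqrt \<epsilon>) t *\<^sub>R exp (\<i> * (\<xi> * t))) = exp (- (\<epsilon> * \<xi>\<^sup>2) / 2)"
proof -
  have i: "integrable lborel (normal_density 0 (sqrt \<epsilon>))"
    using e by (intro integrable_normal_density) auto
  show "integrable lborel (\<lambda>t. normal_density 0 (sqrt \<epsilon>) t *\<^sub>R exp (\<i> * (\<xi> * t)))"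
    by (rule Bochner_Integration.integrable_bound[OF i]) simp_all
  have s: "normal_density 0 (sqrt \<epsilon>) (0 + sqrt \<epsilon> * t) = std_normal_density t / sqrt \<epsilon>" for t
    using e by (simp add: normal_density_def power_mult_distrib real_sqrt_mult)
  have "(LINT t|lborel. normal_density 0 (sqrt \<epsilon>) t *\<^sub>R exp (\<i> * (\<xi> * t))) =
      sqrt \<epsilon> *\<^sub>R (LINT t|lborel. normal_density 0 (sqrt \<epsilon>) (0 + sqrt \<epsilon> * t) *\<^sub>R exp (\<i> * (\<xi> * complex_of_real (0 + sqrt \<epsilon> * t))))"
    using e by (subst lborel_integral_real_affine[where c="sqrt \<epsilon>" and t=0]) (auto simp: )
  also have "\<dots> = (LINT t|lborel. std_normal_density t *\<^sub>R exp (\<i> * ((\<xi> * sqrt \<epsilon>) * t)))"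
    unfolding s using e by (subst integral_scaleR_right[symmetric]) (simp add: mult_ac)
  also have "\<dots> = char std_normal_distribution (\<xi> * sqrt \<epsilon>)"
    unfolding char_def by (subst integral_density) (auto simp: mult_ac)
  also have "\<dots> = exp (- (\<epsilon> * \<xi>\<^sup>2) / 2)"
    using e by (simp add: char_std_normal_distribution power_mult_distrib mult_ac flip: of_real_power)
  finally show "(LINT t|lborel. normal_density 0 (sqrt \<epsilon>) t *\<^sub>R exp (\<i> * (\<xi> * t))) = exp (- (\<epsilon> * \<xi>\<^sup>2) / 2)" .
qed

lemma
  fixes \<xi> :: "real ^ 'd::finite"
  assumes e: "0 < \<epsilon>"
  shows integrable_rgauss_char: "integrable lborel (\<lambda>y. rgauss \<epsilon> y *\<^sub>R exp (\<i> * (\<Sum>k\<in>UNIV. \<xi> $ k * y $ k)))"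
    and integral_rgauss_char: "(LINT y|lborel. rgauss \<epsilon> y *\<^sub>R exp (\<i> * (\<Sum>k\<in>UNIV. \<xi> $ k * y $ k)))
       = exp (- (\<epsilon> * (\<Sum>k\<in>UNIV. (\<xi> $ k)\<^sup>2)) / 2)"
proof -
  have eq: "rgauss \<epsilon> y *\<^sub>R exp (\<i> * (\<Sum>k\<in>UNIV. \<xi> $ k * y $ k)) =
     (\<Prod>k\<in>UNIV. normal_density 0 (sqrt \<epsilon>) (y $ k) *\<^sub>R exp (\<i> * (\<xi> $ k * y $ k)))" for y
    using e by (simp add: rgauss_prod scaleR_conv_of_real prod.distrib exp_sum sum_distrib_left)
  show "integrable lborel (\<lambda>y. rgauss \<epsilon> y *\<^sub>R exp (\<i> * (\<Sum>k\<in>UNIV. \<xi> $ k * y $ k)))"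
    unfolding eq by (rule integrable_lborel_vec_prod) (rule normal_density_char[OF e])
  show "(LINT y|lborel. rgauss \<epsilon> y *\<^sub>R exp (\<i> * (\<Sum>k\<in>UNIV. \<xi> $ k * y $ k)))
       = exp (- (\<epsilon> * (\<Sum>k\<in>UNIV. (\<xi> $ k)\<^sup>2)) / 2)"
    unfolding eq
    by (subst integral_lborel_vec_prod, rule normal_density_char[OF e])
      (simp only: normal_density_char(2)[OF e] exp_sum[symmetric] of_real_prod[symmetric] finite
        sum_distrib_left sum_divide_distrib sum_negf[symmetric])
qed

lemma integrable_rgauss:
  assumes e: "0 < \<epsilon>"
  shows "integrable lborel (rgauss \<epsilon> :: real ^ 'd::finite \<Rightarrow> real)"
  unfolding rgauss_prod[OF e, abs_def]
  by (rule integrable_lborel_vec_prod) (use e in \<open>auto intro: integrable_normal_density\<close>)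

lemma integral_rgauss:
  assumes e: "0 < \<epsilon>"
  shows "(LINT y::real ^ 'd::finite|lborel. rgauss \<epsilon> y) = 1"
  unfolding rgauss_prod[OF e]
  by (subst integral_lborel_vec_prod) (use e in \<open>auto intro: integrable_normal_density integral_normal_density\<close>)

section \<open>Unfolding integrals over the torus\<close>

lemma latt_nth [simp]: "latt L j $ k = L * real_of_int (j $ k)"
  by (simp add: latt_def)

lemma latt_add: "latt L (i + j) = latt L i + latt L j"
  by (simp add: vec_eq_iff algebra_simps)

lemma latt_uminus: "latt L (- j) = - latt L j"
  by (simp add: vec_eq_iff)

lemma cvec_nth [simp]: "cvec x $ k = complex_of_real (x $ k)"
  by (simp add: cvec_def)

lemma re_vec_nth [simp]: "re_vec w $ k = Re (w $ k)"
  by (simp add: re_vec_def)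

lemma re_vec_cvec [simp]: "re_vec (cvec x) = x"
  by (simp add: vec_eq_iff)

lemma cvec_add: "cvec (x + y) = cvec x + cvec y"
  by (simp add: vec_eq_iff)

lemma cvec_diff: "cvec (x - y) = cvec x - cvec y"
  by (simp add: vec_eq_iff)

lemma cvec_uminus: "cvec (- x) = - cvec x"
  by (simp add: vec_eq_iff)

lemma re_vec_add: "re_vec (x + y) = re_vec x + re_vec y"
  by (simp add: vec_eq_iff)

lemma re_vec_diff: "re_vec (x - y) = re_vec x - re_vec y"
  by (simp add: vec_eq_iff)

lemma sets_cell [measurable]: "cell L \<in> sets borel"
proof -
  have "cell L = (\<Inter>k. {y::real^'d. 0 \<le> y $ k \<and> y $ k < L})"
    by (auto simp: cell_def)
  also have "\<dots> \<in> sets borel"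
    by (intro sets.countable_INT') (auto intro: borel_measurable_le borel_measurable_less)
  finally show ?thesis .
qed

definition cell_index :: "real \<Rightarrow> real ^ 'd::finite \<Rightarrow> int ^ 'd" where
  "cell_index L x = (\<chi> k. \<lfloor>x $ k / L\<rfloor>)"

lemma cell_index_iff:
  assumes L: "0 < L"
  shows "x - latt L j \<in> cell L \<longleftrightarrow> j = cell_index L x"
proof -
  have "(0 \<le> a - L * real_of_int i \<and> a - L * real_of_int i < L) \<longleftrightarrow> i = \<lfloor>a / L\<rfloor>" for a i
  proof -
    have "(i = \<lfloor>a / L\<rfloor>) \<longleftrightarrow> (of_int i \<le> a / L \<and> a / L < of_int i + 1)"
      by (metis floor_eq_iff)
    then show ?thesis
      using L by (auto simp: field_simps)
  qed
  then show ?thesis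
    by (auto simp: cell_def cell_index_def vec_eq_iff)
qed

lemma cell_reduce:
  assumes L: "0 < L"
  obtains j where "x - latt L j \<in> cell L"
  using cell_index_iff[OF L] by blast

text \<open>Lebesgue measure of the torus, carried by the fundamental cell inside the covering space.\<close>

definition cell_measure :: "real \<Rightarrow> (real ^ 'd::finite) measure" where
  "cell_measure L = density lborel (\<lambda>y. indicator (cell L) y)"

lemma sets_cell_measure [simp, measurable_cong]: "sets (cell_measure L) = sets borel"
  by (simp add: cell_measure_def)

lemma space_cell_measure [simp]: "space (cell_measure L) = UNIV"
  by (simp add: cell_measure_def)

lemma nn_integral_cell_measure:
  "f \<in> borel_measurable borel \<Longrightarrow> (\<integral>\<^sup>+y. f y \<partial>cell_measure L) = (\<integral>\<^sup>+y. f y * indicator (cell L) y \<partial>lborel)"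
  unfolding cell_measure_def by (subst nn_integral_density) (auto simp: mult.commute)

lemma integral_cell_measure:
  fixes f :: "real ^ 'd::finite \<Rightarrow> 'b::{banach,second_countable_topology}"
  assumes [measurable]: "f \<in> borel_measurable borel"
  shows "(LINT y|cell_measure L. f y) = (LINT y:cell L|lborel. f y)"
  unfolding cell_measure_def set_lebesgue_integral_def ennreal_indicator[symmetric]
  by (subst integral_density) auto

lemma AE_cell_measure_cell: "AE y in cell_measure L. y \<in> cell L"
  unfolding cell_measure_def by (subst AE_density) (auto simp: indicator_def)

lemma emeasure_cell:
  assumes L: "0 < L"
  shows "emeasure lborel (cell L :: (real ^ 'd::finite) set) = ennreal (L ^ CARD('d))"
proof -
  interpret product_sigma_finite "\<lambda>_::'d. lborel :: real measure" ..
  have m: "(\<lambda>f. \<chi> k. f k) \<in> (\<Pi>\<^sub>M k\<in>(UNIV::'d set). (lborel :: real measure)) \<rightarrow>\<^sub>M borel"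
    by measurable
  have "(\<lambda>f. \<chi> k. f k) -` cell L \<inter> space (\<Pi>\<^sub>M k\<in>(UNIV::'d set). (lborel :: real measure))
      = (\<Pi>\<^sub>E k\<in>UNIV. {0..<L})"
    by (auto simp: space_PiM cell_def PiE_def Pi_def)
  then have "emeasure (distr (\<Pi>\<^sub>M k\<in>(UNIV::'d set). lborel) borel (\<lambda>f. \<chi> k. f k)) (cell L) = ennreal (L ^ CARD('d))"
    using L by (simp add: emeasure_distr[OF m] emeasure_PiM ennreal_power)
  then show ?thesis
    by (simp add: lborel_vec_eq[symmetric])
qed

lemma emeasure_cell_measure:
  assumes "0 < L" 
  shows "emeasure (cell_measure L :: (real ^ 'd::finite) measure) UNIV = ennreal (L ^ CARD('d))"
  using emeasure_cell[OF assms, where 'd='d] by (simp add: cell_measure_def emeasure_density)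

lemma finite_measure_cell_measure: "0 < L \<Longrightarrow> finite_measure (cell_measure L)"
  by (intro finite_measureI) (simp add: emeasure_cell_measure)

lemma measure_cell_measure: "0 < L \<Longrightarrow> measure (cell_measure L :: (real ^ 'd::finite) measure) UNIV = L ^ CARD('d)"
  by (simp add: measure_def emeasure_cell_measure)

lemma nn_integral_lborel_translate:
  fixes f :: "real ^ 'd::finite \<Rightarrow> ennreal"
  assumes [measurable]: "f \<in> borel_measurable borel"
  shows "(\<integral>\<^sup>+y. f (c + y) \<partial>lborel) = (\<integral>\<^sup>+y. f y \<partial>lborel)"
  by (subst (2) lborel_distr_plus[of c, symmetric]) (simp add: nn_integral_distr)

lemma integral_lborel_translate:
  fixes f :: "real ^ 'd::finite \<Rightarrow> 'b::{banach,second_countable_topology}"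
  assumes [measurable]: "f \<in> borel_measurable borel"
  shows "(LINT y|lborel. f (c + y)) = (LINT y|lborel. f y)"
  by (subst (2) lborel_distr_plus[of c, symmetric]) (simp add: integral_distr)

lemma integrable_lborel_translate:
  fixes f :: "real ^ 'd::finite \<Rightarrow> 'b::{banach,second_countable_topology}"
  assumes f: "integrable lborel f"
  shows "integrable lborel (\<lambda>y. f (c + y))"
proof -
  have [measurable]: "f \<in> borel_measurable borel"
    using borel_measurable_integrable[OF f] by simp
  show ?thesis
    using f by (subst (asm) lborel_distr_plus[of c, symmetric]) (simp add: integrable_distr_eq)
qed

lemma measurable_count_space_pair:
  fixes f :: "('i::countable \<times> 'a) \<Rightarrow> 'b"
  assumes "\<And>i. (\<lambda>x. f (i, x)) \<in> M \<rightarrow>\<^sub>M N"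
  shows "f \<in> count_space UNIV \<Otimes>\<^sub>M M \<rightarrow>\<^sub>M N"
  using assms by (intro measurable_pair_measure_countable1) auto

text \<open>The lattice translates of the half-open cell tile R^d: after Tonelli, exactly one index
  j brings a given point back into the cell. This is the bridge between integrals over the torus and
  integrals over R^d.\<close>

lemma lborel_eq_distr_cell_measure:
  assumes L: "0 < L"
  shows "(lborel :: (real ^ 'd::finite) measure) = distr (count_space UNIV \<Otimes>\<^sub>M cell_measure L) borel (\<lambda>(j, y). y + latt L j)"
proof (rule measure_eqI)
  interpret C: finite_measure "cell_measure L :: (real^'d) measure" by (rule finite_measure_cell_measure[OF L])
  interpret S: sigma_finite_measure "count_space (UNIV::(int^'d) set)"
    by (rule sigma_finite_measure_count_space_countable) simp
  interpret P: pair_sigma_finite "count_space (UNIV::(int^'d) set)" "lborel :: (real^'d) measure" ..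
  have m [measurable]: "(\<lambda>(j, y). y + latt L j) \<in> count_space (UNIV::(int^'d) set) \<Otimes>\<^sub>M cell_measure L \<rightarrow>\<^sub>M borel"
    by (rule measurable_count_space_pair) simp
  fix A :: "(real ^ 'd) set" assume "A \<in> sets lborel"
  then have A [measurable]: "A \<in> sets borel" by simp
  have "emeasure (distr (count_space UNIV \<Otimes>\<^sub>M cell_measure L) borel (\<lambda>(j, y). y + latt L j)) A
      = (\<integral>\<^sup>+x. indicator A x \<partial>distr (count_space (UNIV::(int^'d) set) \<Otimes>\<^sub>M cell_measure L) borel (\<lambda>(j, y). y + latt L j))"
    by simp
  also have "\<dots> = (\<integral>\<^sup>+p. indicator A (case p of (j, y) \<Rightarrow> y + latt L j) \<partial>(count_space (UNIV::(int^'d) set) \<Otimes>\<^sub>M cell_measure L))"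
    by (subst nn_integral_distr) auto
  also have "\<dots> = (\<integral>\<^sup>+j. \<integral>\<^sup>+y. indicator A (y + latt L j) \<partial>cell_measure L \<partial>count_space (UNIV::(int^'d) set))"
    by (subst C.nn_integral_fst[symmetric]) auto
  also have "\<dots> = (\<integral>\<^sup>+j. \<integral>\<^sup>+y. indicator A y * indicator (cell L) (y - latt L j) \<partial>lborel \<partial>count_space (UNIV::(int^'d) set))"
  proof (intro nn_integral_cong)
    fix j :: "int ^ 'd"
    have "(\<integral>\<^sup>+y. indicator A (y + latt L j) \<partial>cell_measure L) = (\<integral>\<^sup>+y. indicator A (y + latt L j) * indicator (cell L) y \<partial>lborel)"
      by (subst nn_integral_cell_measure) auto
    also have "\<dots> = (\<integral>\<^sup>+y. indicator A (latt L j + y) * indicator (cell L) ((latt L j + y) - latt L j) \<partial>lborel)"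
      by (simp add: add.commute)
    also have "\<dots> = (\<integral>\<^sup>+y. indicator A y * indicator (cell L) (y - latt L j) \<partial>lborel)"
      by (rule nn_integral_lborel_translate) simp
    finally show "(\<integral>\<^sup>+y. indicator A (y + latt L j) \<partial>cell_measure L) = (\<integral>\<^sup>+y. indicator A y * indicator (cell L) (y - latt L j) \<partial>lborel)" .
  qed
  also have "\<dots> = (\<integral>\<^sup>+y. \<integral>\<^sup>+j. indicator A y * indicator (cell L) (y - latt L j) \<partial>count_space (UNIV::(int^'d) set) \<partial>lborel)"
    by (rule P.Fubini'[symmetric], rule measurable_count_space_pair) simp
  also have "\<dots> = (\<integral>\<^sup>+y. indicator A y \<partial>lborel)"
  proof (intro nn_integral_cong)
    fix y :: "real ^ 'd"
    have "(\<integral>\<^sup>+j. indicator A y * indicator (cell L) (y - latt L j) \<partial>count_space (UNIV::(int^'d) set))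
       = (\<integral>\<^sup>+j. indicator A y * indicator {cell_index L y} j \<partial>count_space (UNIV::(int^'d) set))"
      by (intro nn_integral_cong) (auto simp: cell_index_iff[OF L] indicator_def)
    also have "\<dots> = indicator A y"
      by (subst nn_integral_cmult_indicator) auto
    finally show "(\<integral>\<^sup>+j. indicator A y * indicator (cell L) (y - latt L j) \<partial>count_space (UNIV::(int^'d) set)) = indicator A y" .
  qed
  finally show "emeasure lborel A = emeasure (distr (count_space UNIV \<Otimes>\<^sub>M cell_measure L) borel (\<lambda>(j, y). y + latt L j)) A"
    by simp
qed simp

lemma integral_count_space_infsum:
  fixes f :: "'i \<Rightarrow> 'b::{banach,second_countable_topology}"
  assumes "(\<lambda>i. norm (f i)) summable_on UNIV"
  shows "integrable (count_space UNIV) f" "(LINT i|count_space UNIV. f i) = (\<Sum>\<^sub>\<infinity>i. f i)"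
proof -
  have "Infinite_Set_Sum.abs_summable_on f UNIV"
    using assms by (simp add: abs_summable_equivalent)
  then show "integrable (count_space UNIV) f" "(LINT i|count_space UNIV. f i) = (\<Sum>\<^sub>\<infinity>i. f i)"
    using infsetsum_infsum[of f UNIV] by (auto simp: Infinite_Set_Sum.abs_summable_on_def infsetsum_def)
qed

lemma
  fixes f :: "real ^ 'd::finite \<Rightarrow> 'b::{banach,second_countable_topology}"
  assumes L: "0 < L" and f: "integrable lborel f"
    and s: "\<And>y. (\<lambda>j. norm (f (y + latt L j))) summable_on UNIV"
  shows integral_unfold: "(LINT y|lborel. f y) = (LINT y|cell_measure L. (\<Sum>\<^sub>\<infinity>j. f (y + latt L j)))"
    and integrable_unfold: "integrable (cell_measure L) (\<lambda>y. (\<Sum>\<^sub>\<infinity>j. f (y + latt L j)))"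
proof -
  interpret C: finite_measure "cell_measure L :: (real^'d) measure" by (rule finite_measure_cell_measure[OF L])
  interpret S: sigma_finite_measure "count_space (UNIV::(int^'d) set)"
    by (rule sigma_finite_measure_count_space_countable) simp
  interpret P: pair_sigma_finite "count_space (UNIV::(int^'d) set)" "cell_measure L :: (real^'d) measure" ..
  have m [measurable]: "(\<lambda>(j, y). y + latt L j) \<in> count_space (UNIV::(int^'d) set) \<Otimes>\<^sub>M cell_measure L \<rightarrow>\<^sub>M borel"
    by (rule measurable_count_space_pair) simp
  have [measurable]: "f \<in> borel_measurable borel"
    using borel_measurable_integrable[OF f] by simp
  have i: "integrable (count_space UNIV \<Otimes>\<^sub>M cell_measure L) (\<lambda>p. f (case p of (j, y) \<Rightarrow> y + latt L j))"
    using f by (subst (asm) lborel_eq_distr_cell_measure[OF L]) (simp add: integrable_distr_eq)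
  have i': "integrable (count_space UNIV \<Otimes>\<^sub>M cell_measure L) (\<lambda>(j, y). f (y + latt L j))"
    using i by (simp add: case_prod_unfold)
  have "(LINT y|lborel. f y) = (\<integral>p. f (case p of (j, y) \<Rightarrow> y + latt L j) \<partial>(count_space UNIV \<Otimes>\<^sub>M cell_measure L))"
    by (subst lborel_eq_distr_cell_measure[OF L]) (simp add: integral_distr)
  also have "\<dots> = (\<integral>p. (case p of (j, y) \<Rightarrow> f (y + latt L j)) \<partial>(count_space UNIV \<Otimes>\<^sub>M cell_measure L))"
    by (simp add: case_prod_beta)
  also have "\<dots> = (LINT y|cell_measure L. (LINT j|count_space UNIV. f (y + latt L j)))"
    by (rule P.integral_snd[OF i', symmetric])
  finally show "(LINT y|lborel. f y) = (LINT y|cell_measure L. (\<Sum>\<^sub>\<infinity>j. f (y + latt L j)))"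
    by (simp add: integral_count_space_infsum[OF s])
  show "integrable (cell_measure L) (\<lambda>y. (\<Sum>\<^sub>\<infinity>j. f (y + latt L j)))"
    using P.integrable_snd[OF i'] by (simp add: integral_count_space_infsum[OF s])
qed

text \<open>For the Gaussian the integrals over all translated cells add up to 1; this provides the
  summable majorant of its lattice translates.\<close>

lemma
  fixes f :: "real ^ 'd::finite \<Rightarrow> real"
  assumes L: "0 < L" and f: "integrable lborel f" and pos: "\<And>y. 0 \<le> f y"
  shows has_sum_integral_cell_measure: "((\<lambda>j. LINT y|cell_measure L. f (y + latt L j)) has_sum (LINT y|lborel. f y)) UNIV"
    and integrable_cell_measure_translate: "integrable (cell_measure L) (\<lambda>y. f (y + latt L j))"
proof -
  interpret C: finite_measure "cell_measure L :: (real^'d) measure" by (rule finite_measure_cell_measure[OF L])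
  interpret S: sigma_finite_measure "count_space (UNIV::(int^'d) set)"
    by (rule sigma_finite_measure_count_space_countable) simp
  interpret P: pair_sigma_finite "count_space (UNIV::(int^'d) set)" "cell_measure L :: (real^'d) measure" ..
  have m [measurable]: "(\<lambda>(j, y). y + latt L j) \<in> count_space (UNIV::(int^'d) set) \<Otimes>\<^sub>M cell_measure L \<rightarrow>\<^sub>M borel"
    by (rule measurable_count_space_pair) simp
  have [measurable]: "f \<in> borel_measurable borel"
    using borel_measurable_integrable[OF f] by simp
  have i: "integrable (count_space UNIV \<Otimes>\<^sub>M cell_measure L) (\<lambda>p. f (case p of (j, y) \<Rightarrow> y + latt L j))"
    using f by (subst (asm) lborel_eq_distr_cell_measure[OF L]) (simp add: integrable_distr_eq)
  have i': "integrable (count_space UNIV \<Otimes>\<^sub>M cell_measure L) (\<lambda>(j, y). f (y + latt L j))"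
    using i by (simp add: case_prod_unfold)
  have "(LINT y|lborel. f y) = (\<integral>p. f (case p of (j, y) \<Rightarrow> y + latt L j) \<partial>(count_space UNIV \<Otimes>\<^sub>M cell_measure L))"
    by (subst lborel_eq_distr_cell_measure[OF L]) (simp add: integral_distr)
  also have "\<dots> = (\<integral>p. (case p of (j, y) \<Rightarrow> f (y + latt L j)) \<partial>(count_space UNIV \<Otimes>\<^sub>M cell_measure L))"
    by (simp add: case_prod_beta)
  also have "\<dots> = (LINT j|count_space UNIV. (LINT y|cell_measure L. f (y + latt L j)))"
    using P.integral_fst'[OF i'] by simp
  finally have e: "(LINT y|lborel. f y) = (LINT j|count_space UNIV. (LINT y|cell_measure L. f (y + latt L j)))" .
  have "integrable (count_space UNIV) (\<lambda>j. LINT y|cell_measure L. f (y + latt L j))"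
    using P.integrable_fst'[OF i'] by simp
  then have "Infinite_Set_Sum.abs_summable_on (\<lambda>j. LINT y|cell_measure L. f (y + latt L j)) UNIV"
    by (simp add: Infinite_Set_Sum.abs_summable_on_def)
  then have s: "(\<lambda>j. LINT y|cell_measure L. f (y + latt L j)) summable_on UNIV"
    using abs_summable_equivalent abs_summable_summable by blast
  then have "(LINT y|lborel. f y) = (\<Sum>\<^sub>\<infinity>j. LINT y|cell_measure L. f (y + latt L j))"
    unfolding e using pos by (subst integral_count_space_infsum) auto
  then show "((\<lambda>j. LINT y|cell_measure L. f (y + latt L j)) has_sum (LINT y|lborel. f y)) UNIV"
    using s by (simp add: has_sum_infsum)
  show "integrable (cell_measure L) (\<lambda>y. f (y + latt L j))"
    using P.AE_integrable_fst'[OF i'] by (auto simp: AE_count_space)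
qed

section \<open>The periodised Gaussian\<close>

definition im_sq :: "complex ^ 'd::finite \<Rightarrow> real" where
  "im_sq w = (\<Sum>k\<in>UNIV. (Im (w $ k))\<^sup>2)"

lemma im_sq_nonneg [simp]: "0 \<le> im_sq w"
  by (simp add: im_sq_def sum_nonneg)

lemma im_sq_cvec [simp]: "im_sq (cvec x) = 0" "im_sq (w + cvec x) = im_sq w" "im_sq (w - cvec x) = im_sq w"
    "im_sq (cvec x - w) = im_sq w" "im_sq (cvec x + w) = im_sq w"
  by (simp_all add: im_sq_def)

lemma im_sq_strip:
  assumes w: "w \<in> strip \<zeta>"
  shows "im_sq (w :: complex ^ 'd::finite) \<le> real CARD('d) * \<zeta>\<^sup>2"
proof -
  have "(Im (w $ k))\<^sup>2 \<le> \<zeta>\<^sup>2" for k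
  proof -
    have "\<bar>Im (w $ k)\<bar> \<le> \<zeta>" using w by (simp add: strip_def)
    then have "\<bar>Im (w $ k)\<bar>\<^sup>2 \<le> \<zeta>\<^sup>2" by (intro power_mono) auto
    then show ?thesis by simp
  qed
  then have "im_sq w \<le> (\<Sum>k\<in>(UNIV::'d set). \<zeta>\<^sup>2)"
    unfolding im_sq_def by (intro sum_mono) auto
  then show ?thesis by simp
qed

lemma gauss_cvec: "gauss \<epsilon> (cvec x) = complex_of_real (rgauss \<epsilon> x)"
  by (simp add: gauss_def rgauss_def flip: exp_of_real)

text \<open>The real part of (x + i z)^2 is x^2 - z^2, so leaving the real points costs the factor
  \<open>exp (im_sq w / (2 * \<epsilon>))\<close>. It stays bounded as \<epsilon> tends to 0 on
  strips of width of order sqrt \<epsilon>, which explains the choice of \<zeta>.\<close>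

lemma norm_gauss: 
  assumes "0 < \<epsilon>"
  shows "norm (gauss \<epsilon> w) = exp (im_sq w / (2 * \<epsilon>)) * rgauss \<epsilon> (re_vec w)"
proof -
  have "Re (\<Sum>k\<in>UNIV. (w $ k)\<^sup>2) = (\<Sum>k\<in>UNIV. (Re (w $ k))\<^sup>2) - im_sq w"
    by (simp add: im_sq_def sum_subtractf Re_power2)
  then have r: "Re (- (\<Sum>k\<in>UNIV. (w $ k)\<^sup>2) / of_real (2 * \<epsilon>)) = im_sq w / (2 * \<epsilon>) + - (\<Sum>k\<in>UNIV. (Re (w $ k))\<^sup>2) / (2 * \<epsilon>)"
    by (simp add: Re_divide_of_real diff_divide_distrib del: of_real_mult)
  then show ?thesis
    unfolding gauss_def norm_mult norm_exp_eq_Re rgauss_def r exp_add by simp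
qed

lemma gauss_minus [simp]: "gauss \<epsilon> (- w) = gauss \<epsilon> w"
  by (simp add: gauss_def)

text \<open>Since |y|^2 \<le> 2 |x|^2 + 2 |x - y|^2, a Gaussian of doubled variance at y dominates
  up to a factor depending on |x - y| only; \<open>2 powr (CARD('d) / 2)\<close> is the ratio of the
  normalising constants.\<close>

lemma rgauss_le_double:
  fixes x y :: "real ^ 'd::finite"
  assumes e: "0 < \<epsilon>"
  shows "rgauss \<epsilon> x \<le> 2 powr (CARD('d) / 2) * exp ((norm (x - y))\<^sup>2 / (2 * \<epsilon>)) * rgauss (2 * \<epsilon>) y"
proof -
  have "norm y \<le> norm x + norm (x - y)"
    by (metis add.commute diff_add_cancel norm_minus_commute norm_triangle_ineq)
  then have "(norm y)\<^sup>2 \<le> (norm x + norm (x - y))\<^sup>2"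
    by (intro power_mono) auto
  also have "\<dots> \<le> 2 * (norm x)\<^sup>2 + 2 * (norm (x - y))\<^sup>2"
    using sum_squares_bound[of "norm x" "norm (x - y)"] by (simp add: power2_sum)
  finally have "- (norm x)\<^sup>2 / (2 * \<epsilon>) \<le> (norm (x - y))\<^sup>2 / (2 * \<epsilon>) + - (norm y)\<^sup>2 / (2 * (2 * \<epsilon>))"
    using e by (simp add: field_simps)
  then have "exp (- (norm x)\<^sup>2 / (2 * \<epsilon>)) \<le> exp ((norm (x - y))\<^sup>2 / (2 * \<epsilon>)) * exp (- (norm y)\<^sup>2 / (2 * (2 * \<epsilon>)))"
    unfolding exp_add[symmetric] exp_le_cancel_iff .
  moreover have p: "(2 * pi * \<epsilon>) powr (- real CARD('d) / 2) = 2 powr (CARD('d) / 2) * (2 * pi * (2 * \<epsilon>)) powr (- real CARD('d) / 2)"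
  proof -
    have "2 powr (CARD('d) / 2) * (2 * pi * (2 * \<epsilon>)) powr (- real CARD('d) / 2) = 
       2 powr (CARD('d) / 2) * (2 powr (- real CARD('d) / 2) * (2 * pi * \<epsilon>) powr (- real CARD('d) / 2))"
      using e by (simp add: powr_mult[symmetric] mult_ac)
    also have "\<dots> = (2 * pi * \<epsilon>) powr (- real CARD('d) / 2)"
      by (simp add: mult.assoc[symmetric] powr_add[symmetric])
    finally show ?thesis by simp
  qed
  ultimately show ?thesis
    unfolding rgauss_norm p
  proof -
    assume le: "exp (- (norm x)\<^sup>2 / (2 * \<epsilon>)) \<le> exp ((norm (x - y))\<^sup>2 / (2 * \<epsilon>)) * exp (- (norm y)\<^sup>2 / (2 * (2 * \<epsilon>)))"
    define c where "c = 2 powr (CARD('d) / 2) * (2 * pi * (2 * \<epsilon>)) powr (- real CARD('d) / 2)"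
    have "c * exp (- (norm x)\<^sup>2 / (2 * \<epsilon>)) \<le> c * (exp ((norm (x - y))\<^sup>2 / (2 * \<epsilon>)) * exp (- (norm y)\<^sup>2 / (2 * (2 * \<epsilon>))))"
      by (intro mult_left_mono le) (simp add: c_def)
    then show "2 powr (CARD('d) / 2) * (2 * pi * (2 * \<epsilon>)) powr (- real CARD('d) / 2) * exp (- (norm x)\<^sup>2 / (2 * \<epsilon>))
      \<le> 2 powr (CARD('d) / 2) * exp ((norm (x - y))\<^sup>2 / (2 * \<epsilon>)) *
        ((2 * pi * (2 * \<epsilon>)) powr (- real CARD('d) / 2) * exp (- (norm y)\<^sup>2 / (2 * (2 * \<epsilon>))))"
      unfolding c_def by (simp only: mult_ac)
  qed
qed

lemma norm_cell_le:
  assumes "y \<in> cell L"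
  shows "norm (y :: real ^ 'd::finite) \<le> real CARD('d) * L"
proof -
  have "norm y \<le> (\<Sum>k\<in>UNIV. \<bar>y $ k\<bar>)"
    by (rule norm_le_l1_cart)
  also have "\<dots> \<le> (\<Sum>k\<in>(UNIV::'d set). L)"
    using assms by (intro sum_mono) (auto simp: cell_def less_imp_le)
  finally show ?thesis by simp
qed

text \<open>A majorant, summable over the lattice, of the translates of the Gaussian at points of norm at most \<open>R\<close>.\<close>

definition gauss_majorant :: "real \<Rightarrow> real \<Rightarrow> real \<Rightarrow> int ^ 'd::finite \<Rightarrow> real" where
  "gauss_majorant L \<epsilon> R j = 2 powr (CARD('d) / 2) * exp ((R + real CARD('d) * L)\<^sup>2 / (2 * \<epsilon>)) / L ^ CARD('d) *
     (LINT y|cell_measure L. rgauss (2 * \<epsilon>) (y + latt L j))"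

text \<open>Averaging \<open>rgauss_le_double\<close> over y in the cell replaces values at lattice
  translates by integrals over disjoint cells, whose sum is known.\<close>

lemma rgauss_le_gauss_majorant:
  fixes x :: "real ^ 'd::finite"
  assumes L: "0 < L" and e: "0 < \<epsilon>" and x: "norm x \<le> R"
  shows "rgauss \<epsilon> (x + latt L j) \<le> gauss_majorant L \<epsilon> R j"
proof -
  interpret C: finite_measure "cell_measure L :: (real^'d) measure" by (rule finite_measure_cell_measure[OF L])
  let ?c = "2 powr (CARD('d) / 2) * exp ((R + real CARD('d) * L)\<^sup>2 / (2 * \<epsilon>))"
  have i: "integrable (cell_measure L) (\<lambda>y::real^'d. rgauss (2 * \<epsilon>) (y + latt L j))"
    by (rule integrable_cell_measure_translate[OF L integrable_rgauss]) (use e in \<open>auto intro: less_imp_le[OF rgauss_pos]\<close>)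
  have "L ^ CARD('d) * rgauss \<epsilon> (x + latt L j) = (LINT y::real^'d|cell_measure L. rgauss \<epsilon> (x + latt L j))"
    by (simp add: measure_cell_measure[OF L])
  also have "\<dots> \<le> (LINT y::real^'d|cell_measure L. ?c * rgauss (2 * \<epsilon>) (y + latt L j))"
  proof (rule integral_mono_AE)
    show "AE y in cell_measure L. rgauss \<epsilon> (x + latt L j) \<le> ?c * rgauss (2 * \<epsilon>) (y + latt L j)"
      using AE_cell_measure_cell
    proof eventually_elim
      case (elim y)
      have "norm (x + latt L j - (y + latt L j)) \<le> R + real CARD('d) * L"
        using norm_triangle_ineq4[of x y] norm_cell_le[OF elim] x by simp
      then have "exp ((norm (x + latt L j - (y + latt L j)))\<^sup>2 / (2 * \<epsilon>)) \<le> exp ((R + real CARD('d) * L)\<^sup>2 / (2 * \<epsilon>))"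
        using e by (simp add: divide_right_mono power_mono)
      then have "2 powr (CARD('d) / 2) * exp ((norm (x + latt L j - (y + latt L j)))\<^sup>2 / (2 * \<epsilon>)) * rgauss (2 * \<epsilon>) (y + latt L j)
           \<le> ?c * rgauss (2 * \<epsilon>) (y + latt L j)"
        using e by (intro mult_right_mono mult_left_mono less_imp_le[OF rgauss_pos]) auto
      with rgauss_le_double[OF e, of "x + latt L j" "y + latt L j"] show ?case by linarith
    qed
  qed (use i in auto)
  finally show ?thesis
    using L by (simp add: gauss_majorant_def field_simps)
qed

lemma has_sum_gauss_majorant:
  assumes L: "0 < L" and e: "0 < \<epsilon>"
  shows "(gauss_majorant L \<epsilon> R has_sum 2 powr (CARD('d::finite) / 2) * exp ((R + real CARD('d) * L)\<^sup>2 / (2 * \<epsilon>)) / L ^ CARD('d)) (UNIV :: (int ^ 'd) set)"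
proof -
  have "((\<lambda>j. LINT y|cell_measure L. rgauss (2 * \<epsilon>) (y + latt L j)) has_sum (LINT y|lborel. rgauss (2 * \<epsilon>) (y :: real ^ 'd))) (UNIV :: (int ^ 'd) set)"
    by (rule has_sum_integral_cell_measure[OF L integrable_rgauss]) (use e in \<open>auto intro: less_imp_le[OF rgauss_pos]\<close>)
  from has_sum_cmult_right[OF this, of "2 powr (CARD('d) / 2) * exp ((R + real CARD('d) * L)\<^sup>2 / (2 * \<epsilon>)) / L ^ CARD('d)"] show ?thesis
    using e unfolding gauss_majorant_def[abs_def] by (simp add: integral_rgauss)
qed

lemma summable_rgauss:
  assumes L: "0 < L" and e: "0 < \<epsilon>"
  shows "(\<lambda>j. rgauss \<epsilon> (x + latt L j :: real ^ 'd::finite)) summable_on UNIV"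
proof (rule summable_on_comparison_test)
  show "gauss_majorant L \<epsilon> (norm x) summable_on UNIV"
    using has_sum_gauss_majorant[OF L e] by (rule has_sum_imp_summable)
qed (use rgauss_le_gauss_majorant[OF L e order_refl] e in \<open>auto intro: less_imp_le[OF rgauss_pos]\<close>)

definition rgauss_per :: "real \<Rightarrow> real \<Rightarrow> real ^ 'd::finite \<Rightarrow> real" where
  "rgauss_per L \<epsilon> x = (\<Sum>\<^sub>\<infinity>j. rgauss \<epsilon> (x + latt L j))"

lemma infsum_latt_shift:
  fixes i :: "int ^ 'd::finite"
  shows "(\<Sum>\<^sub>\<infinity>j. f (x + latt L i + latt L j)) = (\<Sum>\<^sub>\<infinity>j. f (x + latt L j))"
proof -
  have "(\<Sum>\<^sub>\<infinity>j. f (x + latt L j)) = (\<Sum>\<^sub>\<infinity>j. f (x + latt L (i + j)))"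
    by (rule infsum_reindex_bij_betw[symmetric]) (simp add: bij_betw_def)
  then show ?thesis by (simp add: latt_add add.assoc)
qed

lemma rgauss_per_periodic [simp]: "rgauss_per L \<epsilon> (x + latt L i) = rgauss_per L \<epsilon> x"
  unfolding rgauss_per_def by (rule infsum_latt_shift)

lemma infsum_latt_uminus: "(\<Sum>\<^sub>\<infinity>j. f (latt L j)) = (\<Sum>\<^sub>\<infinity>j. f (- latt L j))"
proof -
  have "(\<Sum>\<^sub>\<infinity>j. f (latt L j)) = (\<Sum>\<^sub>\<infinity>j. f (latt L (- j)))"
    by (rule infsum_reindex_bij_betw[symmetric]) (rule bij_uminus)
  then show ?thesis by (simp add: latt_uminus)
qed

lemma rgauss_per_minus [simp]: "rgauss_per L \<epsilon> (- x) = rgauss_per L \<epsilon> x"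
  unfolding rgauss_per_def
  by (subst infsum_latt_uminus) (metis (no_types, opaque_lifting) rgauss_minus minus_add_distrib)

lemma rgauss_per_commute: "rgauss_per L \<epsilon> (x - y) = rgauss_per L \<epsilon> (y - x)"
  by (metis rgauss_per_minus minus_diff_eq)

lemma rgauss_per_ge_rgauss:
  assumes L: "0 < L" and e: "0 < \<epsilon>"
  shows "rgauss \<epsilon> (x + latt L j) \<le> rgauss_per L \<epsilon> x"
proof -
  have "(\<Sum>\<^sub>\<infinity>i\<in>{j}. rgauss \<epsilon> (x + latt L i)) \<le> (\<Sum>\<^sub>\<infinity>i. rgauss \<epsilon> (x + latt L i))"
    by (rule infsum_mono2) (use summable_rgauss[OF L e] e in \<open>auto intro: less_imp_le[OF rgauss_pos]\<close>)
  then show ?thesis by (simp add: rgauss_per_def)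
qed

text \<open>The contribution of the one lattice translate that lies in the cell, whose norm is at
  most \<open>CARD('d) * L\<close>. As \<epsilon> tends to 0 this vanishes and \<open>gmax\<close>
  blows up, so both are meant for a fixed time.\<close>

definition gmin :: "'d::finite itself \<Rightarrow> real \<Rightarrow> real \<Rightarrow> real" where
  "gmin _ L \<epsilon> = (2 * pi * \<epsilon>) powr (- real CARD('d) / 2) * exp (- (real CARD('d) * L)\<^sup>2 / (2 * \<epsilon>))"

lemma gmin_pos: "0 < \<epsilon> \<Longrightarrow> 0 < gmin TYPE('d::finite) L \<epsilon>"
  by (simp add: gmin_def)

lemma rgauss_per_lower:
  fixes x :: "real ^ 'd::finite"
  assumes L: "0 < L" and e: "0 < \<epsilon>"
  shows "gmin TYPE('d) L \<epsilon> \<le> rgauss_per L \<epsilon> x"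
proof -
  obtain j where j: "x - latt L j \<in> cell L" by (rule cell_reduce[OF L])
  have "gmin TYPE('d) L \<epsilon> \<le> rgauss \<epsilon> (x + latt L (- j))"
    unfolding gmin_def rgauss_norm using norm_cell_le[OF j] e L
    by (intro mult_left_mono) (auto simp: latt_uminus intro!: divide_right_mono power_mono)
  also have "\<dots> \<le> rgauss_per L \<epsilon> x" by (rule rgauss_per_ge_rgauss[OF L e])
  finally show ?thesis .
qed

lemma rgauss_per_pos: "0 < L \<Longrightarrow> 0 < \<epsilon> \<Longrightarrow> 0 < rgauss_per L \<epsilon> x"
  using rgauss_per_lower gmin_pos less_le_trans by metis

text \<open>The total of \<open>gauss_majorant\<close> at \<open>R = CARD('d) * L\<close>. It
  decreases in \<epsilon>, so one value covers all later times.\<close>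

definition gmax :: "'d::finite itself \<Rightarrow> real \<Rightarrow> real \<Rightarrow> real" where
  "gmax _ L \<epsilon> = 2 powr (CARD('d) / 2) * exp ((2 * real CARD('d) * L)\<^sup>2 / (2 * \<epsilon>)) / L ^ CARD('d)"

lemma gmax_pos: "0 < L \<Longrightarrow> 0 < gmax TYPE('d::finite) L \<epsilon>"
  by (simp add: gmax_def)

lemma rgauss_per_upper:
  fixes x :: "real ^ 'd::finite"
  assumes L: "0 < L" and e: "0 < \<epsilon>"
  shows "rgauss_per L \<epsilon> x \<le> gmax TYPE('d) L \<epsilon>"
proof -
  obtain j where j: "x - latt L j \<in> cell L" by (rule cell_reduce[OF L])
  have "rgauss_per L \<epsilon> x = rgauss_per L \<epsilon> (x - latt L j)"
    using rgauss_per_periodic[of L \<epsilon> x "- j"] by (simp add: latt_uminus)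
  also have "\<dots> \<le> (\<Sum>\<^sub>\<infinity>i. gauss_majorant L \<epsilon> (real CARD('d) * L) (i :: int^'d))"
    unfolding rgauss_per_def using has_sum_imp_summable[OF has_sum_gauss_majorant[OF L e]]
    by (intro infsum_mono summable_rgauss[OF L e] rgauss_le_gauss_majorant[OF L e] norm_cell_le[OF j])
  also have "\<dots> = gmax TYPE('d) L \<epsilon>"
    using infsumI[OF has_sum_gauss_majorant[OF L e, where 'd='d, of "real CARD('d) * L"]] by (simp add: gmax_def algebra_simps)
  finally show ?thesis .
qed

lemma
  fixes w :: "complex ^ 'd::finite"
  assumes L: "0 < L" and e: "0 < \<epsilon>"
  shows abs_summable_gauss: "(\<lambda>j. norm (gauss \<epsilon> (w + cvec (latt L j)))) summable_on UNIV"
    and norm_gauss_per_le: "norm (gauss_per L \<epsilon> w) \<le> exp (im_sq w / (2 * \<epsilon>)) * rgauss_per L \<epsilon> (re_vec w)"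
proof -
  have n: "norm (gauss \<epsilon> (w + cvec (latt L j))) = exp (im_sq w / (2 * \<epsilon>)) * rgauss \<epsilon> (re_vec w + latt L j)" for j
    by (simp add: norm_gauss[OF e] re_vec_add)
  show s: "(\<lambda>j. norm (gauss \<epsilon> (w + cvec (latt L j)))) summable_on UNIV"
    unfolding n by (intro summable_on_cmult_right summable_rgauss[OF L e])
  have "norm (gauss_per L \<epsilon> w) \<le> (\<Sum>\<^sub>\<infinity>j. norm (gauss \<epsilon> (w + cvec (latt L j))))"
    unfolding gauss_per_def by (rule norm_infsum_bound[OF s])
  also have "\<dots> = exp (im_sq w / (2 * \<epsilon>)) * rgauss_per L \<epsilon> (re_vec w)"
    unfolding n rgauss_per_def by (rule infsum_cmult_right')
  finally show "norm (gauss_per L \<epsilon> w) \<le> exp (im_sq w / (2 * \<epsilon>)) * rgauss_per L \<epsilon> (re_vec w)" .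
qed

lemma gauss_per_cvec:
  assumes L: "0 < L" and e: "0 < \<epsilon>"
  shows "gauss_per L \<epsilon> (cvec x) = complex_of_real (rgauss_per L \<epsilon> x)"
  unfolding gauss_per_def rgauss_per_def cvec_add[symmetric] gauss_cvec
  by (rule infsumI[OF has_sum_of_real[OF has_sum_infsum[OF summable_rgauss[OF L e]]]])

lemma gauss_per_periodic [simp]: "gauss_per L \<epsilon> (w + cvec (latt L i)) = gauss_per L \<epsilon> w"
proof -
  have "(\<Sum>\<^sub>\<infinity>j. gauss \<epsilon> (w + cvec (latt L j))) = (\<Sum>\<^sub>\<infinity>j. gauss \<epsilon> (w + cvec (latt L (i + j))))"
    by (rule infsum_reindex_bij_betw[symmetric]) (simp add: bij_betw_def)
  then show ?thesis by (simp add: gauss_per_def latt_add cvec_add add.assoc)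
qed

lemma gauss_per_minus [simp]: "gauss_per L \<epsilon> (- w) = gauss_per L \<epsilon> w"
proof -
  have "gauss \<epsilon> (- w + cvec (latt L (- j))) = gauss \<epsilon> (w + cvec (latt L j))" for j
    by (metis (no_types, opaque_lifting) cvec_uminus gauss_minus latt_uminus minus_add_distrib)
  moreover have "(\<Sum>\<^sub>\<infinity>j. gauss \<epsilon> (- w + cvec (latt L j))) = (\<Sum>\<^sub>\<infinity>j. gauss \<epsilon> (- w + cvec (latt L (- j))))"
    by (rule infsum_reindex_bij_betw[symmetric]) (rule bij_uminus)
  ultimately show ?thesis by (simp add: gauss_per_def)
qed

lemma gauss_per_commute: "gauss_per L \<epsilon> (v - w) = gauss_per L \<epsilon> (w - v)"
  by (metis gauss_per_minus minus_diff_eq)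

lemma measurable_infsum_latt:
  fixes F :: "'i::countable \<Rightarrow> 'a \<Rightarrow> 'b::{banach,second_countable_topology}"
  assumes [measurable]: "\<And>j. F j \<in> borel_measurable M"
    and s: "\<And>x. (\<lambda>j. norm (F j x)) summable_on UNIV"
  shows "(\<lambda>x. \<Sum>\<^sub>\<infinity>j. F j x) \<in> borel_measurable M"
proof -
  interpret S: sigma_finite_measure "count_space (UNIV::'i set)"
    by (rule sigma_finite_measure_count_space_countable) simp
  have m: "(\<lambda>(j, x). F j x) \<in> count_space UNIV \<Otimes>\<^sub>M M \<rightarrow>\<^sub>M borel"
    by (rule measurable_count_space_pair) simp
  have "(\<lambda>x. LINT j|count_space UNIV. F j x) \<in> borel_measurable M"
    using measurable_pair_swap[OF m] by (intro S.borel_measurable_lebesgue_integral) (simp add: case_prod_unfold)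
  then show ?thesis by (simp add: integral_count_space_infsum[OF s])
qed

text \<open>The sum is an integral against counting measure, so this is Fubini.\<close>

lemma (in sigma_finite_measure) integral_infsum:
  fixes F :: "'i::countable \<Rightarrow> 'a \<Rightarrow> 'b::{banach,second_countable_topology}"
  assumes [measurable]: "\<And>j. F j \<in> borel_measurable M"
    and s: "\<And>x. (\<lambda>j. norm (F j x)) summable_on UNIV"
    and i: "integrable M (\<lambda>x. \<Sum>\<^sub>\<infinity>j. norm (F j x))"
    and s': "(\<lambda>j. norm (LINT x|M. F j x)) summable_on UNIV"
  shows "(LINT x|M. (\<Sum>\<^sub>\<infinity>j. F j x)) = (\<Sum>\<^sub>\<infinity>j. LINT x|M. F j x)"
proof -
  interpret S: sigma_finite_measure "count_space (UNIV::'i set)"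
    by (rule sigma_finite_measure_count_space_countable) simp
  interpret P: pair_sigma_finite M "count_space (UNIV::'i set)" ..
  interpret Q: pair_sigma_finite "count_space (UNIV::'i set)" M ..
  have m: "(\<lambda>(j, x). F j x) \<in> count_space UNIV \<Otimes>\<^sub>M M \<rightarrow>\<^sub>M borel"
    by (rule measurable_count_space_pair) simp
  have n: "(LINT j|count_space UNIV. norm (F j x)) = (\<Sum>\<^sub>\<infinity>j. norm (F j x))" for x
    using s[of x] by (intro integral_count_space_infsum) simp
  have i': "integrable (M \<Otimes>\<^sub>M count_space UNIV) (\<lambda>(x, j). F j x)"
  proof (rule P.Fubini_integrable)
    show "(\<lambda>(x, j). F j x) \<in> borel_measurable (M \<Otimes>\<^sub>M count_space UNIV)"
      using measurable_pair_swap[OF m] by (simp add: case_prod_unfold)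
  qed (use i s in \<open>auto simp: n intro: integral_count_space_infsum(1)\<close>)
  have "(LINT x|M. (\<Sum>\<^sub>\<infinity>j. F j x)) = (LINT x|M. (LINT j|count_space UNIV. F j x))"
    by (simp add: integral_count_space_infsum[OF s])
  also have "\<dots> = (LINT j|count_space UNIV. (LINT x|M. F j x))"
    using P.integral_fst'[OF i'] Q.integral_fst'[of "\<lambda>(j, x). F j x"] P.integrable_product_swap[OF i']
      P.integral_product_swap[of "\<lambda>(x, j). F j x"] P.integral_snd[of "\<lambda>x j. F j x"] i' by (simp add: case_prod_unfold)
  also have "\<dots> = (\<Sum>\<^sub>\<infinity>j. LINT x|M. F j x)"
    by (rule integral_count_space_infsum[OF s'])
  finally show ?thesis .
qed

lemma infsum_diff_real_normed:
  fixes f g :: "'i \<Rightarrow> 'b::real_normed_vector"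
  assumes f: "f summable_on A" and g: "g summable_on A"
  shows "(\<Sum>\<^sub>\<infinity>i\<in>A. f i - g i) = (\<Sum>\<^sub>\<infinity>i\<in>A. f i) - (\<Sum>\<^sub>\<infinity>i\<in>A. g i)"
    and "(\<lambda>i. f i - g i) summable_on A"
  using infsum_add[OF f summable_on_uminus[THEN iffD2, OF g]] summable_on_add[OF f summable_on_uminus[THEN iffD2, OF g]]
  by (simp_all add: infsum_uminus)

section \<open>Continuity and complex differentiability of the kernel\<close>

lemma bounded_linear_cvec: "bounded_linear (cvec :: real ^ 'd::finite \<Rightarrow> complex ^ 'd)"
proof -
  have "linear (cvec :: real ^ 'd::finite \<Rightarrow> complex ^ 'd)"
    by (rule linearI) (auto simp: vec_eq_iff complex_eq_iff)
  then show ?thesis by (rule linear_conv_bounded_linear[THEN iffD1])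
qed

lemmas continuous_on_cvec [continuous_intros] = bounded_linear.continuous_on[OF bounded_linear_cvec]

lemma borel_measurable_cvec [measurable]: "cvec \<in> borel_measurable borel"
  by (intro borel_measurable_continuous_onI continuous_on_cvec continuous_on_id)

lemma continuous_on_gauss [continuous_intros]:
  "0 < \<epsilon> \<Longrightarrow> continuous_on A f \<Longrightarrow> continuous_on A (\<lambda>x. gauss \<epsilon> (f x))"
  unfolding gauss_def by (intro continuous_intros) auto

definition dgauss :: "real \<Rightarrow> complex ^ 'd::finite \<Rightarrow> complex ^ 'd \<Rightarrow> complex" where
  "dgauss \<epsilon> w v = - gauss \<epsilon> w * (\<Sum>k\<in>UNIV. w $ k * v $ k) / of_real \<epsilon>"

text \<open>The growth \<open>exp (2 * y)\<close> with \<open>y = (norm w + 1) / \<epsilon>\<close>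
  is absorbed in a Gaussian of doubled variance; the exponent is what remains of it. The 3 adds the
  2 of the exponential remainder and the 1 of the quadratic term.\<close>

definition taylor_const :: "'d::finite itself \<Rightarrow> real \<Rightarrow> real \<Rightarrow> real" where
  "taylor_const _ \<epsilon> I = 3 * exp (2 * (1 + sqrt I) / \<epsilon> + 4 / \<epsilon> + I / (2 * \<epsilon>)) * 2 powr (CARD('d) / 2)"

lemma rgauss_exp_double:
  fixes x :: "real ^ 'd::finite"
  assumes e: "0 < \<epsilon>"
  shows "exp ((norm x)\<^sup>2 / (4 * \<epsilon>)) * rgauss \<epsilon> x = 2 powr (CARD('d) / 2) * rgauss (2 * \<epsilon>) x"
proof -
  have "2 powr (CARD('d) / 2) * (2 * pi * (2 * \<epsilon>)) powr (- real CARD('d) / 2) = 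
     2 powr (CARD('d) / 2) * (2 powr (- real CARD('d) / 2) * (2 * pi * \<epsilon>) powr (- real CARD('d) / 2))"
    using e by (simp add: powr_mult[symmetric] mult_ac)
  also have "\<dots> = (2 * pi * \<epsilon>) powr (- real CARD('d) / 2)"
    by (simp add: mult.assoc[symmetric] powr_add[symmetric])
  finally have p: "(2 * pi * \<epsilon>) powr (- real CARD('d) / 2) = 2 powr (CARD('d) / 2) * (2 * pi * (2 * \<epsilon>)) powr (- real CARD('d) / 2)" ..
  have "(norm x)\<^sup>2 / (4 * \<epsilon>) + - (norm x)\<^sup>2 / (2 * \<epsilon>) = - (norm x)\<^sup>2 / (2 * (2 * \<epsilon>))"
    using e by (simp add: field_simps)
  then have "exp ((norm x)\<^sup>2 / (4 * \<epsilon>)) * exp (- (norm x)\<^sup>2 / (2 * \<epsilon>)) = exp (- (norm x)\<^sup>2 / (2 * (2 * \<epsilon>)))"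
    by (simp add: exp_add[symmetric])
  then show ?thesis unfolding rgauss_norm p by (simp add: mult_ac)
qed

lemma norm_cscalar_le:
  fixes w v :: "complex ^ 'd::finite"
  shows "norm (\<Sum>k\<in>UNIV. w $ k * v $ k) \<le> norm w * norm v"
proof -
  have "norm (\<Sum>k\<in>UNIV. w $ k * v $ k) \<le> (\<Sum>k\<in>UNIV. \<bar>norm (w $ k)\<bar> * \<bar>norm (v $ k)\<bar>)"
    by (rule order_trans[OF norm_sum]) (simp add: norm_mult)
  also have "\<dots> \<le> norm w * norm v"
    unfolding norm_vec_def by (rule L2_set_mult_ineq)
  finally show ?thesis .
qed

lemma norm_cvector_le: "norm (w :: complex ^ 'd::finite) \<le> norm (re_vec w) + sqrt (im_sq w)"
proof -
  have "norm w = sqrt ((norm (re_vec w))\<^sup>2 + im_sq w)"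
    by (simp add: norm_vec_def L2_set_def im_sq_def cmod_power2 sum.distrib sum_nonneg)
  also have "\<dots> \<le> sqrt ((norm (re_vec w))\<^sup>2) + sqrt (im_sq w)"
    by (rule sqrt_add_le_add_sqrt) auto
  finally show ?thesis by simp
qed

lemma power2_le_2_exp: "0 \<le> (y::real) \<Longrightarrow> y\<^sup>2 \<le> 2 * exp y"
  using exp_lower_Taylor_quadratic[of y] by simp

text \<open>The quotient of \<open>gauss \<epsilon> (w + v)\<close> and
  \<open>gauss \<epsilon> w\<close> is \<open>exp a\<close> with a of first order in v. The bounds
  are multiples of a Gaussian in \<open>re_vec w\<close>, so that they sum over the lattice.\<close>

lemma
  fixes w v :: "complex ^ 'd::finite"
  assumes e: "0 < \<epsilon>" and I: "im_sq w \<le> I"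
  shows gauss_taylor: "norm v \<le> 1 \<Longrightarrow> norm (gauss \<epsilon> (w + v) - gauss \<epsilon> w - dgauss \<epsilon> w v) \<le> taylor_const TYPE('d) \<epsilon> I * (norm v)\<^sup>2 * rgauss (2 * \<epsilon>) (re_vec w)"
    and norm_dgauss_le: "norm (dgauss \<epsilon> w v) \<le> taylor_const TYPE('d) \<epsilon> I * norm v * rgauss (2 * \<epsilon>) (re_vec w)"
proof -
  define S V y where "S = (\<Sum>k\<in>UNIV. w $ k * v $ k)" and "V = (\<Sum>k\<in>UNIV. (v $ k)\<^sup>2)" and "y = (norm w + 1) / \<epsilon>"
  have S: "norm S \<le> norm w * norm v" unfolding S_def by (rule norm_cscalar_le)
  have V: "norm V \<le> (norm v)\<^sup>2" unfolding V_def power2_eq_square by (rule norm_cscalar_le)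
  have y: "0 \<le> y" using e by (simp add: y_def)
  define r where "r = norm (re_vec w)"
  \<comment> \<open>Young's inequality: the term linear in r is absorbed in the half of the Gaussian
    exponent that \<open>rgauss_exp_double\<close> gives away.\<close>
  have "0 \<le> (r / 2 - 2)\<^sup>2" by simp
  then have "2 * r \<le> r\<^sup>2 / 4 + 4" by (simp add: power2_eq_square field_simps)
  then have "2 * r / \<epsilon> \<le> (r\<^sup>2 / 4 + 4) / \<epsilon>" using e by (intro divide_right_mono) auto
  then have r: "2 * r / \<epsilon> \<le> r\<^sup>2 / (4 * \<epsilon>) + 4 / \<epsilon>" by (simp add: add_divide_distrib)
  have "norm w + 1 \<le> r + sqrt I + 1"
    using norm_cvector_le[of w] real_sqrt_le_mono[OF I] unfolding r_def by linarith
  then have "2 * y \<le> 2 * (1 + sqrt I) / \<epsilon> + 2 * r / \<epsilon>"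
    using e divide_right_mono[of "norm w + 1" "r + sqrt I + 1" \<epsilon>] by (simp add: y_def add_divide_distrib)
  with r have "2 * y \<le> (2 * (1 + sqrt I) / \<epsilon> + 4 / \<epsilon>) + r\<^sup>2 / (4 * \<epsilon>)" by linarith
  moreover have "im_sq w / (2 * \<epsilon>) \<le> I / (2 * \<epsilon>)" using e I by (intro divide_right_mono) auto
  ultimately have "exp (im_sq w / (2 * \<epsilon>) + 2 * y) \<le> exp ((2 * (1 + sqrt I) / \<epsilon> + 4 / \<epsilon> + I / (2 * \<epsilon>)) + r\<^sup>2 / (4 * \<epsilon>))"
    unfolding exp_le_cancel_iff by linarith
  then have "exp (im_sq w / (2 * \<epsilon>) + 2 * y) * rgauss \<epsilon> (re_vec w) \<le> exp ((2 * (1 + sqrt I) / \<epsilon> + 4 / \<epsilon> + I / (2 * \<epsilon>)) + r\<^sup>2 / (4 * \<epsilon>)) * rgauss \<epsilon> (re_vec w)"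
    using rgauss_pos[OF e] by (intro mult_right_mono) (auto intro: less_imp_le)
  also have "\<dots> = exp (2 * (1 + sqrt I) / \<epsilon> + 4 / \<epsilon> + I / (2 * \<epsilon>)) * (2 powr (CARD('d) / 2) * rgauss (2 * \<epsilon>) (re_vec w))"
    unfolding rgauss_exp_double[OF e, symmetric] by (simp add: exp_add r_def)
  finally have G: "3 * exp (2 * y) * norm (gauss \<epsilon> w) \<le> taylor_const TYPE('d) \<epsilon> I * rgauss (2 * \<epsilon>) (re_vec w)"
    unfolding taylor_const_def norm_gauss[OF e] by (simp add: exp_add mult_ac)
  have ey: "y \<le> exp (2 * y)"
    using exp_ge_add_one_self[of "2 * y"] y by linarith
  show "norm (dgauss \<epsilon> w v) \<le> taylor_const TYPE('d) \<epsilon> I * norm v * rgauss (2 * \<epsilon>) (re_vec w)"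
  proof -
    have "norm (dgauss \<epsilon> w v) = norm (gauss \<epsilon> w) * (norm S / \<epsilon>)"
      using e by (simp add: dgauss_def S_def[symmetric] norm_mult norm_divide)
    also have "norm S / \<epsilon> \<le> y * norm v"
      using S e mult_right_mono[of "norm w" "norm w + 1" "norm v"] by (simp add: y_def divide_right_mono)
    also have "y * norm v \<le> 3 * exp (2 * y) * norm v"
    proof (rule mult_right_mono)
      show "y \<le> 3 * exp (2 * y)" using ey exp_gt_zero[of "2*y"] by linarith
    qed simp
    finally have "norm (dgauss \<epsilon> w v) \<le> norm (gauss \<epsilon> w) * (3 * exp (2 * y) * norm v)"
      by (simp add: mult_left_mono)
    also have "\<dots> \<le> taylor_const TYPE('d) \<epsilon> I * rgauss (2 * \<epsilon>) (re_vec w) * norm v"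
      using mult_right_mono[OF G norm_ge_zero[of v]] by (simp add: mult_ac)
    finally show ?thesis by (simp add: mult_ac)
  qed
  assume v: "norm v \<le> 1"
  define a where "a = - (2 * S + V) / (2 * of_real \<epsilon>)"
  have sq: "(\<Sum>k\<in>UNIV. ((w + v) $ k)\<^sup>2) = (\<Sum>k\<in>UNIV. (w $ k)\<^sup>2) + (2 * S + V)"
    by (simp add: S_def V_def power2_sum sum.distrib sum_distrib_left mult_ac)
  have ga: "gauss \<epsilon> (w + v) = gauss \<epsilon> w * exp a"
    unfolding gauss_def sq a_def mult.assoc exp_add[symmetric]
    by (simp add: add_divide_distrib diff_divide_distrib)
  have "norm v * norm v \<le> norm v" using v by (simp add: mult_left_le)
  then have "norm v * norm v \<le> 2 * norm v" using norm_ge_zero[of v] by linarith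
  then have "norm (2 * S + V) \<le> 2 * (norm v * (norm w + 1))"
    using S V norm_triangle_ineq[of "2 * S" V] norm_ge_zero[of v] by (simp add: power2_eq_square algebra_simps norm_mult)
  then have "norm (2 * S + V) / (2 * \<epsilon>) \<le> 2 * (norm v * (norm w + 1)) / (2 * \<epsilon>)"
    using e by (intro divide_right_mono) auto
  moreover have "norm a = norm (2 * S + V) / (2 * \<epsilon>)"
    unfolding a_def norm_divide norm_minus_cancel using e by (simp add: norm_mult)
  ultimately have na: "norm a \<le> norm v * y"
    by (simp add: y_def)
  have "norm v * y \<le> y" using v y by (simp add: mult_right_le_one_le mult.commute)
  with na have nay: "norm a \<le> y" by simp
  have "norm (exp a - (\<Sum>i\<le>1. a ^ i / fact i)) \<le> exp \<bar>Re a\<bar> * (norm a ^ Suc 1) / fact 1"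
    by (rule Taylor_exp)
  also have "\<dots> \<le> exp y * (norm v * y)\<^sup>2"
    using na nay abs_Re_le_cmod[of a] by (auto simp: power2_eq_square intro!: mult_mono)
  also have "\<dots> = exp y * y\<^sup>2 * (norm v)\<^sup>2" by (simp add: power_mult_distrib)
  also have "\<dots> \<le> exp y * (2 * exp y) * (norm v)\<^sup>2"
    using power2_le_2_exp[OF y] by (intro mult_right_mono mult_left_mono) auto
  finally have t1: "norm (exp a - 1 - a) \<le> 2 * exp (2 * y) * (norm v)\<^sup>2"
    unfolding exp_double[of y] by (simp add: power2_eq_square algebra_simps)
  \<comment> \<open>The part of a linear in v is \<open>- S / \<epsilon>\<close>, which is what
    \<open>dgauss\<close> removes; only the quadratic V remains.\<close>
  have "a + S / of_real \<epsilon> = - V / (2 * of_real \<epsilon>)"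
    using e by (simp add: a_def field_simps)
  then have "norm (a + S / of_real \<epsilon>) = norm V / (2 * \<epsilon>)"
    using e by (simp add: norm_divide norm_mult)
  also have "\<dots> \<le> (norm v)\<^sup>2 * y"
  proof -
    have "norm V / (2 * \<epsilon>) \<le> (norm v)\<^sup>2 / (2 * \<epsilon>)" using V e by (simp add: divide_right_mono)
    also have "\<dots> = (norm v)\<^sup>2 * (1 / (2 * \<epsilon>))" by simp
    also have "\<dots> \<le> (norm v)\<^sup>2 * y"
      using e by (intro mult_left_mono) (auto simp: y_def field_simps intro: add_nonneg_nonneg)
    finally show ?thesis .
  qed
  also have "\<dots> \<le> (norm v)\<^sup>2 * exp (2 * y)" using ey by (intro mult_left_mono) auto
  finally have t2: "norm (a + S / of_real \<epsilon>) \<le> exp (2 * y) * (norm v)\<^sup>2" by (simp add: mult_ac)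
  have "gauss \<epsilon> (w + v) - gauss \<epsilon> w - dgauss \<epsilon> w v = gauss \<epsilon> w * ((exp a - 1 - a) + (a + S / of_real \<epsilon>))"
    unfolding ga dgauss_def S_def[symmetric] by (simp add: algebra_simps)
  then have "norm (gauss \<epsilon> (w + v) - gauss \<epsilon> w - dgauss \<epsilon> w v) \<le> norm (gauss \<epsilon> w) * (norm (exp a - 1 - a) + norm (a + S / of_real \<epsilon>))"
    by (simp only: norm_mult mult_left_mono norm_triangle_ineq norm_ge_zero)
  also have "\<dots> \<le> norm (gauss \<epsilon> w) * (3 * exp (2 * y) * (norm v)\<^sup>2)"
    using t1 t2 by (intro mult_left_mono) auto
  also have "\<dots> \<le> taylor_const TYPE('d) \<epsilon> I * rgauss (2 * \<epsilon>) (re_vec w) * (norm v)\<^sup>2"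
    using mult_right_mono[OF G, of "(norm v)\<^sup>2"] by (simp add: mult_ac)
  finally show "norm (gauss \<epsilon> (w + v) - gauss \<epsilon> w - dgauss \<epsilon> w v) \<le> taylor_const TYPE('d) \<epsilon> I * (norm v)\<^sup>2 * rgauss (2 * \<epsilon>) (re_vec w)"
    by (simp add: mult_ac)
qed

lemma dgauss_add: "dgauss \<epsilon> w (u + v) = dgauss \<epsilon> w u + dgauss \<epsilon> w v"
  by (simp add: dgauss_def ring_distribs sum.distrib add_divide_distrib diff_divide_distrib)

lemma dgauss_cscale: "dgauss \<epsilon> w (c *s v) = c * dgauss \<epsilon> w v"
  by (simp add: dgauss_def sum_distrib_left mult_ac)

definition dgauss_per :: "real \<Rightarrow> real \<Rightarrow> complex ^ 'd::finite \<Rightarrow> complex ^ 'd \<Rightarrow> complex" where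
  "dgauss_per L \<epsilon> w v = (\<Sum>\<^sub>\<infinity>j. dgauss \<epsilon> (w + cvec (latt L j)) v)"

lemma taylor_const_pos: "0 < taylor_const TYPE('d::finite) \<epsilon> I"
  by (simp add: taylor_const_def)

lemma
  fixes w v :: "complex ^ 'd::finite"
  assumes L: "0 < L" and e: "0 < \<epsilon>" and I: "im_sq w \<le> I"
  shows abs_summable_dgauss: "(\<lambda>j. norm (dgauss \<epsilon> (w + cvec (latt L j)) v)) summable_on UNIV"
    and norm_dgauss_per_le: "norm (dgauss_per L \<epsilon> w v) \<le> taylor_const TYPE('d) \<epsilon> I * gmax TYPE('d) L (2 * \<epsilon>) * norm v"
    and gauss_per_taylor: "norm v \<le> 1 \<Longrightarrow> norm (gauss_per L \<epsilon> (w + v) - gauss_per L \<epsilon> w - dgauss_per L \<epsilon> w v) \<le> taylor_const TYPE('d) \<epsilon> I * gmax TYPE('d) L (2 * \<epsilon>) * (norm v)\<^sup>2"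
proof -
  have e2: "0 < 2 * \<epsilon>" using e by simp
  let ?G = "\<lambda>j. rgauss (2 * \<epsilon>) (re_vec w + latt L j)"
  have sG: "?G summable_on UNIV" by (rule summable_rgauss[OF L e2])
  have iG: "infsum ?G UNIV \<le> gmax TYPE('d) L (2 * \<epsilon>)"
    using rgauss_per_upper[OF L e2, of "re_vec w"] by (simp add: rgauss_per_def)
  have g: "0 \<le> taylor_const TYPE('d) \<epsilon> I" using taylor_const_pos less_imp_le by blast
  have d: "norm (dgauss \<epsilon> (w + cvec (latt L j)) v) \<le> taylor_const TYPE('d) \<epsilon> I * norm v * ?G j" for j
    using norm_dgauss_le[OF e, of "w + cvec (latt L j)" I v] I by (simp add: re_vec_add)
  show s: "(\<lambda>j. norm (dgauss \<epsilon> (w + cvec (latt L j)) v)) summable_on UNIV"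
    by (rule summable_on_comparison_test[OF summable_on_cmult_right[OF sG] d]) simp
  have "norm (dgauss_per L \<epsilon> w v) \<le> (\<Sum>\<^sub>\<infinity>j. taylor_const TYPE('d) \<epsilon> I * norm v * ?G j)"
    unfolding dgauss_per_def
    by (rule order_trans[OF norm_infsum_bound[OF s]], rule infsum_mono[OF s summable_on_cmult_right[OF sG] d])
  also have "\<dots> = taylor_const TYPE('d) \<epsilon> I * norm v * infsum ?G UNIV" by (rule infsum_cmult_right')
  also have "\<dots> \<le> taylor_const TYPE('d) \<epsilon> I * norm v * gmax TYPE('d) L (2 * \<epsilon>)"
    using g iG by (intro mult_left_mono) auto
  finally show "norm (dgauss_per L \<epsilon> w v) \<le> taylor_const TYPE('d) \<epsilon> I * gmax TYPE('d) L (2 * \<epsilon>) * norm v"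
    by (simp add: mult_ac)
  assume v: "norm v \<le> 1"
  let ?R = "\<lambda>j. gauss \<epsilon> (w + v + cvec (latt L j)) - gauss \<epsilon> (w + cvec (latt L j)) - dgauss \<epsilon> (w + cvec (latt L j)) v"
  have r: "norm (?R j) \<le> taylor_const TYPE('d) \<epsilon> I * (norm v)\<^sup>2 * ?G j" for j
    using gauss_taylor[OF e, of "w + cvec (latt L j)" I v] I v by (simp add: re_vec_add add_ac)
  have sR: "(\<lambda>j. norm (?R j)) summable_on UNIV"
    by (rule summable_on_comparison_test[OF summable_on_cmult_right[OF sG] r]) simp
  note g1 = abs_summable_summable[OF abs_summable_gauss[OF L e, of "w + v"]]
    and g2 = abs_summable_summable[OF abs_summable_gauss[OF L e, of w]] and g3 = abs_summable_summable[OF s]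
  have "gauss_per L \<epsilon> (w + v) - gauss_per L \<epsilon> w - dgauss_per L \<epsilon> w v = infsum ?R UNIV"
    unfolding gauss_per_def dgauss_per_def
    using infsum_diff_real_normed(1)[OF infsum_diff_real_normed(2)[OF g1 g2] g3] infsum_diff_real_normed(1)[OF g1 g2] by simp
  then have "norm (gauss_per L \<epsilon> (w + v) - gauss_per L \<epsilon> w - dgauss_per L \<epsilon> w v) \<le> (\<Sum>\<^sub>\<infinity>j. taylor_const TYPE('d) \<epsilon> I * (norm v)\<^sup>2 * ?G j)"
    by (simp only:) (rule order_trans[OF norm_infsum_bound[OF sR]], rule infsum_mono[OF sR summable_on_cmult_right[OF sG] r])
  also have "\<dots> = taylor_const TYPE('d) \<epsilon> I * (norm v)\<^sup>2 * infsum ?G UNIV" by (rule infsum_cmult_right')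
  also have "\<dots> \<le> taylor_const TYPE('d) \<epsilon> I * (norm v)\<^sup>2 * gmax TYPE('d) L (2 * \<epsilon>)"
    using g iG by (intro mult_left_mono) auto
  finally show "norm (gauss_per L \<epsilon> (w + v) - gauss_per L \<epsilon> w - dgauss_per L \<epsilon> w v) \<le> taylor_const TYPE('d) \<epsilon> I * gmax TYPE('d) L (2 * \<epsilon>) * (norm v)\<^sup>2"
    by (simp add: mult_ac)
qed

lemma dgauss_per_add:
  "0 < L \<Longrightarrow> 0 < \<epsilon> \<Longrightarrow> dgauss_per L \<epsilon> w (u + v) = dgauss_per L \<epsilon> w u + dgauss_per L \<epsilon> w v"
  unfolding dgauss_per_def dgauss_add
  by (intro infsum_add abs_summable_summable[OF abs_summable_dgauss]) auto

lemma dgauss_per_cscale: "dgauss_per L \<epsilon> w (c *s v) = c * dgauss_per L \<epsilon> w v"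
  unfolding dgauss_per_def dgauss_cscale by (rule infsum_cmult_right')

lemma continuous_on_gauss_per:
  fixes f :: "'a::topological_space \<Rightarrow> complex ^ 'd::finite"
  assumes L: "0 < L" and e: "0 < \<epsilon>" and f: "continuous_on A f"
  shows "continuous_on A (\<lambda>x. gauss_per L \<epsilon> (f x))"
proof -
  have "isCont (gauss_per L \<epsilon>) (w :: complex ^ 'd)" for w
  proof -
    let ?C = "taylor_const TYPE('d) \<epsilon> (im_sq w) * gmax TYPE('d) L (2 * \<epsilon>)"
    have "((\<lambda>v. ?C * (norm v)\<^sup>2 + ?C * norm v) \<longlongrightarrow> ?C * (norm (0::complex^'d))\<^sup>2 + ?C * norm (0::complex^'d)) (at 0)"
      by (auto intro!: tendsto_eq_intros)
    then have "((\<lambda>v::complex^'d. ?C * (norm v)\<^sup>2 + ?C * norm v) \<longlongrightarrow> 0) (at 0)" by simp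
    moreover have "\<forall>\<^sub>F v in at 0. norm (gauss_per L \<epsilon> (w + v) - gauss_per L \<epsilon> w) \<le> ?C * (norm v)\<^sup>2 + ?C * norm v"
    proof (rule eventually_at[THEN iffD2], intro exI[of _ 1] conjI ballI impI)
      fix v :: "complex ^ 'd" assume "v \<noteq> 0 \<and> dist v 0 < 1"
      then have v: "norm v \<le> 1" by simp
      show "norm (gauss_per L \<epsilon> (w + v) - gauss_per L \<epsilon> w) \<le> ?C * (norm v)\<^sup>2 + ?C * norm v"
        using gauss_per_taylor[OF L e order_refl v, of w] norm_dgauss_per_le[OF L e order_refl, of w v]
          norm_triangle_sub[of "gauss_per L \<epsilon> (w + v) - gauss_per L \<epsilon> w" "dgauss_per L \<epsilon> w v"] by linarith
    qed simp
    ultimately have "((\<lambda>v. gauss_per L \<epsilon> (w + v) - gauss_per L \<epsilon> w) \<longlongrightarrow> 0) (at 0)"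
      by (rule Lim_null_comparison[rotated])
    then show ?thesis
      by (simp add: isCont_iff LIM_zero_iff)
  qed
  then have "continuous_on UNIV (gauss_per L \<epsilon> :: complex ^ 'd \<Rightarrow> complex)"
    by (simp add: continuous_on_eq_continuous_at)
  then show ?thesis
    by (rule continuous_on_compose2[OF _ f]) auto
qed

lemma continuous_on_rgauss_per:
  fixes f :: "'a::topological_space \<Rightarrow> real ^ 'd::finite"
  assumes L: "0 < L" and e: "0 < \<epsilon>" and f: "continuous_on A f"
  shows "continuous_on A (\<lambda>x. rgauss_per L \<epsilon> (f x))"
proof -
  have "continuous_on A (\<lambda>x. Re (gauss_per L \<epsilon> (cvec (f x))))"
    by (intro continuous_intros continuous_on_gauss_per[OF L e] f)
  then show ?thesis by (simp add: gauss_per_cvec[OF L e])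
qed

lemma measurable_gauss_per [measurable]: "0 < L \<Longrightarrow> 0 < \<epsilon> \<Longrightarrow> gauss_per L \<epsilon> \<in> borel_measurable borel"
  by (intro borel_measurable_continuous_onI continuous_on_gauss_per continuous_on_id)

lemma measurable_rgauss_per [measurable]: "0 < L \<Longrightarrow> 0 < \<epsilon> \<Longrightarrow> rgauss_per L \<epsilon> \<in> borel_measurable borel"
  by (intro borel_measurable_continuous_onI continuous_on_rgauss_per continuous_on_id)

lemma continuous_on_dgauss: "0 < \<epsilon> \<Longrightarrow> continuous_on A (\<lambda>w. dgauss \<epsilon> w v)"
  unfolding dgauss_def by (intro continuous_intros) auto

lemma measurable_dgauss_per:
  assumes L: "0 < L" and e: "0 < \<epsilon>"
  shows "(\<lambda>w. dgauss_per L \<epsilon> w v) \<in> borel_measurable borel"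
  unfolding dgauss_per_def
proof (rule measurable_infsum_latt)
  fix j :: "int ^ 'a"
  have "(\<lambda>w. dgauss \<epsilon> w v) \<in> borel_measurable borel"
    by (intro borel_measurable_continuous_onI continuous_on_dgauss[OF e])
  then show "(\<lambda>w. dgauss \<epsilon> (w + cvec (latt L j)) v) \<in> borel_measurable borel"
    by (rule measurable_compose[rotated]) simp
qed (rule abs_summable_dgauss[OF L e order_refl])

section \<open>Bounded measurable functions\<close>

text \<open>Bounded at every point, not merely almost everywhere: the same function is integrated
  against a density and against sample points.\<close>

definition bdd_borel :: "(real ^ 'd::finite \<Rightarrow> 'b::real_normed_vector) set" where
  "bdd_borel = {f. f \<in> borel_measurable borel \<and> (\<exists>B. \<forall>y. norm (f y) \<le> B)}"

lemma bdd_borel_measurable: "f \<in> bdd_borel \<Longrightarrow> f \<in> borel_measurable borel"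
  by (simp add: bdd_borel_def)

lemma bmE:
  assumes "f \<in> bdd_borel"
  obtains B where "\<And>y. norm (f y) \<le> B" "0 \<le> B"
  using assms by (auto simp: bdd_borel_def) (meson norm_ge_zero order_trans)

lemma bmI: "f \<in> borel_measurable borel \<Longrightarrow> (\<And>y. norm (f y) \<le> B) \<Longrightarrow> f \<in> bdd_borel"
  by (auto simp: bdd_borel_def)

lemma bdd_borel_const [simp]: "(\<lambda>_. c) \<in> bdd_borel"
  by (auto simp: bdd_borel_def)

lemma bdd_borel_add:
  fixes f g :: "real ^ 'd::finite \<Rightarrow> 'b::{real_normed_vector,second_countable_topology}"
  assumes "f \<in> bdd_borel" "g \<in> bdd_borel"
  shows "(\<lambda>y. f y + g y) \<in> bdd_borel"
proof -
  obtain A B where "\<And>y. norm (f y) \<le> A" "\<And>y. norm (g y) \<le> B" using assms by (meson bmE)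
  then show ?thesis
    using assms by (intro bmI[where B="A + B"] borel_measurable_add) (auto simp: bdd_borel_measurable intro: norm_triangle_mono)
qed

lemma bdd_borel_mult:
  fixes f g :: "real ^ 'd::finite \<Rightarrow> 'b::{real_normed_algebra,second_countable_topology}"
  assumes "f \<in> bdd_borel" "g \<in> bdd_borel"
  shows "(\<lambda>y. f y * g y) \<in> bdd_borel"
proof -
  obtain A B where "\<And>y. norm (f y) \<le> A" "\<And>y. norm (g y) \<le> B" "0 \<le> A" using assms by (meson bmE)
  then show ?thesis
    using assms by (intro bmI[where B="A * B"] borel_measurable_times)
      (auto simp: bdd_borel_measurable intro!: order_trans[OF norm_mult_ineq] mult_mono)
qed

lemma bdd_borel_cmult:
  fixes f :: "real ^ 'd::finite \<Rightarrow> 'b::{real_normed_algebra,second_countable_topology}"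
  shows "f \<in> bdd_borel \<Longrightarrow> (\<lambda>y. c * f y) \<in> bdd_borel"
  by (intro bdd_borel_mult) auto

lemma bdd_borel_diff:
  fixes f g :: "real ^ 'd::finite \<Rightarrow> 'b::{real_normed_vector,second_countable_topology}"
  assumes "f \<in> bdd_borel" "g \<in> bdd_borel"
  shows "(\<lambda>y. f y - g y) \<in> bdd_borel"
proof -
  obtain A B where "\<And>y. norm (f y) \<le> A" "\<And>y. norm (g y) \<le> B" using assms by (meson bmE)
  then show ?thesis
    using assms by (intro bmI[where B="A + B"] borel_measurable_diff) (auto simp: bdd_borel_measurable intro: norm_triangle_le_diff add_mono)
qed

lemma bdd_borel_of_real [simp]: "(\<lambda>y. complex_of_real (f y)) \<in> bdd_borel \<longleftrightarrow> f \<in> bdd_borel"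
proof
  assume *: "(\<lambda>y. complex_of_real (f y)) \<in> bdd_borel"
  from bdd_borel_measurable[OF *] have "(\<lambda>y. Re (complex_of_real (f y))) \<in> borel_measurable borel" by measurable
  with * show "f \<in> bdd_borel" by (auto simp: bdd_borel_def)
qed (auto simp: bdd_borel_def)

lemma bdd_borel_norm: "f \<in> bdd_borel \<Longrightarrow> (\<lambda>y. norm (f y)) \<in> bdd_borel"
  by (auto simp: bdd_borel_def)

lemma bdd_borel_translate:
  assumes "f \<in> bdd_borel" 
  shows "(\<lambda>y. f (y + c)) \<in> bdd_borel" "(\<lambda>y. f (y - c)) \<in> bdd_borel" "(\<lambda>y. f (c - y)) \<in> bdd_borel"
  using assms by (auto simp: bdd_borel_def intro: measurable_compose[of _ borel borel])

lemma bdd_borel_gauss_per: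
  fixes w :: "complex ^ 'd::finite"
  assumes L: "0 < L" and e: "0 < \<epsilon>"
  shows "(\<lambda>y. gauss_per L \<epsilon> (cvec y - w)) \<in> bdd_borel" "(\<lambda>y. gauss_per L \<epsilon> (w - cvec y)) \<in> bdd_borel"
proof -
  note [measurable] = measurable_gauss_per[OF L e]
  show 1: "(\<lambda>y. gauss_per L \<epsilon> (cvec y - w)) \<in> bdd_borel"
  proof (rule bmI)
    show "norm (gauss_per L \<epsilon> (cvec y - w)) \<le> exp (im_sq w / (2 * \<epsilon>)) * gmax TYPE('d) L \<epsilon>" for y
      using norm_gauss_per_le[OF L e, of "cvec y - w"] rgauss_per_upper[OF L e, of "re_vec (cvec y - w)"]
      by (auto intro: order_trans mult_left_mono)
  qed measurable
  show "(\<lambda>y. gauss_per L \<epsilon> (w - cvec y)) \<in> bdd_borel"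
    by (subst gauss_per_commute) (rule 1)
qed

lemma bdd_borel_rgauss_per:
  fixes x :: "real ^ 'd::finite"
  assumes L: "0 < L" and e: "0 < \<epsilon>"
  shows "(rgauss_per L \<epsilon> :: real ^ 'd \<Rightarrow> real) \<in> bdd_borel" "(\<lambda>y. rgauss_per L \<epsilon> (y - x)) \<in> bdd_borel" "(\<lambda>y. rgauss_per L \<epsilon> (x - y)) \<in> bdd_borel"
proof -
  show 1: "(rgauss_per L \<epsilon> :: real ^ 'd \<Rightarrow> real) \<in> bdd_borel"
  proof (rule bmI)
    show "norm (rgauss_per L \<epsilon> y) \<le> gmax TYPE('d) L \<epsilon>" for y :: "real ^ 'd"
      using rgauss_per_upper[OF L e, of y] rgauss_per_pos[OF L e, of y] by simp
  qed (rule measurable_rgauss_per[OF L e])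
  show "(\<lambda>y. rgauss_per L \<epsilon> (y - x)) \<in> bdd_borel" "(\<lambda>y. rgauss_per L \<epsilon> (x - y)) \<in> bdd_borel"
    by (rule bdd_borel_translate[OF 1])+
qed

lemma integrable_bdd_borel:
  fixes f :: "real ^ 'd::finite \<Rightarrow> 'b::{banach,second_countable_topology}"
  assumes "finite_measure \<mu>" "sets \<mu> = sets borel" "f \<in> bdd_borel"
  shows "integrable \<mu> f"
proof -
  interpret finite_measure \<mu> by fact
  obtain B where "\<And>y. norm (f y) \<le> B" using bmE[OF \<open>f \<in> bdd_borel\<close>] by metis
  then show ?thesis
    using bdd_borel_measurable[OF \<open>f \<in> bdd_borel\<close>] measurable_cong_sets[OF assms(2) refl, of borel]
    by (intro integrable_const_bound[where B=B]) auto
qed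

lemma
  fixes f :: "real ^ 'd::finite \<Rightarrow> 'b::{banach,second_countable_topology,real_normed_algebra}" and g :: "real ^ 'd::finite \<Rightarrow> 'b"
  assumes f: "f \<in> bdd_borel" and g: "integrable lborel g"
  shows integrable_bdd_borel_mult: "integrable lborel (\<lambda>y. f y * g y)"
    and integrable_mult_bdd_borel: "integrable lborel (\<lambda>y. g y * f y)"
proof -
  obtain B where B: "\<And>y. norm (f y) \<le> B" "0 \<le> B" using bmE[OF f] by metis
  have [measurable]: "f \<in> borel_measurable borel" "g \<in> borel_measurable borel"
    using bdd_borel_measurable[OF f] borel_measurable_integrable[OF g] by auto
  have i: "integrable lborel (\<lambda>y. B * norm (g y))" using g by simp
  have "norm (f y * g y) \<le> norm (B * norm (g y))" "norm (g y * f y) \<le> norm (B * norm (g y))" for y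
    using B(2) by (auto intro!: order_trans[OF norm_mult_ineq] mult_right_mono B) (metis B(1) mult.commute mult_left_mono norm_ge_zero)
  then show "integrable lborel (\<lambda>y. f y * g y)" "integrable lborel (\<lambda>y. g y * f y)"
    by (auto intro!: Bochner_Integration.integrable_bound[OF i])
qed

section \<open>Gaussian averages over R^d and the convolution of Gaussians\<close>

lemma integrable_gauss_translate:
  fixes w :: "complex ^ 'd::finite"
  assumes e: "0 < \<epsilon>"
  shows "integrable lborel (\<lambda>y. gauss \<epsilon> (cvec y - w))"
proof -
  have "(\<lambda>w::complex^'d. gauss \<epsilon> w) \<in> borel_measurable borel"
    using e by (intro borel_measurable_continuous_onI continuous_intros)
  then have [measurable]: "(\<lambda>y. gauss \<epsilon> (cvec y - w)) \<in> borel_measurable borel"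
    by measurable
  have "integrable lborel (\<lambda>y. exp (im_sq w / (2 * \<epsilon>)) * rgauss \<epsilon> (- re_vec w + y))"
    by (intro integrable_mult_right integrable_lborel_translate integrable_rgauss e)
  then show ?thesis
    by (rule Bochner_Integration.integrable_bound) (auto simp: norm_gauss[OF e] re_vec_diff)
qed

text \<open>Periodicity of f takes it out of the lattice sum, so the periodised kernel over the cell
  becomes a single Gaussian over R^d.\<close>

lemma
  fixes w :: "complex ^ 'd::finite"
  assumes L: "0 < L" and e: "0 < \<epsilon>" and f: "f \<in> bdd_borel" and per: "periodic L f"
  shows integral_gauss_per_unfold: "(LINT y|cell_measure L. gauss_per L \<epsilon> (cvec y - w) * f y) = (LINT y|lborel. gauss \<epsilon> (cvec y - w) * f y)"
    and integrable_gauss_unfold: "integrable lborel (\<lambda>y. gauss \<epsilon> (cvec y - w) * f y)"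
proof -
  show i: "integrable lborel (\<lambda>y. gauss \<epsilon> (cvec y - w) * f y)"
    by (rule integrable_mult_bdd_borel[OF f integrable_gauss_translate[OF e]])
  have eq: "gauss \<epsilon> (cvec (y + latt L j) - w) * f (y + latt L j) = gauss \<epsilon> ((cvec y - w) + cvec (latt L j)) * f y" for y j
    using per by (simp add: periodic_def cvec_add algebra_simps)
  have "(LINT y|lborel. gauss \<epsilon> (cvec y - w) * f y) = (LINT y|cell_measure L. (\<Sum>\<^sub>\<infinity>j. gauss \<epsilon> (cvec (y + latt L j) - w) * f (y + latt L j)))"
    by (rule integral_unfold[OF L i])
       (unfold eq norm_mult, rule summable_on_cmult_left[OF abs_summable_gauss[OF L e]])
  then show "(LINT y|cell_measure L. gauss_per L \<epsilon> (cvec y - w) * f y) = (LINT y|lborel. gauss \<epsilon> (cvec y - w) * f y)"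
    unfolding eq infsum_cmult_left' gauss_per_def by simp
qed

lemma
  fixes x :: "real ^ 'd::finite" and f :: "real ^ 'd \<Rightarrow> real"
  assumes L: "0 < L" and e: "0 < \<epsilon>" and f: "f \<in> bdd_borel" and per: "periodic L f"
  shows integral_rgauss_per_unfold: "(LINT y|cell_measure L. rgauss_per L \<epsilon> (y - x) * f y) = (LINT y|lborel. rgauss \<epsilon> (y - x) * f y)"
    and integrable_rgauss_unfold: "integrable lborel (\<lambda>y. rgauss \<epsilon> (y - x) * f y)"
proof -
  have f': "(\<lambda>y. complex_of_real (f y)) \<in> bdd_borel" "periodic L (\<lambda>y. complex_of_real (f y))"
    using f per by (auto simp: periodic_def)
  have "complex_of_real (LINT y|cell_measure L. rgauss_per L \<epsilon> (y - x) * f y) = complex_of_real (LINT y|lborel. rgauss \<epsilon> (y - x) * f y)"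
    using integral_gauss_per_unfold[OF L e f', of "cvec x"]
    by (simp add: cvec_diff[symmetric] gauss_per_cvec[OF L e] gauss_cvec of_real_mult[symmetric] del: of_real_mult)
  then show "(LINT y|cell_measure L. rgauss_per L \<epsilon> (y - x) * f y) = (LINT y|lborel. rgauss \<epsilon> (y - x) * f y)"
    by simp
  show "integrable lborel (\<lambda>y. rgauss \<epsilon> (y - x) * f y)"
    using integrable_gauss_unfold[OF L e f', of "cvec x"]
    by (simp add: cvec_diff[symmetric] gauss_cvec of_real_mult[symmetric] complex_of_real_integrable_eq del: of_real_mult)
qed

text \<open>The centre \<open>(t * p + s * x) / (s + t)\<close> involves only p and x; the shift w,
  later purely imaginary, survives as the linear term \<open>(w / s) * y\<close>.\<close>

lemma gauss_complete_square:
  fixes s t y p w x :: complex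
  assumes "s \<noteq> 0" "t \<noteq> 0" "s + t \<noteq> 0"
  shows "- (((t * p + s * x) / (s + t) + y) - (p + w))\<^sup>2 / (2 * s) - (((t * p + s * x) / (s + t) + y) - x)\<^sup>2 / (2 * t)
    = - y\<^sup>2 / (2 * (s * t / (s + t))) + (w / s) * y + (- ((p + w) - x)\<^sup>2 / (2 * (s + t)) - (s * t / (s + t)) * (w / s)\<^sup>2 / 2 )"
proof -
  define u where "u = s + t"
  have t: "t = u - s" and u: "u \<noteq> 0" "u - s \<noteq> 0" using assms by (auto simp: u_def)
  show ?thesis
    unfolding u_def[symmetric] unfolding t using assms(1) u
    by (simp add: divide_simps) algebra
qed

text \<open>Only the real part of the centre is translated away. The imaginary part of w stays
  behind as a character in y, which \<open>integral_rgauss_char\<close> integrates, so the complex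
  case follows without shifting a contour.\<close>

lemma gauss_convolution:
  fixes w :: "complex ^ 'd::finite"
  assumes s: "0 < s" and t: "0 < t"
  shows "(LINT y|lborel. gauss s (cvec y - w) * of_real (rgauss t (y - x))) = gauss (s + t) (w - cvec x)"
proof -
  define p z where "p = re_vec w" and "z = (\<chi> k. Im (w $ k))"
  \<comment> \<open>Mean m and variance \<tau> of the product of the two Gaussians in y; \<xi> is
    the frequency produced by the imaginary part of w.\<close>
  define m where "m = (1 / (s + t)) *\<^sub>R (t *\<^sub>R p + s *\<^sub>R x)"
  define \<tau> \<xi> where "\<tau> = s * t / (s + t)" and "\<xi> = (\<chi> k. z $ k / s)"
  have \<tau>: "0 < \<tau>" using s t by (simp add: \<tau>_def)
  let ?c = "\<lambda>a. (2 * pi * a) powr (- real CARD('d) / 2)"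
  let ?F = "\<lambda>y. gauss s (cvec y - w) * of_real (rgauss t (y - x))"
  have wk: "w $ k = of_real (p $ k) + \<i> * of_real (z $ k)" for k
    by (simp add: p_def z_def complex_eq)
  have pref: "?c s * ?c t = ?c (s + t) * ?c \<tau>"
  proof -
    have "(2 * pi * s) * (2 * pi * t) = (2 * pi * (s + t)) * (2 * pi * \<tau>)"
      using s t by (simp add: \<tau>_def)
    moreover have "?c a * ?c b = ((2 * pi * a) * (2 * pi * b)) powr (- real CARD('d) / 2)" if "0 < a" "0 < b" for a b
      using that by (subst powr_mult) auto
    ultimately show ?thesis using s t \<tau> by (simp only: add_pos_pos)
  qed
  have F: "?F (m + y) = gauss (s + t) (w - cvec x) * (exp ((\<tau> * (\<Sum>k\<in>UNIV. (\<xi> $ k)\<^sup>2)) / 2) * 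
       (rgauss \<tau> y *\<^sub>R exp (\<i> * (\<Sum>k\<in>UNIV. \<xi> $ k * y $ k))))" for y
  proof -
    have per_coord: "- ((cvec (m + y) - w) $ k)\<^sup>2 / of_real (2 * s) - of_real (((m + y - x) $ k)\<^sup>2 / (2 * t))
       = - of_real ((y $ k)\<^sup>2 / (2 * \<tau>)) + \<i> * of_real (\<xi> $ k * y $ k) - ((w - cvec x) $ k)\<^sup>2 / of_real (2 * (s + t)) + of_real (\<tau> * (\<xi> $ k)\<^sup>2 / 2)" for k
    proof -
      have mk: "complex_of_real (m $ k) = (of_real t * of_real (p $ k) + of_real s * of_real (x $ k)) / (of_real s + of_real t)"
        by (simp add: m_def)
      have nz: "complex_of_real s \<noteq> 0" "complex_of_real t \<noteq> 0" "complex_of_real s + complex_of_real t \<noteq> 0"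
        using s t by (auto simp flip: of_real_add)
      show ?thesis
        using gauss_complete_square[OF nz, of "of_real (p $ k)" "of_real (x $ k)" "of_real (y $ k)" "\<i> * of_real (z $ k)"]
        by (simp add: wk mk[symmetric] \<tau>_def \<xi>_def power_divide power_mult_distrib)
    qed
    have "exp (- (\<Sum>k\<in>UNIV. ((cvec (m + y) - w) $ k)\<^sup>2) / of_real (2 * s)) * of_real (exp (- (\<Sum>k\<in>UNIV. ((m + y - x) $ k)\<^sup>2) / (2 * t)))
       = exp (\<Sum>k\<in>UNIV. - ((cvec (m + y) - w) $ k)\<^sup>2 / of_real (2 * s) - of_real (((m + y - x) $ k)\<^sup>2 / (2 * t)))"
      by (simp only: exp_of_real[symmetric] exp_add[symmetric] sum_subtractf sum_negf sum_divide_distrib of_real_sum of_real_minus minus_divide_left[symmetric] add_uminus_conv_diff)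
    also have "\<dots> = exp (- (\<Sum>k\<in>UNIV. ((w - cvec x) $ k)\<^sup>2) / of_real (2 * (s + t))) * (exp ((\<tau> * (\<Sum>k\<in>UNIV. (\<xi> $ k)\<^sup>2)) / 2) * 
       (exp (- (\<Sum>k\<in>UNIV. (y $ k)\<^sup>2) / (2 * \<tau>)) *\<^sub>R exp (\<i> * (\<Sum>k\<in>UNIV. \<xi> $ k * y $ k))))"
      unfolding per_coord scaleR_conv_of_real
      by (simp only: exp_of_real[symmetric] of_real_exp exp_add[symmetric])
        (simp add: sum.distrib sum_subtractf sum_negf sum_divide_distrib sum_distrib_left algebra_simps)
    finally have E: "exp (- (\<Sum>k\<in>UNIV. ((cvec (m + y) - w) $ k)\<^sup>2) / of_real (2 * s)) * of_real (exp (- (\<Sum>k\<in>UNIV. ((m + y - x) $ k)\<^sup>2) / (2 * t)))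
      = exp (- (\<Sum>k\<in>UNIV. ((w - cvec x) $ k)\<^sup>2) / of_real (2 * (s + t))) * (exp ((\<tau> * (\<Sum>k\<in>UNIV. (\<xi> $ k)\<^sup>2)) / 2) * 
       (exp (- (\<Sum>k\<in>UNIV. (y $ k)\<^sup>2) / (2 * \<tau>)) *\<^sub>R exp (\<i> * (\<Sum>k\<in>UNIV. \<xi> $ k * y $ k))))" .
    have "?F (m + y) = of_real (?c s * ?c t) * (exp (- (\<Sum>k\<in>UNIV. ((cvec (m + y) - w) $ k)\<^sup>2) / of_real (2 * s)) * of_real (exp (- (\<Sum>k\<in>UNIV. ((m + y - x) $ k)\<^sup>2) / (2 * t))))"
      by (simp only: gauss_def rgauss_def of_real_mult mult_ac)
    then show ?thesis
      unfolding E pref gauss_def rgauss_def by (simp only: of_real_mult mult_ac scaleR_conv_of_real)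
  qed
  have [measurable]: "?F \<in> borel_measurable borel"
    using s t by (intro borel_measurable_continuous_onI continuous_intros)
  have "(LINT y|lborel. ?F y) = (LINT y|lborel. ?F (m + y))"
    by (rule integral_lborel_translate[symmetric]) measurable
  also have "\<dots> = gauss (s + t) (w - cvec x) * (exp ((\<tau> * (\<Sum>k\<in>UNIV. (\<xi> $ k)\<^sup>2)) / 2) * exp (- (\<tau> * (\<Sum>k\<in>UNIV. (\<xi> $ k)\<^sup>2)) / 2))"
    by (simp only: F integral_mult_right_zero integral_rgauss_char[OF \<tau>] of_real_mult)
  also have "\<dots> = gauss (s + t) (w - cvec x)"
    by (simp add: exp_add[symmetric] of_real_mult[symmetric] del: of_real_mult)
  finally show ?thesis .
qed

text \<open>Only the kernel with the complex argument is unfolded; the other one, periodic and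
  bounded, acts as the test function and is summed over the lattice afterwards.\<close>

lemma gauss_per_convolution:
  fixes w :: "complex ^ 'd::finite"
  assumes L: "0 < L" and s: "0 < s" and t: "0 < t"
  shows "(LINT y|cell_measure L. gauss_per L s (cvec y - w) * of_real (rgauss_per L t (y - x))) = gauss_per L (s + t) (w - cvec x)"
proof -
  let ?F = "\<lambda>j y. gauss s (cvec y - w) * complex_of_real (rgauss t (y - x + latt L j))"
  have per: "periodic L (\<lambda>y. complex_of_real (rgauss_per L t (y - x)))"
  proof -
    have "rgauss_per L t (y + latt L j - x) = rgauss_per L t (y - x)" for y j
      using rgauss_per_periodic[of L t "y - x" j] by (simp add: algebra_simps)
    then show ?thesis by (simp add: periodic_def)
  qed
  have [measurable]: "?F j \<in> borel_measurable borel" for j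
    using s t by (intro borel_measurable_continuous_onI continuous_intros)
  have tr: "y - x + latt L j = y - (x - latt L j)" for y j by simp
  have F: "(LINT y|lborel. ?F j y) = gauss (s + t) (w - cvec x + cvec (latt L j))" for j
    unfolding tr gauss_convolution[OF s t] by (simp add: cvec_diff algebra_simps)
  have sum_rgauss: "((\<lambda>j. complex_of_real (rgauss t (y - x + latt L j))) has_sum of_real (rgauss_per L t (y - x))) UNIV" for y
    unfolding rgauss_per_def by (rule has_sum_of_real[OF has_sum_infsum[OF summable_rgauss[OF L t]]])
  have nF: "norm (?F j y) = norm (gauss s (cvec y - w)) * rgauss t (y - x + latt L j)" for j y
    by (simp add: norm_mult less_imp_le[OF rgauss_pos[OF t]])
  have "(LINT y|cell_measure L. gauss_per L s (cvec y - w) * of_real (rgauss_per L t (y - x))) = (LINT y|lborel. gauss s (cvec y - w) * of_real (rgauss_per L t (y - x)))"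
    by (rule integral_gauss_per_unfold[OF L s _ per]) (simp add: bdd_borel_rgauss_per[OF L t])
  also have "\<dots> = (LINT y|lborel. (\<Sum>\<^sub>\<infinity>j. ?F j y))"
    using infsumI[OF sum_rgauss] by (simp add: infsum_cmult_right')
  also have "\<dots> = (\<Sum>\<^sub>\<infinity>j. LINT y|lborel. ?F j y)"
  proof (rule sigma_finite_measure.integral_infsum[OF sigma_finite_lborel])
    show "(\<lambda>j. norm (?F j y)) summable_on UNIV" for y
      unfolding nF by (rule summable_on_cmult_right[OF summable_rgauss[OF L t]])
    have "(\<Sum>\<^sub>\<infinity>j. norm (?F j y)) = rgauss_per L t (y - x) * norm (gauss s (cvec y - w))" for y
      unfolding nF infsum_cmult_right' rgauss_per_def by simp
    then show "integrable lborel (\<lambda>y. \<Sum>\<^sub>\<infinity>j. norm (?F j y))"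
      using integrable_bdd_borel_mult[OF bdd_borel_rgauss_per(2)[OF L t, of x] integrable_norm[OF integrable_gauss_translate[OF s, of w]]] by simp
    show "(\<lambda>j. norm (LINT y|lborel. ?F j y)) summable_on UNIV"
      unfolding F by (rule abs_summable_gauss[OF L]) (use s t in simp)
  qed measurable
  also have "\<dots> = gauss_per L (s + t) (w - cvec x)"
    unfolding F gauss_per_def ..
  finally show ?thesis .
qed

section \<open>Kernel operators of a measure\<close>

text \<open>Taking the measure as a parameter lets the density, the sample, their mixtures and
  Lebesgue measure share one theory.\<close>

definition Ku :: "real \<Rightarrow> (real ^ 'd::finite) measure \<Rightarrow> real \<Rightarrow> (real ^ 'd \<Rightarrow> complex) \<Rightarrow> complex ^ 'd \<Rightarrow> complex" where
  "Ku L \<mu> \<epsilon> f w = (LINT y|\<mu>. gauss_per L \<epsilon> (cvec y - w) * f y)"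

definition Kr :: "real \<Rightarrow> (real ^ 'd::finite) measure \<Rightarrow> real \<Rightarrow> (real ^ 'd \<Rightarrow> real) \<Rightarrow> real ^ 'd \<Rightarrow> real" where
  "Kr L \<mu> \<epsilon> f x = (LINT y|\<mu>. rgauss_per L \<epsilon> (y - x) * f y)"

locale torus_measure =
  fixes L :: real and \<mu> :: "(real ^ 'd::finite) measure"
  assumes L: "0 < L" and fin: "finite_measure \<mu>" and sets_\<mu>: "sets \<mu> = sets borel"
begin

sublocale finite_measure \<mu> by (rule fin)

lemma measurable_\<mu>: "f \<in> borel_measurable borel \<Longrightarrow> f \<in> borel_measurable \<mu>"
  using measurable_cong_sets[OF sets_\<mu> refl, of borel] by auto

lemma space_\<mu> [simp]: "space \<mu> = UNIV"
  using sets_eq_imp_space_eq[OF sets_\<mu>] by simp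

lemma integrable_\<mu>:
  fixes f :: "real ^ 'd \<Rightarrow> 'b::{banach,second_countable_topology}"
  shows "f \<in> bdd_borel \<Longrightarrow> integrable \<mu> f"
  by (rule integrable_bdd_borel[OF fin sets_\<mu>])

lemma Ku_integrable:
  assumes e: "0 < \<epsilon>" and f: "f \<in> bdd_borel"
  shows "integrable \<mu> (\<lambda>y. gauss_per L \<epsilon> (cvec y - w) * f y)"
  by (intro integrable_\<mu> bdd_borel_mult bdd_borel_gauss_per L e f)

lemma Kr_integrable:
  assumes e: "0 < \<epsilon>" and f: "f \<in> bdd_borel"
  shows "integrable \<mu> (\<lambda>y. rgauss_per L \<epsilon> (y - x) * f y)"
  by (intro integrable_\<mu> bdd_borel_mult bdd_borel_rgauss_per L e f)

lemma Ku_of_real: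
  assumes e: "0 < \<epsilon>"
  shows "Ku L \<mu> \<epsilon> (\<lambda>y. of_real (f y)) (cvec x) = of_real (Kr L \<mu> \<epsilon> f x)"
  unfolding Ku_def Kr_def by (simp add: cvec_diff[symmetric] gauss_per_cvec[OF L e] flip: of_real_mult)

lemma Ku_diff: "0 < \<epsilon> \<Longrightarrow> f \<in> bdd_borel \<Longrightarrow> g \<in> bdd_borel \<Longrightarrow> Ku L \<mu> \<epsilon> (\<lambda>y. f y - g y) w = Ku L \<mu> \<epsilon> f w - Ku L \<mu> \<epsilon> g w"
  unfolding Ku_def right_diff_distrib by (intro Bochner_Integration.integral_diff Ku_integrable)

lemma Kr_add: "0 < \<epsilon> \<Longrightarrow> f \<in> bdd_borel \<Longrightarrow> g \<in> bdd_borel \<Longrightarrow> Kr L \<mu> \<epsilon> (\<lambda>y. f y + g y) w = Kr L \<mu> \<epsilon> f w + Kr L \<mu> \<epsilon> g w"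
  unfolding Kr_def ring_distribs by (intro Bochner_Integration.integral_add Kr_integrable)

lemma Kr_diff: "0 < \<epsilon> \<Longrightarrow> f \<in> bdd_borel \<Longrightarrow> g \<in> bdd_borel \<Longrightarrow> Kr L \<mu> \<epsilon> (\<lambda>y. f y - g y) w = Kr L \<mu> \<epsilon> f w - Kr L \<mu> \<epsilon> g w"
  unfolding Kr_def right_diff_distrib by (intro Bochner_Integration.integral_diff Kr_integrable)

lemma Kr_cmult: "Kr L \<mu> \<epsilon> (\<lambda>y. c * f y) x = c * Kr L \<mu> \<epsilon> f x"
  unfolding Kr_def by (simp add: mult.left_commute)

lemma Kr_mono:
  assumes e: "0 < \<epsilon>" and "f \<in> bdd_borel" "g \<in> bdd_borel" and "AE y in \<mu>. f y \<le> g y"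
  shows "Kr L \<mu> \<epsilon> f x \<le> Kr L \<mu> \<epsilon> g x"
  unfolding Kr_def
proof (rule integral_mono_AE)
  show "AE y in \<mu>. rgauss_per L \<epsilon> (y - x) * f y \<le> rgauss_per L \<epsilon> (y - x) * g y"
    using assms(4) by eventually_elim (intro mult_left_mono less_imp_le[OF rgauss_per_pos[OF L e]])
qed (intro Kr_integrable assms)+

lemma norm_Ku_le:
  assumes e: "0 < \<epsilon>" and f: "f \<in> bdd_borel"
  shows "norm (Ku L \<mu> \<epsilon> f w) \<le> exp (im_sq w / (2 * \<epsilon>)) * Kr L \<mu> \<epsilon> (\<lambda>y. norm (f y)) (re_vec w)"
proof -
  have "norm (Ku L \<mu> \<epsilon> f w) \<le> (LINT y|\<mu>. norm (gauss_per L \<epsilon> (cvec y - w) * f y))"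
    unfolding Ku_def by (rule integral_norm_bound)
  also have "\<dots> \<le> (LINT y|\<mu>. exp (im_sq w / (2 * \<epsilon>)) * (rgauss_per L \<epsilon> (y - re_vec w) * norm (f y)))"
  proof (rule integral_mono_AE)
    have "norm (gauss_per L \<epsilon> (cvec y - w)) * norm (f y) \<le> exp (im_sq w / (2 * \<epsilon>)) * rgauss_per L \<epsilon> (y - re_vec w) * norm (f y)" for y
      using norm_gauss_per_le[OF L e, of "cvec y - w"] by (intro mult_right_mono) (auto simp: re_vec_diff)
    then show "AE y in \<mu>. norm (gauss_per L \<epsilon> (cvec y - w) * f y) \<le> exp (im_sq w / (2 * \<epsilon>)) * (rgauss_per L \<epsilon> (y - re_vec w) * norm (f y))"
      by (simp add: norm_mult mult.assoc)
  qed (intro integrable_norm Ku_integrable e f integrable_mult_right Kr_integrable bdd_borel_norm)+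
  finally show ?thesis by (simp add: Kr_def)
qed

lemma Kr_pos:
  assumes e: "0 < \<epsilon>" and f: "f \<in> bdd_borel" and pos: "AE y in \<mu>. 0 \<le> f y" 
  shows "gmin TYPE('d) L \<epsilon> * (LINT y|\<mu>. f y) \<le> Kr L \<mu> \<epsilon> f x" "Kr L \<mu> \<epsilon> f x \<le> gmax TYPE('d) L \<epsilon> * (LINT y|\<mu>. f y)"
proof -
  have "(LINT y|\<mu>. gmin TYPE('d) L \<epsilon> * f y) \<le> Kr L \<mu> \<epsilon> f x"
    unfolding Kr_def
  proof (rule integral_mono_AE)
    show "AE y in \<mu>. gmin TYPE('d) L \<epsilon> * f y \<le> rgauss_per L \<epsilon> (y - x) * f y"
      using pos by eventually_elim (intro mult_right_mono rgauss_per_lower L e)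
  qed (intro Kr_integrable e f integrable_mult_right integrable_\<mu>)+
  moreover have "Kr L \<mu> \<epsilon> f x \<le> (LINT y|\<mu>. gmax TYPE('d) L \<epsilon> * f y)"
    unfolding Kr_def
  proof (rule integral_mono_AE)
    show "AE y in \<mu>. rgauss_per L \<epsilon> (y - x) * f y \<le> gmax TYPE('d) L \<epsilon> * f y"
      using pos by eventually_elim (intro mult_right_mono rgauss_per_upper L e)
  qed (intro Kr_integrable e f integrable_mult_right integrable_\<mu>)+
  ultimately show "gmin TYPE('d) L \<epsilon> * (LINT y|\<mu>. f y) \<le> Kr L \<mu> \<epsilon> f x" "Kr L \<mu> \<epsilon> f x \<le> gmax TYPE('d) L \<epsilon> * (LINT y|\<mu>. f y)"
    by simp_all
qed

text \<open>The Taylor remainder of the kernel is quadratic in the increment uniformly in y, so it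
  survives integration against the bounded f; complex linearity of the derivative comes from
  \<open>dgauss_per_cscale\<close>.\<close>

lemma Ku_holo_at:
  assumes e: "0 < \<epsilon>" and f: "f \<in> bdd_borel"
  shows "holo_at (Ku L \<mu> \<epsilon> f) w"
proof -
  obtain B where B: "\<And>y. norm (f y) \<le> B" "0 \<le> B" using bmE[OF f] by metis
  let ?C = "taylor_const TYPE('d) \<epsilon> (im_sq w) * gmax TYPE('d) L (2 * \<epsilon>)"
  have C: "0 \<le> ?C" using less_imp_le[OF taylor_const_pos] less_imp_le[OF gmax_pos[OF L]] by (metis mult_nonneg_nonneg)
  have im: "im_sq (cvec y - w) \<le> im_sq w" for y by simp
  have fm: "f \<in> borel_measurable \<mu>" by (rule measurable_\<mu>[OF bdd_borel_measurable[OF f]])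
  have dm: "(\<lambda>y. dgauss_per L \<epsilon> (cvec y - w) v) \<in> borel_measurable \<mu>" for v
    by (rule measurable_\<mu>, rule measurable_compose[OF _ measurable_dgauss_per[OF L e]]) simp
  have di: "integrable \<mu> (\<lambda>y. dgauss_per L \<epsilon> (cvec y - w) v * f y)" for v
  proof (rule integrable_const_bound)
    show "AE y in \<mu>. norm (dgauss_per L \<epsilon> (cvec y - w) v * f y) \<le> ?C * norm v * B"
      unfolding norm_mult using B C by (intro AE_I2 mult_mono norm_dgauss_per_le[OF L e im]) auto
  qed (intro borel_measurable_times dm fm)
  \<comment> \<open>The kernel is evaluated at y - w, so an increment of w enters with the opposite
    sign.\<close>
  define D where "D v = (LINT y|\<mu>. dgauss_per L \<epsilon> (cvec y - w) (- v) * f y)" for v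
  have Dc: "D (c *s v) = c * D v" for c v
  proof -
    have *: "- (c *s v) = c *s (- v)" by (simp add: vec_eq_iff)
    show ?thesis unfolding D_def * dgauss_per_cscale by (simp add: mult.assoc)
  qed
  have Da: "D (u + v) = D u + D v" for u v
    unfolding D_def minus_add_distrib dgauss_per_add[OF L e] distrib_right
    by (intro Bochner_Integration.integral_add di)
  have DB: "norm (D v) \<le> ?C * B * measure \<mu> UNIV * norm v" for v
  proof -
    have "norm (D v) \<le> (LINT y|\<mu>. ?C * norm (- v) * B)"
      unfolding D_def
    proof (rule Bochner_Integration.integral_norm_bound_integral)
      show "norm (dgauss_per L \<epsilon> (cvec y - w) (- v) * f y) \<le> ?C * norm (- v) * B" for y
        unfolding norm_mult using B C by (intro mult_mono norm_dgauss_per_le[OF L e im]) auto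
    qed (auto intro: di)
    then show ?thesis by (simp add: mult_ac)
  qed
  have lin: "bounded_linear D"
  proof (rule bounded_linear_intro)
    show "D (r *\<^sub>R v) = r *\<^sub>R D v" for r v
    proof -
      have "r *\<^sub>R v = of_real r *s v" by (simp add: vec_eq_iff) (simp add: scaleR_conv_of_real)
      then show ?thesis using Dc[of "of_real r" v] by (simp add: scaleR_conv_of_real)
    qed
    show "norm (D v) \<le> norm v * (?C * B * measure \<mu> UNIV)" for v using DB[of v] by (simp add: mult_ac)
  qed (rule Da)
  have rem: "norm (Ku L \<mu> \<epsilon> f (w + h) - Ku L \<mu> \<epsilon> f w - D h) \<le> ?C * B * measure \<mu> UNIV * (norm h)\<^sup>2" if h: "norm h \<le> 1" for h
  proof -
    have "Ku L \<mu> \<epsilon> f (w + h) - Ku L \<mu> \<epsilon> f w - D h =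
      (LINT y|\<mu>. (gauss_per L \<epsilon> (cvec y - w + - h) - gauss_per L \<epsilon> (cvec y - w) - dgauss_per L \<epsilon> (cvec y - w) (- h)) * f y)"
      using Ku_integrable[OF e f, of w] Ku_integrable[OF e f, of "w + h"] di[of "- h"]
      by (simp add: Ku_def D_def left_diff_distrib algebra_simps)
    also have "norm \<dots> \<le> (LINT y|\<mu>. ?C * (norm (- h))\<^sup>2 * B)"
    proof (rule Bochner_Integration.integral_norm_bound_integral)
      show "integrable \<mu> (\<lambda>y. (gauss_per L \<epsilon> (cvec y - w + - h) - gauss_per L \<epsilon> (cvec y - w) - dgauss_per L \<epsilon> (cvec y - w) (- h)) * f y)"
        using Ku_integrable[OF e f, of w] Ku_integrable[OF e f, of "w + h"] di[of "- h"]
        by (simp add: left_diff_distrib algebra_simps)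
      show "norm ((gauss_per L \<epsilon> (cvec y - w + - h) - gauss_per L \<epsilon> (cvec y - w) - dgauss_per L \<epsilon> (cvec y - w) (- h)) * f y) \<le> ?C * (norm (- h))\<^sup>2 * B" for y
        unfolding norm_mult using B C h by (intro mult_mono gauss_per_taylor[OF L e im]) auto
    qed auto
    finally show ?thesis by (simp add: mult_ac)
  qed
  have "(Ku L \<mu> \<epsilon> f has_derivative D) (at w)"
    unfolding has_derivative_at
  proof (intro conjI lin)
    let ?M = "?C * B * measure \<mu> UNIV"
    have "((\<lambda>h::complex^'d. ?M * norm h) \<longlongrightarrow> 0) (at 0)"
      by (auto intro!: tendsto_eq_intros)
    moreover have "\<forall>\<^sub>F h in at 0. norm (norm (Ku L \<mu> \<epsilon> f (w + h) - Ku L \<mu> \<epsilon> f w - D h) / norm h) \<le> ?M * norm h"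
    proof (rule eventually_at[THEN iffD2], intro exI[of _ 1] conjI ballI impI)
      fix h :: "complex ^ 'd" assume h: "h \<noteq> 0 \<and> dist h 0 < 1"
      then show "norm (norm (Ku L \<mu> \<epsilon> f (w + h) - Ku L \<mu> \<epsilon> f w - D h) / norm h) \<le> ?M * norm h"
        using rem[of h] by (simp add: divide_simps power2_eq_square)
    qed simp
    ultimately show "(\<lambda>h. norm (Ku L \<mu> \<epsilon> f (w + h) - Ku L \<mu> \<epsilon> f w - D h) / norm h) \<midarrow>0\<rightarrow> 0"
      by (rule Lim_null_comparison[rotated])
  qed
  with Dc show ?thesis unfolding holo_at_def by blast
qed

lemma Ku_periodic: "Ku L \<mu> \<epsilon> f (w + cvec (latt L j)) = Ku L \<mu> \<epsilon> f w"
proof -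
  have "gauss_per L \<epsilon> (cvec y - (w + cvec (latt L j))) = gauss_per L \<epsilon> (cvec y - w)" for y
    using gauss_per_periodic[of L \<epsilon> "cvec y - w" "- j"] by (simp add: latt_uminus cvec_uminus algebra_simps)
  then show ?thesis by (simp add: Ku_def)
qed

lemma Kr_periodic: "Kr L \<mu> \<epsilon> f (x + latt L j) = Kr L \<mu> \<epsilon> f x"
proof -
  have "rgauss_per L \<epsilon> (y - (x + latt L j)) = rgauss_per L \<epsilon> (y - x)" for y
    using rgauss_per_periodic[of L \<epsilon> "y - x" "- j"] by (simp add: latt_uminus algebra_simps)
  then show ?thesis by (simp add: Kr_def)
qed

lemma Ku_continuous:
  assumes e: "0 < \<epsilon>" and f: "f \<in> bdd_borel"
  shows "continuous_on A (Ku L \<mu> \<epsilon> f)"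
proof -
  have "isCont (Ku L \<mu> \<epsilon> f) w" for w
    using Ku_holo_at[OF e f, of w] unfolding holo_at_def by (auto dest: has_derivative_continuous)
  then show ?thesis by (simp add: continuous_at_imp_continuous_on)
qed

lemma Ku_Hinf: "0 < \<epsilon> \<Longrightarrow> f \<in> bdd_borel \<Longrightarrow> Ku L \<mu> \<epsilon> f \<in> Hinf L \<zeta>"
  unfolding Hinf_def by (auto intro: Ku_continuous Ku_holo_at simp: Ku_periodic)

lemma Kr_continuous:
  assumes e: "0 < \<epsilon>" and f: "f \<in> bdd_borel"
  shows "continuous_on A (Kr L \<mu> \<epsilon> f)"
proof -
  have "continuous_on A (\<lambda>x. Re (Ku L \<mu> \<epsilon> (\<lambda>y. of_real (f y)) (cvec x)))"
    using f by (intro continuous_intros continuous_on_compose2[OF Ku_continuous[OF e, of _ UNIV]]) auto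
  then show ?thesis by (simp add: Ku_of_real[OF e])
qed

lemma Kr_bdd_borel:
  assumes e: "0 < \<epsilon>" and f: "f \<in> bdd_borel"
  shows "Kr L \<mu> \<epsilon> f \<in> bdd_borel"
proof -
  obtain B where B: "\<And>y. norm (f y) \<le> B" "0 \<le> B" using bmE[OF f] by metis
  have "norm (Kr L \<mu> \<epsilon> f x) \<le> (LINT y|\<mu>. gmax TYPE('d) L \<epsilon> * B)" for x
    unfolding Kr_def
  proof (rule Bochner_Integration.integral_norm_bound_integral[OF Kr_integrable[OF e f]])
    show "norm (rgauss_per L \<epsilon> (y - x) * f y) \<le> gmax TYPE('d) L \<epsilon> * B" for y
      unfolding norm_mult using rgauss_per_upper[OF L e, of "y - x"] rgauss_per_pos[OF L e, of "y - x"] B less_imp_le[OF gmax_pos[OF L]]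
      by (intro mult_mono) auto
  qed simp
  then show ?thesis
    by (intro bmI borel_measurable_continuous_onI Kr_continuous e f)
qed

lemma Ku_cvec_bdd_borel:
  assumes e: "0 < \<epsilon>" and f: "f \<in> bdd_borel"
  shows "(\<lambda>x. Ku L \<mu> \<epsilon> f (cvec x)) \<in> bdd_borel"
proof -
  obtain B where B: "\<And>y. norm (Kr L \<mu> \<epsilon> (\<lambda>y. norm (f y)) y) \<le> B" using bmE[OF Kr_bdd_borel[OF e bdd_borel_norm[OF f]]] by metis
  show ?thesis
  proof (rule bmI)
    show "norm (Ku L \<mu> \<epsilon> f (cvec x)) \<le> B" for x
      using norm_Ku_le[OF e f, of "cvec x"] B[of x] by simp
  qed (intro borel_measurable_continuous_onI continuous_on_compose2[OF Ku_continuous[OF e f, of UNIV]] continuous_intros subset_UNIV)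
qed

lemma torus_measure_cell_measure: "torus_measure L (cell_measure L)"
  unfolding torus_measure_def using L finite_measure_cell_measure[OF L] by simp

text \<open>The outer average is over Lebesgue measure whatever the inner measure is. This smoothing
  later carries a bound at time \<epsilon>/2 on real points to time \<epsilon> on the strip.\<close>

lemma Ku_semigroup:
  assumes s: "0 < s" and t: "0 < t" and f: "f \<in> bdd_borel"
  shows "Ku L \<mu> (s + t) f w = Ku L (cell_measure L) s (\<lambda>z. Ku L \<mu> t f (cvec z)) w"
proof -
  interpret C: torus_measure L "cell_measure L :: (real^'d) measure" by (rule torus_measure_cell_measure)
  interpret P: pair_sigma_finite \<mu> "cell_measure L :: (real^'d) measure" ..
  note [measurable_cong] = sets_\<mu>
  note [measurable] = measurable_gauss_per[OF L s] measurable_gauss_per[OF L t] bdd_borel_measurable[OF f] measurable_rgauss_per[OF L t]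
  obtain A where A: "\<And>y. norm (gauss_per L s (cvec y - w)) \<le> A" using bmE[OF bdd_borel_gauss_per(1)[OF L s, of w]] by metis
  obtain G where G: "\<And>y::real^'d. norm (rgauss_per L t y) \<le> G" using bmE[OF bdd_borel_rgauss_per(1)[OF L t]] by metis
  obtain B where B: "\<And>y. norm (f y) \<le> B" using bmE[OF f] by metis
  let ?F = "\<lambda>y z. gauss_per L s (cvec z - w) * of_real (rgauss_per L t (z - y)) * f y"
  have fp: "finite_measure (\<mu> \<Otimes>\<^sub>M (cell_measure L :: (real^'d) measure))"
    by (intro finite_measure_pair_measure fin C.fin)
  have i: "integrable (\<mu> \<Otimes>\<^sub>M cell_measure L) (case_prod ?F)"
  proof (rule finite_measure.integrable_const_bound[OF fp])
    have A0: "0 \<le> A" "0 \<le> G" "0 \<le> B" using A[of 0] G[of 0] B[of 0] norm_ge_zero order_trans by blast+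
    show "AE p in \<mu> \<Otimes>\<^sub>M cell_measure L. norm (case_prod ?F p) \<le> A * G * B"
      by (intro AE_I2) (use A G B A0 in \<open>auto simp: norm_mult intro!: mult_mono mult_nonneg_nonneg\<close>)
  qed measurable
  have "Ku L (cell_measure L) s (\<lambda>z. Ku L \<mu> t f (cvec z)) w = (LINT z|cell_measure L. LINT y|\<mu>. ?F y z)"
    unfolding Ku_def
    by (simp only: integral_mult_right_zero[symmetric] cvec_diff[symmetric] gauss_per_cvec[OF L t] mult.assoc) 
       (simp only: rgauss_per_commute[of L t "_ :: real ^ 'd"])
  also have "\<dots> = (LINT y|\<mu>. LINT z|cell_measure L. ?F y z)"
    by (rule P.Fubini_integral[OF i])
  also have "\<dots> = (LINT y|\<mu>. gauss_per L (s + t) (w - cvec y) * f y)"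
    by (simp only: integral_mult_left_zero gauss_per_convolution[OF L s t])
  also have "\<dots> = Ku L \<mu> (s + t) f w"
    unfolding Ku_def by (simp add: gauss_per_commute)
  finally show ?thesis ..
qed

lemma Kr_semigroup:
  assumes s: "0 < s" and t: "0 < t" and f: "f \<in> bdd_borel"
  shows "Kr L \<mu> (s + t) f x = Kr L (cell_measure L) s (Kr L \<mu> t f) x"
proof -
  interpret C: torus_measure L "cell_measure L :: (real^'d) measure" by (rule torus_measure_cell_measure)
  have f': "(\<lambda>y. complex_of_real (f y)) \<in> bdd_borel" using f by simp
  have "complex_of_real (Kr L \<mu> (s + t) f x) = complex_of_real (Kr L (cell_measure L) s (Kr L \<mu> t f) x)"
    using Ku_semigroup[OF s t f', of "cvec x"] s t
    by (simp add: Ku_of_real C.Ku_of_real)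
  then show ?thesis by simp
qed

lemma Kr_symmetric:
  assumes \<nu>: "torus_measure L \<nu>" and s: "0 < s" and f: "f \<in> bdd_borel" and g: "g \<in> bdd_borel"
  shows "(LINT x|\<nu>. g x * Kr L \<mu> s f x) = (LINT y|\<mu>. f y * Kr L \<nu> s g y)"
proof -
  interpret C: torus_measure L \<nu> by (rule \<nu>)
  interpret P: pair_sigma_finite \<mu> \<nu> ..
  note [measurable_cong] = sets_\<mu> C.sets_\<mu>
  note [measurable] = bdd_borel_measurable[OF f] bdd_borel_measurable[OF g] measurable_rgauss_per[OF L s]
  obtain A where A: "\<And>y. norm (g y) \<le> A" using bmE[OF g] by metis
  obtain G where G: "\<And>y::real^'d. norm (rgauss_per L s y) \<le> G" using bmE[OF bdd_borel_rgauss_per(1)[OF L s]] by metis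
  obtain B where B: "\<And>y. norm (f y) \<le> B" using bmE[OF f] by metis
  let ?F = "\<lambda>y z. g z * (rgauss_per L s (z - y) * f y)"
  have fp: "finite_measure (\<mu> \<Otimes>\<^sub>M \<nu>)"
    by (intro finite_measure_pair_measure fin C.fin)
  have i: "integrable (\<mu> \<Otimes>\<^sub>M \<nu>) (case_prod ?F)"
  proof (rule finite_measure.integrable_const_bound[OF fp])
    have A0: "0 \<le> A" "0 \<le> G" "0 \<le> B" using A[of 0] G[of 0] B[of 0] norm_ge_zero order_trans by blast+
    show "AE p in \<mu> \<Otimes>\<^sub>M \<nu>. norm (case_prod ?F p) \<le> A * (G * B)"
      by (intro AE_I2) (use A G B A0 in \<open>auto simp: norm_mult abs_mult intro!: mult_mono mult_nonneg_nonneg\<close>)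
  qed measurable
  have "(LINT x|\<nu>. g x * Kr L \<mu> s f x) = (LINT z|\<nu>. LINT y|\<mu>. ?F y z)"
    unfolding Kr_def by (simp only: integral_mult_right_zero[symmetric] rgauss_per_commute[of L s "_ :: real ^ 'd"])
  also have "\<dots> = (LINT y|\<mu>. LINT z|\<nu>. ?F y z)"
    by (rule P.Fubini_integral[OF i])
  also have "\<dots> = (LINT y|\<mu>. f y * Kr L (\<nu>) s g y)"
    unfolding Kr_def by (simp only: integral_mult_right_zero[symmetric] mult_ac)
  finally show ?thesis .
qed

text \<open>Semigroup law and symmetry exhibit the Gaussian kernel as a square for every finite
  measure; the resulting nonnegativity drives \<open>mono_identity\<close>.\<close>

lemma Kr_energy:
  assumes e: "0 < \<epsilon>" and f: "f \<in> bdd_borel"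
  shows "(LINT y|\<mu>. f y * Kr L \<mu> \<epsilon> f y) = (LINT z|cell_measure L. (Kr L \<mu> (\<epsilon> / 2) f z)\<^sup>2)"
proof -
  have e2: "0 < \<epsilon> / 2" using e by simp
  have "(LINT z|cell_measure L. (Kr L \<mu> (\<epsilon> / 2) f z)\<^sup>2) = (LINT y|\<mu>. f y * Kr L (cell_measure L) (\<epsilon> / 2) (Kr L \<mu> (\<epsilon> / 2) f) y)"
    unfolding power2_eq_square by (rule Kr_symmetric[OF torus_measure_cell_measure e2 f Kr_bdd_borel[OF e2 f]])
  then show ?thesis
    using Kr_semigroup[OF e2 e2 f] by simp
qed

lemma Kr_energy_nonneg: "0 < \<epsilon> \<Longrightarrow> f \<in> bdd_borel \<Longrightarrow> 0 \<le> (LINT y|\<mu>. f y * Kr L \<mu> \<epsilon> f y)"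
  by (simp add: Kr_energy)

lemma Kr_cell_measure_one:
  assumes e: "0 < \<epsilon>"
  shows "Kr L (cell_measure L) \<epsilon> (\<lambda>_. 1) (x :: real ^ 'd) = 1"
proof -
  have "Kr L (cell_measure L) \<epsilon> (\<lambda>_. 1) x = (LINT y|lborel. rgauss \<epsilon> (y - x) * 1)"
    unfolding Kr_def by (rule integral_rgauss_per_unfold[OF L e]) (auto simp: periodic_def)
  also have "\<dots> = (LINT y|lborel. rgauss \<epsilon> (- x + y))" by simp
  also have "\<dots> = (LINT y|lborel. rgauss \<epsilon> (y :: real ^ 'd))"
    by (rule integral_lborel_translate) simp
  finally show ?thesis by (simp add: integral_rgauss[OF e])
qed

end

section \<open>The Sinkhorn equation\<close>

lemma LIMSEQ_bdd_borel:
  fixes f :: "nat \<Rightarrow> real ^ 'd::finite \<Rightarrow> real"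
  assumes "\<And>n. f n \<in> bdd_borel" "\<And>n x. norm (f n x) \<le> B" "\<And>x. (\<lambda>n. f n x) \<longlonglongrightarrow> g x"
  shows "g \<in> bdd_borel"
proof (rule bmI)
  show "g \<in> borel_measurable borel"
    by (rule borel_measurable_LIMSEQ_real[of _ f]) (use assms in \<open>auto intro: bdd_borel_measurable\<close>)
  show "norm (g x) \<le> B" for x
    by (rule LIMSEQ_le_const2[OF tendsto_norm[OF assms(3)]]) (use assms(2) in auto)
qed

locale torus_prob = torus_measure L \<mu> + prob_space \<mu> for L :: real and \<mu> :: "(real ^ 'd::finite) measure" +
  fixes \<epsilon> :: real
  assumes e: "0 < \<epsilon>"
begin

lemma measure_UNIV [simp]: "measure \<mu> UNIV = 1"
  using prob_space by simp

lemma Kr_LIMSEQ: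
  assumes f: "\<And>n. f n \<in> bdd_borel" and B: "\<And>n x. norm (f n x) \<le> B" and l: "\<And>x. (\<lambda>n. f n x) \<longlonglongrightarrow> g x"
  shows "(\<lambda>n. Kr L \<mu> \<epsilon> (f n) x) \<longlonglongrightarrow> Kr L \<mu> \<epsilon> g x"
  unfolding Kr_def
proof (rule integral_dominated_convergence[where w="\<lambda>_. gmax TYPE('d) L \<epsilon> * B"])
  have g: "g \<in> bdd_borel" by (rule LIMSEQ_bdd_borel[OF f B l])
  show "(\<lambda>y. rgauss_per L \<epsilon> (y - x) * g y) \<in> borel_measurable \<mu>" "\<And>i. (\<lambda>y. rgauss_per L \<epsilon> (y - x) * f i y) \<in> borel_measurable \<mu>"
    by (intro measurable_\<mu> bdd_borel_measurable bdd_borel_mult bdd_borel_rgauss_per L e f g)+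
  show "AE y in \<mu>. norm (rgauss_per L \<epsilon> (y - x) * f i y) \<le> gmax TYPE('d) L \<epsilon> * B" for i
  proof (rule AE_I2)
    fix y
    show "norm (rgauss_per L \<epsilon> (y - x) * f i y) \<le> gmax TYPE('d) L \<epsilon> * B"
      unfolding norm_mult using rgauss_per_upper[OF L e, of "y - x"] rgauss_per_pos[OF L e, of "y - x"] less_imp_le[OF gmax_pos[OF L]] B
      by (intro mult_mono) auto
  qed
qed (auto intro!: tendsto_intros l)

lemma Kr_nonneg: "f \<in> bdd_borel \<Longrightarrow> (\<And>x. 0 \<le> f x) \<Longrightarrow> 0 \<le> Kr L \<mu> \<epsilon> f x"
  unfolding Kr_def by (intro integral_nonneg_AE AE_I2 mult_nonneg_nonneg less_imp_le[OF rgauss_per_pos[OF L e]])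

lemma Kr_cong_AE: 
  assumes "f \<in> bdd_borel" "g \<in> bdd_borel" "AE y in \<mu>. f y = g y"
  shows "Kr L \<mu> \<epsilon> f x = Kr L \<mu> \<epsilon> g x"
  unfolding Kr_def
proof (rule integral_cong_AE)
  show "AE y in \<mu>. rgauss_per L \<epsilon> (y - x) * f y = rgauss_per L \<epsilon> (y - x) * g y" using assms(3) by eventually_elim simp
qed (intro measurable_\<mu> bdd_borel_measurable bdd_borel_mult bdd_borel_rgauss_per L e assms)+

text \<open>The variance of |k| under a probability measure is nonnegative.\<close>

lemma square_integral_abs_le:
  fixes k :: "real ^ 'd \<Rightarrow> real"
  assumes k: "k \<in> bdd_borel"
  shows "(LINT y|\<mu>. \<bar>k y\<bar>)\<^sup>2 \<le> (LINT y|\<mu>. (k y)\<^sup>2)"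
proof -
  define m where "m = (LINT y|\<mu>. \<bar>k y\<bar>)"
  have ka: "(\<lambda>y. \<bar>k y\<bar>) \<in> bdd_borel" using bdd_borel_norm[OF k] by simp
  have k2: "(\<lambda>y. (k y)\<^sup>2) \<in> bdd_borel" unfolding power2_eq_square by (intro bdd_borel_mult k)
  have "0 \<le> (LINT y|\<mu>. (\<bar>k y\<bar> - m)\<^sup>2)" by simp
  also have "\<dots> = (LINT y|\<mu>. (k y)\<^sup>2 - 2 * m * \<bar>k y\<bar> + m\<^sup>2)"
    by (intro Bochner_Integration.integral_cong refl) (simp add: power2_diff algebra_simps)
  also have "\<dots> = (LINT y|\<mu>. (k y)\<^sup>2) - 2 * m * m + m\<^sup>2"
    using integrable_\<mu>[OF k2] integrable_\<mu>[OF ka] by (simp add: m_def)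
  finally show ?thesis by (simp add: m_def power2_eq_square)
qed

text \<open>
  \<open>sink_sol \<tau> u\<close> is the Sinkhorn equation with \<open>K\<close> replaced by \<open>\<tau> + K\<close>. For \<open>\<tau> > 0\<close> it is solved by
  alternating monotone iteration; symmetry of the kernel makes the two limits agree.
\<close>

definition sink_sol :: "real \<Rightarrow> (real ^ 'd \<Rightarrow> real) \<Rightarrow> bool" where
  "sink_sol \<tau> u \<longleftrightarrow> u \<in> bdd_borel \<and> (\<forall>x. 0 < u x) \<and> (\<forall>x. u x * (\<tau> + Kr L \<mu> \<epsilon> u x) = 1)"

lemma solD:
  assumes "sink_sol \<tau> u"
  shows "u \<in> bdd_borel" "0 < u x" "Kr L \<mu> \<epsilon> u x = 1 / u x - \<tau>"
proof -
  show "u \<in> bdd_borel" and p: "0 < u x" using assms by (auto simp: sink_sol_def)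
  have "u x * (\<tau> + Kr L \<mu> \<epsilon> u x) = 1" using assms by (simp add: sink_sol_def)
  then have "\<tau> + Kr L \<mu> \<epsilon> u x = 1 / u x" using p by (simp add: eq_divide_eq mult.commute)
  then show "Kr L \<mu> \<epsilon> u x = 1 / u x - \<tau>" by simp
qed

lemma sink_sol_exists_pos:
  assumes \<tau>: "0 < \<tau>"
  shows "\<exists>u. sink_sol \<tau> u"
proof -
  \<comment> \<open>T reverses the order, so from 0 its even iterates increase, its odd ones
    decrease, and each even one lies below the next odd one. The shift \<tau> keeps the denominators
    away from 0.\<close>
  define T where "T f x = 1 / (\<tau> + Kr L \<mu> \<epsilon> f x)" for f x
  define it where "it n = (T ^^ n) (\<lambda>_. 0)" for n
  have it_Suc: "it (Suc n) = T (it n)" for n by (simp add: it_def)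
  have T01: "0 \<le> T f x" "T f x \<le> 1 / \<tau>" if "f \<in> bdd_borel" "\<And>x. 0 \<le> f x" for f x
    using Kr_nonneg[OF that, of x] \<tau> by (auto simp: T_def frac_le)
  have Tbm: "T f \<in> bdd_borel" if "f \<in> bdd_borel" "\<And>x. 0 \<le> f x" for f
  proof (rule bmI)
    show "T f \<in> borel_measurable borel"
      unfolding T_def using bdd_borel_measurable[OF Kr_bdd_borel[OF e that(1)]] by measurable
    show "norm (T f x) \<le> 1 / \<tau>" for x using T01[OF that, of x] by simp
  qed
  have it: "it n \<in> bdd_borel \<and> (\<forall>x. 0 \<le> it n x)" for n
    by (induction n) (auto simp: it_Suc Tbm T01, simp_all add: it_def)
  have itb: "norm (it n x) \<le> 1 / \<tau>" for n x
    using T01[of "it (n - 1)" x] it \<tau> by (cases n) (auto simp: it_Suc, simp add: it_def)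
  have anti: "T g x \<le> T f x" if "f \<in> bdd_borel" "g \<in> bdd_borel" "\<And>x. 0 \<le> f x" "\<And>x. f x \<le> g x" for f g x
    unfolding T_def using Kr_mono[OF e that(1,2) AE_I2, of x] that Kr_nonneg[OF that(1,3), of x] \<tau>
    by (intro divide_left_mono mult_pos_pos) (auto intro: add_pos_nonneg Kr_nonneg order_trans)
  have anti': "it (Suc m) x \<le> it (Suc n) x" if "\<forall>x. it n x \<le> it m x" for m n x
    unfolding it_Suc using that it by (intro anti) auto
  have mono2: "(even n \<longrightarrow> (\<forall>x. it n x \<le> it (n + 2) x)) \<and> (odd n \<longrightarrow> (\<forall>x. it (n + 2) x \<le> it n x))" for n
  proof (induction n)
    case 0 then show ?case using it[of 2] by (simp add: it_def[of 0] numeral_2_eq_2)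
  next
    case (Suc n)
    then show ?case using anti'[of n "n + 2"] anti'[of "n + 2" n] by auto
  qed
  have mono1: "(even n \<longrightarrow> (\<forall>x. it n x \<le> it (n + 1) x)) \<and> (odd n \<longrightarrow> (\<forall>x. it (n + 1) x \<le> it n x))" for n
  proof (induction n)
    case 0 then show ?case using it[of 1] by (simp add: it_def[of 0])
  next
    case (Suc n)
    then show ?case using anti'[of n "n + 1"] anti'[of "n + 1" n] by auto
  qed
  have ev: "incseq (\<lambda>n. it (2 * n) x)" and od: "decseq (\<lambda>n. it (Suc (2 * n)) x)" for x
    using mono2[of "2 * _"] mono2[of "Suc (2 * _)"] by (auto intro!: incseq_SucI decseq_SucI)
  have bd: "Bseq (\<lambda>n. it (r n) x)" for r :: "nat \<Rightarrow> nat" and x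
    using itb by (intro BseqI'[of _ "1 / \<tau>"]) auto
  define a b where "a x = lim (\<lambda>n. it (2 * n) x)" and "b x = lim (\<lambda>n. it (Suc (2 * n)) x)" for x
  have la: "(\<lambda>n. it (2 * n) x) \<longlonglongrightarrow> a x" for x
    unfolding a_def using Bseq_monoseq_convergent[OF bd incseq_imp_monoseq[OF ev]] by (simp add: convergent_LIMSEQ_iff)
  have lb: "(\<lambda>n. it (Suc (2 * n)) x) \<longlonglongrightarrow> b x" for x
    unfolding b_def using Bseq_monoseq_convergent[OF bd decseq_imp_monoseq[OF od]] by (simp add: convergent_LIMSEQ_iff)
  have bma: "a \<in> bdd_borel"
    by (rule LIMSEQ_bdd_borel[where f="\<lambda>n. it (2 * n)", OF _ itb la]) (simp add: it)
  have bmb: "b \<in> bdd_borel"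
    by (rule LIMSEQ_bdd_borel[where f="\<lambda>n. it (Suc (2 * n))", OF _ itb lb]) (simp add: it)
  have a0: "0 \<le> a x" and b0: "0 \<le> b x" for x
    using LIMSEQ_le_const[OF la, of 0] LIMSEQ_le_const[OF lb, of 0] it by auto
  have ab: "a x \<le> b x" for x
    by (rule LIMSEQ_le[OF la lb]) (use mono1 in auto)
  have nz: "\<tau> + Kr L \<mu> \<epsilon> a x \<noteq> 0" "\<tau> + Kr L \<mu> \<epsilon> b x \<noteq> 0" for x
    using Kr_nonneg[OF bma a0, of x] Kr_nonneg[OF bmb b0, of x] \<tau> by auto
  have "(\<lambda>n. T (it (2 * n)) x) \<longlonglongrightarrow> 1 / (\<tau> + Kr L \<mu> \<epsilon> a x)" for x
    unfolding T_def by (intro tendsto_intros Kr_LIMSEQ[OF _ itb la] nz) (use it in auto)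
  then have eb: "b x = 1 / (\<tau> + Kr L \<mu> \<epsilon> a x)" for x
    using LIMSEQ_unique[OF lb[of x]] by (simp add: it_Suc)
  have "(\<lambda>n. T (it (Suc (2 * n))) x) \<longlonglongrightarrow> 1 / (\<tau> + Kr L \<mu> \<epsilon> b x)" for x
    unfolding T_def by (intro tendsto_intros Kr_LIMSEQ[OF _ itb lb] nz) (use it in auto)
  then have ea: "a x = 1 / (\<tau> + Kr L \<mu> \<epsilon> b x)" for x
    using LIMSEQ_unique[OF LIMSEQ_Suc[OF la[of x]]] by (simp add: it_Suc)
  have ib: "integrable \<mu> a" "integrable \<mu> b" by (rule integrable_\<mu>[OF bma] integrable_\<mu>[OF bmb])+
  have Ka: "Kr L \<mu> \<epsilon> a \<in> bdd_borel" and Kb: "Kr L \<mu> \<epsilon> b \<in> bdd_borel" by (intro Kr_bdd_borel e bma bmb)+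
  \<comment> \<open>Subtract \<open>b * (\<tau> + Kr a) = 1\<close> and
    \<open>a * (\<tau> + Kr b) = 1\<close>. By symmetry of the kernel the right side has integral 0,
    while the left side is nonnegative.\<close>
  have "\<tau> * (b x - a x) = a x * Kr L \<mu> \<epsilon> b x - b x * Kr L \<mu> \<epsilon> a x" for x
    using ea[of x] eb[of x] nz[of x] by (simp add: field_simps)
  then have "(LINT x|\<mu>. \<tau> * (b x - a x)) = (LINT x|\<mu>. a x * Kr L \<mu> \<epsilon> b x) - (LINT x|\<mu>. b x * Kr L \<mu> \<epsilon> a x)"
    using integrable_\<mu>[OF bdd_borel_mult[OF bma Kb]] integrable_\<mu>[OF bdd_borel_mult[OF bmb Ka]] by simp
  also have "\<dots> = 0"
    using Kr_symmetric[OF torus_measure_axioms e bmb bma] by simp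
  finally have "(LINT x|\<mu>. b x - a x) = 0" using \<tau> by simp
  moreover have "integrable \<mu> (\<lambda>x. b x - a x)" using ib by simp
  ultimately have "AE x in \<mu>. b x - a x = 0"
    using ab by (subst (asm) integral_nonneg_eq_0_iff_AE) auto
  then have "AE x in \<mu>. a x = b x" by eventually_elim simp
  \<comment> \<open>Equality of a and b almost everywhere is all that \<open>Kr\<close> sees, and
    the limit equations then hold with a alone at every point.\<close>
  then have "Kr L \<mu> \<epsilon> a x = Kr L \<mu> \<epsilon> b x" for x by (rule Kr_cong_AE[OF bma bmb])
  then have "sink_sol \<tau> a"
    unfolding sink_sol_def using bma ea Kr_nonneg[OF bmb b0] \<tau> nz by (auto intro: add_pos_nonneg)
  then show ?thesis by blast
qed

text \<open>Pair the difference of the two equations with u - v: the reciprocals give (u - v)^2 / (u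
  v), at least (u - v)^2 / C^2, and the kernel term is nonnegative by
  \<open>Kr_energy_nonneg\<close>. The functions r and s accommodate a shift by \<tau> as well as a
  change of measure.\<close>

lemma mono_identity:
  assumes u: "u \<in> bdd_borel" and v: "v \<in> bdd_borel" and pos: "\<And>x. 0 < u x" "\<And>x. 0 < v x"
    and C: "\<And>x. u x \<le> C" "\<And>x. v x \<le> C"
    and eq: "\<And>x. Kr L \<mu> \<epsilon> u x = 1 / u x - r x" "\<And>x. Kr L \<mu> \<epsilon> v x = 1 / v x - s x"
    and rs: "\<And>x. \<bar>s x - r x\<bar> \<le> D"
  shows "(LINT x|\<mu>. (u x - v x)\<^sup>2) \<le> C\<^sup>2 * (C * D)"
proof -
  have k: "(\<lambda>x. u x - v x) \<in> bdd_borel" by (intro bdd_borel_diff u v)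
  have K: "Kr L \<mu> \<epsilon> (\<lambda>x. u x - v x) x = Kr L \<mu> \<epsilon> u x - Kr L \<mu> \<epsilon> v x" for x by (rule Kr_diff[OF e u v])
  have C0: "0 < C" using pos(1)[of 0] C(1)[of 0] by simp
  have D0: "0 \<le> D" using rs[of 0] by simp
  have bK: "(\<lambda>x. (u x - v x) * Kr L \<mu> \<epsilon> (\<lambda>x. u x - v x) x) \<in> bdd_borel" by (intro bdd_borel_mult k Kr_bdd_borel e)
  have b2: "(\<lambda>x. (u x - v x)\<^sup>2) \<in> bdd_borel" unfolding power2_eq_square by (intro bdd_borel_mult k)
  have ptw: "(u x - v x)\<^sup>2 + C\<^sup>2 * ((u x - v x) * Kr L \<mu> \<epsilon> (\<lambda>x. u x - v x) x) \<le> C\<^sup>2 * (C * D)" for x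
  proof -
    have "u x * v x \<le> C\<^sup>2" unfolding power2_eq_square using C[of x] pos[of x] by (intro mult_mono) auto
    then have "(u x - v x)\<^sup>2 \<le> C\<^sup>2 * ((u x - v x)\<^sup>2 / (u x * v x))"
      using pos[of x] mult_left_mono[of "u x * v x" "C\<^sup>2" "(u x - v x)\<^sup>2"] by (simp add: field_simps)
    moreover have "(u x - v x)\<^sup>2 / (u x * v x) = - (u x - v x) * (1 / u x - 1 / v x)"
      using pos[of x] by (simp add: field_simps power2_eq_square)
    ultimately have "(u x - v x)\<^sup>2 + C\<^sup>2 * ((u x - v x) * Kr L \<mu> \<epsilon> (\<lambda>x. u x - v x) x) \<le> C\<^sup>2 * ((u x - v x) * (s x - r x))"
      unfolding K eq by (simp add: algebra_simps)
    also have "\<dots> \<le> C\<^sup>2 * (C * D)"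
    proof (intro mult_left_mono)
      have "\<bar>u x - v x\<bar> \<le> C" using pos[of x] C[of x] by linarith
      then have "\<bar>(u x - v x) * (s x - r x)\<bar> \<le> C * D"
        unfolding abs_mult using rs[of x] C0 by (intro mult_mono) auto
      then show "(u x - v x) * (s x - r x) \<le> C * D" by simp
    qed simp
    finally show ?thesis .
  qed
  have "(LINT x|\<mu>. (u x - v x)\<^sup>2) \<le> (LINT x|\<mu>. (u x - v x)\<^sup>2) + C\<^sup>2 * (LINT x|\<mu>. (u x - v x) * Kr L \<mu> \<epsilon> (\<lambda>x. u x - v x) x)"
    using Kr_energy_nonneg[OF e k] by simp
  also have "\<dots> = (LINT x|\<mu>. (u x - v x)\<^sup>2 + C\<^sup>2 * ((u x - v x) * Kr L \<mu> \<epsilon> (\<lambda>x. u x - v x) x))"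
    using integrable_\<mu>[OF bK] integrable_\<mu>[OF b2] by simp
  also have "\<dots> \<le> (LINT x|\<mu>. C\<^sup>2 * (C * D))"
    by (intro integral_mono integrable_\<mu> bdd_borel_add b2 bdd_borel_cmult bK bdd_borel_const ptw)
  finally show ?thesis by simp
qed

text \<open>With m the integral of u, the equation gives u \<le> 1 / (gmin m), so m^2 \<le> 1 /
  gmin, so \<tau> + K u \<le> 1 + gmax / sqrt gmin for \<tau> \<le> 1. This bounds u below, and fed
  back into the first inequality it bounds u above. Neither number depends on the measure, so both
  hold along a whole segment of measures.\<close>

definition sink_sol_upper :: real where
  "sink_sol_upper = (1 + gmax TYPE('d) L \<epsilon> / sqrt (gmin TYPE('d) L \<epsilon>)) / gmin TYPE('d) L \<epsilon>"

definition sink_sol_lower :: real where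
  "sink_sol_lower = 1 / (1 + gmax TYPE('d) L \<epsilon> / sqrt (gmin TYPE('d) L \<epsilon>))"

lemma sink_sol_bounds:
  assumes s: "sink_sol \<tau> u" and \<tau>: "0 \<le> \<tau>" "\<tau> \<le> 1"
  shows "u x \<le> sink_sol_upper" "sink_sol_lower \<le> u x" "gmin TYPE('d) L \<epsilon> * sink_sol_lower \<le> Kr L \<mu> \<epsilon> u x"
proof -
  let ?a = "gmin TYPE('d) L \<epsilon>" and ?b = "gmax TYPE('d) L \<epsilon>"
  have a: "0 < ?a" and b: "0 < ?b" by (rule gmin_pos[OF e] gmax_pos[OF L])+
  have u: "u \<in> bdd_borel" and pos: "\<And>x. 0 < u x" and eq: "\<And>x. u x * (\<tau> + Kr L \<mu> \<epsilon> u x) = 1"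
    using s by (auto simp: sink_sol_def)
  define m where "m = (LINT y|\<mu>. u y)"
  have iu: "integrable \<mu> u" by (rule integrable_\<mu>[OF u])
  have "AE y in \<mu>. 0 \<le> u y" using pos by (auto intro: less_imp_le)
  note K = Kr_pos[OF e u this, folded m_def]
  have m: "0 < m"
  proof -
    have "m \<noteq> 0"
    proof
      assume "m = 0"
      then have "AE y in \<mu>. u y = 0" 
        unfolding m_def using pos by (subst (asm) integral_nonneg_eq_0_iff_AE[OF iu]) (auto intro: less_imp_le)
      then have "AE y in \<mu>. False" by eventually_elim (use pos in \<open>metis less_irrefl\<close>)
      then show False using AE_False prob_space by simp
    qed
    moreover have "0 \<le> m" unfolding m_def using pos by (intro integral_nonneg_AE) (auto intro: less_imp_le)
    ultimately show ?thesis by simp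
  qed
  have ueq: "u x = 1 / (\<tau> + Kr L \<mu> \<epsilon> u x)" for x using eq[of x] by (metis mult.commute mult_eq_0_iff nonzero_eq_divide_eq zero_neq_one)
  have am: "0 < ?a * m" using a m by simp
  have tK: "0 < \<tau> + Kr L \<mu> \<epsilon> u x" for x using K(1)[of x] am \<tau> by linarith
  have up: "u x \<le> 1 / (?a * m)" for x
    unfolding ueq[of x] using K(1)[of x] am \<tau> a m tK[of x] by (intro divide_left_mono mult_pos_pos) auto
  have "m \<le> (LINT y|\<mu>. 1 / (?a * m))"
    unfolding m_def[symmetric] by (subst m_def, rule integral_mono[OF iu]) (auto intro: up)
  then have "m * m \<le> 1 / ?a" using a m by (simp add: field_simps)
  then have "m \<le> sqrt (1 / ?a)" by (intro real_le_rsqrt) (simp add: power2_eq_square)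
  then have ms: "m \<le> 1 / sqrt ?a" by (simp add: real_sqrt_divide)
  have low: "sink_sol_lower \<le> u x" for x
  proof -
    have "\<tau> + Kr L \<mu> \<epsilon> u x \<le> 1 + ?b * (1 / sqrt ?a)"
      using K(2)[of x] \<tau> mult_left_mono[OF ms, of ?b] b by linarith
    then show ?thesis
      unfolding ueq[of x] sink_sol_lower_def using K(1)[of x] am \<tau> a b tK[of x] by (intro divide_left_mono mult_pos_pos) (auto intro: add_pos_nonneg)
  qed
  have "(LINT y|\<mu>. sink_sol_lower) \<le> m" unfolding m_def by (rule integral_mono[OF _ iu]) (auto intro: low)
  then have sm: "sink_sol_lower \<le> m" by simp
  have sp: "0 < sink_sol_lower" unfolding sink_sol_lower_def using a b by (simp add: add_pos_nonneg)
  show "sink_sol_lower \<le> u x" by (rule low)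
  show "u x \<le> sink_sol_upper"
  proof -
    have "1 / (?a * m) \<le> 1 / (?a * sink_sol_lower)" using sm sp a m by (intro divide_left_mono mult_left_mono mult_pos_pos) auto
    also have "\<dots> = sink_sol_upper" by (simp add: sink_sol_lower_def sink_sol_upper_def)
    finally show ?thesis using up[of x] by simp
  qed
  show "?a * sink_sol_lower \<le> Kr L \<mu> \<epsilon> u x"
    using K(1)[of x] mult_left_mono[OF sm, of ?a] a by linarith
qed

lemma sink_sol_lower_pos: "0 < sink_sol_lower"
  unfolding sink_sol_lower_def using less_imp_le[OF gmin_pos[OF e, where 'd='d]] less_imp_le[OF gmax_pos[OF L, where 'd='d]]
  by (simp add: add_pos_nonneg)

text \<open>By \<open>mono_identity\<close> the solutions for \<tau> tending to 0 form a Cauchy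
  sequence in mean square; the bounded kernel turns this into pointwise convergence of
  \<open>Kr\<close> applied to them.\<close>

lemma sink_sol_exists: "\<exists>u. sink_sol 0 u"
proof -
  define \<tau> where "\<tau> n = 1 / real (Suc n)" for n
  have \<tau>: "0 < \<tau> n" "\<tau> n \<le> 1" for n by (auto simp: \<tau>_def)
  have "\<forall>n. \<exists>u. sink_sol (\<tau> n) u" using sink_sol_exists_pos[OF \<tau>(1)] by blast
  then obtain U where U: "\<And>n. sink_sol (\<tau> n) (U n)" by metis
  note B = sink_sol_bounds[OF U less_imp_le[OF \<tau>(1)] \<tau>(2)]
  have Ubm: "U n \<in> bdd_borel" and Upos: "0 < U n x" and Ueq: "Kr L \<mu> \<epsilon> (U n) x = 1 / U n x - \<tau> n" for n x
    using solD[OF U[of n]] by auto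
  have sb: "0 < sink_sol_upper" using B(1)[of 0 0] Upos[of 0 0] by linarith
  have K_diff: "\<bar>Kr L \<mu> \<epsilon> (U n) x - Kr L \<mu> \<epsilon> (U m) x\<bar> \<le> gmax TYPE('d) L \<epsilon> * sqrt (sink_sol_upper ^ 3 * \<bar>\<tau> m - \<tau> n\<bar>)" for n m x
  proof -
    have k: "(\<lambda>x. U n x - U m x) \<in> bdd_borel" by (intro bdd_borel_diff Ubm)
    have ka: "(\<lambda>x. \<bar>U n x - U m x\<bar>) \<in> bdd_borel" using bdd_borel_norm[OF k] by simp
    have "\<bar>Kr L \<mu> \<epsilon> (\<lambda>x. U n x - U m x) x\<bar> \<le> Kr L \<mu> \<epsilon> (\<lambda>x. \<bar>U n x - U m x\<bar>) x"
      using norm_Ku_le[OF e, of "\<lambda>y. of_real (U n y - U m y)" "cvec x"] k by (simp only: Ku_of_real[OF e] bdd_borel_of_real norm_of_real) simp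
    also have "\<dots> \<le> gmax TYPE('d) L \<epsilon> * (LINT x|\<mu>. \<bar>U n x - U m x\<bar>)"
      by (rule Kr_pos(2)[OF e ka]) simp
    also have "(LINT x|\<mu>. \<bar>U n x - U m x\<bar>) \<le> sqrt (sink_sol_upper ^ 3 * \<bar>\<tau> m - \<tau> n\<bar>)"
    proof (rule real_le_rsqrt)
      have "(LINT x|\<mu>. \<bar>U n x - U m x\<bar>)\<^sup>2 \<le> (LINT x|\<mu>. (U n x - U m x)\<^sup>2)"
        by (rule square_integral_abs_le[OF k])
      also have "\<dots> \<le> sink_sol_upper\<^sup>2 * (sink_sol_upper * \<bar>\<tau> m - \<tau> n\<bar>)"
        by (rule mono_identity[OF Ubm Ubm Upos Upos B(1) B(1) Ueq Ueq]) simp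
      finally show "(LINT x|\<mu>. \<bar>U n x - U m x\<bar>)\<^sup>2 \<le> sink_sol_upper ^ 3 * \<bar>\<tau> m - \<tau> n\<bar>"
        by (simp add: power2_eq_square power3_eq_cube mult_ac)
    qed
    finally show ?thesis
      using less_imp_le[OF gmax_pos[OF L, where 'd='d]] by (simp add: Kr_diff[OF e Ubm Ubm] mult_left_mono)
  qed
  have \<tau>0: "\<tau> \<longlonglongrightarrow> 0" unfolding \<tau>_def by (rule LIMSEQ_Suc[OF lim_1_over_n])
  have "convergent (\<lambda>n. Kr L \<mu> \<epsilon> (U n) x)" for x
  proof (rule Cauchy_convergent, rule metric_CauchyI)
    fix r :: real assume r: "0 < r"
    let ?G = "gmax TYPE('d) L \<epsilon>"
    have G: "0 < ?G" by (rule gmax_pos[OF L])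
    \<comment> \<open>Solved from \<open>?G * sqrt (sink_sol_upper ^ 3 * q) = r\<close>.\<close>
    define q where "q = (r / ?G)\<^sup>2 / sink_sol_upper ^ 3"
    have q: "0 < q" using r G sb by (simp add: q_def)
    obtain N where N: "\<And>m n. m \<ge> N \<Longrightarrow> n \<ge> N \<Longrightarrow> dist (\<tau> m) (\<tau> n) < q"
      using metric_CauchyD[OF LIMSEQ_imp_Cauchy[OF \<tau>0] q] by blast
    show "\<exists>N. \<forall>m\<ge>N. \<forall>n\<ge>N. dist (Kr L \<mu> \<epsilon> (U m) x) (Kr L \<mu> \<epsilon> (U n) x) < r"
    proof (intro exI[of _ N] allI impI)
      fix m n assume "N \<le> m" "N \<le> n"
      then have "\<bar>\<tau> n - \<tau> m\<bar> < q" using N[of n m] by (simp add: dist_real_def)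
      then have "sink_sol_upper ^ 3 * \<bar>\<tau> n - \<tau> m\<bar> < (r / ?G)\<^sup>2" unfolding q_def using sb by (simp only: pos_less_divide_eq zero_less_power mult.commute)
      then have "sqrt (sink_sol_upper ^ 3 * \<bar>\<tau> n - \<tau> m\<bar>) < r / ?G" using r G by (intro real_less_lsqrt) auto
      then have "?G * sqrt (sink_sol_upper ^ 3 * \<bar>\<tau> n - \<tau> m\<bar>) < r" using G by (simp add: field_simps)
      then show "dist (Kr L \<mu> \<epsilon> (U m) x) (Kr L \<mu> \<epsilon> (U n) x) < r"
        using K_diff[of m x n] by (simp add: dist_real_def)
    qed
  qed
  then have k: "(\<lambda>n. Kr L \<mu> \<epsilon> (U n) x) \<longlonglongrightarrow> lim (\<lambda>n. Kr L \<mu> \<epsilon> (U n) x)" for x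
    by (simp add: convergent_LIMSEQ_iff)
  define k where "k x = lim (\<lambda>n. Kr L \<mu> \<epsilon> (U n) x)" for x
  note k = k[folded k_def]
  have kp: "gmin TYPE('d) L \<epsilon> * sink_sol_lower \<le> k x" for x
    by (rule LIMSEQ_le_const[OF k]) (use B(3) in auto)
  have kpos: "0 < k x" for x using kp[of x] sink_sol_lower_pos gmin_pos[OF e, where 'd='d] by (meson less_le_trans mult_pos_pos)
  define u where "u x = 1 / k x" for x
  \<comment> \<open>The weights are recovered as reciprocals, so they converge at every point
    although only their averages were controlled.\<close>
  have "(\<lambda>n. 1 / (\<tau> n + Kr L \<mu> \<epsilon> (U n) x)) \<longlonglongrightarrow> 1 / (0 + k x)" for x
    proof (intro tendsto_divide tendsto_const tendsto_add \<tau>0 k)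
    show "0 + k x \<noteq> 0" using kpos[of x] by simp
  qed
  then have lim: "(\<lambda>n. U n x) \<longlonglongrightarrow> u x" for x by (simp add: Ueq u_def)
  have nB: "norm (U n x) \<le> sink_sol_upper" for n x using B(1)[of n x] Upos[of n x] by simp
  have "u \<in> bdd_borel" by (rule LIMSEQ_bdd_borel[OF Ubm nB lim])
  moreover have "Kr L \<mu> \<epsilon> u x = k x" for x
    by (rule LIMSEQ_unique[OF Kr_LIMSEQ[OF Ubm nB lim] k])
  ultimately have "sink_sol 0 u" using kpos by (simp add: sink_sol_def u_def less_imp_neq[symmetric])
  then show ?thesis by blast
qed

text \<open>The mean-square estimate with D = 0 gives equality almost everywhere for the measure;
  \<open>Kr\<close> sees no more than that, and the equation upgrades it to every point.\<close>

lemma sink_sol_unique: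
  assumes "sink_sol 0 u" "sink_sol 0 v"
  shows "u = v"
proof -
  have u: "u \<in> bdd_borel" "\<And>x. 0 < u x" "\<And>x. Kr L \<mu> \<epsilon> u x = 1 / u x - 0" and
    v: "v \<in> bdd_borel" "\<And>x. 0 < v x" "\<And>x. Kr L \<mu> \<epsilon> v x = 1 / v x - 0"
    using solD[OF assms(1)] solD[OF assms(2)] by auto
  have C: "u x \<le> sink_sol_upper" "v x \<le> sink_sol_upper" for x using assms sink_sol_bounds(1) by auto
  have k2: "(\<lambda>x. (u x - v x)\<^sup>2) \<in> bdd_borel" unfolding power2_eq_square by (intro bdd_borel_mult bdd_borel_diff u v)
  have "(LINT x|\<mu>. (u x - v x)\<^sup>2) \<le> sink_sol_upper\<^sup>2 * (sink_sol_upper * 0)"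
    by (rule mono_identity[OF u(1) v(1) u(2) v(2) C u(3) v(3)]) simp
  moreover have "0 \<le> (LINT x|\<mu>. (u x - v x)\<^sup>2)" by simp
  ultimately have "(LINT x|\<mu>. (u x - v x)\<^sup>2) = 0" by linarith
  then have "AE x in \<mu>. (u x - v x)\<^sup>2 = 0"
    by (subst (asm) integral_nonneg_eq_0_iff_AE[OF integrable_\<mu>[OF k2]]) auto
  then have "AE x in \<mu>. u x = v x" by eventually_elim simp
  then have "Kr L \<mu> \<epsilon> u x = Kr L \<mu> \<epsilon> v x" for x by (rule Kr_cong_AE[OF u(1) v(1)])
  then have "1 / u x = 1 / v x" for x using u(3) v(3) by simp
  then show ?thesis by (auto simp: fun_eq_iff)
qed

definition sinkhorn_wt :: "real ^ 'd \<Rightarrow> real" where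
  "sinkhorn_wt = (SOME u. sink_sol 0 u)"

lemma sink_sol_sinkhorn_wt: "sink_sol 0 sinkhorn_wt"
  unfolding sinkhorn_wt_def using sink_sol_exists by (rule someI_ex)

lemma sinkhorn_wt_eqI: "sink_sol 0 u \<Longrightarrow> sinkhorn_wt = u"
  using sink_sol_sinkhorn_wt sink_sol_unique by blast

lemma sinkhorn_wt_bdd_borel: "sinkhorn_wt \<in> bdd_borel" and sinkhorn_wt_pos: "0 < sinkhorn_wt x" and Kr_sinkhorn_wt: "Kr L \<mu> \<epsilon> sinkhorn_wt x = 1 / sinkhorn_wt x"
  using solD[OF sink_sol_sinkhorn_wt] by auto

end

section \<open>Interpolation between two measures\<close>

text \<open>For \<open>t \<in> {0..1}\<close> this is \<open>(1 - t) \<mu> + t \<nu>\<close>; elsewhere \<^const>\<open>bernoulli_pmf\<close> truncates \<open>t\<close> to the unit interval.\<close>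

definition mixture :: "'a measure \<Rightarrow> 'a measure \<Rightarrow> real \<Rightarrow> 'a measure" where
  "mixture \<mu> \<nu> t = measure_pmf (bernoulli_pmf t) \<bind> (\<lambda>b. if b then \<nu> else \<mu>)"

locale torus_pair = P: torus_prob L \<mu> \<epsilon> + Q: torus_prob L \<nu> \<epsilon>
  for L :: real and \<mu> :: "(real ^ 'd::finite) measure" and \<nu> :: "(real ^ 'd::finite) measure" and \<epsilon> :: real
begin

lemma mixture_kernel: "(\<lambda>b. if b then \<nu> else \<mu>) \<in> measure_pmf (bernoulli_pmf t) \<rightarrow>\<^sub>M subprob_algebra borel"
proof -
  have "\<mu> \<in> space (subprob_algebra borel)" "\<nu> \<in> space (subprob_algebra borel)"
    using P.sets_\<mu> Q.sets_\<mu> P.prob_space_axioms Q.prob_space_axioms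
    by (auto simp: space_subprob_algebra intro: prob_space_imp_subprob_space)
  then show ?thesis by simp
qed

lemma sets_mixture: "sets (mixture \<mu> \<nu> t) = sets borel"
  unfolding mixture_def by (rule sets_bind[OF sets_kernel[OF mixture_kernel]]) auto

lemma prob_space_mixture: "prob_space (mixture \<mu> \<nu> t)"
  unfolding mixture_def
  by (rule prob_space.prob_space_bind[OF prob_space_measure_pmf _ mixture_kernel])
    (use P.prob_space_axioms Q.prob_space_axioms in auto)

sublocale M: torus_prob L "mixture \<mu> \<nu> t" \<epsilon> for t
proof -
  interpret prob_space "mixture \<mu> \<nu> t" by (rule prob_space_mixture)
  show "torus_prob L (mixture \<mu> \<nu> t) \<epsilon>"
    by unfold_locales (use P.L P.e sets_mixture emeasure_space_1 in auto)
qed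

lemma integral_mixture_real:
  fixes f :: "real ^ 'd \<Rightarrow> real"
  assumes t: "t \<in> {0..1}" and f: "f \<in> bdd_borel"
  shows "(LINT y|mixture \<mu> \<nu> t. f y) = (1 - t) * (LINT y|\<mu>. f y) + t * (LINT y|\<nu>. f y)"
proof -
  obtain B where B: "\<And>y. norm (f y) \<le> B" using bmE[OF f] by metis
  have "(LINT y|mixture \<mu> \<nu> t. f y) = (\<integral>b. (LINT y|(if b then \<nu> else \<mu>). f y) \<partial>measure_pmf (bernoulli_pmf t))"
    unfolding mixture_def
  proof (rule integral_bind[OF bdd_borel_measurable[OF f] _ mixture_kernel])
    show "finite_measure (measure_pmf (bernoulli_pmf t))" by unfold_locales
    show "AE b in measure_pmf (bernoulli_pmf t). emeasure (if b then \<nu> else \<mu>) (space (if b then \<nu> else \<mu>)) \<le> ennreal 1"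
      using P.emeasure_space_1 Q.emeasure_space_1 by (intro AE_I2) auto
  qed (use B in auto)
  also have "\<dots> = (1 - t) * (LINT y|\<mu>. f y) + t * (LINT y|\<nu>. f y)"
    using t by (subst integral_bernoulli_pmf) auto
  finally show ?thesis .
qed

lemma integral_mixture:
  fixes f :: "real ^ 'd \<Rightarrow> complex"
  assumes t: "t \<in> {0..1}" and f: "f \<in> bdd_borel"
  shows "(LINT y|mixture \<mu> \<nu> t. f y) = of_real (1 - t) * (LINT y|\<mu>. f y) + of_real t * (LINT y|\<nu>. f y)"
proof -
  obtain B where B: "\<And>y. norm (f y) \<le> B" using bmE[OF f] by metis
  have Re: "(\<lambda>y. Re (f y)) \<in> bdd_borel" and Im: "(\<lambda>y. Im (f y)) \<in> bdd_borel"
    using bdd_borel_measurable[OF f] by (auto intro!: bmI[where B=B] order_trans[OF abs_Re_le_cmod B] order_trans[OF abs_Im_le_cmod B])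
  show ?thesis
    using integral_mixture_real[OF t Re] integral_mixture_real[OF t Im] P.integrable_\<mu>[OF f] Q.integrable_\<mu>[OF f] M.integrable_\<mu>[OF f, of t]
    by (simp add: complex_eq_iff flip: integral_Re integral_Im)
qed

lemma Ku_mixture:
  assumes t: "t \<in> {0..1}" and f: "f \<in> bdd_borel"
  shows "Ku L (mixture \<mu> \<nu> t) \<epsilon> f w = Ku L \<mu> \<epsilon> f w + of_real t * (Ku L \<nu> \<epsilon> f w - Ku L \<mu> \<epsilon> f w)"
  unfolding Ku_def integral_mixture[OF t bdd_borel_mult[OF bdd_borel_gauss_per(1)[OF P.L P.e] f]]
  by (simp add: algebra_simps)

lemma Kr_mixture:
  assumes t: "t \<in> {0..1}" and f: "f \<in> bdd_borel"
  shows "Kr L (mixture \<mu> \<nu> t) \<epsilon> f x = Kr L \<mu> \<epsilon> f x + t * (Kr L \<nu> \<epsilon> f x - Kr L \<mu> \<epsilon> f x)"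
  unfolding Kr_def integral_mixture_real[OF t bdd_borel_mult[OF bdd_borel_rgauss_per(2)[OF P.L P.e] f]]
  by (simp add: algebra_simps)

text \<open>At real points \<open>inv_wt_path t\<close> is the reciprocal of the Sinkhorn weight of \<open>mixture \<mu> \<nu> t\<close>.\<close>

definition inv_wt_path :: "real \<Rightarrow> complex ^ 'd \<Rightarrow> complex" where
  "inv_wt_path t = Ku L (mixture \<mu> \<nu> t) \<epsilon> (\<lambda>y. of_real (M.sinkhorn_wt t y))"

lemma mixture_0: "t = 0 \<Longrightarrow> M.sinkhorn_wt t = P.sinkhorn_wt" and mixture_1: "t = 1 \<Longrightarrow> M.sinkhorn_wt t = Q.sinkhorn_wt"
proof -
  have "M.sink_sol t 0 P.sinkhorn_wt" if "t = 0"
    using P.sink_sol_sinkhorn_wt P.sinkhorn_wt_bdd_borel that unfolding M.sink_sol_def P.sink_sol_def by (simp add: Kr_mixture)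
  then show "t = 0 \<Longrightarrow> M.sinkhorn_wt t = P.sinkhorn_wt" by (rule M.sinkhorn_wt_eqI)
  have "M.sink_sol t 0 Q.sinkhorn_wt" if "t = 1"
    using Q.sink_sol_sinkhorn_wt Q.sinkhorn_wt_bdd_borel that unfolding M.sink_sol_def Q.sink_sol_def by (simp add: Kr_mixture)
  then show "t = 1 \<Longrightarrow> M.sinkhorn_wt t = Q.sinkhorn_wt" by (rule M.sinkhorn_wt_eqI)
qed

lemma inv_wt_path_0: "inv_wt_path 0 w = Ku L \<mu> \<epsilon> (\<lambda>y. of_real (P.sinkhorn_wt y)) w"
  unfolding inv_wt_path_def mixture_0[OF refl] using P.sinkhorn_wt_bdd_borel by (simp add: Ku_mixture)

lemma inv_wt_path_1: "inv_wt_path 1 w = Ku L \<nu> \<epsilon> (\<lambda>y. of_real (Q.sinkhorn_wt y)) w"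
  unfolding inv_wt_path_def mixture_1[OF refl] using Q.sinkhorn_wt_bdd_borel by (simp add: Ku_mixture)

text \<open>A crude bound, not uniform in \<epsilon>; it serves the continuity of the path in
  t.\<close>

lemma norm_Ku_le_gmax:
  fixes f :: "real ^ 'd \<Rightarrow> complex"
  assumes "torus_measure L \<kappa>" and f: "f \<in> bdd_borel" and I: "im_sq w \<le> I"
  shows "norm (Ku L \<kappa> \<epsilon> f w) \<le> exp (I / (2 * \<epsilon>)) * gmax TYPE('d) L \<epsilon> * (LINT y|\<kappa>. norm (f y))"
proof -
  interpret T: torus_measure L \<kappa> by fact
  have "norm (Ku L \<kappa> \<epsilon> f w) \<le> exp (im_sq w / (2 * \<epsilon>)) * Kr L \<kappa> \<epsilon> (\<lambda>y. norm (f y)) (re_vec w)"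
    by (rule T.norm_Ku_le[OF P.e f])
  also have "\<dots> \<le> exp (I / (2 * \<epsilon>)) * (gmax TYPE('d) L \<epsilon> * (LINT y|\<kappa>. norm (f y)))"
  proof (rule mult_mono)
    show "Kr L \<kappa> \<epsilon> (\<lambda>y. norm (f y)) (re_vec w) \<le> gmax TYPE('d) L \<epsilon> * (LINT y|\<kappa>. norm (f y))"
      by (rule T.Kr_pos(2)[OF P.e bdd_borel_norm[OF f]]) simp
    show "0 \<le> Kr L \<kappa> \<epsilon> (\<lambda>y. norm (f y)) (re_vec w)"
      unfolding Kr_def by (intro integral_nonneg_AE AE_I2 mult_nonneg_nonneg less_imp_le[OF rgauss_per_pos[OF P.L P.e]]) auto
    show "exp (im_sq w / (2 * \<epsilon>)) \<le> exp (I / (2 * \<epsilon>))" using I P.e by (simp add: divide_right_mono)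
  qed simp
  finally show ?thesis by simp
qed

text \<open>Monotonicity bounds the change of the weight in mean square along the path from \<open>\<mu>\<close> to \<open>\<nu>\<close>.\<close>

lemma inv_wt_path_diff_le:
  assumes s: "s \<in> {0..1}" and t: "t \<in> {0..1}" and I: "im_sq w \<le> I"
  shows "norm (inv_wt_path t w - inv_wt_path s w) \<le> exp (I / (2 * \<epsilon>)) * gmax TYPE('d) L \<epsilon> *
     (sqrt (2 * gmax TYPE('d) L \<epsilon> * P.sink_sol_upper ^ 4 * \<bar>t - s\<bar>) + 2 * P.sink_sol_upper * \<bar>t - s\<bar>)"
proof -
  let ?G = "gmax TYPE('d) L \<epsilon>" and ?S = "P.sink_sol_upper"
  define u v where "u = M.sinkhorn_wt t" and "v = M.sinkhorn_wt s"
  have G: "0 < ?G" by (rule gmax_pos[OF P.L])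
  have ub: "u \<in> bdd_borel" "v \<in> bdd_borel" unfolding u_def v_def by (rule M.sinkhorn_wt_bdd_borel)+
  have up: "0 < u x" "0 < v x" for x unfolding u_def v_def by (rule M.sinkhorn_wt_pos)+
  have uC: "u x \<le> ?S" "v x \<le> ?S" for x
    using M.sink_sol_bounds(1)[OF M.sink_sol_sinkhorn_wt order_refl zero_le_one, of t x] M.sink_sol_bounds(1)[OF M.sink_sol_sinkhorn_wt order_refl zero_le_one, of s x]
    unfolding u_def v_def by auto
  have S0: "0 < ?S" using up[of 0] uC[of 0] by linarith
  have K1: "\<bar>Kr L \<kappa> \<epsilon> v x\<bar> \<le> ?G * ?S" if "\<kappa> = \<mu> \<or> \<kappa> = \<nu>" for x \<kappa>
  proof -
    have tm: "torus_prob L \<kappa> \<epsilon>" using that P.torus_prob_axioms Q.torus_prob_axioms by auto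
    interpret T: torus_prob L \<kappa> \<epsilon> by (rule tm)
    have "Kr L \<kappa> \<epsilon> v x \<le> ?G * (LINT y|\<kappa>. v y)"
      by (rule T.Kr_pos(2)[OF P.e ub(2)]) (use up in \<open>auto intro: less_imp_le\<close>)
    also have "(LINT y|\<kappa>. v y) \<le> (LINT y|\<kappa>. ?S)"
      by (rule integral_mono[OF T.integrable_\<mu>[OF ub(2)]]) (use uC in auto)
    finally have "Kr L \<kappa> \<epsilon> v x \<le> ?G * ?S" using G by (simp add: mult_left_mono)
    moreover have "0 \<le> Kr L \<kappa> \<epsilon> v x" by (rule T.Kr_nonneg[OF ub(2)]) (use up in \<open>auto intro: less_imp_le\<close>)
    ultimately show ?thesis by simp
  qed
  \<comment> \<open>The weight v solves the equation of the mixture at s; read against the mixture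
    at t it has the defect r, of order |t - s|.\<close>
  define r where "r x = (t - s) * (Kr L \<nu> \<epsilon> v x - Kr L \<mu> \<epsilon> v x)" for x
  have ts: "Kr L (mixture \<mu> \<nu> t) \<epsilon> v x = Kr L (mixture \<mu> \<nu> s) \<epsilon> v x + r x" for x
    unfolding Kr_mixture[OF t ub(2)] Kr_mixture[OF s ub(2)] r_def by (simp add: algebra_simps)
  have r: "\<bar>r x\<bar> \<le> \<bar>t - s\<bar> * (2 * (?G * ?S))" for x
    unfolding r_def abs_mult
  proof (rule mult_left_mono)
    show "\<bar>Kr L \<nu> \<epsilon> v x - Kr L \<mu> \<epsilon> v x\<bar> \<le> 2 * (?G * ?S)"
      using K1[of \<mu> x, OF disjI1[OF refl]] K1[of \<nu> x, OF disjI2[OF refl]] by linarith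
  qed simp
  have k: "(\<lambda>x. u x - v x) \<in> bdd_borel" by (intro bdd_borel_diff ub)
  have "(LINT x|mixture \<mu> \<nu> t. (u x - v x)\<^sup>2) \<le> ?S\<^sup>2 * (?S * (\<bar>t - s\<bar> * (2 * (?G * ?S))))"
  proof (rule M.mono_identity[OF ub up uC])
    show "Kr L (mixture \<mu> \<nu> t) \<epsilon> u x = 1 / u x - 0" for x unfolding u_def by (simp add: M.Kr_sinkhorn_wt)
    show "Kr L (mixture \<mu> \<nu> t) \<epsilon> v x = 1 / v x - (- r x)" for x unfolding ts by (simp add: M.Kr_sinkhorn_wt v_def)
    show "\<bar>- r x - 0\<bar> \<le> \<bar>t - s\<bar> * (2 * (?G * ?S))" for x using r[of x] by simp
  qed
  then have "(LINT x|mixture \<mu> \<nu> t. \<bar>u x - v x\<bar>)\<^sup>2 \<le> ?S\<^sup>2 * (?S * (\<bar>t - s\<bar> * (2 * (?G * ?S))))"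
    by (rule order_trans[OF M.square_integral_abs_le[OF k]])
  then have L1: "(LINT x|mixture \<mu> \<nu> t. \<bar>u x - v x\<bar>) \<le> sqrt (2 * ?G * ?S ^ 4 * \<bar>t - s\<bar>)"
    by (intro real_le_rsqrt) (simp add: power2_eq_square power4_eq_xxxx mult_ac)
  have ku: "(\<lambda>y. complex_of_real (u y)) \<in> bdd_borel" "(\<lambda>y. complex_of_real (v y)) \<in> bdd_borel" using ub by auto
  \<comment> \<open>Change of the weight under the measure at t, plus change of the measure for the
    weight at s.\<close>
  have "inv_wt_path t w - inv_wt_path s w = Ku L (mixture \<mu> \<nu> t) \<epsilon> (\<lambda>y. of_real (u y) - of_real (v y)) w + of_real (t - s) * (Ku L \<nu> \<epsilon> (\<lambda>y. of_real (v y)) w - Ku L \<mu> \<epsilon> (\<lambda>y. of_real (v y)) w)"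
    unfolding inv_wt_path_def u_def[symmetric] v_def[symmetric] M.Ku_diff[OF P.e ku] Ku_mixture[OF t ku(2)] Ku_mixture[OF s ku(2)]
    by (simp add: algebra_simps)
  also have "norm \<dots> \<le> norm (Ku L (mixture \<mu> \<nu> t) \<epsilon> (\<lambda>y. of_real (u y) - of_real (v y)) w) + \<bar>t - s\<bar> * (norm (Ku L \<nu> \<epsilon> (\<lambda>y. of_real (v y)) w) + norm (Ku L \<mu> \<epsilon> (\<lambda>y. of_real (v y)) w))"
    by (intro norm_triangle_mono order_refl) (simp only: norm_mult norm_of_real mult_left_mono norm_triangle_ineq4 abs_ge_zero)
  also have "norm (Ku L (mixture \<mu> \<nu> t) \<epsilon> (\<lambda>y. of_real (u y) - of_real (v y)) w) \<le> exp (I / (2 * \<epsilon>)) * ?G * sqrt (2 * ?G * ?S ^ 4 * \<bar>t - s\<bar>)"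
  proof -
    have "(\<lambda>y. complex_of_real (u y) - of_real (v y)) \<in> bdd_borel" by (intro bdd_borel_diff ku)
    from norm_Ku_le_gmax[OF M.torus_measure_axioms this I, of t]
    have "norm (Ku L (mixture \<mu> \<nu> t) \<epsilon> (\<lambda>y. of_real (u y) - of_real (v y)) w) \<le> exp (I / (2 * \<epsilon>)) * ?G * (LINT x|mixture \<mu> \<nu> t. \<bar>u x - v x\<bar>)"
      by (simp only: of_real_diff[symmetric] norm_of_real)
    also have "\<dots> \<le> exp (I / (2 * \<epsilon>)) * ?G * sqrt (2 * ?G * ?S ^ 4 * \<bar>t - s\<bar>)"
      using G by (intro mult_left_mono L1) auto
    finally show ?thesis .
  qed
  also have "norm (Ku L \<nu> \<epsilon> (\<lambda>y. of_real (v y)) w) + norm (Ku L \<mu> \<epsilon> (\<lambda>y. of_real (v y)) w) \<le> 2 * (exp (I / (2 * \<epsilon>)) * ?G * ?S)"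
  proof -
    have "norm (Ku L \<kappa> \<epsilon> (\<lambda>y. of_real (v y)) w) \<le> exp (I / (2 * \<epsilon>)) * ?G * ?S" if "torus_prob L \<kappa> \<epsilon>" for \<kappa>
    proof -
      interpret T: torus_prob L \<kappa> \<epsilon> by (rule that)
      have "(LINT y|\<kappa>. norm (complex_of_real (v y))) \<le> (LINT y|\<kappa>. ?S)"
        using uC up by (intro integral_mono integrable_norm T.integrable_\<mu> ku bdd_borel_const) (auto simp: abs_of_pos)
      then have "exp (I / (2 * \<epsilon>)) * ?G * (LINT y|\<kappa>. norm (complex_of_real (v y))) \<le> exp (I / (2 * \<epsilon>)) * ?G * ?S"
        using G by (intro mult_left_mono) auto
      with norm_Ku_le_gmax[OF T.torus_measure_axioms ku(2) I] show ?thesis by linarith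
    qed
    from this[OF P.torus_prob_axioms] this[OF Q.torus_prob_axioms] show ?thesis by linarith
  qed
  finally show ?thesis by (simp add: algebra_simps mult_right_mono)
qed

end

section \<open>Uniqueness of Fourier coefficients\<close>

definition fourier_mode :: "real \<Rightarrow> int ^ 'd::finite \<Rightarrow> real ^ 'd \<Rightarrow> complex" where
  "fourier_mode L k y = exp (- (2 * of_real pi * \<i> / of_real L) * (\<Sum>l\<in>UNIV. of_int (k $ l) * of_real (y $ l)))"

lemma fourier_mode_add: "fourier_mode L k (x + y) = fourier_mode L k x * fourier_mode L k y"
  by (simp add: fourier_mode_def exp_add[symmetric] algebra_simps sum.distrib)

lemma fourier_mode_index_add: "fourier_mode L (j + k) x = fourier_mode L j x * fourier_mode L k x"
  by (simp add: fourier_mode_def exp_add[symmetric] algebra_simps sum.distrib)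

lemma fourier_mode_conv: "fourier_mode L k y = exp (\<i> * (\<Sum>l\<in>UNIV. of_real (- (2 * pi / L) * of_int (k $ l) * (y $ l))))"
  unfolding fourier_mode_def by (rule arg_cong[where f=exp]) (simp add: sum_distrib_left mult_ac)

lemma norm_fourier_mode [simp]: "norm (fourier_mode L k y) = 1"
  unfolding fourier_mode_conv of_real_sum[symmetric] by (simp add: norm_exp_i_times)

lemma continuous_fourier_mode: "continuous_on A (fourier_mode L k)"
  unfolding fourier_mode_def[abs_def] by (intro continuous_intros)

lemma fourier_mode_bdd_borel [simp]: "fourier_mode L k \<in> bdd_borel"
  by (rule bmI[where B=1]) (auto intro: borel_measurable_continuous_onI continuous_fourier_mode)

lemma fourier_mode_latt:
  assumes L: "0 < L"
  shows "fourier_mode L k (latt L j) = 1"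
proof -
  have eq: "- (2 * of_real pi * \<i> / of_real L) * (\<Sum>l\<in>UNIV. of_int (k $ l) * complex_of_real (latt L j $ l))
     = \<i> * (of_int (- (\<Sum>l\<in>UNIV. k $ l * j $ l)) * (of_real pi * 2))"
    using L by (simp add: sum_distrib_left sum_distrib_right mult_ac sum_negf)
  show ?thesis
    unfolding fourier_mode_def eq by (rule exp_2pi_1_int)
qed

lemma fourier_mode_periodic: "0 < L \<Longrightarrow> periodic L (fourier_mode L k)"
  by (simp add: periodic_def fourier_mode_add fourier_mode_latt)

lemma fourier_coeff_cell_measure:
  assumes "f \<in> borel_measurable borel"
  shows "fourier_coeff L f k = of_real (1 / L ^ CARD('d)) * (LINT y|cell_measure L. f (y :: real ^ 'd::finite) * fourier_mode L k y)"
  unfolding fourier_coeff_def fourier_mode_def[symmetric]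
  using assms borel_measurable_continuous_onI[OF continuous_fourier_mode[of UNIV L k]] by (subst integral_cell_measure) auto

text \<open>The translated cell is another fundamental domain: unfolding f cut off to it gives back
  f.\<close>

lemma integral_cell_measure_translate:
  fixes f :: "real ^ 'd::finite \<Rightarrow> 'b::{banach,second_countable_topology}"
  assumes L: "0 < L" and f: "f \<in> bdd_borel" and per: "periodic L f"
  shows "(LINT x|cell_measure L. f (x + y)) = (LINT x|cell_measure L. f x)"
proof -
  have [measurable]: "f \<in> borel_measurable borel" by (rule bdd_borel_measurable[OF f])
  obtain B where B: "\<And>x. norm (f x) \<le> B" using bmE[OF f] by metis
  \<comment> \<open>For every x exactly one lattice translate meets the support of F, so the lattice
    sum below has a single term, equal to \<open>f x\<close>.\<close>
  define F where "F x = indicator (cell L) (x - y) *\<^sub>R f x" for x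
  have [measurable]: "F \<in> borel_measurable borel" unfolding F_def[abs_def] by measurable
  have i0: "integrable lborel (\<lambda>x. indicator (cell L) x *\<^sub>R f (x + y))"
    by (rule integrableI_bounded_set_indicator[where B=B]) (use B L in \<open>auto simp: emeasure_cell\<close>)
  have iF: "integrable lborel F"
    using integrable_lborel_translate[OF i0, of "- y"] by (simp add: F_def[abs_def])
  have F_latt: "F (x + latt L j) = (if j = - cell_index L (x - y) then f x else 0)" for x j
  proof -
    have "x + latt L j - y \<in> cell L \<longleftrightarrow> - j = cell_index L (x - y)"
      using cell_index_iff[OF L, of "x - y" "- j"] by (simp add: latt_uminus algebra_simps)
    then have "x + latt L j - y \<in> cell L \<longleftrightarrow> j = - cell_index L (x - y)" by (metis minus_minus)
    then show ?thesis using per by (auto simp: F_def periodic_def indicator_def)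
  qed
  have s: "(\<lambda>j. norm (F (x + latt L j))) summable_on UNIV" for x
  proof -
    have "(\<lambda>j. norm (F (x + latt L j))) summable_on {- cell_index L (x - y)}" by simp
    then show ?thesis
      by (subst summable_on_cong_neutral[where T="{- cell_index L (x - y)}"]) (auto simp: F_latt)
  qed
  have "(LINT x|cell_measure L. f (x + y)) = (LINT x|lborel. indicator (cell L) x *\<^sub>R f (x + y))"
    by (subst integral_cell_measure) (auto simp: set_lebesgue_integral_def)
  also have "\<dots> = (LINT x|lborel. F (y + x))"
    by (simp add: F_def add.commute)
  also have "\<dots> = (LINT x|lborel. F x)" by (rule integral_lborel_translate) measurable
  also have "\<dots> = (LINT x|cell_measure L. (\<Sum>\<^sub>\<infinity>j. F (x + latt L j)))" by (rule integral_unfold[OF L iF s])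
  also have "\<dots> = (LINT x|cell_measure L. f x)"
  proof (intro Bochner_Integration.integral_cong refl)
    fix x
    have "(\<Sum>\<^sub>\<infinity>j. F (x + latt L j)) = (\<Sum>\<^sub>\<infinity>j\<in>{- cell_index L (x - y)}. F (x + latt L j))"
      by (rule infsum_cong_neutral) (auto simp: F_latt)
    then show "(\<Sum>\<^sub>\<infinity>j. F (x + latt L j)) = f x" by (simp add: F_latt)
  qed
  finally show ?thesis .
qed

text \<open>A trigonometric polynomial with values in \<open>[0, 1]\<close> that is \<open>1\<close> at lattice points only; its normalised powers are an approximate identity.\<close>

definition peak :: "real \<Rightarrow> real ^ 'd::finite \<Rightarrow> real" where
  "peak L x = (\<Prod>k\<in>UNIV. (1 + cos (2 * pi * x $ k / L)) / 2)"

lemma peak_range: "0 \<le> peak L x" "peak L x \<le> 1"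
proof -
  have "0 \<le> (1 + cos t) / 2" for t :: real using add_left_mono[OF cos_ge_minus_one[of t], of 1] by simp
  moreover have "(1 + cos t) / 2 \<le> 1" for t :: real using add_left_mono[OF cos_le_one[of t], of 1] by simp
  ultimately show "0 \<le> peak L x" "peak L x \<le> 1"
    unfolding peak_def by (auto intro!: prod_nonneg prod_le_1)
qed

lemma continuous_peak:
  fixes f :: "'a::t2_space \<Rightarrow> real ^ 'd::finite"
  shows "continuous_on A f \<Longrightarrow> continuous_on A (\<lambda>x. peak L (f x))"
  unfolding peak_def divide_inverse by (intro continuous_intros)

lemma measurable_peak [measurable]: "peak L \<in> borel_measurable borel"
  by (intro borel_measurable_continuous_onI continuous_peak continuous_on_id)

lemma peak_0 [simp]: "peak L 0 = 1"
  by (simp add: peak_def)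

lemma peak_less_1:
  fixes x :: "real ^ 'd::finite"
  assumes L: "0 < L" and k: "x $ k \<noteq> 0" "\<bar>x $ k\<bar> < L"
  shows "peak L x < 1"
proof -
  let ?c = "\<lambda>k. (1 + cos (2 * pi * x $ k / L)) / 2"
  have r: "0 \<le> ?c l" for l using add_left_mono[OF cos_ge_minus_one[of "2 * pi * x $ l / L"], of 1] by simp
  have r': "?c l \<le> 1" for l using add_left_mono[OF cos_le_one[of "2 * pi * x $ l / L"], of 1] by simp
  have "cos (2 * pi * x $ k / L) \<noteq> 1"
  proof
    assume "cos (2 * pi * x $ k / L) = 1"
    then obtain n :: int where "2 * pi * x $ k / L = of_int n * 2 * pi"
      using cos_one_2pi_int by blast
    then have xk: "x $ k = of_int n * L" using L by (simp add: field_simps)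
    with k L have "\<bar>real_of_int n\<bar> < 1" by (simp add: abs_mult)
    then have "n = 0" by linarith
    with xk k show False by simp
  qed
  then have "?c k < 1" by (simp add: less_le)
  have "peak L x = ?c k * (\<Prod>l\<in>UNIV - {k}. ?c l)"
    unfolding peak_def by (rule prod.remove) auto
  also have "\<dots> \<le> ?c k * 1"
    using r r' by (intro mult_left_mono prod_le_1) auto
  finally show ?thesis using \<open>?c k < 1\<close> by simp
qed

lemma peak_periodic: "0 < L \<Longrightarrow> periodic L (peak L)"
proof -
  assume L: "0 < L"
  have "cos (2 * pi * (t + L * real_of_int n) / L) = cos (2 * pi * t / L)" for t n
  proof -
    have "2 * pi * (t + L * real_of_int n) / L = 2 * pi * t / L + 2 * pi * real_of_int n"
      using L by (simp add: field_simps)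
    then show ?thesis by (simp add: cos_add cos_int_2pin sin_int_2pin)
  qed
  then show ?thesis by (simp add: periodic_def peak_def)
qed

lemma peak_bdd_borel: "f \<in> borel_measurable borel \<Longrightarrow> (\<lambda>x. peak L (f x) ^ N) \<in> bdd_borel"
  by (intro bmI[where B=1]) (auto simp: power_le_one peak_range)

definition peak_mass :: "'d::finite itself \<Rightarrow> real \<Rightarrow> nat \<Rightarrow> real" where
  "peak_mass _ L N = (LINT x|cell_measure L. peak L (x :: real ^ 'd) ^ N)"

lemma peak_mass_translate:
  assumes L: "0 < L"
  shows "(LINT x|cell_measure L. peak L (x - y :: real ^ 'd) ^ N) = peak_mass TYPE('d::finite) L N"
proof -
  have "periodic L (\<lambda>x::real^'d. peak L x ^ N)" by (simp add: periodic_def peak_periodic[OF L, unfolded periodic_def, rule_format])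
  from integral_cell_measure_translate[OF L _ this, of "- y"] show ?thesis
    by (simp add: peak_mass_def peak_bdd_borel)
qed

text \<open>Laplace's method. For y interior to the cell, x - y has all coordinates below L in
  absolute value when x is in the closed cell, so by \<open>peak_less_1\<close> the kernel is 1 at y
  only.\<close>

lemma peak_peak:
  fixes h :: "real ^ 'd::finite \<Rightarrow> 'b::{banach,second_countable_topology}"
  assumes L: "0 < L" and y: "\<And>k. 0 < y $ k \<and> y $ k < L"
    and h: "continuous_on UNIV h" and B: "\<And>x. norm (h x) \<le> B"
  shows "(\<lambda>N. (1 / peak_mass TYPE('d) L N) *\<^sub>R (LINT x|cell_measure L. peak L (x - y) ^ N *\<^sub>R h x)) \<longlonglongrightarrow> h y"
proof (rule LIMSEQ_I)
  interpret C: finite_measure "cell_measure L :: (real^'d) measure" by (rule finite_measure_cell_measure[OF L])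
  fix \<eta> :: real assume \<eta>: "0 < \<eta>"
  let ?m = "peak_mass TYPE('d) L"
  have B0: "0 \<le> B" using B[of 0] norm_ge_zero order_trans by blast
  have hm [measurable]: "h \<in> borel_measurable borel" by (rule borel_measurable_continuous_onI[OF h])
  from h have "isCont h y" by (simp add: continuous_on_eq_continuous_at)
  then obtain r where r: "0 < r" "\<And>x. dist x y < r \<Longrightarrow> dist (h x) (h y) < \<eta> / 2"
    using \<eta> unfolding continuous_at by (metis (no_types, lifting) \<eta> continuous_at_eps_delta half_gt_zero \<open>isCont h y\<close>)
  \<comment> \<open>The closed cell is taken so that the supremum of the kernel away from y is
    attained and hence less than 1.\<close>
  define K where "K = cbox 0 (\<chi> k. L) \<inter> {x. r \<le> dist x y}"
  have "compact K" unfolding K_def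
    by (intro compact_Int_closed compact_cbox closed_Collect_le continuous_intros)
  have Klt: "peak L (x - y) < 1" if x: "x \<in> K" for x
  proof -
    have "x \<noteq> y" using x r(1) by (auto simp: K_def)
    then obtain k where k: "x $ k \<noteq> y $ k" by (auto simp: vec_eq_iff)
    have "0 \<le> x $ k" "x $ k \<le> L" using x by (auto simp: K_def mem_box_cart)
    with y[of k] k show ?thesis by (intro peak_less_1[OF L, of _ k]) auto
  qed
  obtain q where q: "0 \<le> q" "q < 1" "\<And>x. x \<in> K \<Longrightarrow> peak L (x - y) \<le> q"
  proof (cases "K = {}")
    case True then show ?thesis using that[of 0] by auto
  next
    case False
    have "continuous_on K (\<lambda>x. peak L (x - y))" by (intro continuous_peak continuous_intros)
    from continuous_attains_sup[OF \<open>compact K\<close> False this] obtain z where "z \<in> K" "\<And>x. x \<in> K \<Longrightarrow> peak L (x - y) \<le> peak L (z - y)" by auto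
    then show ?thesis using that[of "peak L (z - y)"] peak_range Klt by auto
  qed
  \<comment> \<open>A level strictly between q and 1. The kernel exceeds it on an open set V around
    y, so the mass is at least \<open>q' ^ N * v\<close>, while on K the N-th power is at most
    \<open>q ^ N\<close>; the ratio decays geometrically.\<close>
  define q' where "q' = (1 + q) / 2"
  have q': "q < q'" "q' < 1" "0 < q'" using q by (auto simp: q'_def)
  define V where "V = {x. q' < peak L (x - y)} \<inter> box 0 (\<chi> k. L)"
  have V: "open V" unfolding V_def
    by (intro open_Int open_box open_Collect_less continuous_intros continuous_peak)
  moreover have "y \<in> V" using y q' by (simp add: V_def mem_box_cart)
  ultimately have "\<not> negligible V" by (intro open_not_negligible) auto
  then have "emeasure lborel V \<noteq> 0"
    using V by (auto simp: negligible_iff_null_sets null_sets_completion_iff null_sets_def)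
  moreover have "V \<subseteq> cell L" by (auto simp: V_def cell_def mem_box_cart less_imp_le)
  ultimately have "emeasure (cell_measure L) V \<noteq> 0"
    unfolding cell_measure_def using V by (subst emeasure_density) (auto simp: indicator_inter_arith[symmetric] Int_absorb1 Int_absorb2)
  define v where "v = measure (cell_measure L) V"
  have v: "0 < v" unfolding v_def using \<open>emeasure (cell_measure L) V \<noteq> 0\<close> C.emeasure_eq_measure[of V]
    by (auto simp: zero_less_measure_iff)
  have Vs: "V \<in> sets (cell_measure L)" using V by simp
  have km: "(\<lambda>x. peak L (x - y) ^ N) \<in> bdd_borel" for N by (rule peak_bdd_borel) simp
  note ki = integrable_bdd_borel[OF finite_measure_cell_measure[OF L] sets_cell_measure km]
  have mge: "q' ^ N * v \<le> ?m N" for N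
  proof -
    have "q' ^ N * v = (LINT x|cell_measure L. q' ^ N * indicator V x)" using Vs by (simp add: v_def)
    also have "\<dots> \<le> (LINT x|cell_measure L. peak L (x - y) ^ N)"
    proof (rule integral_mono)
      show "integrable (cell_measure L) (\<lambda>x. q' ^ N * indicator V x)"
        using Vs by (intro integrable_mult_right integrable_real_indicator) (auto simp: C.emeasure_eq_measure)
      show "q' ^ N * indicator V x \<le> peak L (x - y) ^ N" for x
        using q' by (cases "x \<in> V") (auto simp: V_def peak_range intro!: power_mono)
    qed (rule ki)
    finally show ?thesis by (simp add: peak_mass_translate[OF L])
  qed
  have mpos: "0 < ?m N" for N using mge[of N] q' v by (meson less_le_trans mult_pos_pos zero_less_power)
  have hi: "integrable (cell_measure L) (\<lambda>x. peak L (x - y) ^ N *\<^sub>R h x)" for N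
  proof (rule C.integrable_const_bound[where B=B])
    have "peak L (x - y) ^ N * norm (h x) \<le> 1 * B" for x
      by (rule mult_mono) (use B in \<open>auto simp: peak_range intro: power_le_one\<close>)
    then show "AE x in cell_measure L. norm (peak L (x - y) ^ N *\<^sub>R h x) \<le> B"
      by (intro AE_I2) (simp add: peak_range)
  qed simp
  have est: "norm ((1 / ?m N) *\<^sub>R (LINT x|cell_measure L. peak L (x - y) ^ N *\<^sub>R h x) - h y) \<le> \<eta> / 2 + 2 * B * L ^ CARD('d) / v * (q / q') ^ N" for N
  proof -
    have "(1 / ?m N) *\<^sub>R (LINT x|cell_measure L. peak L (x - y) ^ N *\<^sub>R h x) - h y
       = (1 / ?m N) *\<^sub>R ((LINT x|cell_measure L. peak L (x - y) ^ N *\<^sub>R h x) - (LINT x|cell_measure L. peak L (x - y) ^ N) *\<^sub>R h y)"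
      using mpos[of N] by (simp add: scaleR_diff_right peak_mass_translate[OF L])
    also have "(LINT x|cell_measure L. peak L (x - y) ^ N *\<^sub>R h x) - (LINT x|cell_measure L. peak L (x - y) ^ N) *\<^sub>R h y
       = (LINT x|cell_measure L. peak L (x - y) ^ N *\<^sub>R (h x - h y))"
      using hi[of N] ki[of N] by (simp add: scaleR_diff_right)
    finally have "norm ((1 / ?m N) *\<^sub>R (LINT x|cell_measure L. peak L (x - y) ^ N *\<^sub>R h x) - h y) = (1 / ?m N) * norm (LINT x|cell_measure L. peak L (x - y) ^ N *\<^sub>R (h x - h y))"
      using mpos[of N] by simp
    also have "\<dots> \<le> (1 / ?m N) * (LINT x|cell_measure L. \<eta> / 2 * peak L (x - y) ^ N + 2 * B * q ^ N)"
    proof (rule mult_left_mono)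
      have "norm (LINT x|cell_measure L. peak L (x - y) ^ N *\<^sub>R (h x - h y)) \<le> (LINT x|cell_measure L. norm (peak L (x - y) ^ N *\<^sub>R (h x - h y)))"
        by (rule integral_norm_bound)
      also have "\<dots> \<le> (LINT x|cell_measure L. \<eta> / 2 * peak L (x - y) ^ N + 2 * B * q ^ N)"
      proof (rule integral_mono_AE)
        show "integrable (cell_measure L) (\<lambda>x. norm (peak L (x - y) ^ N *\<^sub>R (h x - h y)))"
          using hi[of N] ki[of N] by (simp add: scaleR_diff_right)
        show "AE x in cell_measure L. norm (peak L (x - y) ^ N *\<^sub>R (h x - h y)) \<le> \<eta> / 2 * peak L (x - y) ^ N + 2 * B * q ^ N"
          using AE_cell_measure_cell
        proof eventually_elim
          case (elim x)
          have k0: "0 \<le> peak L (x - y) ^ N" by (simp add: peak_range)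
          show ?case
          proof (cases "dist x y < r")
            case True
            then have "norm (h x - h y) \<le> \<eta> / 2" using r(2)[of x] by (simp add: dist_norm)
            then have "peak L (x - y) ^ N * norm (h x - h y) \<le> peak L (x - y) ^ N * (\<eta> / 2)" using k0 by (rule mult_left_mono)
            moreover have "0 \<le> 2 * B * q ^ N" using B0 q by simp
            ultimately show ?thesis using k0 peak_range(1)[of L "x - y"] by (simp add: mult_ac)
          next
            case False
            with elim have "x \<in> K" by (auto simp: K_def cell_def mem_box_cart less_imp_le)
            then have "peak L (x - y) ^ N \<le> q ^ N" using q(3) peak_range by (intro power_mono) auto
            moreover have "norm (h x - h y) \<le> 2 * B" using norm_triangle_ineq4[of "h x" "h y"] B[of x] B[of y] by linarith
            ultimately have "peak L (x - y) ^ N * norm (h x - h y) \<le> q ^ N * (2 * B)" using q(1) by (intro mult_mono) auto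
            moreover have "0 \<le> \<eta> / 2 * peak L (x - y) ^ N" using \<eta> k0 by simp
            ultimately show ?thesis using peak_range(1)[of L "x - y"] by (simp add: mult_ac)
          qed
        qed
      qed (use ki in auto)
      finally show "norm (LINT x|cell_measure L. peak L (x - y) ^ N *\<^sub>R (h x - h y)) \<le> (LINT x|cell_measure L. \<eta> / 2 * peak L (x - y) ^ N + 2 * B * q ^ N)" .
    qed (use mpos[of N] in simp)
    also have "(LINT x|cell_measure L. \<eta> / 2 * peak L (x - y) ^ N + 2 * B * q ^ N) = \<eta> / 2 * ?m N + 2 * B * q ^ N * L ^ CARD('d)"
      using ki[of N] by (simp add: peak_mass_translate[OF L] measure_cell_measure[OF L])
    also have "(1 / ?m N) * \<dots> = \<eta> / 2 + 2 * B * q ^ N * L ^ CARD('d) / ?m N"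
      using mpos[of N] by (simp add: field_simps)
    also have "2 * B * q ^ N * L ^ CARD('d) / ?m N \<le> 2 * B * q ^ N * L ^ CARD('d) / (q' ^ N * v)"
      using mge[of N] q' v B0 q L by (intro divide_left_mono mult_pos_pos mult_nonneg_nonneg) (auto intro: mpos)
    also have "\<dots> = 2 * B * L ^ CARD('d) / v * (q / q') ^ N" by (simp add: power_divide field_simps)
    finally show ?thesis by simp
  qed
  have "(\<lambda>N. 2 * B * L ^ CARD('d) / v * (q / q') ^ N) \<longlonglongrightarrow> 2 * B * L ^ CARD('d) / v * 0"
    using q q' by (intro tendsto_intros LIMSEQ_realpow_zero) auto
  then obtain N0 where N0: "\<And>N. N0 \<le> N \<Longrightarrow> norm (2 * B * L ^ CARD('d) / v * (q / q') ^ N) < \<eta> / 2"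
    using LIMSEQ_D[of _ 0 "\<eta> / 2"] \<eta> by (metis diff_zero half_gt_zero mult_zero_right)
  show "\<exists>no. \<forall>n\<ge>no. norm ((1 / ?m n) *\<^sub>R (LINT x|cell_measure L. peak L (x - y) ^ n *\<^sub>R h x) - h y) < \<eta>"
  proof (intro exI[of _ N0] allI impI)
    fix N assume "N0 \<le> N"
    from N0[OF this] have "2 * B * L ^ CARD('d) / v * (q / q') ^ N < \<eta> / 2"
      unfolding real_norm_def by linarith
    then show "norm ((1 / ?m N) *\<^sub>R (LINT x|cell_measure L. peak L (x - y) ^ N *\<^sub>R h x) - h y) < \<eta>"
      using est[of N] by linarith
  qed
qed

text \<open>Quantifying over all modes makes the property stable under multiplication of p by a
  mode, so it reaches the powers of \<open>peak\<close> factor by factor.\<close>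

definition annihilates :: "real \<Rightarrow> (real ^ 'd::finite \<Rightarrow> complex) \<Rightarrow> (real ^ 'd \<Rightarrow> complex) \<Rightarrow> bool" where
  "annihilates L f p \<longleftrightarrow> p \<in> bdd_borel \<and> (\<forall>m. (LINT y|cell_measure L. f y * fourier_mode L m y * p y) = 0)"

lemma annihilates_trig:
  fixes f p :: "real ^ 'd::finite \<Rightarrow> complex"
  assumes L: "0 < L" and f: "f \<in> bdd_borel" and p: "annihilates L f p"
  shows "annihilates L f (\<lambda>y. (c0 + c1 * fourier_mode L j y + c2 * fourier_mode L k y) * p y)"
proof -
  have pb: "p \<in> bdd_borel" and z: "\<And>m. (LINT y|cell_measure L. f y * fourier_mode L m y * p y) = 0"
    using p by (auto simp: annihilates_def)
  have i: "integrable (cell_measure L) (\<lambda>y. f y * fourier_mode L m y * p y)" for m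
    by (intro integrable_bdd_borel[OF finite_measure_cell_measure[OF L] sets_cell_measure] bdd_borel_mult f pb fourier_mode_bdd_borel)
  have "(LINT y|cell_measure L. f y * fourier_mode L m y * ((c0 + c1 * fourier_mode L j y + c2 * fourier_mode L k y) * p y)) = 0" for m
  proof -
    have "(\<lambda>y. f y * fourier_mode L m y * ((c0 + c1 * fourier_mode L j y + c2 * fourier_mode L k y) * p y)) =
       (\<lambda>y. c0 * (f y * fourier_mode L m y * p y) + c1 * (f y * fourier_mode L (m + j) y * p y) + c2 * (f y * fourier_mode L (m + k) y * p y))"
      by (simp add: fun_eq_iff fourier_mode_index_add algebra_simps)
    then show ?thesis
      using i by (simp add: z)
  qed
  moreover have "(\<lambda>y. (c0 + c1 * fourier_mode L j y + c2 * fourier_mode L k y) * p y) \<in> bdd_borel"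
    by (intro bdd_borel_mult bdd_borel_add bdd_borel_cmult bdd_borel_const fourier_mode_bdd_borel pb)
  ultimately show ?thesis by (simp add: annihilates_def)
qed

lemma fourier_mode_axis: "fourier_mode L (axis l a) y = exp (- (2 * of_real pi * \<i> / of_real L) * (of_int a * of_real (y $ l)))"
proof -
  have "(\<Sum>m\<in>UNIV. complex_of_int (axis l a $ m) * of_real (y $ m)) = (\<Sum>m\<in>UNIV. if m = l then of_int a * of_real (y $ l) else 0)"
    by (intro sum.cong refl) (auto simp: axis_def)
  then show ?thesis by (simp add: fourier_mode_def)
qed

text \<open>Euler's formula: as a function of y each factor is a combination of a constant and two
  modes, the form that \<open>annihilates_trig\<close> handles.\<close>

lemma peak_factor:
  fixes x y :: "real ^ 'd::finite"
  shows "complex_of_real ((1 + cos (2 * pi * (x - y) $ l / L)) / 2) = 1 / 2 + (exp (2 * of_real pi * \<i> / of_real L * of_real (x $ l)) / 4) * fourier_mode L (axis l 1) y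
      + (exp (- (2 * of_real pi * \<i> / of_real L * of_real (x $ l))) / 4) * fourier_mode L (axis l (- 1)) y"
proof -
  define \<theta> where "\<theta> = 2 * pi * (x - y) $ l / L"
  have a: "exp (2 * of_real pi * \<i> / of_real L * of_real (x $ l)) * fourier_mode L (axis l 1) y = exp (\<i> * of_real \<theta>)"
    unfolding fourier_mode_axis exp_add[symmetric] \<theta>_def
    by (rule arg_cong[where f=exp]) (simp add: algebra_simps diff_divide_distrib)
  have b: "exp (- (2 * of_real pi * \<i> / of_real L * of_real (x $ l))) * fourier_mode L (axis l (- 1)) y = exp (- (\<i> * of_real \<theta>))"
    unfolding fourier_mode_axis exp_add[symmetric] \<theta>_def
    by (rule arg_cong[where f=exp]) (simp add: algebra_simps diff_divide_distrib)
  have "complex_of_real (cos \<theta>) = (exp (\<i> * of_real \<theta>) + exp (- (\<i> * of_real \<theta>))) / 2"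
    by (simp add: cos_exp_eq flip: cos_of_real)
  then have c: "complex_of_real ((1 + cos \<theta>) / 2) = 1 / 2 + exp (\<i> * of_real \<theta>) / 4 + exp (- (\<i> * of_real \<theta>)) / 4"
    by (simp add: add_divide_distrib)
  have d: "(z / 4) * z' = (z * z') / 4" for z z' :: complex by simp
  show ?thesis
    unfolding \<theta>_def[symmetric] d a b by (rule c)
qed

lemma annihilates_peak:
  fixes f :: "real ^ 'd::finite \<Rightarrow> complex"
  assumes L: "0 < L" and f: "f \<in> bdd_borel" and z: "\<And>m. (LINT y|cell_measure L. f y * fourier_mode L m y) = 0"
  shows "(LINT y|cell_measure L. f y * of_real (peak L (x - y) ^ N)) = 0"
proof -
  let ?F = "\<lambda>l y. complex_of_real ((1 + cos (2 * pi * (x - y) $ l / L)) / 2)"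
  have prod: "annihilates L f (\<lambda>y. (\<Prod>l\<in>S. ?F l y) * p y)" if "annihilates L f p" for S p
  proof (induction S rule: infinite_finite_induct)
    case (insert l S)
    then show ?case
      using annihilates_trig[OF L f insert.IH, of "1 / 2" "exp (2 * of_real pi * \<i> / of_real L * of_real (x $ l)) / 4" "axis l 1"
        "exp (- (2 * of_real pi * \<i> / of_real L * of_real (x $ l))) / 4" "axis l (- 1)"]
      unfolding peak_factor[symmetric] by (simp add: mult.assoc del: of_real_add of_real_divide)
  qed (use that in auto)
  have "annihilates L f (\<lambda>y. (\<Prod>l\<in>UNIV. ?F l y) ^ N)"
  proof (induction N)
    case 0 then show ?case using z by (simp add: annihilates_def)
  next
    case (Suc N) from prod[OF this, of UNIV] show ?case by simp
  qed
  then have "(LINT y|cell_measure L. f y * fourier_mode L 0 y * (\<Prod>l\<in>UNIV. ?F l y) ^ N) = 0" by (simp add: annihilates_def)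
  then show ?thesis by (simp add: fourier_mode_def peak_def)
qed

lemma AE_cmI:
  assumes "AE y in lborel. P y"
  shows "AE y in cell_measure L. P y"
proof -
  have "AE y in lborel. 0 < (indicator (cell L) y :: ennreal) \<longrightarrow> P y"
    using assms by eventually_elim simp
  then show ?thesis unfolding cell_measure_def by (subst AE_density) auto
qed

text \<open>The faces of the half-open cell lie in finitely many hyperplanes. Interior points are
  those at which \<open>peak_peak\<close> applies.\<close>

lemma AE_cell_measure_interior:
  assumes L: "0 < L"
  shows "AE y in cell_measure L. \<forall>k. 0 < y $ k \<and> y $ k < (L :: real)"
proof -
  have "AE y in (lborel :: (real ^ 'a) measure). y $ k \<noteq> 0" for k :: 'a
  proof -
    have "{y :: real ^ 'a. y $ k = 0} \<in> null_sets lborel"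
      using negligible_standard_hyperplane_cart[where k=k and 'a='a]
      by (subst (asm) negligible_iff_null_sets, subst (asm) null_sets_completion_iff)
        (auto intro!: borel_closed closed_Collect_eq continuous_intros)
    then show ?thesis by (auto intro: AE_I'[of "{y. y $ k = 0}"])
  qed
  then have "AE y in (lborel :: (real ^ 'a) measure). \<forall>k. y $ k \<noteq> 0" by (simp add: AE_all_countable)
  then have "AE y in (cell_measure L :: (real ^ 'a) measure). \<forall>k. y $ k \<noteq> 0"
    by (rule AE_cmI)
  with AE_cell_measure_cell show ?thesis
    by eventually_elim (auto simp: cell_def order.strict_iff_order)
qed

text \<open>Smoothing h by powers of \<open>peak\<close> gives, after Fubini, integrals of f against
  trigonometric polynomials, which vanish; the smoothed functions converge to h at interior points
  and stay bounded by B.\<close>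

lemma fourier_test:
  fixes f h :: "real ^ 'd::finite \<Rightarrow> complex"
  assumes L: "0 < L" and f: "f \<in> bdd_borel" and z: "\<And>m. (LINT y|cell_measure L. f y * fourier_mode L m y) = 0"
    and h: "continuous_on UNIV h" and hB: "\<And>x. norm (h x) \<le> B"
  shows "(LINT y|cell_measure L. f y * h y) = 0"
proof -
  interpret C: finite_measure "cell_measure L :: (real^'d) measure" by (rule finite_measure_cell_measure[OF L])
  interpret P: pair_sigma_finite "cell_measure L :: (real^'d) measure" "cell_measure L :: (real^'d) measure" ..
  have [measurable]: "f \<in> borel_measurable borel" by (rule bdd_borel_measurable[OF f])
  have [measurable]: "h \<in> borel_measurable borel" by (rule borel_measurable_continuous_onI[OF h])
  obtain A where A: "\<And>y. norm (f y) \<le> A" using bmE[OF f] by metis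
  have A0: "0 \<le> A" and B0: "0 \<le> B" using A[of 0] hB[of 0] norm_ge_zero order_trans by blast+
  let ?m = "peak_mass TYPE('d) L"
  define T where "T N y = (1 / ?m N) *\<^sub>R (LINT x|cell_measure L. peak L (x - y) ^ N *\<^sub>R h x)" for N y
  have hi: "integrable (cell_measure L) (\<lambda>x. peak L (x - y) ^ N *\<^sub>R h x)" for N y
  proof (rule C.integrable_const_bound[where B=B])
    have "peak L (x - y) ^ N * norm (h x) \<le> 1 * B" for x
      by (rule mult_mono) (use hB in \<open>auto simp: peak_range intro: power_le_one\<close>)
    then show "AE x in cell_measure L. norm (peak L (x - y) ^ N *\<^sub>R h x) \<le> B"
      by (intro AE_I2) (simp add: peak_range)
  qed simp
  have ki: "integrable (cell_measure L) (\<lambda>x. peak L (x - y) ^ N)" for N y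
    by (rule integrable_bdd_borel[OF finite_measure_cell_measure[OF L] sets_cell_measure peak_bdd_borel]) simp
  have m0: "0 \<le> ?m N" for N unfolding peak_mass_def by (intro integral_nonneg_AE AE_I2) (simp add: peak_range)
  have TB: "norm (T N y) \<le> B" for N y
  proof (cases "?m N = 0")
    \<comment> \<open>Here division by zero makes \<open>T N y\<close> vanish.\<close>
    case True then show ?thesis using B0 by (simp add: T_def)
  next
    case False
    then have m: "0 < ?m N" using m0[of N] by simp
    have "norm (LINT x|cell_measure L. peak L (x - y) ^ N *\<^sub>R h x) \<le> (LINT x|cell_measure L. peak L (x - y) ^ N * B)"
      by (rule Bochner_Integration.integral_norm_bound_integral[OF hi])
        (use ki[of y N] hB in \<open>auto simp: peak_range intro: mult_left_mono\<close>)
    also have "\<dots> = ?m N * B" by (simp add: peak_mass_translate[OF L])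
    finally show ?thesis using m by (simp add: T_def field_simps)
  qed
  have Tlim: "AE y in cell_measure L. (\<lambda>N. f y * T N y) \<longlonglongrightarrow> f y * h y"
    using AE_cell_measure_interior[OF L] unfolding T_def
    by eventually_elim (intro tendsto_intros peak_peak[OF L _ h hB], auto)
  have pm: "(\<lambda>(y, x). peak L (x - y) ^ N *\<^sub>R h x) \<in> borel_measurable (borel \<Otimes>\<^sub>M borel)" for N
    by measurable
  have Tm: "T N \<in> borel_measurable borel" for N
    unfolding T_def[abs_def]
    by (intro borel_measurable_scaleR borel_measurable_const C.borel_measurable_lebesgue_integral) (use pm in simp)
  have zero: "(LINT y|cell_measure L. f y * T N y) = 0" for N
  proof -
    let ?F = "\<lambda>y x. f y * (peak L (x - y) ^ N *\<^sub>R h x)"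
    have i: "integrable (cell_measure L \<Otimes>\<^sub>M cell_measure L) (case_prod ?F)"
    proof (rule finite_measure.integrable_const_bound[OF finite_measure_pair_measure[OF C.finite_measure_axioms C.finite_measure_axioms]])
      have "norm (?F y x) \<le> A * (1 * B)" for x y
        unfolding norm_mult norm_scaleR
        by (intro mult_mono A) (use hB A0 B0 in \<open>auto simp: peak_range intro!: power_le_one mult_nonneg_nonneg mult_mono\<close>)
      then show "AE p in cell_measure L \<Otimes>\<^sub>M cell_measure L. norm (case_prod ?F p) \<le> A * (1 * B)"
        by (intro AE_I2) auto
    qed measurable
    have "(LINT y|cell_measure L. (LINT x|cell_measure L. ?F y x)) = (LINT x|cell_measure L. (LINT y|cell_measure L. ?F y x))"
      by (rule P.Fubini_integral[OF i, symmetric])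
    also have "\<dots> = (LINT x|cell_measure L. h x * (LINT y|cell_measure L. f y * of_real (peak L (x - y) ^ N)))"
      by (simp only: integral_mult_right_zero[symmetric] scaleR_conv_of_real mult_ac)
    also have "\<dots> = 0" by (simp only: annihilates_peak[OF L f z]) simp
    finally have "(LINT y|cell_measure L. f y * (LINT x|cell_measure L. peak L (x - y) ^ N *\<^sub>R h x)) = 0"
      by (simp only: integral_mult_right_zero)
    then show ?thesis by (simp add: T_def)
  qed
  have "(\<lambda>N. LINT y|cell_measure L. f y * T N y) \<longlonglongrightarrow> (LINT y|cell_measure L. f y * h y)"
  proof (rule integral_dominated_convergence[where w="\<lambda>_. A * B"])
    show "AE y in cell_measure L. norm (f y * T N y) \<le> A * B" for N
      unfolding norm_mult using A TB A0 by (intro AE_I2 mult_mono) auto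
  qed (use Tm Tlim in auto)
  then show ?thesis by (simp add: zero LIMSEQ_const_iff)
qed

text \<open>Approximating the conjugate of f by bounded continuous functions turns
  \<open>fourier_test\<close> into the vanishing of the integral of |f|^2.\<close>

lemma fourier_unique:
  fixes f :: "real ^ 'd::finite \<Rightarrow> complex"
  assumes L: "0 < L" and f: "f \<in> bdd_borel" and z: "\<And>m. (LINT y|cell_measure L. f y * fourier_mode L m y) = 0"
  shows "AE y in cell_measure L. f y = 0"
proof -
  have fm [measurable]: "f \<in> borel_measurable borel" by (rule bdd_borel_measurable[OF f])
  obtain A where A: "\<And>y. norm (f y) \<le> A" "0 \<le> A" using bmE[OF f] by metis
  define B where "B = A + 1"
  have B: "0 < B" "\<And>y. norm (f y) \<le> B" using A(2) by (auto simp: B_def intro: order_trans[OF A(1)])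
  have cell_measure [measurable]: "(\<lambda>y. cnj (f y)) \<in> borel_measurable borel"
    by (rule measurable_compose[OF fm]) (intro borel_measurable_continuous_onI continuous_on_cnj continuous_on_id)
  have "(\<lambda>y. cnj (f y)) \<in> borel_measurable lebesgue"
    by (rule measurable_completion) simp
  \<comment> \<open>\<open>measurable_on\<close> supplies continuous functions converging off a
    negligible set.\<close>
  then have "(\<lambda>y. cnj (f y)) measurable_on UNIV"
    by (rule lebesgue_measurable_imp_measurable_on) simp
  then obtain N g where N: "negligible N" and g: "\<And>n. continuous_on UNIV (g n)"
    and lim: "\<And>x. x \<notin> N \<Longrightarrow> (\<lambda>n. g n x) \<longlonglongrightarrow> cnj (f x)"
    unfolding measurable_on_def by auto
  \<comment> \<open>Radial truncation at B keeps continuity, supplies the dominating constant and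
    leaves the limit unchanged because |f| \<le> B; the 1 in B makes it positive.\<close>
  define h where "h n x = (B / max B (norm (g n x))) *\<^sub>R g n x" for n x
  have hc: "continuous_on UNIV (h n)" for n
    unfolding h_def using B(1) by (intro continuous_intros g) (auto simp: max_def)
  have hB: "norm (h n x) \<le> B" for n x
    using B(1) by (auto simp: h_def max_def abs_mult field_simps)
  have hlim: "(\<lambda>n. h n x) \<longlonglongrightarrow> cnj (f x)" if "x \<notin> N" for x
  proof -
    have "(\<lambda>n. h n x) \<longlonglongrightarrow> (B / max B (norm (cnj (f x)))) *\<^sub>R cnj (f x)"
      unfolding h_def using B(1) by (intro tendsto_intros lim[OF that]) auto
    moreover have "max B (norm (cnj (f x))) = B" using B(2)[of x] by (simp add: max_def)
    ultimately show ?thesis using B(1) by simp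
  qed
  have zero: "(LINT y|cell_measure L. f y * h n y) = 0" for n by (rule fourier_test[OF L f z hc hB])
  have AEN: "AE y in cell_measure L. y \<notin> N"
  proof -
    have "AE y in lebesgue. y \<notin> N" using N by (simp add: negligible_iff_null_sets AE_not_in)
    then have "AE y in lborel. y \<notin> N" by (simp add: AE_completion_iff)
    then show ?thesis by (rule AE_cmI)
  qed
  have hm: "h n \<in> borel_measurable borel" for n by (rule borel_measurable_continuous_onI[OF hc])
  have "(\<lambda>n. LINT y|cell_measure L. f y * h n y) \<longlonglongrightarrow> (LINT y|cell_measure L. f y * cnj (f y))"
  proof (rule integral_dominated_convergence[where w="\<lambda>_. B * B"])
    show "AE y in cell_measure L. norm (f y * h n y) \<le> B * B" for n
      unfolding norm_mult using B hB by (intro AE_I2 mult_mono) auto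
    show "AE y in cell_measure L. (\<lambda>n. f y * h n y) \<longlonglongrightarrow> f y * cnj (f y)"
      using AEN by eventually_elim (intro tendsto_intros hlim)
  qed (use hm integrable_bdd_borel[OF finite_measure_cell_measure[OF L] sets_cell_measure bdd_borel_const] in auto)
  then have "(LINT y|cell_measure L. f y * cnj (f y)) = 0" by (simp add: zero LIMSEQ_const_iff)
  then have "complex_of_real (LINT y|cell_measure L. (norm (f y))\<^sup>2) = 0"
    by (simp add: complex_norm_square[symmetric] del: of_real_power)
  then have "(LINT y|cell_measure L. (norm (f y))\<^sup>2) = 0" by simp
  moreover have "(\<lambda>y. (norm (f y))\<^sup>2) \<in> bdd_borel" unfolding power2_eq_square by (intro bdd_borel_mult bdd_borel_norm f)
  ultimately have "AE y in cell_measure L. (norm (f y))\<^sup>2 = 0"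
    by (subst (asm) integral_nonneg_eq_0_iff_AE[OF integrable_bdd_borel[OF finite_measure_cell_measure[OF L] sets_cell_measure]]) auto
  then show ?thesis by eventually_elim simp
qed

text \<open>A translation multiplies the coefficient of mode k by a character, so an average over
  translations is a Fourier multiplier. The Gaussian average and \<open>heat_avg\<close> are both
  instances.\<close>

lemma
  fixes \<psi> :: "real ^ 'd::finite \<Rightarrow> complex" and \<Theta> :: "'p \<Rightarrow> real" and Y :: "'p \<Rightarrow> real ^ 'd"
  assumes L: "0 < L" and P: "sigma_finite_measure P" and \<Theta>: "integrable P \<Theta>" and Y [measurable]: "Y \<in> borel_measurable P"
    and \<psi>: "\<psi> \<in> bdd_borel" "periodic L \<psi>" and B: "\<And>y. norm (\<psi> y) \<le> B"
  shows average_norm: "norm (LINT p|P. \<Theta> p *\<^sub>R \<psi> (x + Y p)) \<le> B * (LINT p|P. \<bar>\<Theta> p\<bar>)"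
    and average_bdd_borel: "(\<lambda>x. LINT p|P. \<Theta> p *\<^sub>R \<psi> (x + Y p)) \<in> bdd_borel"
    and average_fourier: "(LINT x|cell_measure L. (LINT p|P. \<Theta> p *\<^sub>R \<psi> (x + Y p)) * fourier_mode L k x) =
       (LINT p|P. \<Theta> p *\<^sub>R fourier_mode L k (- Y p)) * (LINT x|cell_measure L. \<psi> x * fourier_mode L k x)"
proof -
  interpret P: sigma_finite_measure P by fact
  interpret C: finite_measure "cell_measure L :: (real^'d) measure" by (rule finite_measure_cell_measure[OF L])
  interpret PC: pair_sigma_finite P "cell_measure L :: (real^'d) measure" ..
  have [measurable]: "\<psi> \<in> borel_measurable borel" by (rule bdd_borel_measurable[OF \<psi>(1)])
  have [measurable]: "\<Theta> \<in> borel_measurable P" using \<Theta> by simp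
  have [measurable]: "fourier_mode L k \<in> borel_measurable borel" for k :: "int ^ 'd" by (rule bdd_borel_measurable[OF fourier_mode_bdd_borel])
  have B0: "0 \<le> B" using B[of 0] norm_ge_zero order_trans by blast
  have nb: "norm (LINT p|P. \<Theta> p *\<^sub>R \<psi> (x + Y p)) \<le> B * (LINT p|P. \<bar>\<Theta> p\<bar>)" for x
  proof -
    have "norm (LINT p|P. \<Theta> p *\<^sub>R \<psi> (x + Y p)) \<le> (LINT p|P. norm (\<Theta> p *\<^sub>R \<psi> (x + Y p)))"
      by (rule integral_norm_bound)
    also have "\<dots> \<le> (LINT p|P. B * \<bar>\<Theta> p\<bar>)"
    proof (rule integral_mono_AE')
      show "AE p in P. norm (\<Theta> p *\<^sub>R \<psi> (x + Y p)) \<le> B * \<bar>\<Theta> p\<bar>"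
        by (intro AE_I2) (simp add: mult.commute[of B] mult_left_mono B)
    qed (use \<Theta> B0 in auto)
    finally show ?thesis by simp
  qed
  then show "norm (LINT p|P. \<Theta> p *\<^sub>R \<psi> (x + Y p)) \<le> B * (LINT p|P. \<bar>\<Theta> p\<bar>)" .
  show "(\<lambda>x. LINT p|P. \<Theta> p *\<^sub>R \<psi> (x + Y p)) \<in> bdd_borel"
    by (rule bmI[OF _ nb]) measurable
  let ?F = "\<lambda>p x. \<Theta> p *\<^sub>R (\<psi> (x + Y p) * fourier_mode L k x)"
  have i: "integrable (P \<Otimes>\<^sub>M cell_measure L) (case_prod ?F)"
  proof (rule Bochner_Integration.integrable_bound)
    show "integrable (P \<Otimes>\<^sub>M (cell_measure L :: (real^'d) measure)) (\<lambda>(p, x). B * \<bar>\<Theta> p\<bar>)"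
    proof (rule PC.Fubini_integrable)
      show "integrable P (\<lambda>p. LINT x|cell_measure L. norm (case (p, x) of (p, x) \<Rightarrow> B * \<bar>\<Theta> p\<bar>))"
        using \<Theta> by simp
    qed auto
    show "AE p in P \<Otimes>\<^sub>M cell_measure L. norm (case_prod ?F p) \<le> norm (case p of (p, x) \<Rightarrow> B * \<bar>\<Theta> p\<bar>)"
      using B0 by (intro AE_I2) (auto simp: norm_mult abs_mult mult.commute[of B] intro!: mult_left_mono B)
  qed measurable
  have "(LINT x|cell_measure L. (LINT p|P. \<Theta> p *\<^sub>R \<psi> (x + Y p)) * fourier_mode L k x) = (LINT x|cell_measure L. (LINT p|P. ?F p x))"
    by (simp only: integral_mult_left_zero[symmetric] mult_scaleR_left)
  also have "\<dots> = (LINT p|P. (LINT x|cell_measure L. ?F p x))" by (rule PC.Fubini_integral[OF i])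
  also have "\<dots> = (LINT p|P. (\<Theta> p *\<^sub>R fourier_mode L k (- Y p)) * (LINT x|cell_measure L. \<psi> x * fourier_mode L k x))"
  proof (intro Bochner_Integration.integral_cong refl)
    fix p
    have per: "periodic L (\<lambda>x. \<psi> x * fourier_mode L k x)" using \<psi>(2) fourier_mode_periodic[OF L, of k] by (simp add: periodic_def)
    have eq: "\<psi> (x + Y p) * fourier_mode L k x = (\<psi> (x + Y p) * fourier_mode L k (x + Y p)) * fourier_mode L k (- Y p)" for x
      using fourier_mode_add[of L k "x + Y p" "- Y p"] by simp
    have "(LINT x|cell_measure L. \<psi> (x + Y p) * fourier_mode L k x) = (LINT x|cell_measure L. (\<psi> (x + Y p) * fourier_mode L k (x + Y p)) * fourier_mode L k (- Y p))"
      by (intro Bochner_Integration.integral_cong refl eq)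
    also have "\<dots> = (LINT x|cell_measure L. \<psi> (x + Y p) * fourier_mode L k (x + Y p)) * fourier_mode L k (- Y p)"
      by (rule integral_mult_left_zero)
    also have "(LINT x|cell_measure L. \<psi> (x + Y p) * fourier_mode L k (x + Y p)) = (LINT x|cell_measure L. \<psi> x * fourier_mode L k x)"
      by (rule integral_cell_measure_translate[OF L _ per]) (intro bdd_borel_mult \<psi> fourier_mode_bdd_borel)
    finally show "(LINT x|cell_measure L. ?F p x) = (\<Theta> p *\<^sub>R fourier_mode L k (- Y p)) * (LINT x|cell_measure L. \<psi> x * fourier_mode L k x)"
      by (simp add: mult.commute)
  qed
  finally show "(LINT x|cell_measure L. (LINT p|P. \<Theta> p *\<^sub>R \<psi> (x + Y p)) * fourier_mode L k x) =
       (LINT p|P. \<Theta> p *\<^sub>R fourier_mode L k (- Y p)) * (LINT x|cell_measure L. \<psi> x * fourier_mode L k x)" by (simp only: integral_mult_left_zero)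
qed

section \<open>Bessel potentials\<close>

text \<open>The exceptional set in R^d consists of countably many translates of the one in the
  cell.\<close>

lemma AE_cell_measure_lborel:
  fixes P :: "real ^ 'd::finite \<Rightarrow> bool"
  assumes L: "0 < L" and P: "AE y in cell_measure L. P y" and per: "\<And>y j. P (y + latt L j) \<longleftrightarrow> P y"
    and [measurable]: "Measurable.pred borel P"
  shows "AE y in lborel. P y"
proof -
  interpret C: finite_measure "cell_measure L :: (real^'d) measure" by (rule finite_measure_cell_measure[OF L])
  interpret S: sigma_finite_measure "count_space (UNIV::(int^'d) set)"
    by (rule sigma_finite_measure_count_space_countable) simp
  interpret PP: pair_sigma_finite "count_space (UNIV::(int^'d) set)" "cell_measure L :: (real^'d) measure" ..
  have m [measurable]: "(\<lambda>(j, y). y + latt L j) \<in> count_space (UNIV::(int^'d) set) \<Otimes>\<^sub>M cell_measure L \<rightarrow>\<^sub>M borel"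
    by (rule measurable_count_space_pair) simp
  have "AE p in count_space (UNIV::(int^'d) set) \<Otimes>\<^sub>M cell_measure L. P (case p of (j, y) \<Rightarrow> y + latt L j)"
  proof (rule PP.AE_pair_measure)
    show "{p \<in> space (count_space (UNIV::(int^'d) set) \<Otimes>\<^sub>M cell_measure L). P (case p of (j, y) \<Rightarrow> y + latt L j)} \<in> sets (count_space UNIV \<Otimes>\<^sub>M cell_measure L)"
      by measurable
  qed (use P per in \<open>auto simp: AE_count_space\<close>)
  then show ?thesis
    by (subst lborel_eq_distr_cell_measure[OF L], subst AE_distr_iff) auto
qed

text \<open>The eigenvalue of -\<Delta> on the mode k, so that \<open>1 + freq L k\<close> is that
  of J.\<close>

definition freq :: "real \<Rightarrow> int ^ 'd::finite \<Rightarrow> real" where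
  "freq L k = (2 * pi / L)\<^sup>2 * (\<Sum>l\<in>UNIV. (real_of_int (k $ l))\<^sup>2)"

lemma freq_nonneg [simp]: "0 \<le> freq L k"
  by (simp add: freq_def sum_nonneg)

lemma integral_rgauss_fourier_mode:
  fixes k :: "int ^ 'd::finite"
  assumes e: "0 < \<epsilon>"
  shows "(LINT y|lborel. rgauss \<epsilon> y *\<^sub>R fourier_mode L k (- y)) = of_real (exp (- (\<epsilon> / 2 * freq L k)))"
proof -
  define \<xi> :: "real ^ 'd" where "\<xi> = (\<chi> l. 2 * pi / L * of_int (k $ l))"
  have "fourier_mode L k (- y) = exp (\<i> * (\<Sum>l\<in>UNIV. \<xi> $ l * y $ l))" for y
    unfolding fourier_mode_conv \<xi>_def by (simp add: of_real_sum)
  moreover have "(\<Sum>l\<in>UNIV. (\<xi> $ l)\<^sup>2) = freq L k"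
    unfolding \<xi>_def freq_def by (simp add: power_mult_distrib power_divide sum_distrib_left)
  ultimately show ?thesis
    using integral_rgauss_char[OF e, of \<xi>] by simp
qed

text \<open>Since \<open>rgauss (2 * t)\<close> is the kernel of exp(t \<Delta>), this is the
  integral of w(t) exp(t \<Delta>) \<psi> over t, written as one double integral to fit the lemmas
  on averages of translates.\<close>

definition heat_avg :: "(real \<Rightarrow> real) \<Rightarrow> (real ^ 'd::finite \<Rightarrow> complex) \<Rightarrow> real ^ 'd \<Rightarrow> complex" where
  "heat_avg w \<psi> x = (LINT p|(lborel \<Otimes>\<^sub>M lborel). (w (fst p) * rgauss (2 * fst p) (snd p)) *\<^sub>R \<psi> (x + snd p))"

text \<open>On the mode k the heat semigroup acts as \<open>exp (- (t * freq L k))\<close>, so the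
  multiplier is the Laplace transform of w at \<open>freq L k\<close>.\<close>

lemma
  fixes \<psi> :: "real ^ 'd::finite \<Rightarrow> complex"
  assumes L: "0 < L" and w: "integrable lborel w" and w0: "\<And>t. 0 \<le> w t" "\<And>t. t \<le> 0 \<Longrightarrow> w t = 0"
    and \<psi>: "\<psi> \<in> bdd_borel" "periodic L \<psi>" and B: "\<And>y. norm (\<psi> y) \<le> B"
  shows heat_avg_norm: "norm (heat_avg w \<psi> x) \<le> B * (LINT t|lborel. w t)"
    and heat_avg_bdd_borel: "heat_avg w \<psi> \<in> bdd_borel"
    and heat_avg_periodic: "periodic L (heat_avg w \<psi>)"
    and heat_avg_fourier: "(LINT x|cell_measure L. heat_avg w \<psi> x * fourier_mode L k x) = of_real (LINT t|lborel. w t * exp (- (t * freq L k))) * (LINT x|cell_measure L. \<psi> x * fourier_mode L k x)"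
proof -
  let ?P = "lborel \<Otimes>\<^sub>M lborel :: (real \<times> (real ^ 'd)) measure"
  let ?\<Theta> = "\<lambda>p::real \<times> (real ^ 'd). w (fst p) * rgauss (2 * fst p) (snd p)"
  have P: "sigma_finite_measure ?P" by unfold_locales
  have [measurable]: "w \<in> borel_measurable borel" using borel_measurable_integrable[OF w] by simp
  have fourier_mode_m [measurable]: "fourier_mode L k \<in> borel_measurable borel" by (rule bdd_borel_measurable[OF fourier_mode_bdd_borel])
  \<comment> \<open>For t \<le> 0 the weight vanishes, so the meaningless value of
    \<open>rgauss\<close> at nonpositive time is multiplied by 0.\<close>
  have wg: "w t * rgauss (2 * t) y = \<bar>w t * rgauss (2 * t) y\<bar>" for t and y :: "real ^ 'd"
    using w0(1)[of t] w0(2)[of t] rgauss_pos[of "2 * t" y] by (cases "0 < t") (auto simp: abs_mult)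
  have ig: "(LINT y|lborel. w t * rgauss (2 * t) (y :: real ^ 'd)) = w t" for t
    using w0(2)[of t] integral_rgauss[of "2 * t", where 'd='d] by (cases "0 < t") auto
  have i\<Theta>: "integrable ?P ?\<Theta>"
  proof (rule lborel_pair.Fubini_integrable)
    show "?\<Theta> \<in> borel_measurable ?P" by measurable
    have "integrable lborel (\<lambda>y. w t * rgauss (2 * t) (y :: real ^ 'd))" for t
      using w0(2)[of t] integrable_rgauss[of "2 * t", where 'd='d] by (cases "0 < t") auto
    then show "AE t in lborel. integrable lborel (\<lambda>y. ?\<Theta> (t, y))" by simp
    show "integrable lborel (\<lambda>t. LINT y|lborel. norm (?\<Theta> (t, y)))"
      using w by (simp only: fst_conv snd_conv real_norm_def wg[symmetric] ig)
  qed
  have "(LINT p|?P. \<bar>?\<Theta> p\<bar>) = (LINT p|?P. ?\<Theta> p)" by (simp add: wg[symmetric])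
  also have "\<dots> = (LINT t|lborel. LINT y|lborel. ?\<Theta> (t, y))" by (rule lborel_pair.integral_fst'[OF i\<Theta>, symmetric])
  also have "\<dots> = (LINT t|lborel. w t)" by (simp only: fst_conv snd_conv ig)
  finally have n\<Theta>: "(LINT p|?P. \<bar>?\<Theta> p\<bar>) = (LINT t|lborel. w t)" .
  have c\<Theta>: "(LINT p|?P. ?\<Theta> p *\<^sub>R fourier_mode L k (- snd p)) = of_real (LINT t|lborel. w t * exp (- (t * freq L k)))"
  proof -
    have i: "integrable ?P (\<lambda>p. ?\<Theta> p *\<^sub>R fourier_mode L k (- snd p))"
      by (rule Bochner_Integration.integrable_bound[OF i\<Theta>]) (auto intro!: borel_measurable_scaleR)
    have inner: "(LINT y|lborel. (w t * rgauss (2 * t) y) *\<^sub>R fourier_mode L k (- y)) = of_real (w t * exp (- (t * freq L k)))" for t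
    proof (cases "0 < t")
      case True
      have "(LINT y|lborel. (w t * rgauss (2 * t) y) *\<^sub>R fourier_mode L k (- y)) = w t *\<^sub>R (LINT y|lborel. rgauss (2 * t) y *\<^sub>R fourier_mode L k (- y))"
        by (simp only: scaleR_scaleR[symmetric] integral_scaleR_right)
      then show ?thesis using integral_rgauss_fourier_mode[of "2 * t" L k] True by (simp add: scaleR_conv_of_real)
    qed (use w0(2) in auto)
    have "(LINT p|?P. ?\<Theta> p *\<^sub>R fourier_mode L k (- snd p)) = (LINT t|lborel. LINT y|lborel. (w t * rgauss (2 * t) y) *\<^sub>R fourier_mode L k (- y))"
      using lborel_pair.integral_fst'[OF i] by simp
    then show ?thesis by (simp only: inner integral_complex_of_real)
  qed
  have sm: "snd \<in> borel_measurable ?P" by simp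
  show "norm (heat_avg w \<psi> x) \<le> B * (LINT t|lborel. w t)"
    unfolding heat_avg_def n\<Theta>[symmetric] by (rule average_norm[OF L P i\<Theta> sm \<psi> B])
  show "heat_avg w \<psi> \<in> bdd_borel"
    unfolding heat_avg_def[abs_def] by (rule average_bdd_borel[OF L P i\<Theta> sm \<psi> B])
  show "periodic L (heat_avg w \<psi>)"
    using \<psi>(2) by (simp add: periodic_def heat_avg_def add.assoc add.commute[of "latt L _"]) (simp add: add.assoc[symmetric])
  show "(LINT x|cell_measure L. heat_avg w \<psi> x * fourier_mode L k x) = of_real (LINT t|lborel. w t * exp (- (t * freq L k))) * (LINT x|cell_measure L. \<psi> x * fourier_mode L k x)"
    unfolding heat_avg_def c\<Theta>[symmetric] by (rule average_fourier[OF L P i\<Theta> sm \<psi> B])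
qed

section \<open>Weights in time and their Laplace transforms\<close>

definition gamma_weight :: "real \<Rightarrow> real \<Rightarrow> real" where
  "gamma_weight \<sigma> t = (if 0 < t then t powr (\<sigma> - 1) * exp (- t) / Gamma \<sigma> else 0)"

text \<open>Euler's integral after the substitution of (1 + c) t for t. The weight is the Gamma
  density of shape \<sigma>; at \<open>c = freq L k\<close> the value is the multiplier of J to the
  power -\<sigma>.\<close>

lemma has_bochner_integral_gamma_weight:
  assumes \<sigma>: "0 < \<sigma>" and c: "0 \<le> c"
  shows "has_bochner_integral lborel (\<lambda>t. gamma_weight \<sigma> t * exp (- (t * c))) ((1 + c) powr (- \<sigma>))"
proof (rule has_bochner_integral_nn_integral)
  have G: "0 < Gamma \<sigma>" using \<sigma> by (rule Gamma_real_pos)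
  let ?f = "\<lambda>t. indicator {0..} t * t powr (\<sigma> - 1) / exp t"
  have pt: "?f (0 + (1 + c) * t) = Gamma \<sigma> * (1 + c) powr (\<sigma> - 1) * (gamma_weight \<sigma> t * exp (- (t * c)))" if "t \<noteq> 0" for t
  proof (cases "0 < t")
    case True
    then have "0 \<le> (1 + c) * t" using c by simp
    have "((1 + c) * t) powr (\<sigma> - 1) = (1 + c) powr (\<sigma> - 1) * t powr (\<sigma> - 1)"
      using c True by (subst powr_mult) auto
    moreover have "exp ((1 + c) * t) = exp t * exp (t * c)"
      by (simp add: exp_add[symmetric] algebra_simps)
    ultimately show ?thesis using True G \<open>0 \<le> (1 + c) * t\<close>
      by (simp add: gamma_weight_def exp_minus field_simps)
  next
    case False
    then have "\<not> 0 \<le> (1 + c) * t" using that c by (simp add: zero_le_mult_iff)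
    then show ?thesis using False by (simp add: gamma_weight_def)
  qed
  have [measurable]: "gamma_weight \<sigma> \<in> borel_measurable borel" unfolding gamma_weight_def[abs_def] by measurable
  have g0: "0 \<le> gamma_weight \<sigma> t * exp (- (t * c))" for t using G by (simp add: gamma_weight_def)
  have "ennreal (Gamma \<sigma>) = (\<integral>\<^sup>+t. ennreal (?f t) \<partial>lborel)" using Gamma_conv_nn_integral_real[OF \<sigma>] .
  also have "\<dots> = ennreal \<bar>1 + c\<bar> * (\<integral>\<^sup>+t. ennreal (?f (0 + (1 + c) * t)) \<partial>lborel)"
    using c by (intro nn_integral_real_affine) auto
  also have "(\<integral>\<^sup>+t. ennreal (?f (0 + (1 + c) * t)) \<partial>lborel) = (\<integral>\<^sup>+t. ennreal (Gamma \<sigma> * (1 + c) powr (\<sigma> - 1)) * ennreal (gamma_weight \<sigma> t * exp (- (t * c))) \<partial>lborel)"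
  proof (rule nn_integral_cong_AE)
    show "AE t in lborel. ennreal (?f (0 + (1 + c) * t)) = ennreal (Gamma \<sigma> * (1 + c) powr (\<sigma> - 1)) * ennreal (gamma_weight \<sigma> t * exp (- (t * c)))"
      using AE_lborel_singleton[of 0]
    proof eventually_elim
      case (elim t)
      show ?case unfolding pt[OF elim] using G g0 by (intro ennreal_mult) auto
    qed
  qed
  also have "\<dots> = ennreal (Gamma \<sigma> * (1 + c) powr (\<sigma> - 1)) * (\<integral>\<^sup>+t. ennreal (gamma_weight \<sigma> t * exp (- (t * c))) \<partial>lborel)"
    by (rule nn_integral_cmult) measurable
  finally have E: "ennreal (Gamma \<sigma>) = ennreal \<bar>1 + c\<bar> * (ennreal (Gamma \<sigma> * (1 + c) powr (\<sigma> - 1)) * (\<integral>\<^sup>+t. ennreal (gamma_weight \<sigma> t * exp (- (t * c))) \<partial>lborel))" .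
  have "(1 + c) * (1 + c) powr (\<sigma> - 1) = (1 + c) powr \<sigma>"
    using c by (simp add: powr_diff)
  then have eq: "\<bar>1 + c\<bar> * (Gamma \<sigma> * (1 + c) powr (\<sigma> - 1)) = Gamma \<sigma> * (1 + c) powr \<sigma>"
    using c by (simp add: mult.left_commute)
  let ?I = "\<integral>\<^sup>+t. ennreal (gamma_weight \<sigma> t * exp (- (t * c))) \<partial>lborel" and ?a = "Gamma \<sigma> * (1 + c) powr \<sigma>"
  have a: "0 < ?a" using G c by simp
  have "ennreal (Gamma \<sigma>) = ennreal ?a * ?I"
    unfolding eq[symmetric] using E G by (subst ennreal_mult) (auto simp: mult.assoc)
  then have "ennreal (1 / ?a) * ennreal (Gamma \<sigma>) = ennreal (1 / ?a) * ennreal ?a * ?I"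
    by (simp only: mult.assoc)
  moreover have "ennreal (1 / ?a) * ennreal ?a = 1"
    using a by (subst ennreal_mult[symmetric]) auto
  moreover have "ennreal (1 / ?a) * ennreal (Gamma \<sigma>) = ennreal ((1 + c) powr (- \<sigma>))"
    using a G by (subst ennreal_mult[symmetric]) (auto simp: powr_minus divide_inverse)
  ultimately show "?I = ennreal ((1 + c) powr (- \<sigma>))" by simp
  show "AE t in lborel. 0 \<le> gamma_weight \<sigma> t * exp (- (t * c))" using g0 by simp
qed (use assms in \<open>auto simp: gamma_weight_def\<close>)

lemma gamma_weight_nonneg: "0 < \<sigma> \<Longrightarrow> 0 \<le> gamma_weight \<sigma> t" and gamma_weight_nonpos: "t \<le> 0 \<Longrightarrow> gamma_weight \<sigma> t = 0"
  using Gamma_real_pos[of \<sigma>] by (auto simp: gamma_weight_def)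

lemma gamma_weight_integral:
  assumes "0 < \<sigma>"
  shows "integrable lborel (gamma_weight \<sigma>)" "(LINT t|lborel. gamma_weight \<sigma> t) = 1"
    "0 \<le> c \<Longrightarrow> (LINT t|lborel. gamma_weight \<sigma> t * exp (- (t * c))) = (1 + c) powr (- \<sigma>)"
  using has_bochner_integral_gamma_weight[OF assms, of 0] has_bochner_integral_gamma_weight[OF assms, of c]
  by (auto simp: has_bochner_integral_iff)

text \<open>The last identity is multiplied by c instead of divided, so that the zero frequency is
  covered.\<close>

lemma integral_exp_interval:
  assumes h: "0 < h"
  shows "integrable lborel (indicator {0<..h} :: real \<Rightarrow> real)" "(LINT t|lborel. (indicator {0<..h} t :: real)) = h"
    "c * (LINT t|lborel. (indicator {0<..h} t) * exp (- (t * c))) = 1 - exp (- (h * c))"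
proof -
  show "integrable lborel (indicator {0<..h} :: real \<Rightarrow> real)" "(LINT t|lborel. (indicator {0<..h} t :: real)) = h"
    using h by auto
  have "(LINT t|lborel. (c * exp (- (t * c))) * indicator {0..h} t) = - exp (- (h * c)) - - exp (- (0 * c))"
    using h by (intro integral_FTC_Icc_real) (auto intro!: derivative_eq_intros continuous_intros)
  moreover have "(LINT t|lborel. (c * exp (- (t * c))) * indicator {0..h} t) = (LINT t|lborel. c * (indicator {0<..h} t * exp (- (t * c))))"
  proof (rule integral_cong_AE)
    show "AE t in lborel. (c * exp (- (t * c))) * indicator {0..h} t = c * (indicator {0<..h} t * exp (- (t * c)))"
      using AE_lborel_singleton[of 0] by eventually_elim (auto simp: indicator_def)
  qed measurable
  ultimately show "c * (LINT t|lborel. (indicator {0<..h} t) * exp (- (t * c))) = 1 - exp (- (h * c))"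
    by simp
qed

text \<open>
  With \<open>J\<^sup>\<sigma> \<phi> = \<psi>\<close>, both \<open>\<phi>\<close> and \<open>J \<phi>\<close> are Gamma averages of the heat semigroup applied to \<open>\<psi>\<close>, and
  \<open>\<phi> - C\<^sub>\<epsilon> \<phi>\<close> is the integral of \<open>- \<Delta> / 2 = (J - I) / 2\<close> along the semigroup.
\<close>

lemma bessel_potential_bounds:
  fixes \<phi> \<psi> :: "real ^ 'd::finite \<Rightarrow> complex"
  assumes L: "0 < L" and \<sigma>: "1 < \<sigma>" and \<phi>: "\<phi> \<in> bdd_borel" "periodic L \<phi>" and \<psi>: "\<psi> \<in> bdd_borel" "periodic L \<psi>"
    and B: "\<And>y. norm (\<psi> y) \<le> B"
    and J: "\<And>k. (LINT y|cell_measure L. \<psi> y * fourier_mode L k y) = of_real ((1 + freq L k) powr \<sigma>) * (LINT y|cell_measure L. \<phi> y * fourier_mode L k y)"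
  shows "AE x in cell_measure L. norm (\<phi> x) \<le> B"
    and "0 < \<epsilon> \<Longrightarrow> AE x in cell_measure L. norm (\<phi> x - (LINT y|lborel. rgauss \<epsilon> y *\<^sub>R \<phi> (x + y))) \<le> \<epsilon> * B"
proof -
  have \<sigma>0: "0 < \<sigma>" "0 < \<sigma> - 1" using \<sigma> by auto
  \<comment> \<open>The order is \<sigma> for \<phi> and \<sigma> - 1 for J \<phi>; the second is an
    average with a positive weight because \<sigma> > 1, and this is what s > 2 provides.\<close>
  define \<Phi> \<eta> where "\<Phi> = heat_avg (gamma_weight \<sigma>) \<psi>" and "\<eta> = heat_avg (gamma_weight (\<sigma> - 1)) \<psi>"
  let ?c = "\<lambda>f k. LINT y|cell_measure L. f y * fourier_mode L k y"
  note g = gamma_weight_integral[OF \<sigma>0(1)] gamma_weight_nonneg[OF \<sigma>0(1)] gamma_weight_nonpos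
  note g' = gamma_weight_integral[OF \<sigma>0(2)] gamma_weight_nonneg[OF \<sigma>0(2)] gamma_weight_nonpos
  note H = heat_avg_norm[OF L g(1,4,5) \<psi> B] heat_avg_bdd_borel[OF L g(1,4,5) \<psi> B] heat_avg_periodic[OF L g(1,4,5) \<psi> B]
  note H' = heat_avg_norm[OF L g'(1,4,5) \<psi> B] heat_avg_bdd_borel[OF L g'(1,4,5) \<psi> B] heat_avg_periodic[OF L g'(1,4,5) \<psi> B]
  have \<Phi>B: "norm (\<Phi> x) \<le> B" and \<eta>B: "norm (\<eta> x) \<le> B" for x
    using H(1)[of x] H'(1)[of x] g(2) g'(2) by (auto simp: \<Phi>_def \<eta>_def)
  have \<Phi>bdd_borel: "\<Phi> \<in> bdd_borel" "periodic L \<Phi>" and \<eta>bdd_borel: "\<eta> \<in> bdd_borel" "periodic L \<eta>"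
    using H H' by (auto simp: \<Phi>_def \<eta>_def)
  have fp: "0 < 1 + freq L k" for k :: "int ^ 'd" using freq_nonneg[of L k] by linarith
  have c\<Phi>: "?c \<Phi> k = ?c \<phi> k" for k
  proof -
    have "?c \<Phi> k = of_real ((1 + freq L k) powr (- \<sigma>) * (1 + freq L k) powr \<sigma>) * ?c \<phi> k"
      using heat_avg_fourier[OF L g(1,4,5) \<psi> B, of k] unfolding J g(3)[OF freq_nonneg] \<Phi>_def by simp
    also have "(1 + freq L k) powr (- \<sigma>) * (1 + freq L k) powr \<sigma> = 1"
      using fp[of k] by (simp add: powr_add[symmetric])
    finally show ?thesis by simp
  qed
  have c\<eta>: "?c \<eta> k = of_real (1 + freq L k) * ?c \<phi> k" for k
  proof -
    have "?c \<eta> k = of_real ((1 + freq L k) powr (- (\<sigma> - 1)) * (1 + freq L k) powr \<sigma>) * ?c \<phi> k"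
      using heat_avg_fourier[OF L g'(1,4,5) \<psi> B, of k] unfolding J g'(3)[OF freq_nonneg] \<eta>_def by simp
    also have "(1 + freq L k) powr (- (\<sigma> - 1)) * (1 + freq L k) powr \<sigma> = 1 + freq L k"
      using fp[of k] by (simp add: powr_add[symmetric])
    finally show ?thesis .
  qed
  have int: "integrable (cell_measure L) (\<lambda>y. f y * fourier_mode L k y)" if "f \<in> bdd_borel" for f and k :: "int ^ 'd"
    by (intro integrable_bdd_borel[OF finite_measure_cell_measure[OF L] sets_cell_measure] bdd_borel_mult that fourier_mode_bdd_borel)
  have "AE x in cell_measure L. \<phi> x - \<Phi> x = 0"
    by (rule fourier_unique[OF L bdd_borel_diff[OF \<phi>(1) \<Phi>bdd_borel(1)]])
      (simp add: left_diff_distrib int \<phi> \<Phi>bdd_borel c\<Phi>)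
  then show "AE x in cell_measure L. norm (\<phi> x) \<le> B"
    by eventually_elim (use \<Phi>B in \<open>metis eq_iff_diff_eq_0\<close>)
  assume e: "0 < \<epsilon>"
  let ?w = "indicator {0<..\<epsilon> / 2} :: real \<Rightarrow> real"
  have e2: "0 < \<epsilon> / 2" using e by simp
  \<comment> \<open>The time interval ends at \<epsilon>/2 because \<open>rgauss \<epsilon>\<close>
    is the kernel of exp((\<epsilon>/2) \<Delta>). With the bound 2 B for \<eta> - \<Phi> this gives
    (\<epsilon>/2) 2 B = \<epsilon> B.\<close>
  define D where "D = heat_avg ?w (\<lambda>x. \<eta> x - \<Phi> x)"
  have w: "0 \<le> ?w t" "t \<le> 0 \<Longrightarrow> ?w t = 0" for t by auto
  have \<eta>\<Phi>: "(\<lambda>x. \<eta> x - \<Phi> x) \<in> bdd_borel" "periodic L (\<lambda>x. \<eta> x - \<Phi> x)"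
    using bdd_borel_diff[OF \<eta>bdd_borel(1) \<Phi>bdd_borel(1)] \<eta>bdd_borel(2) \<Phi>bdd_borel(2) by (auto simp: periodic_def)
  have \<eta>\<Phi>B: "norm (\<eta> x - \<Phi> x) \<le> 2 * B" for x
    using norm_triangle_ineq4[of "\<eta> x" "\<Phi> x"] \<eta>B[of x] \<Phi>B[of x] by linarith
  note HD = heat_avg_norm[OF L integral_exp_interval(1)[OF e2] w \<eta>\<Phi> \<eta>\<Phi>B] heat_avg_bdd_borel[OF L integral_exp_interval(1)[OF e2] w \<eta>\<Phi> \<eta>\<Phi>B]
  have DB: "norm (D x) \<le> \<epsilon> * B" for x
    using HD(1)[of x] unfolding integral_exp_interval(2)[OF e2] D_def by (simp add: mult_ac)
  have Dbm: "D \<in> bdd_borel" using HD(2) by (simp add: D_def)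
  have cD: "?c D k = of_real (1 - exp (- (\<epsilon> / 2 * freq L k))) * ?c \<phi> k" for k
  proof -
    have "?c (\<lambda>x. \<eta> x - \<Phi> x) k = of_real (freq L k) * ?c \<phi> k"
      by (simp add: left_diff_distrib int \<eta>bdd_borel \<Phi>bdd_borel c\<Phi> c\<eta> algebra_simps)
    then have "?c D k = of_real (freq L k * (LINT t|lborel. ?w t * exp (- (t * freq L k)))) * ?c \<phi> k"
      using heat_avg_fourier[OF L integral_exp_interval(1)[OF e2] w \<eta>\<Phi> \<eta>\<Phi>B, of k] unfolding D_def by simp
    then show ?thesis unfolding integral_exp_interval(3)[OF e2] .
  qed
  obtain A where A: "\<And>y. norm (\<phi> y) \<le> A" using bmE[OF \<phi>(1)] by metis
  let ?C = "\<lambda>x. LINT y|lborel. rgauss \<epsilon> y *\<^sub>R \<phi> (x + y)"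
  have ym: "(\<lambda>y. y) \<in> borel_measurable lborel" by simp
  have Cbm: "?C \<in> bdd_borel" by (rule average_bdd_borel[OF L sigma_finite_lborel integrable_rgauss[OF e] ym \<phi> A])
  have cC: "?c ?C k = of_real (exp (- (\<epsilon> / 2 * freq L k))) * ?c \<phi> k" for k
    using average_fourier[OF L sigma_finite_lborel integrable_rgauss[OF e] ym \<phi> A, of k] integral_rgauss_fourier_mode[OF e, of L k] by simp
  have "?c (\<lambda>x. (\<phi> x - ?C x) - D x) k = ?c \<phi> k - ?c ?C k - ?c D k" for k
    by (simp add: left_diff_distrib int \<phi> Cbm Dbm)
  then have "?c (\<lambda>x. (\<phi> x - ?C x) - D x) k = 0" for k
    unfolding cC cD by (simp add: algebra_simps)
  then have "AE x in cell_measure L. (\<phi> x - ?C x) - D x = 0"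
    by (rule fourier_unique[OF L bdd_borel_diff[OF bdd_borel_diff[OF \<phi>(1) Cbm] Dbm]])
  then show "AE x in cell_measure L. norm (\<phi> x - ?C x) \<le> \<epsilon> * B"
    by eventually_elim (use DB in \<open>metis eq_iff_diff_eq_0\<close>)
qed

section \<open>Uniform bounds for the Sinkhorn weight\<close>

text \<open>The smoothness of the density enters the later estimates through \<open>f_heat\<close>,
  with the same B that bounds f. The function f is a representative of log \<rho> bounded at every
  point.\<close>

locale log_density =
  fixes L B :: real and f :: "real ^ 'd::finite \<Rightarrow> real"
  assumes L: "0 < L" and f_bdd_borel: "f \<in> bdd_borel" and f_per: "periodic L f" and f_B: "\<And>x. \<bar>f x\<bar> \<le> B"
    and f_heat: "\<And>\<epsilon>. 0 < \<epsilon> \<Longrightarrow> AE x in lborel. \<bar>f x - Kr L (cell_measure L) \<epsilon> f x\<bar> \<le> \<epsilon> * B"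
    and mass: "(LINT y|cell_measure L. exp (f y)) = 1"
begin

definition \<mu> :: "(real ^ 'd) measure" where
  "\<mu> = density (cell_measure L) (\<lambda>y. ennreal (exp (f y)))"

sublocale C: torus_measure L "cell_measure L :: (real ^ 'd) measure"
  unfolding torus_measure_def using L finite_measure_cell_measure[OF L] by simp

lemma f_meas [measurable]: "f \<in> borel_measurable borel"
  by (rule bdd_borel_measurable[OF f_bdd_borel])

lemma B_nonneg: "0 \<le> B"
  using f_B[of 0] by linarith

lemma exp_bdd_borel: "(\<lambda>y. exp (c * f y)) \<in> bdd_borel"
proof (rule bmI)
  show "norm (exp (c * f y)) \<le> exp (\<bar>c\<bar> * B)" for y
    using mult_left_mono[OF f_B[of y], of "\<bar>c\<bar>"] by (simp flip: abs_mult)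
qed measurable

lemma expf_bdd_borel: "(\<lambda>y. exp (f y)) \<in> bdd_borel"
  using exp_bdd_borel[of 1] by simp

lemma expf_bounds: "exp (- B) \<le> exp (f x)" "exp (f x) \<le> exp B"
  using f_B[of x] by auto

lemma integral_\<mu>:
  fixes g :: "real ^ 'd \<Rightarrow> 'b::{banach,second_countable_topology}"
  assumes [measurable]: "g \<in> borel_measurable borel"
  shows "(LINT y|\<mu>. g y) = (LINT y|cell_measure L. exp (f y) *\<^sub>R g y)"
  unfolding \<mu>_def by (rule integral_density) auto

lemma sets_mu [simp, measurable_cong]: "sets \<mu> = sets borel"
  by (simp add: \<mu>_def)

lemma prob_space_\<mu>: "prob_space \<mu>"
proof
  have "emeasure \<mu> (space \<mu>) = (\<integral>\<^sup>+y. ennreal (exp (f y)) \<partial>cell_measure L)"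
    by (simp add: \<mu>_def emeasure_density)
  also have "\<dots> = ennreal (LINT y|cell_measure L. exp (f y))"
    by (rule nn_integral_eq_integral[OF C.integrable_\<mu>[OF expf_bdd_borel]]) simp
  finally show "emeasure \<mu> (space \<mu>) = 1" using mass by simp
qed

lemma torus_prob_\<mu>: "0 < \<epsilon> \<Longrightarrow> torus_prob L \<mu> \<epsilon>"
proof -
  assume e: "0 < \<epsilon>"
  interpret prob_space \<mu> by (rule prob_space_\<mu>)
  show "torus_prob L \<mu> \<epsilon>"
    by unfold_locales (use L e emeasure_space_1 in auto)
qed

lemma Kr_\<mu>:
  assumes e: "0 < \<epsilon>" and g: "g \<in> bdd_borel"
  shows "Kr L \<mu> \<epsilon> g x = Kr L (cell_measure L) \<epsilon> (\<lambda>y. exp (f y) * g y) x"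
  unfolding Kr_def using bdd_borel_measurable[OF bdd_borel_mult[OF bdd_borel_rgauss_per(2)[OF L e, of x] g]]
  by (subst integral_\<mu>) (auto simp: mult_ac)

lemma Kr_cell_measure_const: "0 < \<epsilon> \<Longrightarrow> Kr L (cell_measure L) \<epsilon> (\<lambda>_. c) (x :: real ^ 'd) = c"
  using C.Kr_cmult[of \<epsilon> c "\<lambda>_. 1" x] C.Kr_cell_measure_one[of \<epsilon> x] by simp

text \<open>The factor \<open>exp (2 * \<epsilon>0 * B)\<close> is the loss of the iteration,
  \<open>gmax\<close> is taken at the time it reaches, and the root bounds the integral of
  \<open>mass_wt\<close>. The factor \<open>exp (2 * B)\<close> is added so that the same number
  also bounds \<open>mass_wt\<close> everywhere and both reciprocals.\<close>

definition weight_bound :: "real \<Rightarrow> real" where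
  "weight_bound \<epsilon>0 = exp (2 * B) * (exp (2 * \<epsilon>0 * B) * gmax TYPE('d) L (2 * \<epsilon>0) * sqrt (L ^ CARD('d)))"

lemma weight_bound_pos: "0 < weight_bound \<epsilon>0"
  unfolding weight_bound_def using gmax_pos[OF L, where 'd='d] L by simp

context
  fixes \<epsilon> \<epsilon>0 :: real
  assumes e: "0 < \<epsilon>" and e0: "\<epsilon> \<le> \<epsilon>0"
begin

interpretation T: torus_prob L \<mu> \<epsilon> by (rule torus_prob_\<mu>[OF e])

abbreviation "u \<equiv> T.sinkhorn_wt"

text \<open>With these, the Sinkhorn equation reads \<open>inv_wt = C\<^sub>\<epsilon> mass_wt\<close> and \<open>mass_wt inv_wt = exp f\<close>.\<close>

definition mass_wt :: "real ^ 'd \<Rightarrow> real" where "mass_wt x = exp (f x) * u x"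
definition inv_wt :: "real ^ 'd \<Rightarrow> real" where "inv_wt x = 1 / u x"

lemma mass_wt_bdd_borel: "mass_wt \<in> bdd_borel"
  unfolding mass_wt_def[abs_def] by (intro bdd_borel_mult expf_bdd_borel T.sinkhorn_wt_bdd_borel)

lemma mass_wt_pos: "0 < mass_wt x" and inv_wt_pos: "0 < inv_wt x"
  by (simp_all add: mass_wt_def inv_wt_def T.sinkhorn_wt_pos)

lemma inv_wt_eq: "inv_wt = Kr L (cell_measure L) \<epsilon> mass_wt"
  unfolding inv_wt_def[abs_def] mass_wt_def[abs_def] Kr_\<mu>[OF e T.sinkhorn_wt_bdd_borel, symmetric] T.Kr_sinkhorn_wt by simp

lemma inv_wt_bdd_borel: "inv_wt \<in> bdd_borel"
  unfolding inv_wt_eq by (intro C.Kr_bdd_borel e mass_wt_bdd_borel)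

lemma mass_wt_inv_wt: "mass_wt x * inv_wt x = exp (f x)"
  using T.sinkhorn_wt_pos[of x] by (simp add: mass_wt_def inv_wt_def)

text \<open>The tangent of exp at the mean lies below it, and averages of constants are exact. The
  halved exponent prepares for \<open>cauchy_schwarz\<close>, where \<open>exp (f / 2)\<close> is
  the geometric mean of \<open>mass_wt\<close> and \<open>inv_wt\<close>.\<close>

lemma jensen: "exp (Kr L (cell_measure L) \<epsilon> f x / 2) \<le> Kr L (cell_measure L) \<epsilon> (\<lambda>y. exp (f y / 2)) x"
proof -
  define m where "m = Kr L (cell_measure L) \<epsilon> f x / 2"
  have q: "(\<lambda>y. exp (f y / 2)) \<in> bdd_borel" using exp_bdd_borel[of "1 / 2"] by simp
  have h: "(\<lambda>y. exp m * (1 - m) + exp m / 2 * f y) \<in> bdd_borel"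
    by (intro bdd_borel_add bdd_borel_const bdd_borel_cmult f_bdd_borel)
  have "exp m = exp m * (1 - m) + exp m / 2 * Kr L (cell_measure L) \<epsilon> f x"
    by (simp add: m_def algebra_simps)
  also have "\<dots> = Kr L (cell_measure L) \<epsilon> (\<lambda>y. exp m * (1 - m) + exp m / 2 * f y) x"
    by (simp only: C.Kr_add[OF e bdd_borel_const bdd_borel_cmult[OF f_bdd_borel]] Kr_cell_measure_const[OF e] C.Kr_cmult)
  also have "\<dots> \<le> Kr L (cell_measure L) \<epsilon> (\<lambda>y. exp (f y / 2)) x"
  proof (rule C.Kr_mono[OF e h q], rule AE_I2)
    fix y
    have "exp m * (1 + (f y / 2 - m)) \<le> exp m * exp (f y / 2 - m)"
      by (intro mult_left_mono exp_ge_add_one_self) auto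
    also have "\<dots> = exp (f y / 2)" by (simp add: exp_add[symmetric])
    finally show "exp m * (1 - m) + exp m / 2 * f y \<le> exp (f y / 2)" by (simp add: algebra_simps)
  qed
  finally show ?thesis by (simp add: m_def)
qed

text \<open>For the average C this is (C sqrt(a b))^2 \<le> (C a) (C b) with C a = b by the Sinkhorn
  equation. It is obtained from the inequality of arithmetic and geometric means with a free
  parameter s.\<close>

lemma cauchy_schwarz: "(Kr L (cell_measure L) \<epsilon> (\<lambda>y. exp (f y / 2)) x)\<^sup>2 \<le> inv_wt x * Kr L (cell_measure L) \<epsilon> inv_wt x"
proof -
  define k where "k = Kr L (cell_measure L) \<epsilon> inv_wt x"
  have k: "0 < k"
  proof -
    have "0 < gmin TYPE('d) L \<epsilon> * (LINT y|cell_measure L. inv_wt y)"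
    proof (intro mult_pos_pos gmin_pos e)
      have "(LINT y|cell_measure L. inv_wt y) \<noteq> 0"
      proof
        assume "(LINT y|cell_measure L. inv_wt y) = 0"
        then have "AE y in cell_measure L. inv_wt y = 0"
          by (subst (asm) integral_nonneg_eq_0_iff_AE[OF C.integrable_\<mu>[OF inv_wt_bdd_borel]]) (auto intro: less_imp_le[OF inv_wt_pos])
        then have "AE y in (cell_measure L :: (real ^ 'd) measure). False"
          by eventually_elim (use inv_wt_pos in \<open>metis less_irrefl\<close>)
        then show False
          using emeasure_cell_measure[OF L, where 'd='d] L by (subst (asm) AE_iff_measurable[where N=UNIV]) auto
      qed
      moreover have "0 \<le> (LINT y|cell_measure L. inv_wt y)" by (intro integral_nonneg_AE AE_I2 less_imp_le inv_wt_pos)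
      ultimately show "0 < (LINT y|cell_measure L. inv_wt y)" by simp
    qed
    also have "\<dots> \<le> k" unfolding k_def by (rule C.Kr_pos(1)[OF e inv_wt_bdd_borel]) (auto intro: less_imp_le[OF inv_wt_pos])
    finally show ?thesis .
  qed
  \<comment> \<open>The optimal parameter: it makes the two averages in the arithmetic mean equal at
    x, \<open>s * inv_wt x = k / s\<close>.\<close>
  define s where "s = sqrt (k / inv_wt x)"
  have s: "0 < s" and s2: "s * s = k / inv_wt x" using k inv_wt_pos[of x] by (auto simp: s_def)
  have q: "(\<lambda>y. exp (f y / 2)) \<in> bdd_borel" using exp_bdd_borel[of "1 / 2"] by simp
  have h: "(\<lambda>y. s / 2 * mass_wt y + 1 / (2 * s) * inv_wt y) \<in> bdd_borel" by (intro bdd_borel_add bdd_borel_cmult mass_wt_bdd_borel inv_wt_bdd_borel)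
  have "Kr L (cell_measure L) \<epsilon> (\<lambda>y. exp (f y / 2)) x \<le> Kr L (cell_measure L) \<epsilon> (\<lambda>y. s / 2 * mass_wt y + 1 / (2 * s) * inv_wt y) x"
  proof (rule C.Kr_mono[OF e q h], rule AE_I2)
    fix y
    have "exp (f y / 2) = sqrt (mass_wt y * inv_wt y)" unfolding mass_wt_inv_wt
      by (rule real_sqrt_unique[symmetric]) (simp_all add: power2_eq_square exp_add[symmetric])
    also have "\<dots> = sqrt ((s * mass_wt y) * (inv_wt y / s))" using s by simp
    also have "\<dots> \<le> (s * mass_wt y + inv_wt y / s) / 2"
      using s mass_wt_pos[of y] inv_wt_pos[of y] by (intro arith_geo_mean_sqrt) auto
    finally show "exp (f y / 2) \<le> s / 2 * mass_wt y + 1 / (2 * s) * inv_wt y" using s by (simp add: field_simps)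
  qed
  also have "\<dots> = s / 2 * inv_wt x + 1 / (2 * s) * k"
    unfolding k_def by (simp only: C.Kr_add[OF e bdd_borel_cmult[OF mass_wt_bdd_borel] bdd_borel_cmult[OF inv_wt_bdd_borel]] C.Kr_cmult inv_wt_eq[symmetric])
  also have "\<dots> = s * inv_wt x"
  proof -
    have "k = s * s * inv_wt x" using s2 inv_wt_pos[of x] by simp
    then show ?thesis using s by (simp add: field_simps)
  qed
  finally have "Kr L (cell_measure L) \<epsilon> (\<lambda>y. exp (f y / 2)) x \<le> s * inv_wt x" .
  moreover have "0 \<le> Kr L (cell_measure L) \<epsilon> (\<lambda>y. exp (f y / 2)) x"
    using jensen[of x] exp_ge_zero order_trans by blast
  ultimately have "(Kr L (cell_measure L) \<epsilon> (\<lambda>y. exp (f y / 2)) x)\<^sup>2 \<le> (s * inv_wt x)\<^sup>2" by (intro power_mono)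
  also have "\<dots> = (s * s) * (inv_wt x * inv_wt x)" by (simp add: power2_eq_square mult_ac)
  also have "\<dots> = inv_wt x * k" unfolding s2 using inv_wt_pos[of x] by simp
  finally show ?thesis by (simp add: k_def)
qed

text \<open>With a = \<open>mass_wt\<close> and b = \<open>inv_wt\<close>, squaring
  \<open>jensen\<close> and using \<open>f_heat\<close> gives a b exp(-\<epsilon> B) \<le> b (C b).
  The factor b cancels, and C b is the average of a over time 2 \<epsilon>.\<close>

lemma mass_wt_le_step: "AE x in lborel. mass_wt x \<le> exp (\<epsilon> * B) * Kr L (cell_measure L) (2 * \<epsilon>) mass_wt x"
  using f_heat[OF e]
proof eventually_elim
  case (elim x)
  let ?q = "Kr L (cell_measure L) \<epsilon> (\<lambda>y. exp (f y / 2)) x"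
  have "exp (f x / 2 - \<epsilon> * B / 2) \<le> exp (Kr L (cell_measure L) \<epsilon> f x / 2)" using elim by simp
  also have "\<dots> \<le> ?q" by (rule jensen)
  finally have "(exp (f x / 2 - \<epsilon> * B / 2))\<^sup>2 \<le> ?q\<^sup>2" by (intro power_mono) auto
  also have "\<dots> \<le> inv_wt x * Kr L (cell_measure L) \<epsilon> inv_wt x" by (rule cauchy_schwarz)
  also have "Kr L (cell_measure L) \<epsilon> inv_wt x = Kr L (cell_measure L) (2 * \<epsilon>) mass_wt x"
    using C.Kr_semigroup[OF e e mass_wt_bdd_borel, of x] inv_wt_eq by simp
  also have "(exp (f x / 2 - \<epsilon> * B / 2))\<^sup>2 = exp (f x) * exp (- (\<epsilon> * B))"
    by (simp add: exp_add[symmetric] exp_double[symmetric] algebra_simps)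
  also have "exp (f x) = mass_wt x * inv_wt x" by (simp add: mass_wt_inv_wt)
  finally have "mass_wt x * exp (- (\<epsilon> * B)) \<le> Kr L (cell_measure L) (2 * \<epsilon>) mass_wt x"
    using inv_wt_pos[of x] by (simp add: mult_ac)
  then have "exp (\<epsilon> * B) * (mass_wt x * exp (- (\<epsilon> * B))) \<le> exp (\<epsilon> * B) * Kr L (cell_measure L) (2 * \<epsilon>) mass_wt x"
    by (intro mult_left_mono) auto
  then show ?case by (simp add: exp_minus field_simps)
qed

text \<open>An average preserves a bound valid almost everywhere. Each round adds 2 \<epsilon> to
  the time and \<epsilon> B to the exponent, so about \<epsilon>0 / \<epsilon> rounds cost a factor
  bounded in \<epsilon>.\<close>

lemma mass_wt_le_iter: "AE x in lborel. mass_wt x \<le> exp (real (Suc n) * \<epsilon> * B) * Kr L (cell_measure L) (2 * (real (Suc n) * \<epsilon>)) mass_wt x"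
proof (induction n)
  case 0 then show ?case using mass_wt_le_step by simp
next
  case (Suc n)
  let ?t = "2 * (real (Suc n) * \<epsilon>)" and ?E = "exp (real (Suc n) * \<epsilon> * B)"
  have t: "0 < ?t" and e2: "0 < 2 * \<epsilon>" using e by auto
  show ?case
    using mass_wt_le_step
  proof eventually_elim
    case (elim x)
    have b: "(\<lambda>x. ?E * Kr L (cell_measure L) ?t mass_wt x) \<in> bdd_borel" by (intro bdd_borel_cmult C.Kr_bdd_borel t mass_wt_bdd_borel)
    have "Kr L (cell_measure L) (2 * \<epsilon>) mass_wt x \<le> Kr L (cell_measure L) (2 * \<epsilon>) (\<lambda>x. ?E * Kr L (cell_measure L) ?t mass_wt x) x"
      by (rule C.Kr_mono[OF e2 mass_wt_bdd_borel b AE_cmI[OF Suc]])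
    also have "\<dots> = ?E * Kr L (cell_measure L) (2 * \<epsilon> + ?t) mass_wt x"
      unfolding C.Kr_cmult C.Kr_semigroup[OF e2 t mass_wt_bdd_borel] ..
    finally have "exp (\<epsilon> * B) * Kr L (cell_measure L) (2 * \<epsilon>) mass_wt x \<le> exp (\<epsilon> * B) * (?E * Kr L (cell_measure L) (2 * \<epsilon> + ?t) mass_wt x)"
      by (intro mult_left_mono) auto
    also have "\<dots> = exp (real (Suc (Suc n)) * \<epsilon> * B) * Kr L (cell_measure L) (2 * (real (Suc (Suc n)) * \<epsilon>)) mass_wt x"
      by (simp add: mult.assoc[symmetric] exp_add[symmetric]) (simp add: algebra_simps)
    finally show ?case using elim by simp
  qed
qed

text \<open>The energy identity makes the square integral of the half-time average equal to the
  integral of a b = \<rho>, which is 1, and this average has the same integral as a. Cauchy-Schwarz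
  on a torus of volume L^d concludes.\<close>

lemma mass_wt_integral: "(LINT y|cell_measure L. mass_wt y) \<le> sqrt (L ^ CARD('d))"
proof -
  have e2: "0 < \<epsilon> / 2" using e by simp
  let ?k = "Kr L (cell_measure L) (\<epsilon> / 2) mass_wt"
  have kb: "?k \<in> bdd_borel" by (intro C.Kr_bdd_borel e2 mass_wt_bdd_borel)
  have k2: "(\<lambda>y. (?k y)\<^sup>2) \<in> bdd_borel" unfolding power2_eq_square by (intro bdd_borel_mult kb)
  have V: "0 < L ^ CARD('d)" using L by simp
  have "(LINT x|cell_measure L. 1 * ?k x) = (LINT y|cell_measure L. mass_wt y * Kr L (cell_measure L) (\<epsilon> / 2) (\<lambda>_. 1) y)"
    by (rule C.Kr_symmetric[OF C.torus_measure_axioms e2 mass_wt_bdd_borel bdd_borel_const])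
  then have m: "(LINT x|cell_measure L. ?k x) = (LINT y|cell_measure L. mass_wt y)" by (simp add: Kr_cell_measure_const[OF e2])
  have "(LINT x|cell_measure L. (?k x)\<^sup>2) = (LINT y|cell_measure L. mass_wt y * Kr L (cell_measure L) \<epsilon> mass_wt y)"
    by (rule C.Kr_energy[OF e mass_wt_bdd_borel, symmetric])
  also have "\<dots> = (LINT y|cell_measure L. exp (f y))" by (simp add: inv_wt_eq[symmetric] mass_wt_inv_wt)
  finally have E: "(LINT x|cell_measure L. (?k x)\<^sup>2) = 1" using mass by simp
  \<comment> \<open>The mean of \<open>?k\<close>, so that the next line is the nonnegativity of its
    variance.\<close>
  define c where "c = (LINT y|cell_measure L. mass_wt y) / L ^ CARD('d)"
  have "0 \<le> (LINT x|cell_measure L. (?k x - c)\<^sup>2)" by simp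
  also have "\<dots> = (LINT x|cell_measure L. (?k x)\<^sup>2 - 2 * c * ?k x + c\<^sup>2)"
    by (intro Bochner_Integration.integral_cong refl) (simp add: power2_diff algebra_simps)
  also have "\<dots> = 1 - 2 * c * (LINT y|cell_measure L. mass_wt y) + c\<^sup>2 * L ^ CARD('d)"
    using C.integrable_\<mu>[OF k2] C.integrable_\<mu>[OF kb] by (simp add: E m measure_cell_measure[OF L])
  also have "\<dots> = 1 - (LINT y|cell_measure L. mass_wt y)\<^sup>2 / L ^ CARD('d)"
    using V by (simp add: c_def power2_eq_square field_simps)
  finally have "(LINT y|cell_measure L. mass_wt y)\<^sup>2 \<le> L ^ CARD('d)" using V by simp
  then show ?thesis by (rule real_le_rsqrt)
qed

lemma gmax_antimono: "0 < s \<Longrightarrow> s \<le> t \<Longrightarrow> gmax TYPE('d) L t \<le> gmax TYPE('d) L s"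
  unfolding gmax_def using L by (intro divide_right_mono mult_left_mono) (auto intro!: divide_left_mono)

lemma mass_wt_le_AE: "AE x in lborel. mass_wt x \<le> weight_bound \<epsilon>0 * exp (- (2 * B))"
proof -
  \<comment> \<open>With the ceiling of \<epsilon>0 / \<epsilon> rounds the product
    \<open>real (Suc n) * \<epsilon>\<close> lies between \<epsilon>0 and 2 \<epsilon>0: the kernel
    time is at least 2 \<epsilon>0 and the accumulated exponent at most 2 \<epsilon>0 B.\<close>
  define n where "n = nat \<lceil>\<epsilon>0 / \<epsilon>\<rceil> - 1"
  have "1 \<le> \<epsilon>0 / \<epsilon>" using e e0 by simp
  then have n: "real (Suc n) = real_of_int \<lceil>\<epsilon>0 / \<epsilon>\<rceil>"
    unfolding n_def by (simp add: Suc_diff_1)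
  have "\<epsilon>0 / \<epsilon> \<le> real (Suc n)" "real (Suc n) \<le> \<epsilon>0 / \<epsilon> + 1" unfolding n by linarith+
  then have N: "\<epsilon>0 \<le> real (Suc n) * \<epsilon>" "real (Suc n) * \<epsilon> \<le> 2 * \<epsilon>0"
    using e e0 by (auto simp: field_simps)
  let ?t = "2 * (real (Suc n) * \<epsilon>)"
  have e00: "0 < 2 * \<epsilon>0" "2 * \<epsilon>0 \<le> ?t" using e e0 N by auto
  have t: "0 < ?t" using e00 by linarith
  show ?thesis
    using mass_wt_le_iter[of n]
  proof eventually_elim
    case (elim x)
    have "Kr L (cell_measure L) ?t mass_wt x \<le> gmax TYPE('d) L ?t * (LINT y|cell_measure L. mass_wt y)"
      by (rule C.Kr_pos(2)[OF t mass_wt_bdd_borel]) (auto intro: less_imp_le[OF mass_wt_pos])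
    also have "\<dots> \<le> gmax TYPE('d) L (2 * \<epsilon>0) * sqrt (L ^ CARD('d))"
      by (intro mult_mono gmax_antimono e00 mass_wt_integral less_imp_le[OF gmax_pos[OF L]] integral_nonneg_AE AE_I2 less_imp_le[OF mass_wt_pos])
    finally have K: "Kr L (cell_measure L) ?t mass_wt x \<le> gmax TYPE('d) L (2 * \<epsilon>0) * sqrt (L ^ CARD('d))" .
    have K0: "0 \<le> Kr L (cell_measure L) ?t mass_wt x"
      unfolding Kr_def by (intro integral_nonneg_AE AE_I2 mult_nonneg_nonneg less_imp_le[OF mass_wt_pos] less_imp_le[OF rgauss_per_pos[OF L t]])
    have "real (Suc n) * \<epsilon> * B \<le> 2 * \<epsilon>0 * B" by (intro mult_right_mono N B_nonneg)
    then have "exp (real (Suc n) * \<epsilon> * B) * Kr L (cell_measure L) ?t mass_wt x \<le> exp (2 * \<epsilon>0 * B) * (gmax TYPE('d) L (2 * \<epsilon>0) * sqrt (L ^ CARD('d)))"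
      by (intro mult_mono K K0) auto
    with elim have "mass_wt x \<le> exp (2 * \<epsilon>0 * B) * (gmax TYPE('d) L (2 * \<epsilon>0) * sqrt (L ^ CARD('d)))" by linarith
    also have "\<dots> = weight_bound \<epsilon>0 * exp (- (2 * B))" by (simp add: weight_bound_def exp_minus field_simps)
    finally show ?case .
  qed
qed

lemma weight_bound_bounds:
  shows "inv_wt x \<le> weight_bound \<epsilon>0" "1 / weight_bound \<epsilon>0 \<le> inv_wt x" "mass_wt x \<le> weight_bound \<epsilon>0" "1 / weight_bound \<epsilon>0 \<le> mass_wt x"
proof -
  let ?A = "weight_bound \<epsilon>0 * exp (- (2 * B))"
  have A: "0 < ?A" using weight_bound_pos by simp
  \<comment> \<open>An average ignores null sets, so the bound on \<open>mass_wt\<close> almost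
    everywhere becomes one on \<open>inv_wt\<close> at every point; the relation
    \<open>mass_wt_inv_wt\<close> returns it to \<open>mass_wt\<close>, again at every
    point.\<close>
  have b1: "inv_wt y \<le> ?A" for y
  proof -
    have "inv_wt y \<le> Kr L (cell_measure L) \<epsilon> (\<lambda>_. ?A) y"
      unfolding inv_wt_eq by (rule C.Kr_mono[OF e mass_wt_bdd_borel bdd_borel_const AE_cmI[OF mass_wt_le_AE]])
    then show ?thesis by (simp add: Kr_cell_measure_const[OF e])
  qed
  have a1: "exp (- B) / ?A \<le> mass_wt y" for y
  proof -
    have "exp (- B) \<le> mass_wt y * inv_wt y" unfolding mass_wt_inv_wt by (rule expf_bounds)
    also have "\<dots> \<le> mass_wt y * ?A" by (intro mult_left_mono b1 less_imp_le[OF mass_wt_pos])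
    finally show ?thesis using A by (simp add: pos_divide_le_eq)
  qed
  have b2: "exp (- B) / ?A \<le> inv_wt y" for y
  proof -
    have "Kr L (cell_measure L) \<epsilon> (\<lambda>_. exp (- B) / ?A) y \<le> inv_wt y"
      unfolding inv_wt_eq by (rule C.Kr_mono[OF e bdd_borel_const mass_wt_bdd_borel AE_I2[OF a1]])
    then show ?thesis by (simp only: Kr_cell_measure_const[OF e])
  qed
  have AA: "?A \<le> weight_bound \<epsilon>0" using weight_bound_pos B_nonneg by (simp add: mult_le_cancel_left1)
  have "1 / weight_bound \<epsilon>0 \<le> exp (- B) / ?A"
    using weight_bound_pos[of \<epsilon>0] B_nonneg by (simp add: divide_simps exp_add[symmetric] flip: exp_minus)
  then show "inv_wt x \<le> weight_bound \<epsilon>0" "1 / weight_bound \<epsilon>0 \<le> inv_wt x" "1 / weight_bound \<epsilon>0 \<le> mass_wt x"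
    using b1[of x] b2[of x] a1[of x] AA by linarith+
  have "mass_wt x * (exp (- B) / ?A) \<le> mass_wt x * inv_wt x" by (intro mult_left_mono b2 less_imp_le[OF mass_wt_pos])
  also have "\<dots> \<le> exp B" unfolding mass_wt_inv_wt by (rule expf_bounds)
  finally have "mass_wt x * exp (- B) \<le> exp B * ?A" using A by (simp add: field_simps)
  then have "mass_wt x * exp (- B) * exp B \<le> exp B * ?A * exp B" by (intro mult_right_mono) auto
  also have "exp B * ?A * exp B = weight_bound \<epsilon>0 * (exp B * exp B * exp (- (2 * B)))" by (simp add: mult_ac)
  also have "exp B * exp B * exp (- (2 * B)) = 1" by (simp add: exp_add[symmetric])
  finally show "mass_wt x \<le> weight_bound \<epsilon>0" by (simp add: mult.assoc exp_add[symmetric])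
qed

end

end

section \<open>A localised energy estimate\<close>

lemma
  fixes h :: "real ^ 'd::finite \<Rightarrow> 'b::{banach,second_countable_topology}"
  assumes c: "c \<noteq> 0" and [measurable]: "h \<in> borel_measurable borel"
  shows integral_lborel_affine: "(LINT y|lborel. h y) = (\<bar>c\<bar> ^ CARD('d)) *\<^sub>R (LINT y|lborel. h (t + c *\<^sub>R y))"
    and integrable_lborel_affine: "integrable lborel h \<Longrightarrow> integrable lborel (\<lambda>y. h (t + c *\<^sub>R y))"
proof -
  have A: "(lborel :: (real ^ 'd) measure) = density (distr lborel borel (\<lambda>x. t + c *\<^sub>R x)) (\<lambda>_. ennreal (\<bar>c\<bar> ^ CARD('d)))"
    using lborel_affine[OF c, of t] by (simp add: ennreal_power)
  show "(LINT y|lborel. h y) = (\<bar>c\<bar> ^ CARD('d)) *\<^sub>R (LINT y|lborel. h (t + c *\<^sub>R y))"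
    by (subst A, subst integral_density) (simp_all add: integral_distr)
  assume "integrable lborel h"
  then have "integrable (density (distr lborel borel (\<lambda>x. t + c *\<^sub>R x)) (\<lambda>_. ennreal (\<bar>c\<bar> ^ CARD('d)))) h"
    using A by simp
  then have "integrable lborel (\<lambda>x. (\<bar>c\<bar> ^ CARD('d)) *\<^sub>R h (t + c *\<^sub>R x))"
    by (subst (asm) integrable_density) (auto simp: integrable_distr_eq)
  then have "integrable lborel (\<lambda>x. (1 / \<bar>c\<bar> ^ CARD('d)) *\<^sub>R ((\<bar>c\<bar> ^ CARD('d)) *\<^sub>R h (t + c *\<^sub>R x)))"
    by (rule integrable_scaleR_right)
  then show "integrable lborel (\<lambda>y. h (t + c *\<^sub>R y))"
    using c by simp
qed

text \<open>This norm makes the exponential weight a product over coordinates, which reduces its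
  integrability to one dimension.\<close>

definition l1_norm :: "real ^ 'd::finite \<Rightarrow> real" where
  "l1_norm x = (\<Sum>k\<in>UNIV. \<bar>x $ k\<bar>)"

lemma l1_norm_nonneg [simp]: "0 \<le> l1_norm x"
  by (simp add: l1_norm_def sum_nonneg)

lemma l1_norm_minus: "l1_norm (x - y) = l1_norm (y - x)"
  by (simp add: l1_norm_def abs_minus_commute)

lemma l1_norm_triangle: "l1_norm x \<le> l1_norm y + l1_norm (x - y)"
  unfolding l1_norm_def sum.distrib[symmetric] by (intro sum_mono) simp

lemma l1_norm_le: "l1_norm (x :: real ^ 'd::finite) \<le> real CARD('d) * norm x"
proof -
  have "l1_norm x \<le> (\<Sum>k\<in>(UNIV::'d set). norm x)"
    unfolding l1_norm_def by (intro sum_mono component_le_norm_cart)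
  then show ?thesis by simp
qed

lemma measurable_l1_norm [measurable]: "l1_norm \<in> borel_measurable borel"
  unfolding l1_norm_def[abs_def] by measurable

lemma integrable_exp_neg_abs:
  assumes "0 < c"
  shows "integrable lborel (\<lambda>t::real. exp (- c * \<bar>t\<bar>))"
proof -
  have h: "((\<lambda>t. exp (- c * t)) has_integral exp (- c * 0) / c) {0..}"
    using has_integral_exp_minus_to_infinity[OF assms, of 0] by simp
  have "(\<lambda>t. exp (- c * t)) absolutely_integrable_on {0..}"
    using h by (intro nonnegative_absolutely_integrable_1) (auto simp: integrable_on_def)
  then have "set_integrable lebesgue {0..} (\<lambda>t. exp (- c * t))" .
  then have 1: "integrable lborel (\<lambda>t. indicator {0..} t * exp (- c * t))"
    unfolding set_integrable_def by (subst (asm) integrable_completion) auto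
  have 2: "integrable lborel (\<lambda>t. indicator {0..} (0 + (-1) * t) * exp (- c * (0 + (-1) * t)))"
    using lborel_integrable_real_affine[OF 1, of "-1" 0] by simp
  show ?thesis
    by (rule Bochner_Integration.integrable_bound[OF Bochner_Integration.integrable_add[OF 1 2]])
      (auto simp: indicator_def)
qed

definition exp_weight :: "real \<Rightarrow> real ^ 'd::finite \<Rightarrow> real" where
  "exp_weight \<eta> x = exp (- \<eta> * l1_norm x)"

lemma exp_weight_pos: "0 < exp_weight \<eta> x"
  by (simp add: exp_weight_def)

lemma measurable_exp_weight [measurable]: "exp_weight \<eta> \<in> borel_measurable borel"
  unfolding exp_weight_def[abs_def] by measurable

lemma integrable_exp_weight:
  assumes "0 < \<eta>"
  shows "integrable lborel (exp_weight \<eta> :: real ^ 'd::finite \<Rightarrow> real)"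
proof -
  have "exp_weight \<eta> x = (\<Prod>k\<in>UNIV. exp (- \<eta> * \<bar>x $ k\<bar>))" for x :: "real ^ 'd"
    by (simp add: exp_weight_def l1_norm_def exp_sum[symmetric] sum_distrib_left sum_negf)
  then show ?thesis
    using integrable_lborel_vec_prod[of "\<lambda>(k::'d) t. exp (- \<eta> * \<bar>t\<bar>)"] integrable_exp_neg_abs[OF assms]
    by (simp add: fun_eq_iff[symmetric] cong: Bochner_Integration.integrable_cong)
qed

lemma exp_weight_le_1: "0 \<le> \<eta> \<Longrightarrow> exp_weight \<eta> x \<le> 1"
  by (simp add: exp_weight_def)

text \<open>The relative variation of the weight is of order \<eta>, at the price of an exponential
  in the distance that the Gaussian kernel absorbs.\<close>

lemma exp_weight_diff:
  assumes \<eta>: "0 \<le> \<eta>" "\<eta> \<le> 1"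
  shows "\<bar>exp_weight \<eta> x - exp_weight \<eta> y\<bar> \<le> exp_weight \<eta> y * (\<eta> * exp (l1_norm (x - y)))"
proof -
  define s where "s = l1_norm (x - y)"
  have s: "0 \<le> s" by (simp add: s_def)
  define a where "a = \<eta> * (l1_norm y - l1_norm x)"
  have a: "\<bar>a\<bar> \<le> \<eta> * s"
    unfolding a_def s_def abs_mult using \<eta> l1_norm_triangle[of x y] l1_norm_triangle[of y x] l1_norm_minus[of x y]
    by (intro mult_mono) auto
  have ex: "exp_weight \<eta> x = exp_weight \<eta> y * exp a"
    by (simp add: exp_weight_def a_def exp_add[symmetric] algebra_simps)
  have "\<bar>exp a - 1\<bar> \<le> exp (\<eta> * s) - 1"
  proof (cases "0 \<le> a")
    case True then show ?thesis using a by simp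
  next
    case False
    have "1 - exp a \<le> - a" using exp_ge_add_one_self[of a] by linarith
    also have "\<dots> \<le> \<eta> * s" using a by simp
    also have "\<dots> \<le> exp (\<eta> * s) - 1" using exp_ge_add_one_self[of "\<eta> * s"] by linarith
    finally show ?thesis using False by simp
  qed
  also have "\<dots> \<le> \<eta> * exp s"
  proof -
    \<comment> \<open>Convexity between 0 and s extracts the factor \<eta>; this is where \<eta>
      \<le> 1 is used.\<close>
    have "exp ((1 - \<eta>) *\<^sub>R 0 + \<eta> *\<^sub>R s) \<le> (1 - \<eta>) * exp 0 + \<eta> * exp s"
      by (rule convex_onD[OF exp_convex]) (use \<eta> in auto)
    then show ?thesis using \<eta> by simp
  qed
  finally have "exp_weight \<eta> y * \<bar>exp a - 1\<bar> \<le> exp_weight \<eta> y * (\<eta> * exp s)"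
    by (intro mult_left_mono less_imp_le[OF exp_weight_pos])
  moreover have "\<bar>exp_weight \<eta> x - exp_weight \<eta> y\<bar> = exp_weight \<eta> y * \<bar>exp a - 1\<bar>"
  proof -
    have "exp_weight \<eta> x - exp_weight \<eta> y = exp_weight \<eta> y * (exp a - 1)" unfolding ex by (simp add: right_diff_distrib)
    then show ?thesis using exp_weight_pos[of \<eta> y] by (simp add: abs_mult)
  qed
  ultimately show ?thesis by (simp add: s_def)
qed

text \<open>Young's inequality hides the linear exponent in half of the Gaussian one. It bounds the
  mass of the kernel of the localisation error.\<close>

lemma exp_l1_norm_rgauss_le:
  "exp (l1_norm z) * rgauss 1 z \<le> exp ((real CARD('d))\<^sup>2) * 2 powr (CARD('d) / 2) * rgauss 2 (z :: real ^ 'd::finite)"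
proof -
  let ?d = "real CARD('d)" and ?r = "norm z"
  have "0 \<le> (?r / 2 - ?d)\<^sup>2" by simp
  then have "?d * ?r \<le> ?r\<^sup>2 / 4 + ?d\<^sup>2" by (simp add: power2_eq_square field_simps)
  with l1_norm_le[of z] have "l1_norm z \<le> ?d\<^sup>2 + ?r\<^sup>2 / (4 * 1)" by simp
  then have "exp (l1_norm z) \<le> exp (?d\<^sup>2) * exp (?r\<^sup>2 / (4 * 1))" by (simp add: exp_add[symmetric])
  then have "exp (l1_norm z) * rgauss 1 z \<le> exp (?d\<^sup>2) * exp (?r\<^sup>2 / (4 * 1)) * rgauss 1 z"
    using rgauss_pos[of 1 z] by (intro mult_right_mono) auto
  also have "\<dots> = exp (?d\<^sup>2) * (2 powr (CARD('d) / 2) * rgauss (2 * 1) z)"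
    unfolding mult.assoc rgauss_exp_double[OF zero_less_one] ..
  finally show ?thesis by (simp add: mult.assoc)
qed

text \<open>The Gaussian decays faster than any exponential, with one constant for all \<eta> \<le>
  1. It leads from the weighted square integral back to a Gaussian average.\<close>

lemma rgauss_le_exp_weight:
  assumes \<eta>: "0 \<le> \<eta>" "\<eta> \<le> 1"
  shows "rgauss 1 (z :: real ^ 'd::finite) \<le> exp (2 * (real CARD('d))\<^sup>2) * (exp_weight \<eta> z)\<^sup>2"
proof -
  let ?d = "real CARD('d)" and ?r = "norm z"
  have "0 \<le> (?r - 2 * ?d)\<^sup>2" by simp
  then have q: "2 * (?d * ?r) \<le> ?r\<^sup>2 / 2 + 2 * ?d\<^sup>2" by (simp add: power2_eq_square field_simps)
  have "\<eta> * l1_norm z \<le> 1 * (?d * ?r)" using \<eta> l1_norm_le[of z] by (intro mult_mono) auto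
  with q have "- ?r\<^sup>2 / (2 * 1) \<le> 2 * ?d\<^sup>2 + 2 * (- \<eta> * l1_norm z)" by linarith
  then have "exp (- ?r\<^sup>2 / (2 * 1)) \<le> exp (2 * ?d\<^sup>2) * exp (2 * (- \<eta> * l1_norm z))" by (simp only: exp_add[symmetric] exp_le_cancel_iff)
  also have "exp (2 * (- \<eta> * l1_norm z)) = (exp_weight \<eta> z)\<^sup>2" unfolding exp_weight_def by (rule exp_double)
  finally have "exp (- ?r\<^sup>2 / (2 * 1)) \<le> exp (2 * ?d\<^sup>2) * (exp_weight \<eta> z)\<^sup>2" .
  moreover have "rgauss 1 z \<le> 1 * exp (- ?r\<^sup>2 / (2 * 1))"
    unfolding rgauss_norm
  proof (rule mult_right_mono)
    have "1 \<le> 2 * pi * 1" using pi_gt3 by simp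
    then have "(2 * pi * 1) powr (- real CARD('d) / 2) \<le> (2 * pi * 1) powr 0"
      by (intro powr_mono) auto
    then show "(2 * pi * 1) powr (- real CARD('d) / 2) \<le> 1" by simp
  qed simp
  ultimately show ?thesis by simp
qed

lemma
  fixes F H k :: "real ^ 'd::finite \<Rightarrow> real"
  assumes F: "integrable lborel F" and H: "H \<in> bdd_borel" and k: "integrable lborel k"
  shows conv_fubini: "(LINT z|lborel. H z * (LINT x|lborel. k (z - x) * F x)) = (LINT x|lborel. F x * (LINT z|lborel. k (z - x) * H z))"
    and conv_integrable: "integrable lborel (\<lambda>z. H z * (LINT x|lborel. k (z - x) * F x))"
    and conv_integrable': "integrable lborel (\<lambda>x. F x * (LINT z|lborel. k (z - x) * H z))"
proof -
  have [measurable]: "F \<in> borel_measurable borel" "H \<in> borel_measurable borel" "k \<in> borel_measurable borel"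
    using borel_measurable_integrable[OF F] borel_measurable_integrable[OF k] bdd_borel_measurable[OF H] by auto
  obtain B where B: "\<And>y. norm (H y) \<le> B" "0 \<le> B" using bmE[OF H] by metis
  let ?f = "\<lambda>x z. H z * (k (z - x) * F x)"
  have kt: "integrable lborel (\<lambda>z. k (z - x))" for x
    using integrable_lborel_translate[OF k, of "- x"] by simp
  have kn: "(LINT z|lborel. \<bar>k (z - x)\<bar>) = (LINT z|lborel. \<bar>k z\<bar>)" for x
    using integral_lborel_translate[of "\<lambda>z. \<bar>k z\<bar>" "- x"] by simp
  have i0: "integrable (lborel \<Otimes>\<^sub>M lborel) (\<lambda>(x, z). B * (\<bar>k (z - x)\<bar> * \<bar>F x\<bar>))"
  proof (rule lborel_pair.Fubini_integrable)
    show "integrable lborel (\<lambda>x. LINT z|lborel. norm (case (x, z) of (x, z) \<Rightarrow> B * (\<bar>k (z - x)\<bar> * \<bar>F x\<bar>)))"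
      using F B(2) by (simp add: kn abs_mult)
    show "AE x in lborel. integrable lborel (\<lambda>z. case (x, z) of (x, z) \<Rightarrow> B * (\<bar>k (z - x)\<bar> * \<bar>F x\<bar>))"
      using kt by simp
  qed measurable
  have i: "integrable (lborel \<Otimes>\<^sub>M lborel) (case_prod ?f)"
    by (rule Bochner_Integration.integrable_bound[OF i0]) (use B in \<open>auto simp: abs_mult intro!: mult_right_mono AE_I2\<close>)
  have inner1: "H z * (LINT x|lborel. k (z - x) * F x) = (LINT x|lborel. ?f x z)" for z by simp
  have inner2: "F x * (LINT z|lborel. k (z - x) * H z) = (LINT z|lborel. ?f x z)" for x
    by (simp only: integral_mult_right_zero[symmetric] mult_ac)
  show "(LINT z|lborel. H z * (LINT x|lborel. k (z - x) * F x)) = (LINT x|lborel. F x * (LINT z|lborel. k (z - x) * H z))"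
    unfolding inner1 inner2 by (rule lborel_pair.Fubini_integral[OF i])
  show "integrable lborel (\<lambda>z. H z * (LINT x|lborel. k (z - x) * F x))"
    unfolding inner1 using lborel_pair.integrable_snd[OF i] .
  show "integrable lborel (\<lambda>x. F x * (LINT z|lborel. k (z - x) * H z))"
    unfolding inner2 using lborel_pair.integrable_fst[OF i] .
qed

lemma conv_bdd_borel:
  fixes H k :: "real ^ 'd::finite \<Rightarrow> real"
  assumes H: "H \<in> bdd_borel" and k: "integrable lborel k"
  shows "(\<lambda>x. LINT y|lborel. k (x - y) * H y) \<in> bdd_borel" "integrable lborel (\<lambda>y. k (x - y) * H y)"
proof -
  have [measurable]: "H \<in> borel_measurable borel" "k \<in> borel_measurable borel"
    using borel_measurable_integrable[OF k] bdd_borel_measurable[OF H] by auto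
  obtain B where B: "\<And>y. norm (H y) \<le> B" "0 \<le> B" using bmE[OF H] by metis
  have kt: "integrable lborel (\<lambda>y. k (x - y))" for x
    using integrable_lborel_affine[of "-1" k x] k by simp
  show i: "integrable lborel (\<lambda>y. k (x - y) * H y)" for x
    by (rule integrable_mult_bdd_borel[OF H kt])
  have n: "(LINT y|lborel. \<bar>k (x - y)\<bar>) = (LINT y|lborel. \<bar>k y\<bar>)" for x
    using integral_lborel_affine[of "-1" "\<lambda>z. \<bar>k z\<bar>" x] by simp
  have "norm (LINT y|lborel. k (x - y) * H y) \<le> B * (LINT y|lborel. \<bar>k y\<bar>)" for x
  proof -
    have "norm (LINT y|lborel. k (x - y) * H y) \<le> (LINT y|lborel. B * \<bar>k (x - y)\<bar>)"
    proof (rule Bochner_Integration.integral_norm_bound_integral[OF i])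
      show "norm (k (x - y) * H y) \<le> B * \<bar>k (x - y)\<bar>" for y
        using mult_left_mono[OF B(1)[of y], of "\<bar>k (x - y)\<bar>"] by (simp add: abs_mult mult.commute)
    qed (use kt in auto)
    then show ?thesis by (simp add: n)
  qed
  then show "(\<lambda>x. LINT y|lborel. k (x - y) * H y) \<in> bdd_borel"
    by (rule bmI[rotated]) measurable
qed

lemma rgauss_conv_real:
  fixes x y :: "real ^ 'd::finite"
  assumes s: "0 < s" and t: "0 < t"
  shows "(LINT z|lborel. rgauss s (z - x) * rgauss t (z - y)) = rgauss (s + t) (x - y)"
proof -
  have "complex_of_real (LINT z|lborel. rgauss s (z - x) * rgauss t (z - y)) = complex_of_real (rgauss (s + t) (x - y))"
    using gauss_convolution[OF s t, of "cvec x" y]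
    by (simp add: cvec_diff[symmetric] gauss_cvec flip: of_real_mult)
  then show ?thesis by simp
qed

text \<open>The Gaussian of variance 1 is the convolution square of that of variance 1/2. The
  analogue of \<open>Kr_energy\<close> on R^d is required because localised functions are not
  periodic.\<close>

lemma rgauss_positive_definite:
  fixes F :: "real ^ 'd::finite \<Rightarrow> real"
  assumes F: "integrable lborel F" "F \<in> bdd_borel"
  shows "0 \<le> (LINT x|lborel. F x * (LINT y|lborel. rgauss 1 (x - y) * F y))"
proof -
  let ?g = "rgauss (1 / 2) :: real ^ 'd \<Rightarrow> real"
  have g: "integrable lborel ?g" by (rule integrable_rgauss) simp
  have gb: "(\<lambda>z. ?g (z - x)) \<in> bdd_borel" for x
  proof (rule bdd_borel_translate(2), rule bmI)
    show "norm (?g y) \<le> (2 * pi * (1 / 2)) powr (- real CARD('d) / 2) * 1" for y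
      unfolding rgauss_norm by (simp add: abs_mult mult_left_mono)
  qed measurable
  have sym: "?g (x - z) = ?g (z - x)" for x z by (metis rgauss_minus minus_diff_eq)
  define h where "h z = (LINT x|lborel. ?g (z - x) * F x)" for z
  have hb: "h \<in> bdd_borel" unfolding h_def by (rule conv_bdd_borel(1)[OF F(2) g])
  have inner: "(LINT z|lborel. ?g (z - y) * h z) = (LINT x|lborel. rgauss 1 (y - x) * F x)" for y
  proof -
    have "(LINT z|lborel. ?g (z - y) * h z) = (LINT x|lborel. F x * (LINT z|lborel. ?g (z - x) * ?g (z - y)))"
      unfolding h_def by (rule conv_fubini[OF F(1) gb g])
    also have "\<dots> = (LINT x|lborel. rgauss 1 (y - x) * F x)"
      by (simp add: rgauss_conv_real) (metis (no_types, lifting) rgauss_minus minus_diff_eq mult.commute)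
    finally show ?thesis .
  qed
  have "(LINT z|lborel. h z * h z) = (LINT y|lborel. F y * (LINT z|lborel. ?g (z - y) * h z))"
    using conv_fubini[OF F(1) hb g] by (simp add: h_def)
  also have "\<dots> = (LINT x|lborel. F x * (LINT y|lborel. rgauss 1 (x - y) * F y))" by (simp add: inner)
  finally show ?thesis by (metis (no_types, lifting) integral_nonneg_AE AE_I2 zero_le_square)
qed

definition energy_base :: "'d::finite itself \<Rightarrow> real" where
  "energy_base _ = exp ((real CARD('d))\<^sup>2) * 2 powr (CARD('d) / 2)"

lemma energy_base_pos: "0 < energy_base TYPE('d::finite)"
  by (simp add: energy_base_def)

text \<open>Chosen so that the localisation error, whose kernel has mass at most rate times
  \<open>energy_base\<close>, consumes at most a quarter of c0; the minimum with 1 serves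
  \<open>exp_weight_diff\<close>.\<close>

definition energy_rate :: "'d::finite itself \<Rightarrow> real \<Rightarrow> real" where
  "energy_rate _ c0 = min 1 (c0 / (4 * energy_base TYPE('d)))"

text \<open>Under the root: the factor of \<open>rgauss_le_exp_weight\<close>, the 2 / c0^2 left by
  the coercive estimate, and the total of the squared weight against which the constant E is
  tested.\<close>

definition energy_const :: "'d::finite itself \<Rightarrow> real \<Rightarrow> real" where
  "energy_const _ c0 = sqrt (exp (2 * (real CARD('d))\<^sup>2) * (2 / c0\<^sup>2) * (LINT x|lborel. (exp_weight (energy_rate TYPE('d) c0) (x :: real ^ 'd))\<^sup>2))"

text \<open>
  The weight \<open>exp_weight \<eta>\<close> varies slowly at the scale of the Gaussian, so that the quadratic form of the Gaussian
  stays nearly nonnegative after localisation; the error is absorbed by the coercive term \<open>c0 m\<^sup>2\<close>.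
\<close>

lemma energy_estimate_unit:
  fixes m e :: "real ^ 'd::finite \<Rightarrow> real"
  assumes c0: "0 < c0" and m: "m \<in> bdd_borel" and e: "e \<in> bdd_borel" and E: "\<And>x. \<bar>e x\<bar> \<le> E"
    and eq: "\<And>x. c0 * (m x)\<^sup>2 \<le> - (m x * ((LINT y|lborel. rgauss 1 (x - y) * m y) + e x))"
  shows "(LINT y|lborel. rgauss 1 y * \<bar>m y\<bar>) \<le> energy_const TYPE('d) c0 * E"
proof -
  let ?c = "energy_base TYPE('d)" and ?\<eta> = "energy_rate TYPE('d) c0"
  have \<eta>: "0 < ?\<eta>" "0 \<le> ?\<eta>" "?\<eta> \<le> 1" "?\<eta> * ?c \<le> c0 / 4"
  proof -
    show "0 < ?\<eta>" using c0 energy_base_pos[where 'd='d] by (simp add: energy_rate_def)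
    then show "0 \<le> ?\<eta>" by simp
    show "?\<eta> \<le> 1" by (simp add: energy_rate_def)
    have "?\<eta> \<le> c0 / (4 * ?c)" by (simp add: energy_rate_def)
    then show "?\<eta> * ?c \<le> c0 / 4" using energy_base_pos[where 'd='d] by (simp add: field_simps)
  qed
  have E0: "0 \<le> E" using E[of 0] by linarith
  let ?W = "exp_weight ?\<eta> :: real ^ 'd \<Rightarrow> real"
  have mm [measurable]: "m \<in> borel_measurable borel" and em [measurable]: "e \<in> borel_measurable borel"
    by (rule bdd_borel_measurable[OF m] bdd_borel_measurable[OF e])+
  have Wb: "?W \<in> bdd_borel" by (rule bmI[where B=1]) (auto simp: abs_of_pos exp_weight_pos exp_weight_le_1[OF \<eta>(2)])
  have Wi: "integrable lborel ?W" by (rule integrable_exp_weight[OF \<eta>(1)])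
  define F where "F x = ?W x * m x" for x
  have Fb: "F \<in> bdd_borel" unfolding F_def by (intro bdd_borel_mult Wb m)
  have Fi: "integrable lborel F" unfolding F_def by (rule integrable_mult_bdd_borel[OF m Wi])
  have Fa: "(\<lambda>x. \<bar>F x\<bar>) \<in> bdd_borel" "integrable lborel (\<lambda>x. \<bar>F x\<bar>)" using bdd_borel_norm[OF Fb] Fi by auto
  have F2: "integrable lborel (\<lambda>x. (F x)\<^sup>2)" unfolding power2_eq_square by (rule integrable_mult_bdd_borel[OF Fb Fi])
  have W2: "integrable lborel (\<lambda>x. (?W x)\<^sup>2)" unfolding power2_eq_square by (rule integrable_mult_bdd_borel[OF Wb Wi])
  define A where "A = (LINT x|lborel. (F x)\<^sup>2)"
  define I where "I = (LINT x|lborel. (?W x)\<^sup>2)"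
  let ?g = "rgauss 1 :: real ^ 'd \<Rightarrow> real"
  have gi: "integrable lborel ?g" by (rule integrable_rgauss) simp
  have g2i: "integrable lborel (rgauss 2 :: real ^ 'd \<Rightarrow> real)" by (rule integrable_rgauss) simp
  have g0: "0 \<le> ?g z" for z using rgauss_pos[of 1 z] by simp
  \<comment> \<open>By \<open>exp_weight_diff\<close> this majorises, relative to the weight, the
    commutator of the Gaussian average with multiplication by \<open>?W\<close>.\<close>
  define \<theta> where "\<theta> z = ?\<eta> * (exp (l1_norm z) * ?g z)" for z
  have \<theta>0: "0 \<le> \<theta> z" for z unfolding \<theta>_def using \<eta> g0 by simp
  have \<theta>le: "\<theta> z \<le> ?\<eta> * (?c * rgauss 2 z)" for z
    unfolding \<theta>_def energy_base_def using exp_l1_norm_rgauss_le[of z] \<eta> by (intro mult_left_mono) auto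
  have [measurable]: "\<theta> \<in> borel_measurable borel" unfolding \<theta>_def[abs_def] by measurable
  have i2: "integrable lborel (\<lambda>z::real^'d. ?\<eta> * (?c * rgauss 2 z))" using g2i by simp
  have \<theta>i: "integrable lborel \<theta>"
    by (rule Bochner_Integration.integrable_bound[OF i2])
      (use \<theta>0 \<theta>le energy_base_pos[where 'd='d] \<eta> rgauss_pos[of 2] in \<open>auto simp: abs_of_nonneg intro!: AE_I2 order_trans[OF \<theta>le]\<close>)
  have \<theta>int: "(LINT z|lborel. \<theta> z) \<le> c0 / 4"
  proof -
    have "(LINT z|lborel. \<theta> z) \<le> (LINT z|lborel. ?\<eta> * (?c * rgauss 2 (z :: real ^ 'd)))"
      by (rule integral_mono[OF \<theta>i i2 \<theta>le])
    also have "\<dots> = ?\<eta> * ?c" using integral_rgauss[of 2, where 'd='d] by simp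
    finally show ?thesis using \<eta>(4) by linarith
  qed
  let ?G = "\<lambda>x. LINT y|lborel. ?g (x - y) * m y"
  let ?T = "\<lambda>x. LINT y|lborel. \<theta> (x - y) * \<bar>F y\<bar>"
  let ?P = "\<lambda>x. LINT y|lborel. ?g (x - y) * F y"
  have loc: "\<bar>?W x * ?G x - ?P x\<bar> \<le> ?T x" for x
  proof -
    note j1 = conv_bdd_borel(2)[OF m gi, of x] and j2 = conv_bdd_borel(2)[OF Fb gi, of x] and j3 = conv_bdd_borel(2)[OF Fa(1) \<theta>i, of x]
    have eqf: "(\<lambda>y. ?g (x - y) * ((?W x - ?W y) * m y)) = (\<lambda>y. ?W x * (?g (x - y) * m y) - ?g (x - y) * F y)"
      by (simp add: F_def fun_eq_iff algebra_simps)
    have "?W x * ?G x - ?P x = (LINT y|lborel. ?g (x - y) * ((?W x - ?W y) * m y))"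
      unfolding eqf using integrable_mult_right[OF j1, of "?W x"] j2 by simp
    also have "\<bar>\<dots>\<bar> \<le> (LINT y|lborel. \<theta> (x - y) * \<bar>F y\<bar>)"
      unfolding real_norm_def[symmetric]
    proof (rule Bochner_Integration.integral_norm_bound_integral)
      show "integrable lborel (\<lambda>y. ?g (x - y) * ((?W x - ?W y) * m y))"
        unfolding eqf using integrable_mult_right[OF j1, of "?W x"] j2 by simp
      fix y
      have "\<bar>?W x - ?W y\<bar> * \<bar>m y\<bar> \<le> (?W y * (?\<eta> * exp (l1_norm (x - y)))) * \<bar>m y\<bar>"
        by (intro mult_right_mono exp_weight_diff \<eta>) auto
      then have "?g (x - y) * (\<bar>?W x - ?W y\<bar> * \<bar>m y\<bar>) \<le> ?g (x - y) * ((?W y * (?\<eta> * exp (l1_norm (x - y)))) * \<bar>m y\<bar>)"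
        by (intro mult_left_mono g0)
      also have "\<dots> = \<theta> (x - y) * \<bar>F y\<bar>" using exp_weight_pos[of ?\<eta> y] by (simp add: \<theta>_def F_def abs_mult)
      finally show "norm (?g (x - y) * ((?W x - ?W y) * m y)) \<le> \<theta> (x - y) * norm (F y)"
        using g0[of "x - y"] by (simp add: abs_mult)
    qed (use j3 in simp)
    finally show ?thesis .
  qed
  have pt: "c0 * (F x)\<^sup>2 \<le> - (F x * ?P x) + \<bar>F x\<bar> * ?T x + (c0 / 4 * (F x)\<^sup>2 + E\<^sup>2 / c0 * (?W x)\<^sup>2)" for x
  proof -
    have "c0 * (F x)\<^sup>2 = (?W x)\<^sup>2 * (c0 * (m x)\<^sup>2)" by (simp add: F_def power_mult_distrib)
    also have "\<dots> \<le> (?W x)\<^sup>2 * (- (m x * (?G x + e x)))" by (intro mult_left_mono eq) simp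
    also have "\<dots> = - (F x * ?P x) - F x * (?W x * ?G x - ?P x) - F x * (?W x * e x)"
      by (simp add: F_def power2_eq_square algebra_simps)
    finally have s1: "c0 * (F x)\<^sup>2 \<le> - (F x * ?P x) - F x * (?W x * ?G x - ?P x) - F x * (?W x * e x)" .
    have s2: "- (F x * (?W x * ?G x - ?P x)) \<le> \<bar>F x\<bar> * ?T x"
    proof -
      have "- (F x * (?W x * ?G x - ?P x)) \<le> \<bar>F x\<bar> * \<bar>?W x * ?G x - ?P x\<bar>"
        unfolding abs_mult[symmetric] by (rule abs_ge_minus_self)
      also have "\<dots> \<le> \<bar>F x\<bar> * ?T x" by (intro mult_left_mono loc) auto
      finally show ?thesis .
    qed
    \<comment> \<open>Young's inequality: the forcing takes another quarter of the coercive term and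
      leaves a multiple of E^2.\<close>
    have s3: "- (F x * (?W x * e x)) \<le> c0 / 4 * (F x)\<^sup>2 + E\<^sup>2 / c0 * (?W x)\<^sup>2"
    proof -
      have "0 \<le> (c0 / 2 * F x + ?W x * e x)\<^sup>2" by simp
      then have "- (c0 * (F x * (?W x * e x))) \<le> c0\<^sup>2 / 4 * (F x)\<^sup>2 + (?W x)\<^sup>2 * (e x)\<^sup>2"
        by (simp add: power2_eq_square algebra_simps)
      also have "(e x)\<^sup>2 \<le> E\<^sup>2" using E[of x] E0 by (metis abs_le_square_iff abs_of_nonneg)
      finally have "- (c0 * (F x * (?W x * e x))) \<le> c0\<^sup>2 / 4 * (F x)\<^sup>2 + (?W x)\<^sup>2 * E\<^sup>2"
        by (simp add: mult_left_mono)
      then have "(- (c0 * (F x * (?W x * e x)))) / c0 \<le> (c0\<^sup>2 / 4 * (F x)\<^sup>2 + (?W x)\<^sup>2 * E\<^sup>2) / c0"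
        using c0 by (intro divide_right_mono) auto
      then show ?thesis using c0 by (simp add: add_divide_distrib power2_eq_square mult_ac)
    qed
    from s1 s2 s3 show ?thesis by linarith
  qed
  have iP: "integrable lborel (\<lambda>x. F x * ?P x)" by (rule integrable_mult_bdd_borel[OF conv_bdd_borel(1)[OF Fb gi] Fi])
  have iT: "integrable lborel (\<lambda>x. \<bar>F x\<bar> * ?T x)" by (rule integrable_mult_bdd_borel[OF conv_bdd_borel(1)[OF Fa(1) \<theta>i] Fa(2)])
  \<comment> \<open>Schur's test: 2 |F x| |F y| \<le> (F x)^2 + (F y)^2, and both marginals of
    \<theta> (x - y) have the mass of \<theta>, at most c0/4.\<close>
  have T: "(LINT x|lborel. \<bar>F x\<bar> * ?T x) \<le> c0 / 4 * A"
  proof -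
    have \<theta>n: "(LINT y|lborel. \<theta> (x - y)) = (LINT z|lborel. \<theta> z)" "(LINT y|lborel. \<theta> (y - x)) = (LINT z|lborel. \<theta> z)" for x
      using integral_lborel_affine[of "-1" \<theta> x] integral_lborel_translate[of \<theta> "- x"] by auto
    have \<theta>t: "integrable lborel (\<lambda>y. \<theta> (x - y))" for x
      using conv_bdd_borel(2)[OF bdd_borel_const[of 1] \<theta>i, of x] by simp
    note k1 = conv_integrable[OF F2 bdd_borel_const[of 1] \<theta>i] and k2 = conv_fubini[OF F2 bdd_borel_const[of 1] \<theta>i]
    have F2b: "(\<lambda>y. (F y)\<^sup>2) \<in> bdd_borel" unfolding power2_eq_square by (intro bdd_borel_mult Fb)
    have "(LINT x|lborel. \<bar>F x\<bar> * ?T x) \<le> (LINT x|lborel. 1 / 2 * ((F x)\<^sup>2 * (LINT z|lborel. \<theta> z)) + 1 / 2 * (LINT y|lborel. \<theta> (x - y) * (F y)\<^sup>2))"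
    proof (rule integral_mono[OF iT])
      show "integrable lborel (\<lambda>x. 1 / 2 * ((F x)\<^sup>2 * (LINT z|lborel. \<theta> z)) + 1 / 2 * (LINT y|lborel. \<theta> (x - y) * (F y)\<^sup>2))"
        using F2 k1 by simp
      fix x
      have "\<bar>F x\<bar> * ?T x = (LINT y|lborel. \<bar>F x\<bar> * (\<theta> (x - y) * \<bar>F y\<bar>))" by simp
      also have "\<dots> \<le> (LINT y|lborel. 1 / 2 * ((F x)\<^sup>2 * \<theta> (x - y)) + 1 / 2 * (\<theta> (x - y) * (F y)\<^sup>2))"
      proof (rule integral_mono)
        show "integrable lborel (\<lambda>y. \<bar>F x\<bar> * (\<theta> (x - y) * \<bar>F y\<bar>))"
          by (intro integrable_mult_right conv_bdd_borel(2)[OF Fa(1) \<theta>i])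
        show "integrable lborel (\<lambda>y. 1 / 2 * ((F x)\<^sup>2 * \<theta> (x - y)) + 1 / 2 * (\<theta> (x - y) * (F y)\<^sup>2))"
          using \<theta>t[of x] conv_bdd_borel(2)[OF F2b \<theta>i, of x] by simp
        fix y
        have "2 * \<bar>F x\<bar> * \<bar>F y\<bar> \<le> \<bar>F x\<bar>\<^sup>2 + \<bar>F y\<bar>\<^sup>2" by (rule sum_squares_bound)
        then have "\<theta> (x - y) * (2 * \<bar>F x\<bar> * \<bar>F y\<bar>) \<le> \<theta> (x - y) * ((F x)\<^sup>2 + (F y)\<^sup>2)"
          by (intro mult_left_mono \<theta>0) simp
        then show "\<bar>F x\<bar> * (\<theta> (x - y) * \<bar>F y\<bar>) \<le> 1 / 2 * ((F x)\<^sup>2 * \<theta> (x - y)) + 1 / 2 * (\<theta> (x - y) * (F y)\<^sup>2)"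
          by (simp add: algebra_simps)
      qed
      also have "\<dots> = 1 / 2 * ((F x)\<^sup>2 * (LINT z|lborel. \<theta> z)) + 1 / 2 * (LINT y|lborel. \<theta> (x - y) * (F y)\<^sup>2)"
        using \<theta>t[of x] conv_bdd_borel(2)[OF F2b \<theta>i, of x] by (simp add: \<theta>n)
      finally show "\<bar>F x\<bar> * ?T x \<le> 1 / 2 * ((F x)\<^sup>2 * (LINT z|lborel. \<theta> z)) + 1 / 2 * (LINT y|lborel. \<theta> (x - y) * (F y)\<^sup>2)" .
    qed
    also have "\<dots> = 1 / 2 * (A * (LINT z|lborel. \<theta> z)) + 1 / 2 * (LINT x|lborel. LINT y|lborel. \<theta> (x - y) * (F y)\<^sup>2)"
      using F2 k1 by (simp add: A_def)
    also have "(LINT x|lborel. LINT y|lborel. \<theta> (x - y) * (F y)\<^sup>2) = A * (LINT z|lborel. \<theta> z)"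
      using k2 by (simp add: \<theta>n A_def)
    finally have "(LINT x|lborel. \<bar>F x\<bar> * ?T x) \<le> A * (LINT z|lborel. \<theta> z)" by simp
    also have "\<dots> \<le> A * (c0 / 4)" by (intro mult_left_mono \<theta>int) (simp add: A_def)
    finally show ?thesis by (simp add: mult.commute)
  qed
  have "c0 * A = (LINT x|lborel. c0 * (F x)\<^sup>2)" by (simp add: A_def)
  also have "\<dots> \<le> (LINT x|lborel. - (F x * ?P x) + \<bar>F x\<bar> * ?T x + (c0 / 4 * (F x)\<^sup>2 + E\<^sup>2 / c0 * (?W x)\<^sup>2))"
    by (rule integral_mono[OF _ _ pt]) (use F2 W2 iP iT in simp_all)
  also have "\<dots> = - (LINT x|lborel. F x * ?P x) + (LINT x|lborel. \<bar>F x\<bar> * ?T x) + (c0 / 4 * A + E\<^sup>2 / c0 * I)"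
    using F2 W2 iP iT by (simp add: A_def I_def)
  \<comment> \<open>Positive definiteness discards the term with \<open>?P\<close>; the localisation
    error and the forcing cost c0/4 each, so half of \<open>c0 * A\<close> survives on the
    left.\<close>
  also have "\<dots> \<le> c0 / 4 * A + (c0 / 4 * A + E\<^sup>2 / c0 * I)"
    using T rgauss_positive_definite[OF Fi Fb] by linarith
  finally have "c0 * A \<le> c0 / 4 * A + (c0 / 4 * A + E\<^sup>2 / c0 * I)" .
  moreover have "c0 / 2 * A = c0 * A - (c0 / 4 * A + c0 / 4 * A)" by (simp add: field_simps)
  ultimately have "c0 / 2 * A \<le> E\<^sup>2 / c0 * I" by linarith
  then have AI: "A \<le> 2 / c0\<^sup>2 * I * E\<^sup>2" using c0 by (simp add: field_simps power2_eq_square)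
  let ?D = "exp (2 * (real CARD('d))\<^sup>2)"
  have m2b: "(\<lambda>y. (m y)\<^sup>2) \<in> bdd_borel" unfolding power2_eq_square by (intro bdd_borel_mult m)
  have gm2: "integrable lborel (\<lambda>y. ?g y * (m y)\<^sup>2)" by (rule integrable_mult_bdd_borel[OF m2b gi])
  have gm1: "integrable lborel (\<lambda>y. ?g y * \<bar>m y\<bar>)" by (rule integrable_mult_bdd_borel[OF _ gi]) (use bdd_borel_norm[OF m] in simp)
  have "(LINT y|lborel. ?g y * (m y)\<^sup>2) \<le> (LINT y|lborel. ?D * (F y)\<^sup>2)"
  proof (rule integral_mono[OF gm2])
    show "?g y * (m y)\<^sup>2 \<le> ?D * (F y)\<^sup>2" for y
      using mult_right_mono[OF rgauss_le_exp_weight[OF \<eta>(2,3), of y], of "(m y)\<^sup>2"] by (simp add: F_def power_mult_distrib mult.assoc)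
  qed (use F2 in simp)
  also have "\<dots> = ?D * A" by (simp add: A_def)
  also have "\<dots> \<le> ?D * (2 / c0\<^sup>2 * I * E\<^sup>2)" by (intro mult_left_mono AI) simp
  finally have S: "(LINT y|lborel. ?g y * (m y)\<^sup>2) \<le> ?D * (2 / c0\<^sup>2) * I * E\<^sup>2" by (simp add: mult.assoc)
  \<comment> \<open>The square mean is turned into a mean: the variance of |m| under the Gaussian
    probability density is nonnegative.\<close>
  define a where "a = (LINT y|lborel. ?g y * \<bar>m y\<bar>)"
  have "0 \<le> (LINT y|lborel. ?g y * (\<bar>m y\<bar> - a)\<^sup>2)" by (intro integral_nonneg_AE AE_I2 mult_nonneg_nonneg g0) simp
  also have "\<dots> = (LINT y|lborel. ?g y * (m y)\<^sup>2 - 2 * a * (?g y * \<bar>m y\<bar>) + a\<^sup>2 * ?g y)"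
    by (intro Bochner_Integration.integral_cong refl) (simp add: power2_diff algebra_simps)
  also have "\<dots> = (LINT y|lborel. ?g y * (m y)\<^sup>2) - 2 * a * a + a\<^sup>2"
    using gm1 gm2 gi integral_rgauss[of 1, where 'd='d] by (simp add: a_def)
  finally have "a\<^sup>2 \<le> ?D * (2 / c0\<^sup>2) * I * E\<^sup>2" using S by (simp add: power2_eq_square)
  then have "a \<le> sqrt (?D * (2 / c0\<^sup>2) * I * E\<^sup>2)" by (rule real_le_rsqrt)
  also have "\<dots> = energy_const TYPE('d) c0 * E" 
    unfolding energy_const_def I_def[symmetric] real_sqrt_mult[of _ "E\<^sup>2"] using E0 by simp
  finally show ?thesis by (simp add: a_def)
qed

lemma rgauss_scale:
  assumes e: "0 < \<epsilon>"
  shows "(sqrt \<epsilon>) ^ CARD('d) * rgauss \<epsilon> (sqrt \<epsilon> *\<^sub>R z) = rgauss 1 (z :: real ^ 'd::finite)"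
proof -
  have "(norm (sqrt \<epsilon> *\<^sub>R z))\<^sup>2 / (2 * \<epsilon>) = (norm z)\<^sup>2 / (2 * 1)" using e by (simp add: power_mult_distrib)
  moreover have "(sqrt \<epsilon>) ^ CARD('d) * (2 * pi * \<epsilon>) powr (- real CARD('d) / 2) = (2 * pi * 1) powr (- real CARD('d) / 2)"
  proof -
    have "(sqrt \<epsilon>) ^ CARD('d) = \<epsilon> powr (CARD('d) / 2)"
      using e by (simp add: powr_half_sqrt[symmetric] powr_realpow[symmetric] powr_powr)
    moreover have "(2 * pi * \<epsilon>) powr (- real CARD('d) / 2) = (2 * pi) powr (- real CARD('d) / 2) * \<epsilon> powr (- real CARD('d) / 2)"
      using e by (subst powr_mult) auto
    moreover have "\<epsilon> powr (CARD('d) / 2) * \<epsilon> powr (- real CARD('d) / 2) = 1" using e by (simp add: powr_add[symmetric])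
    ultimately show ?thesis by (simp add: mult.left_commute)
  qed
  ultimately show ?thesis unfolding rgauss_norm by (simp add: mult.assoc[symmetric])
qed

text \<open>The substitution y = x0 + sqrt \<epsilon> y' turns the average at \<epsilon> into the
  one at 1 and leaves c0 and E unchanged; hence the constant is free of \<epsilon> and of
  x0.\<close>

lemma energy_estimate:
  fixes m e :: "real ^ 'd::finite \<Rightarrow> real"
  assumes \<epsilon>: "0 < \<epsilon>" and c0: "0 < c0" and m: "m \<in> bdd_borel" and e: "e \<in> bdd_borel" and E: "\<And>x. \<bar>e x\<bar> \<le> E"
    and eq: "\<And>x. c0 * (m x)\<^sup>2 \<le> - (m x * ((LINT y|lborel. rgauss \<epsilon> (y - x) * m y) + e x))"
  shows "(LINT y|lborel. rgauss \<epsilon> (y - x0) * \<bar>m y\<bar>) \<le> energy_const TYPE('d) c0 * E"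
proof -
  let ?s = "sqrt \<epsilon>"
  have s: "?s \<noteq> 0" "\<bar>?s\<bar> = ?s" using \<epsilon> by auto
  have cov: "(LINT y|lborel. rgauss \<epsilon> (y - (x0 + ?s *\<^sub>R x)) * h y) = (LINT y|lborel. rgauss 1 (x - y) * h (x0 + ?s *\<^sub>R y))"
    if [measurable]: "h \<in> borel_measurable borel" for h :: "real ^ 'd \<Rightarrow> real" and x
  proof -
    have "(LINT y|lborel. rgauss \<epsilon> (y - (x0 + ?s *\<^sub>R x)) * h y) = (?s ^ CARD('d)) * (LINT y|lborel. rgauss \<epsilon> ((x0 + ?s *\<^sub>R y) - (x0 + ?s *\<^sub>R x)) * h (x0 + ?s *\<^sub>R y))"
      using integral_lborel_affine[OF s(1), of "\<lambda>y. rgauss \<epsilon> (y - (x0 + ?s *\<^sub>R x)) * h y" x0] s(2) by simp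
    also have "\<dots> = (LINT y|lborel. (?s ^ CARD('d) * rgauss \<epsilon> (?s *\<^sub>R (y - x))) * h (x0 + ?s *\<^sub>R y))"
      by (simp add: scaleR_diff_right mult.assoc)
    also have "\<dots> = (LINT y|lborel. rgauss 1 (x - y) * h (x0 + ?s *\<^sub>R y))"
      unfolding rgauss_scale[OF \<epsilon>] by (metis (no_types) rgauss_minus minus_diff_eq)
    finally show ?thesis .
  qed
  have bms: "(\<lambda>x. h (x0 + ?s *\<^sub>R x)) \<in> bdd_borel" if "h \<in> bdd_borel" for h :: "real ^ 'd \<Rightarrow> real"
    using that by (auto simp: bdd_borel_def intro: measurable_compose[of _ borel borel])
  have mm: "m \<in> borel_measurable borel" by (rule bdd_borel_measurable[OF m])
  have "(LINT y|lborel. rgauss 1 y * \<bar>m (x0 + ?s *\<^sub>R y)\<bar>) \<le> energy_const TYPE('d) c0 * E"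
    by (rule energy_estimate_unit[OF c0 bms[OF m] bms[OF e] E]) (unfold cov[OF mm, symmetric], rule eq)
  moreover have "(LINT y|lborel. rgauss \<epsilon> (y - x0) * \<bar>m y\<bar>) = (LINT y|lborel. rgauss 1 y * \<bar>m (x0 + ?s *\<^sub>R y)\<bar>)"
    using cov[of "\<lambda>y. \<bar>m y\<bar>" 0] mm by simp
  ultimately show ?thesis by simp
qed

section \<open>Analytic functions on the strip\<close>

text \<open>Up to sign the phase of the Gaussian at x + i z is \<theta> = x.z / \<epsilon>, and cos
  \<theta> \<ge> 1 - \<theta>^2 / 2. The factor |x|^2 / \<epsilon> in \<theta>^2 is absorbed in a
  Gaussian of doubled variance, which leaves |z|^2 / \<epsilon> as the small parameter.\<close>

lemma Re_gauss_ge: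
  fixes w :: "complex ^ 'd::finite"
  assumes e: "0 < \<epsilon>"
  shows "rgauss \<epsilon> (re_vec w) - 2 * 2 powr (CARD('d) / 2) * (im_sq w / \<epsilon>) * rgauss (2 * \<epsilon>) (re_vec w) \<le> exp (- im_sq w / (2 * \<epsilon>)) * Re (gauss \<epsilon> w)"
proof -
  define \<theta> where "\<theta> = (\<Sum>k\<in>UNIV. Re (w $ k) * Im (w $ k)) / \<epsilon>"
  let ?x = "re_vec w"
  have "(\<Sum>k\<in>UNIV. (w $ k)\<^sup>2) = of_real ((\<Sum>k\<in>UNIV. (?x $ k)\<^sup>2) - im_sq w) + \<i> * of_real (2 * (\<epsilon> * \<theta>))"
    using e by (simp add: complex_eq_iff Re_power2 Im_power2 sum_subtractf im_sq_def \<theta>_def mult.assoc flip: sum_distrib_left)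
  then have ex: "- (\<Sum>k\<in>UNIV. (w $ k)\<^sup>2) / of_real (2 * \<epsilon>) = Complex (im_sq w / (2 * \<epsilon>) + - (\<Sum>k\<in>UNIV. (?x $ k)\<^sup>2) / (2 * \<epsilon>)) (- \<theta>)"
    using e by (simp add: complex_eq_iff Re_divide_of_real Im_divide_of_real field_simps del: of_real_mult)
  have "Re (gauss \<epsilon> w) = exp (im_sq w / (2 * \<epsilon>)) * (rgauss \<epsilon> ?x * cos \<theta>)"
  proof -
    have E: "Re (exp (Complex (p + q) (- \<theta>))) = exp p * exp q * cos \<theta>" for p q
      by (simp add: Re_exp exp_add)
    have R: "Re (complex_of_real c * z) = c * Re z" for c z by simp
    show ?thesis unfolding gauss_def ex rgauss_def R E by (simp only: mult_ac)
  qed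
  then have R: "exp (- im_sq w / (2 * \<epsilon>)) * Re (gauss \<epsilon> w) = rgauss \<epsilon> ?x * cos \<theta>"
    by (simp add: exp_minus field_simps)
  have c: "1 - \<theta>\<^sup>2 / 2 \<le> cos \<theta>"
  proof -
    have "cos \<theta> = 1 - 2 * (sin (\<theta> / 2))\<^sup>2" using cos_double_sin[of "\<theta> / 2"] by simp
    moreover have "(sin (\<theta> / 2))\<^sup>2 \<le> (\<theta> / 2)\<^sup>2" by (rule abs_le_square_iff[THEN iffD1, OF abs_sin_x_le_abs_x])
    ultimately show ?thesis by (simp add: power_divide)
  qed
  have \<theta>2: "\<theta>\<^sup>2 \<le> (norm ?x)\<^sup>2 * im_sq w / \<epsilon>\<^sup>2"
  proof -
    have "(\<Sum>k\<in>UNIV. Re (w $ k) * Im (w $ k))\<^sup>2 \<le> (\<Sum>k\<in>UNIV. (Re (w $ k))\<^sup>2) * (\<Sum>k\<in>UNIV. (Im (w $ k))\<^sup>2)"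
      by (rule Cauchy_Schwarz_ineq_sum)
    also have "(\<Sum>k\<in>UNIV. (Re (w $ k))\<^sup>2) = (norm ?x)\<^sup>2" by (simp add: norm_vec_def L2_set_def sum_nonneg)
    finally show ?thesis unfolding \<theta>_def power_divide im_sq_def by (intro divide_right_mono) auto
  qed
  have t: "(norm ?x)\<^sup>2 / \<epsilon> \<le> 4 * exp ((norm ?x)\<^sup>2 / (4 * \<epsilon>))"
  proof -
    have "(norm ?x)\<^sup>2 / \<epsilon> = 4 * ((norm ?x)\<^sup>2 / (4 * \<epsilon>))" by simp
    then show ?thesis using exp_ge_add_one_self[of "(norm ?x)\<^sup>2 / (4 * \<epsilon>)"] by linarith
  qed
  have g0: "0 \<le> rgauss \<epsilon> ?x" using rgauss_pos[OF e, of ?x] by simp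
  have "rgauss \<epsilon> ?x * (\<theta>\<^sup>2 / 2) \<le> rgauss \<epsilon> ?x * ((norm ?x)\<^sup>2 / \<epsilon> * (im_sq w / \<epsilon>) / 2)"
    using \<theta>2 g0 by (intro mult_left_mono) (auto simp: power2_eq_square)
  also have "\<dots> \<le> rgauss \<epsilon> ?x * (4 * exp ((norm ?x)\<^sup>2 / (4 * \<epsilon>)) * (im_sq w / \<epsilon>) / 2)"
    using t g0 e by (intro mult_left_mono divide_right_mono mult_right_mono) auto
  also have "\<dots> = 2 * (im_sq w / \<epsilon>) * (exp ((norm ?x)\<^sup>2 / (4 * \<epsilon>)) * rgauss \<epsilon> ?x)" by simp
  also have "\<dots> = 2 * 2 powr (CARD('d) / 2) * (im_sq w / \<epsilon>) * rgauss (2 * \<epsilon>) ?x"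
    unfolding rgauss_exp_double[OF e] by simp
  finally have "rgauss \<epsilon> ?x - 2 * 2 powr (CARD('d) / 2) * (im_sq w / \<epsilon>) * rgauss (2 * \<epsilon>) ?x \<le> rgauss \<epsilon> ?x * (1 - \<theta>\<^sup>2 / 2)"
    by (simp add: algebra_simps)
  also have "\<dots> \<le> rgauss \<epsilon> ?x * cos \<theta>" by (intro mult_left_mono c g0)
  finally show ?thesis unfolding R .
qed

text \<open>The second condition makes \<open>im_sq w \<le> \<epsilon>\<close> on the strip; the
  third lets the loss in \<open>Re_gauss_ge\<close>, weighted with \<beta>, consume at most half of
  the lower bound \<open>1 / \<beta>\<close>.\<close>

definition strip_const :: "'d::finite itself \<Rightarrow> real \<Rightarrow> real \<Rightarrow> bool" where
  "strip_const _ \<beta> Z \<longleftrightarrow> 0 < Z \<and> real CARD('d) * Z\<^sup>2 \<le> 1 \<and> \<beta>\<^sup>2 * (2 * 2 powr (CARD('d) / 2)) * (real CARD('d) * Z\<^sup>2) \<le> 1 / 2"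

lemma strip_const_exists:
  assumes "0 < \<beta>"
  shows "\<exists>Z. strip_const TYPE('d::finite) \<beta> Z"
proof -
  let ?K = "\<beta>\<^sup>2 * (2 * 2 powr (CARD('d) / 2))" and ?d = "real CARD('d)"
  have K: "0 < ?K" using assms by simp
  define q where "q = min 1 (1 / (2 * ?K)) / ?d"
  have q: "0 < q" "?d * q \<le> 1" "?K * (?d * q) \<le> 1 / 2"
  proof -
    show "0 < q" using K by (simp add: q_def)
    have d: "?d * q = min 1 (1 / (2 * ?K))" by (simp add: q_def)
    then show "?d * q \<le> 1" by simp
    have "?K * (?d * q) \<le> ?K * (1 / (2 * ?K))" unfolding d using K by (intro mult_left_mono) auto
    also have "\<dots> = 1 / 2" using K assms by simp
    finally show "?K * (?d * q) \<le> 1 / 2" .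
  qed
  then have "strip_const TYPE('d) \<beta> (sqrt q)" by (simp add: strip_const_def)
  then show ?thesis ..
qed

lemma strip_im_sq:
  assumes Z: "strip_const TYPE('d::finite) \<beta> Z" and e: "0 < \<epsilon>" and w: "w \<in> strip (Z * sqrt \<epsilon>)"
  shows "im_sq (w :: complex ^ 'd) \<le> real CARD('d) * Z\<^sup>2 * \<epsilon>" "im_sq w \<le> \<epsilon>"
proof -
  show 1: "im_sq w \<le> real CARD('d) * Z\<^sup>2 * \<epsilon>"
    using im_sq_strip[OF w] e by (simp add: power_mult_distrib mult.assoc)
  have "real CARD('d) * Z\<^sup>2 * \<epsilon> \<le> 1 * \<epsilon>" using Z e by (intro mult_right_mono) (auto simp: strip_const_def)
  with 1 show "im_sq w \<le> \<epsilon>" by simp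
qed

text \<open>In \<open>Re_gauss_ge\<close> the main term is tested with the lower bound of a and the
  loss with its upper bound; both Gaussians have mass 1, so the result is uniform in
  \<epsilon>.\<close>

lemma Ku_cell_measure_lower:
  fixes a :: "real ^ 'd::finite \<Rightarrow> real"
  assumes L: "0 < L" and e: "0 < \<epsilon>" and a: "a \<in> bdd_borel" "periodic L a" and \<beta>: "0 < \<beta>"
    and ab: "\<And>x. 1 / \<beta> \<le> a x" "\<And>x. a x \<le> \<beta>" and Z: "strip_const TYPE('d) \<beta> Z" and w: "w \<in> strip (Z * sqrt \<epsilon>)"
  shows "1 / (2 * \<beta>) \<le> norm (Ku L (cell_measure L) \<epsilon> (\<lambda>y. of_real (a y)) w)"
proof -
  let ?K = "2 * 2 powr (CARD('d) / 2) :: real"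
  have e2: "0 < 2 * \<epsilon>" using e by simp
  have a': "(\<lambda>y. complex_of_real (a y)) \<in> bdd_borel" "periodic L (\<lambda>y. complex_of_real (a y))" using a by (auto simp: periodic_def)
  have Ku: "Ku L (cell_measure L) \<epsilon> (\<lambda>y. of_real (a y)) w = (LINT y|lborel. gauss \<epsilon> (cvec y - w) * of_real (a y))"
    unfolding Ku_def by (rule integral_gauss_per_unfold[OF L e a'])
  note ig = integrable_gauss_unfold[OF L e a', of w]
  let ?p = "re_vec w" and ?E = "exp (- im_sq w / (2 * \<epsilon>))"
  have gi: "integrable lborel (\<lambda>y. rgauss t (y - ?p))" "(LINT y|lborel. rgauss t (y - ?p)) = 1" if "0 < t" for t
    using integrable_lborel_translate[OF integrable_rgauss[OF that], of "- ?p"] integral_lborel_translate[of "rgauss t" "- ?p"] integral_rgauss[OF that, where 'd='d] by auto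
  have S: "im_sq w / \<epsilon> \<le> real CARD('d) * Z\<^sup>2" using strip_im_sq(1)[OF Z e w] e by (simp add: pos_divide_le_eq)
  have "1 / \<beta> - \<beta> * (?K * (im_sq w / \<epsilon>)) = (LINT y|lborel. rgauss \<epsilon> (y - ?p) * (1 / \<beta>) - ?K * (im_sq w / \<epsilon>) * rgauss (2 * \<epsilon>) (y - ?p) * \<beta>)"
    using gi[OF e] gi[OF e2] by simp
  also have "\<dots> \<le> (LINT y|lborel. ?E * Re (gauss \<epsilon> (cvec y - w) * of_real (a y)))"
  proof (rule integral_mono)
    show "integrable lborel (\<lambda>y. rgauss \<epsilon> (y - ?p) * (1 / \<beta>) - ?K * (im_sq w / \<epsilon>) * rgauss (2 * \<epsilon>) (y - ?p) * \<beta>)"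
      using gi[OF e] gi[OF e2] by simp
    show "integrable lborel (\<lambda>y. ?E * Re (gauss \<epsilon> (cvec y - w) * of_real (a y)))"
      using integrable_Re[OF ig] by (intro integrable_mult_right) simp
    fix y
    have g: "0 \<le> rgauss \<epsilon> (y - ?p)" "0 \<le> rgauss (2 * \<epsilon>) (y - ?p)" using rgauss_pos[OF e] rgauss_pos[OF e2] less_imp_le by blast+
    have a0: "0 \<le> a y" using ab(1)[of y] \<beta> by (meson divide_nonneg_pos order_trans zero_le_one)
    have "rgauss \<epsilon> (y - ?p) * (1 / \<beta>) - ?K * (im_sq w / \<epsilon>) * rgauss (2 * \<epsilon>) (y - ?p) * \<beta>
        \<le> rgauss \<epsilon> (y - ?p) * a y - ?K * (im_sq w / \<epsilon>) * rgauss (2 * \<epsilon>) (y - ?p) * a y"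
      using g ab e by (intro diff_mono mult_left_mono mult_nonneg_nonneg) auto
    also have "\<dots> = (rgauss \<epsilon> (y - ?p) - ?K * (im_sq w / \<epsilon>) * rgauss (2 * \<epsilon>) (y - ?p)) * a y" by (simp add: left_diff_distrib)
    also have "\<dots> \<le> (?E * Re (gauss \<epsilon> (cvec y - w))) * a y"
      using Re_gauss_ge[OF e, of "cvec y - w"] by (intro mult_right_mono a0) (simp add: re_vec_diff)
    finally show "rgauss \<epsilon> (y - ?p) * (1 / \<beta>) - ?K * (im_sq w / \<epsilon>) * rgauss (2 * \<epsilon>) (y - ?p) * \<beta> \<le> ?E * Re (gauss \<epsilon> (cvec y - w) * of_real (a y))"
      by simp
  qed
  also have "\<dots> = ?E * Re (Ku L (cell_measure L) \<epsilon> (\<lambda>y. of_real (a y)) w)"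
    unfolding Ku using integral_Re[OF ig] by simp
  also have "\<dots> \<le> ?E * norm (Ku L (cell_measure L) \<epsilon> (\<lambda>y. of_real (a y)) w)"
    by (intro mult_left_mono complex_Re_le_cmod) auto
  also have "\<dots> \<le> 1 * norm (Ku L (cell_measure L) \<epsilon> (\<lambda>y. of_real (a y)) w)"
    using e by (intro mult_right_mono) auto
  finally have F: "1 / \<beta> - \<beta> * (?K * (im_sq w / \<epsilon>)) \<le> norm (Ku L (cell_measure L) \<epsilon> (\<lambda>y. of_real (a y)) w)" by simp
  have "\<beta>\<^sup>2 * (?K * (im_sq w / \<epsilon>)) \<le> \<beta>\<^sup>2 * (?K * (real CARD('d) * Z\<^sup>2))"
    using S by (intro mult_left_mono) auto
  also have "\<dots> \<le> 1 / 2" using Z by (simp add: strip_const_def mult.assoc)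
  finally have "\<beta> * (\<beta> * (?K * (im_sq w / \<epsilon>))) \<le> 1 / 2" by (simp add: power2_eq_square mult.assoc)
  then have "\<beta> * (?K * (im_sq w / \<epsilon>)) \<le> 1 / (2 * \<beta>)" using \<beta> by (simp add: field_simps)
  moreover have "1 / \<beta> - 1 / (2 * \<beta>) = 1 / (2 * \<beta>)" using \<beta> by (simp add: field_simps)
  ultimately show ?thesis using F by linarith
qed

section \<open>Closure properties of the space of analytic functions\<close>

lemma Hinf_mult: "\<phi> \<in> Hinf L \<zeta> \<Longrightarrow> \<psi> \<in> Hinf L \<zeta> \<Longrightarrow> (\<lambda>w. \<phi> w * \<psi> w) \<in> Hinf L \<zeta>"
proof -
  assume a: "\<phi> \<in> Hinf L \<zeta>" "\<psi> \<in> Hinf L \<zeta>"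
  have "holo_at (\<lambda>w. \<phi> w * \<psi> w) w" if w: "w \<in> interior (strip \<zeta>)" for w
  proof -
    obtain \<phi>' \<psi>' where d: "(\<phi> has_derivative \<phi>') (at w)" "(\<psi> has_derivative \<psi>') (at w)"
      and l: "\<And>c v. \<phi>' (c *s v) = c * \<phi>' v" "\<And>c v. \<psi>' (c *s v) = c * \<psi>' v"
      using a w unfolding Hinf_def holo_at_def by blast
    show ?thesis
      unfolding holo_at_def
      by (rule exI, rule conjI, rule has_derivative_mult[OF d]) (simp add: l algebra_simps)
  qed
  then show ?thesis using a by (auto simp: Hinf_def intro!: continuous_intros)
qed

lemma Hinf_inverse:
  assumes \<phi>: "\<phi> \<in> Hinf L \<zeta>" and nz: "\<And>w. w \<in> strip \<zeta> \<Longrightarrow> \<phi> w \<noteq> 0"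
  shows "(\<lambda>w. inverse (\<phi> w)) \<in> Hinf L \<zeta>"
proof -
  have "holo_at (\<lambda>w. inverse (\<phi> w)) w" if w: "w \<in> interior (strip \<zeta>)" for w
  proof -
    obtain \<phi>' where d: "(\<phi> has_derivative \<phi>') (at w)" and l: "\<And>c v. \<phi>' (c *s v) = c * \<phi>' v"
      using \<phi> w unfolding Hinf_def holo_at_def by blast
    have "\<phi> w \<noteq> 0" using w interior_subset nz by blast
    from Deriv.has_derivative_inverse[OF this d] show ?thesis
      unfolding holo_at_def by (intro exI conjI, assumption) (simp add: l algebra_simps)
  qed
  then show ?thesis using \<phi> nz by (auto simp: Hinf_def intro!: continuous_intros)
qed

lemma Hinf_diff: "\<phi> \<in> Hinf L \<zeta> \<Longrightarrow> \<psi> \<in> Hinf L \<zeta> \<Longrightarrow> (\<lambda>w. \<phi> w - \<psi> w) \<in> Hinf L \<zeta>"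
proof -
  assume a: "\<phi> \<in> Hinf L \<zeta>" "\<psi> \<in> Hinf L \<zeta>"
  have "holo_at (\<lambda>w. \<phi> w - \<psi> w) w" if w: "w \<in> interior (strip \<zeta>)" for w
  proof -
    obtain \<phi>' \<psi>' where d: "(\<phi> has_derivative \<phi>') (at w)" "(\<psi> has_derivative \<psi>') (at w)"
      and l: "\<And>c v. \<phi>' (c *s v) = c * \<phi>' v" "\<And>c v. \<psi>' (c *s v) = c * \<psi>' v"
      using a w unfolding Hinf_def holo_at_def by blast
    show ?thesis
      unfolding holo_at_def
      by (rule exI, rule conjI, rule has_derivative_diff[OF d]) (simp add: l algebra_simps)
  qed
  then show ?thesis using a by (auto simp: Hinf_def intro!: continuous_intros)
qed

lemma cvec_in_strip: "0 \<le> \<zeta> \<Longrightarrow> cvec x \<in> strip \<zeta>"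
  by (simp add: strip_def)

text \<open>\<open>Hinf\<close> contains no bound in its definition; at real points it comes from
  compactness of the closed cell and periodicity.\<close>

lemma Hinf_bdd_borel:
  fixes \<phi> :: "complex ^ 'd::finite \<Rightarrow> complex"
  assumes L: "0 < L" and \<zeta>: "0 \<le> \<zeta>" and \<phi>: "\<phi> \<in> Hinf L \<zeta>"
  shows "(\<lambda>x. \<phi> (cvec x)) \<in> bdd_borel"
proof -
  have c: "continuous_on UNIV (\<lambda>x. \<phi> (cvec x))"
  proof (rule continuous_on_compose2[OF _ continuous_on_cvec[OF continuous_on_id]])
    show "continuous_on (strip \<zeta>) \<phi>" using \<phi> by (simp add: Hinf_def)
  qed (auto intro: cvec_in_strip[OF \<zeta>])
  have "compact ((\<lambda>x. \<phi> (cvec x)) ` cbox 0 (\<chi> k. L))"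
    by (intro compact_continuous_image compact_cbox continuous_on_subset[OF c]) auto
  from compact_imp_bounded[OF this] obtain B where B: "\<And>x. x \<in> cbox 0 (\<chi> k. L) \<Longrightarrow> norm (\<phi> (cvec x)) \<le> B"
    unfolding bounded_iff by auto
  show ?thesis
  proof (rule bmI)
    show "norm (\<phi> (cvec x)) \<le> B" for x
    proof -
      obtain j where j: "x - latt L j \<in> cell L" by (rule cell_reduce[OF L])
      have "\<phi> (cvec (x - latt L j) + cvec (latt L j)) = \<phi> (cvec (x - latt L j))"
        using \<phi> cvec_in_strip[OF \<zeta>] by (auto simp: Hinf_def)
      then have "\<phi> (cvec x) = \<phi> (cvec (x - latt L j))" by (simp add: cvec_diff)
      moreover have "x - latt L j \<in> cbox 0 (\<chi> k. L)" using j by (auto simp: cell_def mem_box_cart less_imp_le)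
      ultimately show ?thesis using B by metis
    qed
  qed (rule borel_measurable_continuous_onI[OF c])
qed

section \<open>Stability of the Sinkhorn weight\<close>

lemma exp1_mono: "0 < \<epsilon> \<Longrightarrow> I \<le> \<epsilon> \<Longrightarrow> exp (I / \<epsilon>) \<le> exp 1" "0 < \<epsilon> \<Longrightarrow> 0 \<le> I \<Longrightarrow> I \<le> \<epsilon> \<Longrightarrow> exp (I / (2 * \<epsilon>)) \<le> exp (1::real)"
  by (auto simp: field_simps)

text \<open>The leading \<open>2 * \<beta>\<close> bounds 1 / |b|, and
  \<open>4 * \<beta> * exp 1\<close> times \<delta> bounds the sampling error of a weight of size 4
  \<beta>. The bracket adds the energy estimate at coercivity 1 / (4 \<beta>^2), moved to the strip
  by \<open>exp 1\<close>, to the sampling error itself.\<close>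

definition close_const :: "'d::finite itself \<Rightarrow> real \<Rightarrow> real" where
  "close_const _ \<beta> = 2 * \<beta> * ((exp 1 * energy_const TYPE('d) (1 / (4 * \<beta>\<^sup>2)) + 1) * (4 * \<beta> * exp 1))"

lemma energy_const_nonneg: "0 \<le> energy_const TYPE('d::finite) c"
  unfolding energy_const_def by (intro real_sqrt_ge_zero mult_nonneg_nonneg integral_nonneg_AE) auto

lemma close_const_pos: "0 < \<beta> \<Longrightarrow> 0 < close_const TYPE('d::finite) \<beta>"
  unfolding close_const_def using energy_const_nonneg[where 'd='d, of "1 / (4 * \<beta>\<^sup>2)"]
  by (intro mult_pos_pos add_nonneg_pos mult_nonneg_nonneg) auto

lemma (in torus_prob) sinkhorn_wt_periodic: "periodic L sinkhorn_wt"
proof -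
  have "sinkhorn_wt x = 1 / Kr L \<mu> \<epsilon> sinkhorn_wt x" for x by (simp add: Kr_sinkhorn_wt)
  then show ?thesis unfolding periodic_def by (metis Kr_periodic)
qed

text \<open>The empirical measure enters as a general \<nu>. The assumption on \<delta> is the
  operator norm bound in pointwise form, with the size N of the argument already scaled in.\<close>

locale sink_pair = log_density L B f for L B and f :: "real ^ 'd::finite \<Rightarrow> real" +
  fixes \<nu> :: "(real ^ 'd) measure" and \<epsilon> \<epsilon>0 \<beta> Z \<delta> :: real
  assumes e: "0 < \<epsilon>" and e0: "\<epsilon> \<le> \<epsilon>0" and \<nu>: "torus_prob L \<nu> \<epsilon>" and \<beta>: "\<beta> = weight_bound \<epsilon>0"
    and Z: "strip_const TYPE('d) \<beta> Z" and \<delta>0: "0 \<le> \<delta>"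
    and \<delta>: "\<And>\<phi> N x. \<phi> \<in> Hinf L (Z * sqrt \<epsilon>) \<Longrightarrow> (\<And>w. w \<in> strip (Z * sqrt \<epsilon>) \<Longrightarrow> norm (\<phi> w) \<le> N) \<Longrightarrow>
      norm (Ku L \<nu> (\<epsilon> / 2) (\<lambda>y. \<phi> (cvec y)) (cvec x) - Ku L \<mu> (\<epsilon> / 2) (\<lambda>y. \<phi> (cvec y)) (cvec x)) \<le> \<delta> * N"
begin

abbreviation "\<zeta> \<equiv> Z * sqrt \<epsilon>"

sublocale P: torus_prob L \<mu> \<epsilon> by (rule torus_prob_\<mu>[OF e])
sublocale Q: torus_prob L \<nu> \<epsilon> by (rule \<nu>)
sublocale TP: torus_pair L \<mu> \<nu> \<epsilon> ..

lemma \<beta>_pos: "0 < \<beta>" using weight_bound_pos \<beta> by simp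

lemma Z_pos: "0 < Z" using Z by (simp add: strip_const_def)

lemma \<zeta>_nonneg: "0 \<le> \<zeta>" using Z_pos e by simp

lemma e2: "0 < \<epsilon> / 2" using e by simp

lemma strip_exp: 
  assumes "(w :: complex ^ 'd) \<in> strip \<zeta>"
  shows "exp (im_sq w / (2 * \<epsilon>)) \<le> exp 1" "exp (im_sq w / \<epsilon>) \<le> exp 1"
  using exp1_mono[OF e] strip_im_sq(2)[OF Z e assms] by auto

definition a :: "real ^ 'd \<Rightarrow> real" where "a x = exp (f x) * P.sinkhorn_wt x"

lemma P_bounds: "1 / P.sinkhorn_wt x \<le> \<beta>" "1 / \<beta> \<le> 1 / P.sinkhorn_wt x" "a x \<le> \<beta>" "1 / \<beta> \<le> a x"
  using weight_bound_bounds[OF e e0, of x] unfolding mass_wt_def[OF e e0] inv_wt_def[OF e e0] \<beta> a_def by auto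

lemma Ku_\<mu>:
  assumes t: "0 < t" and g: "g \<in> bdd_borel"
  shows "Ku L \<mu> t g w = Ku L (cell_measure L) t (\<lambda>y. of_real (exp (f y)) * g y) w"
proof -
  have [measurable]: "(\<lambda>y. gauss_per L t (cvec y - w)) \<in> borel_measurable borel" "g \<in> borel_measurable borel"
    by (intro bdd_borel_measurable bdd_borel_gauss_per L t g)+
  show ?thesis
    unfolding Ku_def by (subst integral_\<mu>) (auto simp: scaleR_conv_of_real mult_ac)
qed

abbreviation "b \<equiv> TP.inv_wt_path 0"

lemma b_eq: "b w = Ku L (cell_measure L) \<epsilon> (\<lambda>y. of_real (a y)) w"
  unfolding TP.inv_wt_path_0 a_def using P.sinkhorn_wt_bdd_borel by (simp add: Ku_\<mu>[OF e])

lemma b_lower: "w \<in> strip \<zeta> \<Longrightarrow> 1 / (2 * \<beta>) \<le> norm (b w)"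
  unfolding b_eq
proof (rule Ku_cell_measure_lower[OF L e _ _ \<beta>_pos P_bounds(4,3) Z])
  show "a \<in> bdd_borel" unfolding a_def[abs_def] by (intro bdd_borel_mult expf_bdd_borel P.sinkhorn_wt_bdd_borel)
  show "periodic L a" using P.sinkhorn_wt_periodic f_per by (simp add: a_def[abs_def] periodic_def)
qed

text \<open>By the semigroup law the difference at time \<epsilon> is the Lebesgue average over time
  \<epsilon>/2 of the difference at time \<epsilon>/2 on real points, where \<delta> controls it;
  evaluating that average on the strip costs at most the factor e.\<close>

lemma E_bound:
  assumes \<phi>: "\<phi> \<in> Hinf L \<zeta>" and N: "\<And>w. w \<in> strip \<zeta> \<Longrightarrow> norm (\<phi> w) \<le> N" and w: "w \<in> strip \<zeta>"
  shows "norm (Ku L \<nu> \<epsilon> (\<lambda>y. \<phi> (cvec y)) w - Ku L \<mu> \<epsilon> (\<lambda>y. \<phi> (cvec y)) w) \<le> exp 1 * (\<delta> * N)"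
proof -
  have \<phi>b: "(\<lambda>y. \<phi> (cvec y)) \<in> bdd_borel" by (rule Hinf_bdd_borel[OF L \<zeta>_nonneg \<phi>])
  let ?D = "\<lambda>z. Ku L \<nu> (\<epsilon> / 2) (\<lambda>y. \<phi> (cvec y)) (cvec z) - Ku L \<mu> (\<epsilon> / 2) (\<lambda>y. \<phi> (cvec y)) (cvec z)"
  have b1: "(\<lambda>z. Ku L \<nu> (\<epsilon> / 2) (\<lambda>y. \<phi> (cvec y)) (cvec z)) \<in> bdd_borel" "(\<lambda>z. Ku L \<mu> (\<epsilon> / 2) (\<lambda>y. \<phi> (cvec y)) (cvec z)) \<in> bdd_borel"
    by (intro Q.Ku_cvec_bdd_borel P.Ku_cvec_bdd_borel e2 \<phi>b)+
  have D: "?D \<in> bdd_borel" by (rule bdd_borel_diff[OF b1])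
  have "Ku L \<nu> \<epsilon> (\<lambda>y. \<phi> (cvec y)) w - Ku L \<mu> \<epsilon> (\<lambda>y. \<phi> (cvec y)) w = Ku L (cell_measure L) (\<epsilon> / 2) ?D w"
    using Q.Ku_semigroup[OF e2 e2 \<phi>b, of w] P.Ku_semigroup[OF e2 e2 \<phi>b, of w] C.Ku_diff[OF e2 b1, of w] by simp
  also have "norm \<dots> \<le> exp (im_sq w / (2 * (\<epsilon> / 2))) * Kr L (cell_measure L) (\<epsilon> / 2) (\<lambda>z. norm (?D z)) (re_vec w)"
    by (rule C.norm_Ku_le[OF e2 D])
  also have "\<dots> \<le> exp 1 * (\<delta> * N)"
  proof (rule mult_mono)
    show "exp (im_sq w / (2 * (\<epsilon> / 2))) \<le> exp 1" using strip_exp(2)[OF w] by simp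
    have "Kr L (cell_measure L) (\<epsilon> / 2) (\<lambda>z. norm (?D z)) (re_vec w) \<le> Kr L (cell_measure L) (\<epsilon> / 2) (\<lambda>_. \<delta> * N) (re_vec w)"
      by (rule C.Kr_mono[OF e2 bdd_borel_norm[OF D] bdd_borel_const]) (intro AE_I2 \<delta>[OF \<phi> N])
    then show "Kr L (cell_measure L) (\<epsilon> / 2) (\<lambda>z. norm (?D z)) (re_vec w) \<le> \<delta> * N" by (simp add: Kr_cell_measure_const[OF e2])
    show "0 \<le> Kr L (cell_measure L) (\<epsilon> / 2) (\<lambda>z. norm (?D z)) (re_vec w)"
      unfolding Kr_def by (intro integral_nonneg_AE AE_I2 mult_nonneg_nonneg less_imp_le[OF rgauss_per_pos[OF L e2]]) auto
  qed simp
  finally show ?thesis .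
qed

lemma inv_wt_path_real: "TP.inv_wt_path t (cvec x) = of_real (1 / TP.M.sinkhorn_wt t x)"
  unfolding TP.inv_wt_path_def by (simp add: TP.M.Ku_of_real[OF e] TP.M.Kr_sinkhorn_wt)

lemma inv_wt_path_Hinf: "TP.inv_wt_path t \<in> Hinf L \<zeta>"
  unfolding TP.inv_wt_path_def[abs_def] by (rule TP.M.Ku_Hinf[OF e]) (simp add: TP.M.sinkhorn_wt_bdd_borel)

lemma bootstrap:
  assumes t: "t \<in> {0..1}" and half: "\<And>w. w \<in> strip \<zeta> \<Longrightarrow> norm (TP.inv_wt_path t w / b w - 1) \<le> 1 / 2" and w: "w \<in> strip \<zeta>"
  shows "norm (TP.inv_wt_path t w / b w - 1) \<le> close_const TYPE('d) \<beta> * \<delta>"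
proof -
  let ?u = "P.sinkhorn_wt" and ?v = "TP.M.sinkhorn_wt t"
  have bnz: "b w \<noteq> 0" if "w \<in> strip \<zeta>" for w :: "complex ^ 'd" using b_lower[OF that] \<beta>_pos by (auto simp: field_simps)
  have btl: "1 / (4 * \<beta>) \<le> norm (TP.inv_wt_path t w)" if w: "w \<in> strip \<zeta>" for w
  proof -
    have "1 / 2 \<le> norm (TP.inv_wt_path t w / b w)"
      using half[OF w] norm_triangle_ineq2[of 1 "TP.inv_wt_path t w / b w"] by (simp add: norm_minus_commute)
    then have "1 / 2 * norm (b w) \<le> norm (TP.inv_wt_path t w)"
      using bnz[OF w] by (simp add: norm_divide field_simps)
    moreover have "1 / 2 * (1 / (2 * \<beta>)) \<le> 1 / 2 * norm (b w)" by (intro mult_left_mono b_lower w) simp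
    ultimately show ?thesis by simp
  qed
  have btnz: "TP.inv_wt_path t w \<noteq> 0" if "w \<in> strip \<zeta>" for w using btl[OF that] \<beta>_pos by (auto simp: field_simps)
  \<comment> \<open>The analytic extension of the weight. The bound 4 \<beta> combines |b| \<ge> 1 /
    (2 \<beta>) with the ratio being at least 1/2 in modulus.\<close>
  define V where "V w = inverse (TP.inv_wt_path t w)" for w
  have VH: "V \<in> Hinf L \<zeta>" unfolding V_def[abs_def] by (rule Hinf_inverse[OF inv_wt_path_Hinf btnz])
  have VN: "norm (V w) \<le> 4 * \<beta>" if w: "w \<in> strip \<zeta>" for w
  proof -
    have "inverse (norm (TP.inv_wt_path t w)) \<le> inverse (1 / (4 * \<beta>))" using btl[OF w] \<beta>_pos by (intro le_imp_inverse_le) auto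
    then show ?thesis by (simp add: V_def norm_inverse)
  qed
  have Vr: "(\<lambda>y. V (cvec y)) = (\<lambda>y. of_real (?v y))"
    by (simp add: V_def inv_wt_path_real fun_eq_iff)
  have EV: "norm (Ku L \<nu> \<epsilon> (\<lambda>y. of_real (?v y)) w - Ku L \<mu> \<epsilon> (\<lambda>y. of_real (?v y)) w) \<le> exp 1 * (\<delta> * (4 * \<beta>))"
    if "w \<in> strip \<zeta>" for w
    using E_bound[OF VH _ that, of "4 * \<beta>"] VN unfolding Vr by blast
  let ?E = "exp 1 * (\<delta> * (4 * \<beta>))"
  have vb: "?v \<in> bdd_borel" and vp: "0 < ?v x" and ub: "?u \<in> bdd_borel" and up: "0 < ?u x" for x
    by (rule TP.M.sinkhorn_wt_bdd_borel TP.M.sinkhorn_wt_pos P.sinkhorn_wt_bdd_borel P.sinkhorn_wt_pos)+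
  have v4: "?v x \<le> 4 * \<beta>" for x
    using VN[OF cvec_in_strip[OF \<zeta>_nonneg], of x] vp[of x] by (simp add: V_def inv_wt_path_real)
  \<comment> \<open>The equation of \<open>?v\<close> for the mixture reads
    \<open>Kr L \<mu> \<epsilon> ?v + ee = 1 / ?v\<close>: everything foreign to \<mu> sits in this
    forcing term.\<close>
  define ee where "ee x = t * (Kr L \<nu> \<epsilon> ?v x - Kr L \<mu> \<epsilon> ?v x)" for x
  have eeb: "ee \<in> bdd_borel" unfolding ee_def by (intro bdd_borel_cmult bdd_borel_diff P.Kr_bdd_borel Q.Kr_bdd_borel e vb)
  have eeE: "\<bar>ee x\<bar> \<le> ?E" for x
  proof -
    have "\<bar>Kr L \<nu> \<epsilon> ?v x - Kr L \<mu> \<epsilon> ?v x\<bar> \<le> ?E"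
      using EV[OF cvec_in_strip[OF \<zeta>_nonneg], of x] by (simp add: P.Ku_of_real[OF e] Q.Ku_of_real[OF e] flip: of_real_diff)
    then have "t * \<bar>Kr L \<nu> \<epsilon> ?v x - Kr L \<mu> \<epsilon> ?v x\<bar> \<le> 1 * ?E" using t by (intro mult_mono) auto
    then show ?thesis using t by (simp add: ee_def abs_mult)
  qed
  define k where "k x = ?v x - ?u x" for x
  have kb: "k \<in> bdd_borel" unfolding k_def by (intro bdd_borel_diff vb ub)
  have Kk: "Kr L \<mu> \<epsilon> k x + ee x = 1 / ?v x - 1 / ?u x" for x
  proof -
    have "Kr L \<mu> \<epsilon> ?v x + ee x = 1 / ?v x"
      using TP.Kr_mixture[OF t vb, of x] TP.M.Kr_sinkhorn_wt[of t x] by (simp add: ee_def)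
    then show ?thesis unfolding k_def P.Kr_diff[OF e vb ub] P.Kr_sinkhorn_wt by simp
  qed
  define m where "m x = exp (f x) * k x" for x
  have mb: "m \<in> bdd_borel" unfolding m_def by (intro bdd_borel_mult expf_bdd_borel kb)
  have vper: "periodic L ?v"
    by (rule TP.M.sinkhorn_wt_periodic)
  have mper: "periodic L m" using vper P.sinkhorn_wt_periodic f_per by (simp add: m_def k_def periodic_def)
  have Km: "Kr L \<mu> \<epsilon> k x = (LINT y|lborel. rgauss \<epsilon> (y - x) * m y)" for x
    unfolding Kr_\<mu>[OF e kb] m_def[symmetric] unfolding Kr_def by (rule integral_rgauss_per_unfold[OF L e mb mper])
  \<comment> \<open>The bracket equals 1 / v - 1 / u = - k / (u v), and m = exp(f) k, so the right
    side is m^2 / (a v). The bounds a \<le> \<beta> and v \<le> 4 \<beta> give the coercivity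
    constant.\<close>
  have key: "1 / (4 * \<beta>\<^sup>2) * (m x)\<^sup>2 \<le> - (m x * ((LINT y|lborel. rgauss \<epsilon> (y - x) * m y) + ee x))" for x
  proof -
    have av: "a x * ?v x \<le> \<beta> * (4 * \<beta>)" using P_bounds(3)[of x] v4[of x] vp[of x] \<beta>_pos by (intro mult_mono) auto
    have ap: "0 < a x" using up[of x] by (simp add: a_def)
    have "- (m x * (1 / ?v x - 1 / ?u x)) = (m x)\<^sup>2 / (a x * ?v x)"
      using up[of x] vp[of x] by (simp add: m_def a_def k_def field_simps power2_eq_square)
    moreover have "(m x)\<^sup>2 / (\<beta> * (4 * \<beta>)) \<le> (m x)\<^sup>2 / (a x * ?v x)"
      using av ap vp[of x] \<beta>_pos by (intro divide_left_mono mult_pos_pos) auto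
    ultimately show ?thesis unfolding Km[symmetric] Kk by (simp add: power2_eq_square mult_ac)
  qed
  let ?c = "energy_const TYPE('d) (1 / (4 * \<beta>\<^sup>2))"
  have mint: "(LINT y|lborel. rgauss \<epsilon> (y - x) * \<bar>m y\<bar>) \<le> ?c * ?E" for x
    by (rule energy_estimate[OF e _ mb eeb eeE key]) (use \<beta>_pos in simp)
  have kc: "(\<lambda>y. complex_of_real (k y)) \<in> bdd_borel" using kb by simp
  have "norm (Ku L \<mu> \<epsilon> (\<lambda>y. of_real (k y)) w) \<le> exp (im_sq w / (2 * \<epsilon>)) * Kr L \<mu> \<epsilon> (\<lambda>y. norm (complex_of_real (k y))) (re_vec w)"
    by (rule P.norm_Ku_le[OF e kc])
  also have "Kr L \<mu> \<epsilon> (\<lambda>y. norm (complex_of_real (k y))) (re_vec w) = (LINT y|lborel. rgauss \<epsilon> (y - re_vec w) * \<bar>m y\<bar>)"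
  proof -
    have ka: "(\<lambda>y. \<bar>k y\<bar>) \<in> bdd_borel" and ma: "(\<lambda>y. \<bar>m y\<bar>) \<in> bdd_borel" using bdd_borel_norm[OF kb] bdd_borel_norm[OF mb] by auto
    have "periodic L (\<lambda>y. \<bar>m y\<bar>)" using mper by (simp add: periodic_def)
    from integral_rgauss_per_unfold[OF L e ma this] Kr_\<mu>[OF e ka, of "re_vec w"] show ?thesis
      by (simp add: Kr_def m_def abs_mult)
  qed
  also have "exp (im_sq w / (2 * \<epsilon>)) * \<dots> \<le> exp 1 * (?c * ?E)"
    by (intro mult_mono strip_exp(1)[OF w] mint integral_nonneg_AE AE_I2 mult_nonneg_nonneg less_imp_le[OF rgauss_pos[OF e]]) auto
  finally have K1: "norm (Ku L \<mu> \<epsilon> (\<lambda>y. of_real (k y)) w) \<le> exp 1 * (?c * ?E)" .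
  have vc: "(\<lambda>y. complex_of_real (?v y)) \<in> bdd_borel" "(\<lambda>y. complex_of_real (?u y)) \<in> bdd_borel" using vb ub by auto
  \<comment> \<open>Change of the weight under \<mu>, bounded by the energy estimate, plus the
    sampling error of the perturbed weight.\<close>
  have "TP.inv_wt_path t w - b w = Ku L \<mu> \<epsilon> (\<lambda>y. of_real (k y)) w + of_real t * (Ku L \<nu> \<epsilon> (\<lambda>y. of_real (?v y)) w - Ku L \<mu> \<epsilon> (\<lambda>y. of_real (?v y)) w)"
    unfolding TP.inv_wt_path_0 unfolding TP.inv_wt_path_def TP.Ku_mixture[OF t vc(1)] k_def of_real_diff P.Ku_diff[OF e vc] by simp
  also have "norm \<dots> \<le> exp 1 * (?c * ?E) + 1 * ?E"
  proof (rule norm_triangle_mono[OF K1])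
    show "norm (of_real t * (Ku L \<nu> \<epsilon> (\<lambda>y. of_real (?v y)) w - Ku L \<mu> \<epsilon> (\<lambda>y. of_real (?v y)) w)) \<le> 1 * ?E"
      unfolding norm_mult using t by (intro mult_mono EV[OF w]) auto
  qed
  finally have D: "norm (TP.inv_wt_path t w - b w) \<le> (exp 1 * ?c + 1) * ?E" by (simp add: algebra_simps)
  have bl: "1 / norm (b w) \<le> 2 * \<beta>"
  proof -
    have "1 / norm (b w) \<le> 1 / (1 / (2 * \<beta>))" using b_lower[OF w] \<beta>_pos bnz[OF w] by (intro divide_left_mono) auto
    then show ?thesis by simp
  qed
  have "TP.inv_wt_path t w / b w - 1 = (TP.inv_wt_path t w - b w) / b w" using bnz[OF w] by (simp add: field_simps)
  then have "norm (TP.inv_wt_path t w / b w - 1) = norm (TP.inv_wt_path t w - b w) * (1 / norm (b w))" by (simp add: norm_divide)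
  also have "\<dots> \<le> ((exp 1 * ?c + 1) * ?E) * (2 * \<beta>)"
    using \<delta>0 \<beta>_pos energy_const_nonneg[where 'd='d, of "1 / (4 * \<beta>\<^sup>2)"]
    by (intro mult_mono D bl mult_nonneg_nonneg add_nonneg_nonneg) auto
  also have "\<dots> = close_const TYPE('d) \<beta> * \<delta>" by (simp add: close_const_def mult_ac)
  finally show ?thesis .
qed

lemma closeness:
  assumes small: "close_const TYPE('d) \<beta> * \<delta> \<le> 1 / 4" and w: "w \<in> strip \<zeta>"
  shows "norm (TP.inv_wt_path 1 w / b w - 1) \<le> close_const TYPE('d) \<beta> * \<delta>"
proof -
  let ?G = "gmax TYPE('d) L \<epsilon>"
  \<comment> \<open>The modulus of continuity from \<open>inv_wt_path_diff_le\<close> with I =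
    \<epsilon>. It is not uniform in \<epsilon>, but only the existence of a fine enough subdivision
    of the segment is drawn from it.\<close>
  let ?R = "\<lambda>h. exp (\<epsilon> / (2 * \<epsilon>)) * ?G * (sqrt (2 * ?G * P.sink_sol_upper ^ 4 * h) + 2 * P.sink_sol_upper * h)"
  have bnz: "b w \<noteq> 0" if "w \<in> strip \<zeta>" for w :: "complex ^ 'd" using b_lower[OF that] \<beta>_pos by (auto simp: field_simps)
  have "(\<lambda>N. 2 * \<beta> * ?R (1 / real (Suc N))) \<longlonglongrightarrow> 2 * \<beta> * ?R 0"
    by (intro tendsto_intros LIMSEQ_Suc[OF lim_1_over_n])
  then have "(\<lambda>N. 2 * \<beta> * ?R (1 / real (Suc N))) \<longlonglongrightarrow> 0" by simp
  then have "eventually (\<lambda>N. 2 * \<beta> * ?R (1 / real (Suc N)) < 1 / 4) sequentially"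
    by (rule order_tendstoD) simp
  then obtain N where N: "2 * \<beta> * ?R (1 / real (Suc N)) < 1 / 4" by (auto simp: eventually_sequentially)
  let ?t = "\<lambda>i. real i / real (Suc N)"
  have step: "norm (TP.inv_wt_path (?t (Suc i)) w / b w - TP.inv_wt_path (?t i) w / b w) \<le> 1 / 4" if i: "Suc i \<le> Suc N" and w: "w \<in> strip \<zeta>" for i and w :: "complex ^ 'd"
  proof -
    have ti: "?t i \<in> {0..1}" "?t (Suc i) \<in> {0..1}" using i by auto
    have "?t (Suc i) - ?t i = 1 / real (Suc N)" by (simp add: diff_divide_distrib[symmetric])
    then have d: "\<bar>?t (Suc i) - ?t i\<bar> = 1 / real (Suc N)" by simp
    have "norm (TP.inv_wt_path (?t (Suc i)) w - TP.inv_wt_path (?t i) w) \<le> ?R (1 / real (Suc N))"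
      using TP.inv_wt_path_diff_le[OF ti strip_im_sq(2)[OF Z e w]] unfolding d .
    moreover have "1 / norm (b w) \<le> 2 * \<beta>"
    proof -
      have "1 / norm (b w) \<le> 1 / (1 / (2 * \<beta>))" using b_lower[OF w] \<beta>_pos bnz[OF w] by (intro divide_left_mono) auto
      then show ?thesis by simp
    qed
    ultimately have "norm (TP.inv_wt_path (?t (Suc i)) w - TP.inv_wt_path (?t i) w) * (1 / norm (b w)) \<le> ?R (1 / real (Suc N)) * (2 * \<beta>)"
      by (intro mult_mono) (auto intro: order_trans[OF norm_ge_zero])
    also have "\<dots> \<le> 1 / 4" using N by (simp add: mult_ac)
    finally show ?thesis by (simp add: diff_divide_distrib[symmetric] norm_divide)
  qed
  \<comment> \<open>At each node \<open>bootstrap\<close> improves 1/2 to 1/4, and the step to the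
    next node adds at most 1/4. The strip is kept whole in the induction because
    \<open>bootstrap\<close> needs the bound on all of it.\<close>
  have "\<forall>w\<in>(strip \<zeta> :: (complex^'d) set). norm (TP.inv_wt_path (?t i) w / b w - 1) \<le> 1 / 2" if "i \<le> Suc N" for i
    using that
  proof (induction i)
    case 0 then show ?case using bnz by simp
  next
    case (Suc i)
    show ?case
    proof
      fix w :: "complex ^ 'd" assume w: "w \<in> strip \<zeta>"
      have "norm (TP.inv_wt_path (?t i) w / b w - 1) \<le> close_const TYPE('d) \<beta> * \<delta>"
        using Suc by (intro bootstrap[OF _ _ w]) auto
      moreover have "norm (TP.inv_wt_path (?t (Suc i)) w / b w - 1) \<le> norm (TP.inv_wt_path (?t (Suc i)) w / b w - TP.inv_wt_path (?t i) w / b w) + norm (TP.inv_wt_path (?t i) w / b w - 1)"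
        using norm_triangle_ineq[of "TP.inv_wt_path (?t (Suc i)) w / b w - TP.inv_wt_path (?t i) w / b w" "TP.inv_wt_path (?t i) w / b w - 1"] by simp
      ultimately show "norm (TP.inv_wt_path (?t (Suc i)) w / b w - 1) \<le> 1 / 2"
        using step[OF Suc.prems w] small by linarith
    qed
  qed
  from this[of "Suc N"] have "\<forall>w\<in>(strip \<zeta> :: (complex^'d) set). norm (TP.inv_wt_path 1 w / b w - 1) \<le> 1 / 2" by simp
  then show ?thesis by (intro bootstrap[OF _ _ w]) auto
qed

end

section \<open>Sinkhorn weights of the density and of the sample\<close>

text \<open>The hypotheses on \<rho> hold up to null sets, while the locale asks for bounds at every
  point. Cutting off on null sets preserves Fourier coefficients, so
  \<open>bessel_potential_bounds\<close> can be applied to the modified functions.\<close>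

lemma density_log:
  fixes \<rho> :: "real ^ 'd::finite \<Rightarrow> real"
  assumes L: "0 < L" and s: "2 < s" and B: "0 \<le> B" and \<rho>: "torus_density L \<rho>"
    and pos: "\<exists>c>0. AE y in lborel. c \<le> \<rho> y" and W: "W_norm L s (\<lambda>y. complex_of_real (ln (\<rho> y))) = ennreal B"
  shows "\<exists>f. log_density L (B + 1) f \<and> (AE y in lborel. \<rho> y = exp (f y))"
proof -
  interpret C: torus_measure L "cell_measure L :: (real^'d) measure" by (simp add: torus_measure_def L finite_measure_cell_measure)
  let ?B = "B + 1"
  have \<rho>m [measurable]: "\<rho> \<in> borel_measurable borel" and \<rho>p: "periodic L \<rho>" and \<rho>1: "(LINT y:cell L|lborel. \<rho> y) = 1"
    using \<rho> by (auto simp: torus_density_def)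
  \<comment> \<open>The extra 1 gives a strict inequality, from which the infimum yields a \<psi>;
    hence \<open>B + 1\<close> in all constants.\<close>
  have "W_norm L s (\<lambda>y. complex_of_real (ln (\<rho> y))) < ennreal ?B" unfolding W using B by (simp add: ennreal_less_iff)
  then obtain \<psi> where J: "J_pow L s (\<lambda>y. complex_of_real (ln (\<rho> y))) \<psi>" and \<psi>B: "Linf_norm \<psi> < ennreal ?B"
    unfolding W_norm_def INF_less_iff by auto
  have \<psi>m [measurable]: "\<psi> \<in> borel_measurable borel" and \<psi>p: "periodic L \<psi>" using J by (auto simp: J_pow_def Linf_def)
  have \<psi>AE: "AE x in lborel. norm (\<psi> x) \<le> ?B"
    using esssup_AE[of "\<lambda>x. ennreal (norm (\<psi> x))" lborel]
  proof eventually_elim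
    case (elim x)
    then have "ennreal (norm (\<psi> x)) \<le> ennreal ?B" using \<psi>B unfolding Linf_norm_def by (meson le_less_trans less_imp_le)
    then show ?case using B by (subst (asm) ennreal_le_iff) auto
  qed
  obtain D0 where D0: "AE x in lborel. norm (complex_of_real (ln (\<rho> x))) \<le> D0" using J by (auto simp: J_pow_def Linf_def)
  define D where "D = max D0 0"
  have DAE: "AE x in lborel. \<bar>ln (\<rho> x)\<bar> \<le> D" using D0 by eventually_elim (auto simp: D_def)
  \<comment> \<open>Both cut-offs change the functions on a null set only and keep them
    periodic.\<close>
  define \<psi>1 where "\<psi>1 y = (if norm (\<psi> y) \<le> ?B then \<psi> y else 0)" for y
  define \<phi>1 where "\<phi>1 y = (if \<bar>ln (\<rho> y)\<bar> \<le> D then complex_of_real (ln (\<rho> y)) else 0)" for y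
  have m1 [measurable]: "\<psi>1 \<in> borel_measurable borel" "\<phi>1 \<in> borel_measurable borel"
    unfolding \<psi>1_def[abs_def] \<phi>1_def[abs_def] by measurable
  have \<psi>1B: "norm (\<psi>1 y) \<le> ?B" for y using B by (simp add: \<psi>1_def)
  have "norm (\<phi>1 y) \<le> D" for y by (auto simp: \<phi>1_def D_def)
  with \<psi>1B have bdd_borel: "\<psi>1 \<in> bdd_borel" "\<phi>1 \<in> bdd_borel" by (auto intro: bmI m1)
  have per: "periodic L \<psi>1" "periodic L \<phi>1" using \<rho>p \<psi>p by (auto simp: periodic_def \<psi>1_def \<phi>1_def)
  have ekm [measurable]: "fourier_mode L k \<in> borel_measurable borel" for k :: "int ^ 'd"
    by (rule borel_measurable_continuous_onI[OF continuous_fourier_mode])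
  have lm: "(\<lambda>y. complex_of_real (ln (\<rho> y))) \<in> borel_measurable borel" by measurable
  have i\<psi>: "(LINT y|cell_measure L. \<psi>1 y * fourier_mode L k y) = (LINT y|cell_measure L. \<psi> y * fourier_mode L k y)" for k
    by (rule integral_cong_AE) (auto intro!: AE_cmI[OF AE_mp[OF \<psi>AE]] simp: \<psi>1_def)
  have i\<phi>: "(LINT y|cell_measure L. \<phi>1 y * fourier_mode L k y) = (LINT y|cell_measure L. complex_of_real (ln (\<rho> y)) * fourier_mode L k y)" for k
    by (rule integral_cong_AE) (auto intro!: AE_cmI[OF AE_mp[OF DAE]] simp: \<phi>1_def)
  have coef: "(LINT y|cell_measure L. \<psi>1 y * fourier_mode L k y) = of_real ((1 + freq L k) powr (s / 2)) * (LINT y|cell_measure L. \<phi>1 y * fourier_mode L k y)" for k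
  proof -
    have "fourier_coeff L \<psi> k = of_real ((1 + freq L k) powr (s / 2)) * fourier_coeff L (\<lambda>y. complex_of_real (ln (\<rho> y))) k"
      using J by (simp add: J_pow_def freq_def)
    then have "complex_of_real (1 / L ^ CARD('d)) * (LINT y|cell_measure L. \<psi>1 y * fourier_mode L k y) =
       complex_of_real (1 / L ^ CARD('d)) * (of_real ((1 + freq L k) powr (s / 2)) * (LINT y|cell_measure L. \<phi>1 y * fourier_mode L k y))"
      unfolding i\<psi> i\<phi> by (simp only: fourier_coeff_cell_measure[OF \<psi>m] fourier_coeff_cell_measure[OF lm] mult_ac)
    moreover have "complex_of_real (1 / L ^ CARD('d)) \<noteq> 0" using L by simp
    ultimately show ?thesis using mult_left_cancel by blast
  qed
  have s1: "1 < s / 2" using s by simp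
  note bp = bessel_potential_bounds[OF L s1 bdd_borel(2) per(2) bdd_borel(1) per(1) \<psi>1B coef]
  have \<phi>1AE: "AE x in lborel. norm (\<phi>1 x) \<le> ?B"
    by (rule AE_cell_measure_lborel[OF L bp(1)]) (use per in \<open>auto simp: periodic_def\<close>)
  \<comment> \<open>A second cut-off, now at \<open>B + 1\<close>: the first part of
    \<open>bp\<close> replaces the bound D, about which nothing quantitative is known.\<close>
  define f where "f y = (if \<bar>ln (\<rho> y)\<bar> \<le> ?B then ln (\<rho> y) else 0)" for y
  have fm [measurable]: "f \<in> borel_measurable borel" unfolding f_def[abs_def] by measurable
  have fB: "\<bar>f y\<bar> \<le> ?B" for y using B by (simp add: f_def)
  have fb: "f \<in> bdd_borel" using fB by (intro bmI[OF fm]) auto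
  have fp: "periodic L f" using \<rho>p by (simp add: periodic_def f_def)
  have fln: "AE y in lborel. \<phi>1 y = of_real (f y) \<and> f y = ln (\<rho> y)"
    using \<phi>1AE DAE by eventually_elim (auto simp: \<phi>1_def f_def split: if_splits)
  have \<rho>f: "AE y in lborel. \<rho> y = exp (f y)"
  proof -
    obtain c where "0 < c" "AE y in lborel. c \<le> \<rho> y" using pos by auto
    from this(2) fln show ?thesis by eventually_elim (use \<open>0 < c\<close> in auto)
  qed
  have heat: "AE x in lborel. \<bar>f x - Kr L (cell_measure L) \<epsilon> f x\<bar> \<le> \<epsilon> * ?B" if e: "0 < \<epsilon>" for \<epsilon>
  proof (rule AE_cell_measure_lborel[OF L])
    have [measurable]: "rgauss \<epsilon> \<in> borel_measurable (borel :: (real^'d) measure)"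
      using integrable_rgauss[OF e] by (auto dest: borel_measurable_integrable)
    have [measurable]: "Kr L (cell_measure L) \<epsilon> f \<in> borel_measurable borel" by (rule bdd_borel_measurable[OF C.Kr_bdd_borel[OF e fb]])
    have I: "(LINT y|lborel. rgauss \<epsilon> y *\<^sub>R \<phi>1 (x + y)) = of_real (Kr L (cell_measure L) \<epsilon> f x)" for x
    proof -
      have "(LINT y|lborel. rgauss \<epsilon> y *\<^sub>R \<phi>1 (x + y)) = (LINT y|lborel. (\<lambda>y. rgauss \<epsilon> (y - x) *\<^sub>R \<phi>1 y) (x + y))" by simp
      also have "\<dots> = (LINT y|lborel. rgauss \<epsilon> (y - x) *\<^sub>R \<phi>1 y)" by (rule integral_lborel_translate) measurable
      also have "\<dots> = (LINT y|lborel. complex_of_real (rgauss \<epsilon> (y - x) * f y))"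
      proof (rule integral_cong_AE)
        show "AE y in lborel. rgauss \<epsilon> (y - x) *\<^sub>R \<phi>1 y = complex_of_real (rgauss \<epsilon> (y - x) * f y)"
          using fln by eventually_elim (simp add: scaleR_conv_of_real)
      qed measurable
      also have "\<dots> = of_real (LINT y|lborel. rgauss \<epsilon> (y - x) * f y)" by (rule integral_complex_of_real)
      also have "(LINT y|lborel. rgauss \<epsilon> (y - x) * f y) = Kr L (cell_measure L) \<epsilon> f x"
        unfolding Kr_def by (rule integral_rgauss_per_unfold[OF L e fb fp, symmetric])
      finally show ?thesis .
    qed
    show "AE x in cell_measure L. \<bar>f x - Kr L (cell_measure L) \<epsilon> f x\<bar> \<le> \<epsilon> * ?B"
      using bp(2)[OF e] AE_cmI[OF fln]
    proof eventually_elim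
      case (elim x)
      then have "norm (complex_of_real (f x - Kr L (cell_measure L) \<epsilon> f x)) \<le> \<epsilon> * ?B" unfolding I by simp
      then show ?case unfolding norm_of_real .
    qed
    show "\<bar>f (y + latt L j) - Kr L (cell_measure L) \<epsilon> f (y + latt L j)\<bar> \<le> \<epsilon> * ?B \<longleftrightarrow> \<bar>f y - Kr L (cell_measure L) \<epsilon> f y\<bar> \<le> \<epsilon> * ?B" for y j
      using fp C.Kr_periodic by (simp add: periodic_def)
    show "Measurable.pred borel (\<lambda>x. \<bar>f x - Kr L (cell_measure L) \<epsilon> f x\<bar> \<le> \<epsilon> * ?B)" by measurable
  qed
  have "(LINT y|cell_measure L. exp (f y)) = (LINT y|cell_measure L. \<rho> y)"
    by (rule integral_cong_AE) (auto intro!: AE_cmI[OF AE_mp[OF \<rho>f]])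
  then have mass: "(LINT y|cell_measure L. exp (f y)) = 1" using integral_cell_measure[OF \<rho>m] \<rho>1 by simp
  have "log_density L ?B f"
    by unfold_locales (use L fb fp fB heat mass in auto)
  with \<rho>f show ?thesis by blast
qed

lemma (in log_density) K_op_eq:
  assumes [measurable]: "\<rho> \<in> borel_measurable borel" and \<rho>: "AE y in lborel. \<rho> y = exp (f y)"
    and t: "0 < t" and \<phi>: "(\<lambda>y. \<phi> (cvec y)) \<in> bdd_borel"
  shows "K_op L \<rho> t \<phi> w = Ku L \<mu> t (\<lambda>y. \<phi> (cvec y)) w"
proof -
  have [measurable]: "(\<lambda>y. gauss_per L t (cvec y - w)) \<in> borel_measurable borel" "(\<lambda>y. \<phi> (cvec y)) \<in> borel_measurable borel"
    by (intro bdd_borel_measurable bdd_borel_gauss_per L t \<phi>)+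
  have "K_op L \<rho> t \<phi> w = (LINT y|cell_measure L. gauss_per L t (cvec y - w) * (of_real (\<rho> y) * \<phi> (cvec y)))"
    unfolding K_op_def C_op_def by (subst integral_cell_measure) auto
  also have "\<dots> = (LINT y|cell_measure L. exp (f y) *\<^sub>R (gauss_per L t (cvec y - w) * \<phi> (cvec y)))"
    by (rule integral_cong_AE) (auto intro!: AE_cmI[OF AE_mp[OF \<rho>]] simp: scaleR_conv_of_real)
  also have "\<dots> = Ku L \<mu> t (\<lambda>y. \<phi> (cvec y)) w"
    unfolding Ku_def by (rule integral_\<mu>[symmetric]) measurable
  finally show ?thesis .
qed

lemma C_op_eq:
  assumes "0 < L" "0 < t" and \<phi>: "(\<lambda>y. \<phi> (cvec y)) \<in> bdd_borel"
  shows "C_op L t \<phi> w = Ku L (cell_measure L) t (\<lambda>y. \<phi> (cvec y)) w"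
proof -
  have [measurable]: "(\<lambda>y. gauss_per L t (cvec y - w)) \<in> borel_measurable borel" "(\<lambda>y. \<phi> (cvec y)) \<in> borel_measurable borel"
    by (intro bdd_borel_measurable bdd_borel_gauss_per assms)+
  show ?thesis unfolding C_op_def Ku_def by (rule integral_cell_measure[symmetric]) measurable
qed

text \<open>The uniform distribution sits on the indices, so repeated sample points keep their
  multiplicity.\<close>

definition empirical :: "nat \<Rightarrow> (nat \<Rightarrow> real ^ 'd::finite) \<Rightarrow> (real ^ 'd) measure" where
  "empirical M x = distr (measure_pmf (pmf_of_set {1..M})) borel x"

lemma torus_prob_empirical:
  assumes "0 < L" "0 < \<epsilon>"
  shows "torus_prob L (empirical M x) \<epsilon>"
proof -
  interpret prob_space "empirical M x"
    unfolding empirical_def by (rule measure_pmf.prob_space_distr) simp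
  show ?thesis
    by unfold_locales (use assms emeasure_space_1 in \<open>auto simp: empirical_def\<close>)
qed

lemma integral_empirical:
  fixes f :: "real ^ 'd::finite \<Rightarrow> 'b::{banach,second_countable_topology}"
  assumes M: "1 \<le> M" and [measurable]: "f \<in> borel_measurable borel"
  shows "(LINT y|empirical M x. f y) = (1 / real M) *\<^sub>R (\<Sum>i = 1..M. f (x i))"
proof -
  have "(LINT y|empirical M x. f y) = (LINT i|measure_pmf (pmf_of_set {1..M}). f (x i))"
    unfolding empirical_def by (rule integral_distr) auto
  also have "\<dots> = (\<Sum>i = 1..M. pmf (pmf_of_set {1..M}) i *\<^sub>R f (x i))"
    by (rule integral_measure_pmf) (use M in \<open>auto simp: set_pmf_of_set\<close>)
  also have "\<dots> = (\<Sum>i = 1..M. (1 / real M) *\<^sub>R f (x i))"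
    by (intro sum.cong refl) (use M in auto)
  finally show ?thesis by (simp add: scaleR_sum_right)
qed

lemma KM_op_eq:
  assumes "0 < L" "0 < t" and M: "1 \<le> M" and \<phi>: "(\<lambda>y. \<phi> (cvec y)) \<in> bdd_borel"
  shows "KM_op L M x t \<phi> w = Ku L (empirical M x) t (\<lambda>y. \<phi> (cvec y)) w"
proof -
  have [measurable]: "(\<lambda>y. gauss_per L t (cvec y - w)) \<in> borel_measurable borel" "(\<lambda>y. \<phi> (cvec y)) \<in> borel_measurable borel"
    by (intro bdd_borel_measurable bdd_borel_gauss_per assms)+
  show ?thesis
    unfolding KM_op_def Ku_def using M
    by (subst integral_empirical) (auto simp: scaleR_conv_of_real gauss_per_commute[of L t w])
qed

context torus_prob
begin

text \<open>The hypothesis \<open>reg\<close> reduces uniqueness among all functions, as \<^const>\<open>sinkhorn\<close> demands, to uniqueness among bounded measurable ones.\<close>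

lemma sinkhorn_eq:
  assumes K: "\<And>\<phi> w. (\<lambda>y. \<phi> (cvec y)) \<in> bdd_borel \<Longrightarrow> K \<epsilon> \<phi> w = Ku L \<mu> \<epsilon> (\<lambda>y. \<phi> (cvec y)) w"
    and reg: "\<And>u :: real ^ 'd \<Rightarrow> real. (\<And>x. 0 < u x) \<Longrightarrow> (\<And>x. complex_of_real (u x) * K \<epsilon> (\<lambda>w. complex_of_real (u (re_vec w))) (cvec x) = 1) \<Longrightarrow> u \<in> bdd_borel"
  shows "sinkhorn L K \<epsilon> = sinkhorn_wt"
    and "U_wt L K \<epsilon> w = 1 / Ku L \<mu> \<epsilon> (\<lambda>y. of_real (sinkhorn_wt y)) w"
proof -
  have Kb: "complex_of_real (u x) * K \<epsilon> (\<lambda>w. complex_of_real (u (re_vec w))) (cvec x) = of_real (u x * Kr L \<mu> \<epsilon> u x)" if "u \<in> bdd_borel" for u x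
    using that by (subst K) (auto simp: Ku_of_real[OF e])
  show 1: "sinkhorn L K \<epsilon> = sinkhorn_wt"
    unfolding sinkhorn_def
  proof (rule the_equality)
    show "periodic L sinkhorn_wt \<and> (\<forall>x. 0 < sinkhorn_wt x) \<and> (\<forall>x. complex_of_real (sinkhorn_wt x) * K \<epsilon> (\<lambda>w. complex_of_real (sinkhorn_wt (re_vec w))) (cvec x) = 1)"
      using sinkhorn_wt_periodic sinkhorn_wt_pos by (auto simp: Kb[OF sinkhorn_wt_bdd_borel] Kr_sinkhorn_wt less_imp_neq[symmetric])
    fix u assume u: "periodic L u \<and> (\<forall>x. 0 < u x) \<and> (\<forall>x. complex_of_real (u x) * K \<epsilon> (\<lambda>w. complex_of_real (u (re_vec w))) (cvec x) = 1)"
    then have ub: "u \<in> bdd_borel" by (intro reg) auto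
    have "u x * Kr L \<mu> \<epsilon> u x = 1" for x
      using u Kb[OF ub, of x] by (metis of_real_eq_1_iff)
    then have "sink_sol 0 u" using u ub by (simp add: sink_sol_def)
    then show "u = sinkhorn_wt" by (simp add: sinkhorn_wt_eqI)
  qed
  show "U_wt L K \<epsilon> w = 1 / Ku L \<mu> \<epsilon> (\<lambda>y. of_real (sinkhorn_wt y)) w"
    unfolding U_wt_def 1 by (subst K) (auto simp: sinkhorn_wt_bdd_borel)
qed

end

text \<open>The operator reads u at the sample points only, so u is the reciprocal of a finite
  positive combination of kernels. This is measurable, and the term of \<open>x 1\<close> keeps the
  combination away from 0.\<close>

lemma KM_op_regular:
  fixes u :: "real ^ 'd::finite \<Rightarrow> real"
  assumes L: "0 < L" and t: "0 < t" and M: "1 \<le> M" and pos: "\<And>x. 0 < u x"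
    and eq: "\<And>y. complex_of_real (u y) * KM_op L M x t (\<lambda>w. complex_of_real (u (re_vec w))) (cvec y) = 1"
  shows "u \<in> bdd_borel"
proof -
  define k where "k y = 1 / real M * (\<Sum>i = 1..M. rgauss_per L t (y - x i) * u (x i))" for y
  have "KM_op L M x t (\<lambda>w. complex_of_real (u (re_vec w))) (cvec y) = of_real (k y)" for y
    by (simp add: KM_op_def k_def cvec_diff[symmetric] gauss_per_cvec[OF L t])
  then have "u y * k y = 1" for y using eq[of y] by (metis of_real_mult of_real_eq_1_iff)
  then have uk: "u y = 1 / k y" for y using pos[of y] by (metis less_irrefl nonzero_eq_divide_eq mult_zero_right zero_neq_one)
  have [measurable]: "rgauss_per L t \<in> borel_measurable (borel :: (real^'d) measure)" by (rule measurable_rgauss_per[OF L t])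
  let ?c = "1 / real M * (gmin TYPE('d) L t * u (x 1))"
  have c: "0 < ?c" using M pos[of "x 1"] gmin_pos[OF t, where 'd='d] by simp
  have kc: "?c \<le> k y" for y
  proof -
    have "gmin TYPE('d) L t * u (x 1) \<le> rgauss_per L t (y - x 1) * u (x 1)"
      using rgauss_per_lower[OF L t, of "y - x 1"] less_imp_le[OF pos[of "x 1"]] by (intro mult_right_mono) auto
    also have "\<dots> \<le> (\<Sum>i = 1..M. rgauss_per L t (y - x i) * u (x i))"
      using M by (intro member_le_sum) (auto intro: mult_nonneg_nonneg less_imp_le[OF pos] less_imp_le[OF rgauss_per_pos[OF L t]])
    finally show ?thesis unfolding k_def using M by (intro mult_left_mono) auto
  qed
  show ?thesis
  proof (rule bmI)
    have "k \<in> borel_measurable borel" unfolding k_def[abs_def] by measurable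
    then have "(\<lambda>y. 1 / k y) \<in> borel_measurable borel" by measurable
    then show "u \<in> borel_measurable borel" by (simp add: uk[symmetric])
    show "norm (u y) \<le> 1 / ?c" for y
    proof -
      have "1 / k y \<le> 1 / ?c" by (rule divide_left_mono[OF kc _ mult_pos_pos[OF less_le_trans[OF c kc] c]]) simp
      then show ?thesis unfolding uk[of y] using less_le_trans[OF c kc[of y]] by (simp only: real_norm_def abs_of_pos zero_less_divide_1_iff)
    qed
  qed
qed

text \<open>The equation forces integrability, as a non-integrable integrand would have integral 0.
  Then u is the reciprocal of an average of a nonnegative integrable function, which is measurable
  and bounded away from 0.\<close>

lemma K_op_regular:
  fixes u \<rho> :: "real ^ 'd::finite \<Rightarrow> real"
  assumes L: "0 < L" and t: "0 < t" and \<rho>: "AE y in lborel. 0 \<le> \<rho> y" and pos: "\<And>x. 0 < u x"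
    and eq: "\<And>x. complex_of_real (u x) * K_op L \<rho> t (\<lambda>w. complex_of_real (u (re_vec w))) (cvec x) = 1"
  shows "u \<in> bdd_borel"
proof -
  have gm [measurable]: "rgauss_per L t \<in> borel_measurable (borel :: (real^'d) measure)" by (rule measurable_rgauss_per[OF L t])
  let ?a = "gmin TYPE('d) L t"
  have a: "0 < ?a" by (rule gmin_pos[OF t])
  define G where "G y = indicat_real (cell L) y * (\<rho> y * u y)" for y
  define h where "h x y = rgauss_per L t (y - x) * G y" for x y
  have Kh: "K_op L \<rho> t (\<lambda>w. complex_of_real (u (re_vec w))) (cvec x) = (LINT y|lborel. complex_of_real (h x y))" for x
    unfolding K_op_def C_op_def set_lebesgue_integral_def h_def G_def
    by (intro Bochner_Integration.integral_cong refl) (simp add: cvec_diff[symmetric] gauss_per_cvec[OF L t] scaleR_conv_of_real mult_ac)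
  have nz: "(LINT y|lborel. complex_of_real (h x y)) \<noteq> 0" for x
    using eq[of x] unfolding Kh by auto
  \<comment> \<open>The default value 0 of the integral of a non-integrable function contradicts the
    equation.\<close>
  have "integrable lborel (\<lambda>y. complex_of_real (h x y))" for x
    using nz[of x] not_integrable_integral_eq by blast
  then have hi: "integrable lborel (h x)" for x
    using integrable_Re by fastforce
  define k where "k x = (LINT y|lborel. h x y)" for x
  have "u x * k x = 1" for x
    using eq[of x] unfolding Kh integral_complex_of_real k_def[symmetric] by (metis of_real_mult of_real_eq_1_iff)
  then have uk: "u x = 1 / k x" and knz: "k x \<noteq> 0" for x using pos[of x] by (metis less_irrefl nonzero_eq_divide_eq mult_zero_right zero_neq_one)+
  have G0: "AE y in lborel. 0 \<le> G y" using \<rho> by eventually_elim (simp add: G_def less_imp_le[OF pos])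
  \<comment> \<open>Measurability of G cannot come from u; it is inherited from the integrable
    \<open>h 0\<close> by dividing out the positive kernel.\<close>
  have hg: "G y = h 0 y / rgauss_per L t y" for y using rgauss_per_pos[OF L t, of y] by (simp add: h_def)
  have hm: "h 0 \<in> borel_measurable borel" using borel_measurable_integrable[OF hi[of 0]] by simp
  have Gm [measurable]: "G \<in> borel_measurable borel" unfolding hg[abs_def] using hm by measurable
  have Gi: "integrable lborel G"
  proof (rule Bochner_Integration.integrable_bound)
    show "integrable lborel (\<lambda>y. 1 / ?a * h 0 y)" by (intro integrable_mult_right hi)
    show "AE y in lborel. norm (G y) \<le> norm (1 / ?a * h 0 y)"
    proof (rule AE_I2)
      fix y
      have "?a * \<bar>G y\<bar> \<le> rgauss_per L t y * \<bar>G y\<bar>" by (intro mult_right_mono rgauss_per_lower[OF L t]) auto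
      then show "norm (G y) \<le> norm (1 / ?a * h 0 y)"
        using a rgauss_per_pos[OF L t, of y] by (simp add: h_def abs_mult field_simps)
    qed
  qed simp
  have klow: "?a * (LINT y|lborel. G y) \<le> k x" for x
  proof -
    have "(LINT y|lborel. ?a * G y) \<le> k x"
      unfolding k_def
    proof (rule integral_mono_AE)
      show "AE y in lborel. ?a * G y \<le> h x y"
        using G0 by eventually_elim (auto simp: h_def intro!: mult_right_mono rgauss_per_lower[OF L t])
    qed (auto intro: hi Gi)
    then show ?thesis by simp
  qed
  have "(LINT y|lborel. G y) \<noteq> 0"
  proof
    assume "(LINT y|lborel. G y) = 0"
    then have "AE y in lborel. G y = 0" using integral_nonneg_eq_0_iff_AE[OF Gi G0] by simp
    then have "AE y in lborel. h 0 y = 0" by eventually_elim (simp add: h_def)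
    then have "k 0 = 0" unfolding k_def by (rule integral_eq_zero_AE)
    then show False using knz by simp
  qed
  moreover have "0 \<le> (LINT y|lborel. G y)" by (rule integral_nonneg_AE[OF G0])
  ultimately have c: "0 < ?a * (LINT y|lborel. G y)" using a by simp
  show ?thesis
  proof (rule bmI)
    have "k \<in> borel_measurable borel" unfolding k_def[abs_def] h_def by measurable
    then have "(\<lambda>y. 1 / k y) \<in> borel_measurable borel" by measurable
    then show "u \<in> borel_measurable borel" by (simp add: uk[symmetric])
    show "norm (u x) \<le> 1 / (?a * (LINT y|lborel. G y))" for x
    proof -
      have "1 / k x \<le> 1 / (?a * (LINT y|lborel. G y))" by (rule divide_left_mono[OF klow _ mult_pos_pos[OF less_le_trans[OF c klow] c]]) simp
      then show ?thesis unfolding uk[of x] using less_le_trans[OF c klow[of x]] by (simp only: real_norm_def abs_of_pos zero_less_divide_1_iff)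
    qed
  qed
qed

section \<open>Normalised operators\<close>

lemma Ku_cmult: "Ku L \<mu> t (\<lambda>y. c * f y) w = c * Ku L \<mu> t f w"
  by (simp add: Ku_def mult.left_commute)

lemma (in torus_measure) norm_Ku_real_le:
  assumes t: "0 < t" and f: "f \<in> bdd_borel" and g: "g \<in> bdd_borel" and fg: "\<And>y. norm (f y) \<le> g y"
  shows "norm (Ku L \<mu> t f (cvec x)) \<le> Kr L \<mu> t g x"
proof -
  have "norm (Ku L \<mu> t f (cvec x)) \<le> Kr L \<mu> t (\<lambda>y. norm (f y)) x"
    using norm_Ku_le[OF t f, of "cvec x"] by simp
  also have "\<dots> \<le> Kr L \<mu> t g x" by (intro Kr_mono t bdd_borel_norm f g AE_I2 fg)
  finally show ?thesis .
qed

lemma strip_0: "w \<in> strip 0 \<longleftrightarrow> w = cvec (re_vec w)"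
  by (auto simp: strip_def cvec_def re_vec_def vec_eq_iff complex_eq_iff)

context torus_prob
begin

interpretation C: torus_measure L "cell_measure L :: (real ^ 'd) measure" by (rule torus_measure_cell_measure)

text \<open>Expressed through \<open>Ku\<close> and the weight at real points, the operators with
  and without superscript become one family indexed by the measure.\<close>

definition Uc :: "complex ^ 'd \<Rightarrow> complex" where
  "Uc w = 1 / Ku L \<mu> \<epsilon> (\<lambda>y. of_real (sinkhorn_wt y)) w"

definition Yc :: "complex ^ 'd \<Rightarrow> complex" where
  "Yc = Ku L \<mu> (\<epsilon> / 2) (\<lambda>y. of_real (sinkhorn_wt y))"

definition Pc :: "'d cop" where
  "Pc \<phi> w = Uc w * Ku L \<mu> \<epsilon> (\<lambda>y. of_real (sinkhorn_wt y) * \<phi> (cvec y)) w"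

definition Gc :: "'d cop" where
  "Gc \<phi> w = Uc w * Ku L (cell_measure L) (\<epsilon> / 2) (\<lambda>y. Yc (cvec y) * \<phi> (cvec y)) w"

definition Hc :: "'d cop" where
  "Hc \<phi> w = inverse (Yc w) * Ku L \<mu> (\<epsilon> / 2) (\<lambda>y. of_real (sinkhorn_wt y) * \<phi> (cvec y)) w"

lemma e2: "0 < \<epsilon> / 2" using e by simp

lemma skc_bdd_borel: "(\<lambda>y. complex_of_real (sinkhorn_wt y)) \<in> bdd_borel"
  using sinkhorn_wt_bdd_borel by simp

lemma Uc_cvec [simp]: "Uc (cvec x) = of_real (sinkhorn_wt x)"
  by (simp add: Uc_def Ku_of_real[OF e] Kr_sinkhorn_wt)

lemma Yc_cvec: "Yc (cvec x) = of_real (Kr L \<mu> (\<epsilon> / 2) sinkhorn_wt x)"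
  by (simp add: Yc_def Ku_of_real[OF e2])

lemma Yr_pos: "0 < Kr L \<mu> (\<epsilon> / 2) sinkhorn_wt x"
proof -
  have "(LINT y|\<mu>. sink_sol_lower) \<le> (LINT y|\<mu>. sinkhorn_wt y)"
    by (rule integral_mono[OF _ integrable_\<mu>[OF sinkhorn_wt_bdd_borel]]) (auto intro: sink_sol_bounds(2)[OF sink_sol_sinkhorn_wt])
  then have "0 < (LINT y|\<mu>. sinkhorn_wt y)" using sink_sol_lower_pos by simp
  then have "0 < gmin TYPE('d) L (\<epsilon> / 2) * (LINT y|\<mu>. sinkhorn_wt y)" using gmin_pos[OF e2, where 'd='d] by simp
  also have "\<dots> \<le> Kr L \<mu> (\<epsilon> / 2) sinkhorn_wt x" by (rule Kr_pos(1)[OF e2 sinkhorn_wt_bdd_borel]) (simp add: less_imp_le[OF sinkhorn_wt_pos])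
  finally show ?thesis .
qed

lemma Yc_bdd_borel: "(\<lambda>y. Yc (cvec y)) \<in> bdd_borel"
  unfolding Yc_def by (rule Ku_cvec_bdd_borel[OF e2 skc_bdd_borel])

lemma Yc_Hinf: "Yc \<in> Hinf L z"
  unfolding Yc_def by (rule Ku_Hinf[OF e2 skc_bdd_borel])

lemma Uc_Hinf:
  assumes "\<And>w. w \<in> strip z \<Longrightarrow> Ku L \<mu> \<epsilon> (\<lambda>y. of_real (sinkhorn_wt y)) w \<noteq> 0"
  shows "Uc \<in> Hinf L z"
  unfolding Uc_def[abs_def] divide_inverse mult_1 by (rule Hinf_inverse[OF Ku_Hinf[OF e skc_bdd_borel] assms])

lemma Uc_Hinf_0: "Uc \<in> Hinf L 0"
proof (rule Uc_Hinf)
  fix w :: "complex ^ 'd" assume "w \<in> strip 0"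
  then have "w = cvec (re_vec w)" by (simp add: strip_0)
  then have "Ku L \<mu> \<epsilon> (\<lambda>y. of_real (sinkhorn_wt y)) w = of_real (1 / sinkhorn_wt (re_vec w))"
    using Ku_of_real[OF e, of sinkhorn_wt "re_vec w"] by (simp add: Kr_sinkhorn_wt)
  then show "Ku L \<mu> \<epsilon> (\<lambda>y. of_real (sinkhorn_wt y)) w \<noteq> 0" using sinkhorn_wt_pos[of "re_vec w"] by simp
qed

context
  fixes \<phi> :: "complex ^ 'd \<Rightarrow> complex"
  assumes \<phi>: "(\<lambda>y. \<phi> (cvec y)) \<in> bdd_borel"
begin

lemma Pc_Hinf: "Uc \<in> Hinf L z \<Longrightarrow> Pc \<phi> \<in> Hinf L z"
  unfolding Pc_def[abs_def] by (intro Hinf_mult Ku_Hinf e bdd_borel_mult skc_bdd_borel \<phi>)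

lemma Gc_Hinf: "Uc \<in> Hinf L z \<Longrightarrow> Gc \<phi> \<in> Hinf L z"
  unfolding Gc_def[abs_def] by (intro Hinf_mult C.Ku_Hinf e2 bdd_borel_mult Yc_bdd_borel \<phi>)

lemma Hc_Hinf: "Hc \<phi> \<in> Hinf L 0"
  unfolding Hc_def[abs_def]
proof (intro Hinf_mult Hinf_inverse Yc_Hinf Ku_Hinf e2 bdd_borel_mult skc_bdd_borel \<phi>)
  fix w :: "complex ^ 'd" assume "w \<in> strip 0"
  then have "w = cvec (re_vec w)" by (simp add: strip_0)
  then have "Yc w = of_real (Kr L \<mu> (\<epsilon> / 2) sinkhorn_wt (re_vec w))" using Yc_cvec by metis
  then show "Yc w \<noteq> 0" using Yr_pos[of "re_vec w"] by simp
qed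

text \<open>\<open>Hc\<close> and \<open>Gc\<close> are Markov operators on the torus itself.\<close>

lemma norm_K_sinkhorn_wt_le:
  assumes "\<And>y. norm (\<phi> (cvec y)) \<le> N"
  shows "norm (Ku L \<mu> (\<epsilon> / 2) (\<lambda>y. of_real (sinkhorn_wt y) * \<phi> (cvec y)) (cvec x)) \<le> N * Kr L \<mu> (\<epsilon> / 2) sinkhorn_wt x"
  unfolding Kr_cmult[symmetric]
proof (rule norm_Ku_real_le[OF e2 bdd_borel_mult[OF skc_bdd_borel \<phi>] bdd_borel_cmult[OF sinkhorn_wt_bdd_borel]])
  show "norm (complex_of_real (sinkhorn_wt y) * \<phi> (cvec y)) \<le> N * sinkhorn_wt y" for y
    using assms[of y] sinkhorn_wt_pos[of y] by (simp add: norm_mult mult.commute)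
qed

lemma norm_Hc_le:
  assumes "\<And>y. norm (\<phi> (cvec y)) \<le> N"
  shows "norm (Hc \<phi> (cvec x)) \<le> N"
  using norm_K_sinkhorn_wt_le[OF assms, of x] Yr_pos[of x]
  by (simp add: Hc_def Yc_cvec norm_mult norm_inverse norm_divide pos_divide_le_eq divide_inverse[symmetric] mult.commute[of "inverse _"])

lemma norm_Gc_le:
  assumes N: "\<And>y. norm (\<phi> (cvec y)) \<le> N"
  shows "norm (Gc \<phi> (cvec x)) \<le> N"
proof -
  have yb: "Kr L \<mu> (\<epsilon> / 2) sinkhorn_wt \<in> bdd_borel" by (rule Kr_bdd_borel[OF e2 sinkhorn_wt_bdd_borel])
  have "norm (Ku L (cell_measure L) (\<epsilon> / 2) (\<lambda>y. Yc (cvec y) * \<phi> (cvec y)) (cvec x)) \<le> Kr L (cell_measure L) (\<epsilon> / 2) (\<lambda>y. N * Kr L \<mu> (\<epsilon> / 2) sinkhorn_wt y) x"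
  proof (rule C.norm_Ku_real_le[OF e2 bdd_borel_mult[OF Yc_bdd_borel \<phi>] bdd_borel_cmult[OF yb]])
    show "norm (Yc (cvec y) * \<phi> (cvec y)) \<le> N * Kr L \<mu> (\<epsilon> / 2) sinkhorn_wt y" for y
      using N[of y] Yr_pos[of y] by (simp add: norm_mult Yc_cvec mult.commute)
  qed
  \<comment> \<open>Two half-time averages combine to \<open>Kr L \<mu> \<epsilon>\<close> of the
    weight, which is its reciprocal; this is the normalisation G 1 = 1.\<close>
  also have "\<dots> = N / sinkhorn_wt x"
    unfolding C.Kr_cmult using Kr_semigroup[OF e2 e2 sinkhorn_wt_bdd_borel, of x, symmetric] by (simp add: Kr_sinkhorn_wt)
  finally show ?thesis using sinkhorn_wt_pos[of x] by (simp add: Gc_def norm_mult pos_le_divide_eq mult.commute)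
qed

end

section \<open>Identification with the operators of the statement\<close>

context
  fixes K :: "real \<Rightarrow> 'd cop"
  assumes K: "\<And>t \<phi> w. 0 < t \<Longrightarrow> (\<lambda>y. \<phi> (cvec y)) \<in> bdd_borel \<Longrightarrow> K t \<phi> w = Ku L \<mu> t (\<lambda>y. \<phi> (cvec y)) w"
    and reg: "\<And>u :: real ^ 'd \<Rightarrow> real. (\<And>x. 0 < u x) \<Longrightarrow> (\<And>x. complex_of_real (u x) * K \<epsilon> (\<lambda>w. complex_of_real (u (re_vec w))) (cvec x) = 1) \<Longrightarrow> u \<in> bdd_borel"
begin

lemma U_wt_eq: "U_wt L K \<epsilon> = Uc"
proof
  fix w
  have "U_wt L K \<epsilon> w = 1 / Ku L \<mu> \<epsilon> (\<lambda>y. of_real (sinkhorn_wt y)) w"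
    by (rule sinkhorn_eq(2)) (use K[OF e] reg in blast)+
  then show "U_wt L K \<epsilon> w = Uc w" by (simp add: Uc_def)
qed

lemma Y_wt_eq: "Y_wt L K \<epsilon> = Yc"
  unfolding Y_wt_def U_wt_eq Yc_def by (intro ext, subst K[OF e2]) (simp_all add: skc_bdd_borel sinkhorn_wt_bdd_borel)

lemma K_Uc_eq:
  assumes t: "0 < t" and \<phi>: "(\<lambda>y. \<phi> (cvec y)) \<in> bdd_borel"
  shows "K t (\<lambda>v. Uc v * \<phi> v) w = Ku L \<mu> t (\<lambda>y. of_real (sinkhorn_wt y) * \<phi> (cvec y)) w"
proof -
  have "(\<lambda>y. Uc (cvec y) * \<phi> (cvec y)) \<in> bdd_borel" using bdd_borel_mult[OF skc_bdd_borel \<phi>] by simp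
  from K[OF t this] show ?thesis by simp
qed

lemma P_op_eq: "(\<lambda>y. \<phi> (cvec y)) \<in> bdd_borel \<Longrightarrow> P_op L K \<epsilon> \<phi> = Pc \<phi>"
  by (intro ext) (simp add: P_op_def Pc_def U_wt_eq K_Uc_eq[OF e])

lemma G_op_eq: "(\<lambda>y. \<phi> (cvec y)) \<in> bdd_borel \<Longrightarrow> G_op L K \<epsilon> \<phi> = Gc \<phi>"
  by (intro ext) (simp add: G_op_def Gc_def U_wt_eq Y_wt_eq C_op_eq[OF L e2] bdd_borel_mult Yc_bdd_borel)

lemma H_op_eq: "(\<lambda>y. \<phi> (cvec y)) \<in> bdd_borel \<Longrightarrow> H_op L K \<epsilon> \<phi> = Hc \<phi>"
  by (intro ext) (simp add: H_op_def Hc_def U_wt_eq Y_wt_eq K_Uc_eq[OF e2])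

text \<open>Membership in \<open>Hinf L 0\<close> is carried along because \<open>G_op_eq\<close>
  and \<open>H_op_eq\<close> identify the operators on arguments that are bounded and measurable at
  real points.\<close>

lemma Q_op_eq:
  assumes "\<phi> \<in> Hinf L 0"
  shows "Q_op L K \<epsilon> n \<phi> = ((Hc \<circ> Gc) ^^ n) \<phi> \<and> ((Hc \<circ> Gc) ^^ n) \<phi> \<in> Hinf L 0"
proof (induction n)
  case 0 then show ?case using assms by (simp add: Q_op_def)
next
  case (Suc n)
  let ?\<psi> = "((Hc \<circ> Gc) ^^ n) \<phi>"
  have b: "(\<lambda>y. ?\<psi> (cvec y)) \<in> bdd_borel" using Suc Hinf_bdd_borel[OF L order_refl] by blast
  have b': "(\<lambda>y. Gc ?\<psi> (cvec y)) \<in> bdd_borel" by (rule Hinf_bdd_borel[OF L order_refl Gc_Hinf[OF b Uc_Hinf_0]])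
  have "Q_op L K \<epsilon> (Suc n) \<phi> = H_op L K \<epsilon> (G_op L K \<epsilon> (Q_op L K \<epsilon> n \<phi>))" by (simp add: Q_op_def)
  also have "\<dots> = Hc (Gc ?\<psi>)" using Suc G_op_eq[OF b] H_op_eq[OF b'] by argo
  finally show ?case using Hc_Hinf[OF b'] unfolding funpow.simps comp_apply by blast
qed

end

end

section \<open>Operator error bounds\<close>

lemma funpow_comp_Suc: "((f \<circ> g) ^^ Suc n) x = f (g (((f \<circ> g) ^^ n) x))"
  by simp

lemma norm_mult_mono:
  fixes u v :: "'a::real_normed_div_algebra"
  assumes "norm u \<le> p" "norm v \<le> q"
  shows "norm (u * v) \<le> p * q"
  unfolding norm_mult using assms order_trans[OF norm_ge_zero assms(1)] by (intro mult_mono) auto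

context sink_pair
begin

text \<open>R bounds averages against \<mu> on the strip: \<open>exp 1\<close> from the imaginary
  part, \<open>exp B\<close> from the density. The constants \<open>cY\<close>, \<open>cP\<close>,
  \<open>cG\<close>, \<open>cH\<close>, \<open>cT\<close> collect the terms of
  \<open>K_half_diff\<close>, \<open>P_diff\<close>, \<open>G_diff\<close>, \<open>H_diff\<close>
  and \<open>T_diff\<close>.\<close>

definition R :: real where "R = exp 1 * exp B"
definition \<kappa> :: real where "\<kappa> = close_const TYPE('d) \<beta>"
definition cY :: real where "cY = 4 * \<beta> + R * (4 * \<beta> * \<kappa>)"
definition cP :: real where "cP = 4 * \<beta> * (exp 1 * (4 * \<beta>)) + 4 * \<beta> * (R * (4 * \<beta> * \<kappa>)) + 4 * \<beta> * \<kappa> * (R * (2 * \<beta>))"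
definition cG :: real where "cG = 4 * \<beta> * \<kappa> * (exp 1 * (R * (2 * \<beta>) + 1)) + 2 * \<beta> * (exp 1 * cY)"
definition cH :: real where "cH = 2 * \<beta> * cY"
definition cT :: real where "cT = cG + cH * (2 * \<beta> * (exp 1 * (R * (2 * \<beta>))))"

lemma \<kappa>_pos: "0 < \<kappa>"
  unfolding \<kappa>_def by (rule close_const_pos[OF \<beta>_pos])

lemma R_pos: "0 < R" by (simp add: R_def)

lemma const_pos: "0 < cY" "0 < cP" "0 < cG" "0 < cH" "0 < cT"
  using \<beta>_pos \<kappa>_pos R_pos by (auto simp: cY_def cP_def cG_def cH_def cT_def intro!: add_pos_pos mult_pos_pos)

text \<open>The condition \<open>\<epsilon> \<le> 2 * t\<close> admits both times that occur,
  \<epsilon> and \<epsilon>/2, and keeps \<open>exp (im_sq w / (2 * t))\<close> at most e on the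
  strip.\<close>

lemma K_bound:
  assumes t: "\<epsilon> \<le> 2 * t" and g: "g \<in> bdd_borel" and N: "\<And>y. norm (g y) \<le> N" and w: "w \<in> strip \<zeta>"
  shows "norm (Ku L \<mu> t g w) \<le> R * N" "norm (Ku L (cell_measure L) t g w) \<le> exp 1 * N"
proof -
  have t0: "0 < t" using t e by linarith
  have N0: "0 \<le> N" using N[of 0] norm_ge_zero order_trans by blast
  have E: "exp (im_sq w / (2 * t)) \<le> exp 1"
    using strip_im_sq(2)[OF Z e w] t t0 by (simp add: field_simps)
  have 1: "Kr L (cell_measure L) t (\<lambda>y. norm (g y)) x \<le> N" for x
    using C.Kr_mono[OF t0 bdd_borel_norm[OF g] bdd_borel_const AE_I2[OF N], of x] by (simp add: Kr_cell_measure_const[OF t0])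
  have "Kr L \<mu> t (\<lambda>y. norm (g y)) x \<le> Kr L (cell_measure L) t (\<lambda>_. exp B * N) x" for x
    unfolding Kr_\<mu>[OF t0 bdd_borel_norm[OF g]]
    by (rule C.Kr_mono[OF t0 bdd_borel_mult[OF expf_bdd_borel bdd_borel_norm[OF g]] bdd_borel_const])
      (auto intro!: AE_I2 mult_mono expf_bounds N simp del: exp_le_cancel_iff)
  then have 2: "Kr L \<mu> t (\<lambda>y. norm (g y)) x \<le> exp B * N" for x by (simp add: Kr_cell_measure_const[OF t0])
  have nn: "0 \<le> Kr L \<mu> t (\<lambda>y. norm (g y)) x" "0 \<le> Kr L (cell_measure L) t (\<lambda>y. norm (g y)) x" for x
    unfolding Kr_def by (intro integral_nonneg_AE AE_I2 mult_nonneg_nonneg less_imp_le[OF rgauss_per_pos[OF L t0]] norm_ge_zero)+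
  have "norm (Ku L \<mu> t g w) \<le> exp (im_sq w / (2 * t)) * Kr L \<mu> t (\<lambda>y. norm (g y)) (re_vec w)"
    by (rule P.norm_Ku_le[OF t0 g])
  also have "\<dots> \<le> exp 1 * (exp B * N)" using nn by (intro mult_mono E 2) auto
  finally show "norm (Ku L \<mu> t g w) \<le> R * N" by (simp add: R_def mult.assoc)
  have "norm (Ku L (cell_measure L) t g w) \<le> exp (im_sq w / (2 * t)) * Kr L (cell_measure L) t (\<lambda>y. norm (g y)) (re_vec w)"
    by (rule C.norm_Ku_le[OF t0 g])
  also have "\<dots> \<le> exp 1 * N" using nn by (intro mult_mono E 1) auto
  finally show "norm (Ku L (cell_measure L) t g w) \<le> exp 1 * N" .
qed

lemma b_nz: "w \<in> strip \<zeta> \<Longrightarrow> b w \<noteq> 0"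
  using b_lower[of w] \<beta>_pos by auto

context
  assumes small: "\<kappa> * \<delta> \<le> 1 / 4" and small_Y: "cY * \<delta> \<le> 1"
begin

lemma Q_bound:
  assumes w: "w \<in> strip \<zeta>"
  shows "TP.inv_wt_path 1 w \<noteq> 0" "norm (1 / TP.inv_wt_path 1 w) \<le> 4 * \<beta>" "norm (TP.inv_wt_path 1 w / b w - 1) \<le> \<kappa> * \<delta>"
proof -
  show c: "norm (TP.inv_wt_path 1 w / b w - 1) \<le> \<kappa> * \<delta>"
    unfolding \<kappa>_def by (rule closeness[OF small[unfolded \<kappa>_def] w])
  have "1 / 2 \<le> norm (TP.inv_wt_path 1 w / b w)"
    using c small norm_triangle_ineq2[of 1 "TP.inv_wt_path 1 w / b w"] by (simp add: norm_minus_commute)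
  then have "1 / 2 * norm (b w) \<le> norm (TP.inv_wt_path 1 w)"
    using b_nz[OF w] by (simp add: norm_divide pos_le_divide_eq)
  moreover have "1 / 2 * (1 / (2 * \<beta>)) \<le> 1 / 2 * norm (b w)" by (intro mult_left_mono b_lower w) simp
  ultimately have l: "1 / (4 * \<beta>) \<le> norm (TP.inv_wt_path 1 w)" by simp
  moreover have "0 < 1 / (4 * \<beta>)" using \<beta>_pos by simp
  ultimately have p: "0 < norm (TP.inv_wt_path 1 w)" by linarith
  then show "TP.inv_wt_path 1 w \<noteq> 0" by simp
  have "1 / norm (TP.inv_wt_path 1 w) \<le> 1 / (1 / (4 * \<beta>))" using l p \<beta>_pos by (intro divide_left_mono) auto
  then show "norm (1 / TP.inv_wt_path 1 w) \<le> 4 * \<beta>" by (simp add: norm_divide)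
qed

lemma PU: "P.Uc w = 1 / b w" and QU: "Q.Uc w = 1 / TP.inv_wt_path 1 w"
  by (simp_all only: P.Uc_def Q.Uc_def TP.inv_wt_path_0 TP.inv_wt_path_1)

lemma U_bounds:
  assumes w: "w \<in> strip \<zeta>"
  shows "norm (P.Uc w) \<le> 2 * \<beta>" "norm (Q.Uc w) \<le> 4 * \<beta>" "norm (Q.Uc w - P.Uc w) \<le> 4 * \<beta> * \<kappa> * \<delta>"
proof -
  have "1 / norm (b w) \<le> 1 / (1 / (2 * \<beta>))" using b_lower[OF w] b_nz[OF w] \<beta>_pos by (intro divide_left_mono) auto
  then show "norm (P.Uc w) \<le> 2 * \<beta>" by (simp add: PU norm_divide)
  show 2: "norm (Q.Uc w) \<le> 4 * \<beta>" unfolding QU by (rule Q_bound(2)[OF w])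
  \<comment> \<open>Both weights are reciprocals, so their difference is expressed by the ratio that
    \<open>closeness\<close> controls.\<close>
  have "Q.Uc w - P.Uc w = - (Q.Uc w * (TP.inv_wt_path 1 w / b w - 1))"
    using Q_bound(1)[OF w] b_nz[OF w] unfolding PU QU by (simp add: field_simps)
  then have "norm (Q.Uc w - P.Uc w) = norm (Q.Uc w) * norm (TP.inv_wt_path 1 w / b w - 1)" by (simp only: norm_minus_cancel norm_mult)
  also have "\<dots> \<le> 4 * \<beta> * (\<kappa> * \<delta>)" using \<beta>_pos by (intro mult_mono 2 Q_bound(3)[OF w]) auto
  finally show "norm (Q.Uc w - P.Uc w) \<le> 4 * \<beta> * \<kappa> * \<delta>" by (simp add: mult.assoc)
qed

lemma U_Hinf: "P.Uc \<in> Hinf L \<zeta>" "Q.Uc \<in> Hinf L \<zeta>"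
  using b_nz Q_bound(1) by (auto intro!: P.Uc_Hinf Q.Uc_Hinf simp: TP.inv_wt_path_0 TP.inv_wt_path_1)

lemma sinkhorn_wt_bounds: "\<bar>P.sinkhorn_wt y\<bar> \<le> 2 * \<beta>" "\<bar>Q.sinkhorn_wt y\<bar> \<le> 4 * \<beta>" "\<bar>Q.sinkhorn_wt y - P.sinkhorn_wt y\<bar> \<le> 4 * \<beta> * \<kappa> * \<delta>"
  using U_bounds[OF cvec_in_strip[OF \<zeta>_nonneg], of y] by (simp_all flip: of_real_diff)

context
  fixes \<phi> :: "complex ^ 'd \<Rightarrow> complex" and N :: real
  assumes \<phi>: "\<phi> \<in> Hinf L \<zeta>" and N: "\<And>w. w \<in> strip \<zeta> \<Longrightarrow> norm (\<phi> w) \<le> N"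
begin

lemma \<phi>_bm: "(\<lambda>y. \<phi> (cvec y)) \<in> bdd_borel"
  by (rule Hinf_bdd_borel[OF L \<zeta>_nonneg \<phi>])

lemma \<phi>_real: "norm (\<phi> (cvec y)) \<le> N"
  by (rule N[OF cvec_in_strip[OF \<zeta>_nonneg]])

lemma U\<phi>: "(\<lambda>w. Q.Uc w * \<phi> w) \<in> Hinf L \<zeta>" "w \<in> strip \<zeta> \<Longrightarrow> norm (Q.Uc w * \<phi> w) \<le> 4 * \<beta> * N"
  by (rule Hinf_mult[OF U_Hinf(2) \<phi>]) (auto simp: norm_mult intro!: mult_mono U_bounds N less_imp_le[OF \<beta>_pos])

lemma X_bounds:
  assumes t: "\<epsilon> \<le> 2 * t" and w: "w \<in> strip \<zeta>"
  shows "norm (Ku L \<mu> t (\<lambda>y. of_real (P.sinkhorn_wt y) * \<phi> (cvec y)) w) \<le> R * (2 * \<beta> * N)"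
    and "norm (Ku L \<mu> t (\<lambda>y. of_real (Q.sinkhorn_wt y) * \<phi> (cvec y)) w - Ku L \<mu> t (\<lambda>y. of_real (P.sinkhorn_wt y) * \<phi> (cvec y)) w) \<le> R * (4 * \<beta> * \<kappa> * \<delta> * N)"
proof -
  have t0: "0 < t" using t e by linarith
  have N0: "0 \<le> N" using \<phi>_real[of 0] norm_ge_zero order_trans by blast
  have b: "(\<lambda>y. of_real (P.sinkhorn_wt y) * \<phi> (cvec y)) \<in> bdd_borel" "(\<lambda>y. of_real (Q.sinkhorn_wt y) * \<phi> (cvec y)) \<in> bdd_borel"
    by (intro bdd_borel_mult P.skc_bdd_borel Q.skc_bdd_borel \<phi>_bm)+
  show "norm (Ku L \<mu> t (\<lambda>y. of_real (P.sinkhorn_wt y) * \<phi> (cvec y)) w) \<le> R * (2 * \<beta> * N)"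
    by (rule K_bound(1)[OF t b(1) _ w]) (auto simp: norm_mult intro!: mult_mono sinkhorn_wt_bounds \<phi>_real less_imp_le[OF \<beta>_pos])
  have "norm (of_real (Q.sinkhorn_wt y) * \<phi> (cvec y) - of_real (P.sinkhorn_wt y) * \<phi> (cvec y)) \<le> 4 * \<beta> * \<kappa> * \<delta> * N" for y
  proof -
    have "of_real (Q.sinkhorn_wt y) * \<phi> (cvec y) - of_real (P.sinkhorn_wt y) * \<phi> (cvec y) = of_real (Q.sinkhorn_wt y - P.sinkhorn_wt y) * \<phi> (cvec y)"
      by (simp add: left_diff_distrib)
    also have "norm \<dots> \<le> 4 * \<beta> * \<kappa> * \<delta> * N"
      unfolding norm_mult norm_of_real using \<beta>_pos \<kappa>_pos \<delta>0 by (intro mult_mono sinkhorn_wt_bounds(3) \<phi>_real) auto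
    finally show ?thesis .
  qed
  then show "norm (Ku L \<mu> t (\<lambda>y. of_real (Q.sinkhorn_wt y) * \<phi> (cvec y)) w - Ku L \<mu> t (\<lambda>y. of_real (P.sinkhorn_wt y) * \<phi> (cvec y)) w) \<le> R * (4 * \<beta> * \<kappa> * \<delta> * N)"
    unfolding P.Ku_diff[OF t0 b(2,1), symmetric] by (rule K_bound(1)[OF t bdd_borel_diff[OF b(2,1)] _ w])
qed

lemma P_diff:
  assumes w: "w \<in> strip \<zeta>"
  shows "norm (Q.Pc \<phi> w - P.Pc \<phi> w) \<le> cP * (\<delta> * N)"
proof -
  have t: "\<epsilon> \<le> 2 * \<epsilon>" using e by simp
  define A B' C' where "A = Ku L \<nu> \<epsilon> (\<lambda>y. of_real (Q.sinkhorn_wt y) * \<phi> (cvec y)) w"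
    and "B' = Ku L \<mu> \<epsilon> (\<lambda>y. of_real (Q.sinkhorn_wt y) * \<phi> (cvec y)) w" and "C' = Ku L \<mu> \<epsilon> (\<lambda>y. of_real (P.sinkhorn_wt y) * \<phi> (cvec y)) w"
  have AB: "norm (A - B') \<le> exp 1 * (\<delta> * (4 * \<beta> * N))"
    using E_bound[OF U\<phi>(1) _ w, of "4 * \<beta> * N"] U\<phi>(2) by (simp add: A_def B'_def)
  note X = X_bounds[OF t w, folded B'_def C'_def]
  \<comment> \<open>Three replacements in turn: the measure, the weight under the integral, the
    weight in front.\<close>
  have "Q.Pc \<phi> w - P.Pc \<phi> w = Q.Uc w * (A - B') + Q.Uc w * (B' - C') + (Q.Uc w - P.Uc w) * C'"
    unfolding Q.Pc_def P.Pc_def A_def[symmetric] C'_def[symmetric] by (simp add: algebra_simps)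
  also have "norm \<dots> \<le> 4 * \<beta> * (exp 1 * (\<delta> * (4 * \<beta> * N))) + 4 * \<beta> * (R * (4 * \<beta> * \<kappa> * \<delta> * N)) + 4 * \<beta> * \<kappa> * \<delta> * (R * (2 * \<beta> * N))"
    by (intro norm_triangle_mono norm_mult_mono AB X U_bounds w)
  also have "\<dots> = cP * (\<delta> * N)" by (simp add: cP_def algebra_simps)
  finally show ?thesis .
qed

text \<open>Evaluated at real points, where at time \<epsilon>/2 the sampling error is what \<delta>
  bounds. With \<phi> = 1 it also compares the two functions \<open>Yc\<close>.\<close>

lemma K_half_diff:
  "norm (Ku L \<nu> (\<epsilon> / 2) (\<lambda>y. of_real (Q.sinkhorn_wt y) * \<phi> (cvec y)) (cvec x) - Ku L \<mu> (\<epsilon> / 2) (\<lambda>y. of_real (P.sinkhorn_wt y) * \<phi> (cvec y)) (cvec x)) \<le> cY * \<delta> * N"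
proof -
  have t: "\<epsilon> \<le> 2 * (\<epsilon> / 2)" by simp
  define A B' C' where "A = Ku L \<nu> (\<epsilon> / 2) (\<lambda>y. of_real (Q.sinkhorn_wt y) * \<phi> (cvec y)) (cvec x)"
    and "B' = Ku L \<mu> (\<epsilon> / 2) (\<lambda>y. of_real (Q.sinkhorn_wt y) * \<phi> (cvec y)) (cvec x)" and "C' = Ku L \<mu> (\<epsilon> / 2) (\<lambda>y. of_real (P.sinkhorn_wt y) * \<phi> (cvec y)) (cvec x)"
  have AB: "norm (A - B') \<le> \<delta> * (4 * \<beta> * N)"
    using \<delta>[OF U\<phi>(1), of "4 * \<beta> * N" x] U\<phi>(2) by (simp add: A_def B'_def)
  note X = X_bounds(2)[OF t cvec_in_strip[OF \<zeta>_nonneg, of x], folded B'_def C'_def]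
  have "norm (A - C') = norm ((A - B') + (B' - C'))" by simp
  also have "\<dots> \<le> \<delta> * (4 * \<beta> * N) + R * (4 * \<beta> * \<kappa> * \<delta> * N)" by (rule norm_triangle_mono[OF AB X])
  also have "\<dots> = cY * \<delta> * N" by (simp add: cY_def algebra_simps)
  finally show ?thesis unfolding A_def C'_def .
qed

end

lemma one_Hinf: "(\<lambda>_. 1) \<in> Hinf L z"
  by (auto simp: Hinf_def holo_at_def intro!: exI[of _ "\<lambda>_. 0"])

lemma Y_diff: "norm (Q.Yc (cvec x) - P.Yc (cvec x)) \<le> cY * \<delta>"
  using K_half_diff[OF one_Hinf, of 1 x] by (simp add: Q.Yc_def P.Yc_def)

lemma Y_upper: "norm (P.Yc (cvec x)) \<le> R * (2 * \<beta>)" "norm (Q.Yc (cvec x)) \<le> R * (2 * \<beta>) + 1"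
proof -
  show 1: "norm (P.Yc (cvec x)) \<le> R * (2 * \<beta>)"
    using X_bounds(1)[OF one_Hinf _ _ cvec_in_strip[OF \<zeta>_nonneg], of 1 "\<epsilon> / 2" x] by (simp add: P.Yc_def)
  show "norm (Q.Yc (cvec x)) \<le> R * (2 * \<beta>) + 1"
    using Y_diff[of x] norm_triangle_sub[of "Q.Yc (cvec x)" "P.Yc (cvec x)"] 1 small_Y by linarith
qed

text \<open>At real points \<open>P.Yc\<close> is the average over time \<epsilon>/2 of
  \<open>a\<close>, which is at least \<open>1 / \<beta>\<close>.\<close>

lemma Y_lower: "norm (inverse (P.Yc (cvec x))) \<le> \<beta>"
proof -
  have "a \<in> bdd_borel" unfolding a_def[abs_def] by (intro bdd_borel_mult expf_bdd_borel P.sinkhorn_wt_bdd_borel)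
  from C.Kr_mono[OF e2 bdd_borel_const this AE_I2[OF P_bounds(4)], of x]
  have l: "1 / \<beta> \<le> Kr L \<mu> (\<epsilon> / 2) P.sinkhorn_wt x"
    by (simp add: Kr_cell_measure_const[OF e2] Kr_\<mu>[OF e2 P.sinkhorn_wt_bdd_borel] a_def)
  have "inverse (Kr L \<mu> (\<epsilon> / 2) P.sinkhorn_wt x) \<le> inverse (1 / \<beta>)" using l \<beta>_pos by (intro le_imp_inverse_le) auto
  then show ?thesis using P.Yr_pos[of x] by (simp add: P.Yc_cvec norm_inverse)
qed

lemma H_diff:
  assumes \<phi>: "\<phi> \<in> Hinf L \<zeta>" and N: "\<And>w. w \<in> strip \<zeta> \<Longrightarrow> norm (\<phi> w) \<le> N"
  shows "norm (Q.Hc \<phi> (cvec x) - P.Hc \<phi> (cvec x)) \<le> cH * (\<delta> * N)"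
proof -
  let ?yp = "P.Yc (cvec x)" and ?yq = "Q.Yc (cvec x)"
  define A C' where "A = Ku L \<nu> (\<epsilon> / 2) (\<lambda>y. of_real (Q.sinkhorn_wt y) * \<phi> (cvec y)) (cvec x)"
    and "C' = Ku L \<mu> (\<epsilon> / 2) (\<lambda>y. of_real (P.sinkhorn_wt y) * \<phi> (cvec y)) (cvec x)"
  have Nr: "norm (\<phi> (cvec y)) \<le> N" for y by (rule \<phi>_real[OF \<phi> N])
  have nz: "?yp \<noteq> 0" "?yq \<noteq> 0" using P.Yr_pos[of x] Q.Yr_pos[of x] by (auto simp: P.Yc_cvec Q.Yc_cvec)
  \<comment> \<open>The reciprocal of \<open>?yq\<close> is hidden in \<open>Q.Hc\<close>, a
    contraction at real points, so only \<open>inverse ?yp\<close> has to be estimated.\<close>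
  have "Q.Hc \<phi> (cvec x) - P.Hc \<phi> (cvec x) = - (inverse ?yp * ((?yq - ?yp) * Q.Hc \<phi> (cvec x))) + inverse ?yp * (A - C')"
    using nz unfolding Q.Hc_def P.Hc_def A_def[symmetric] C'_def[symmetric] by (simp add: field_simps)
  also have "norm \<dots> \<le> \<beta> * (cY * \<delta> * N) + \<beta> * (cY * \<delta> * N)"
  proof (rule norm_triangle_mono)
    show "norm (- (inverse ?yp * ((?yq - ?yp) * Q.Hc \<phi> (cvec x)))) \<le> \<beta> * (cY * \<delta> * N)"
      unfolding norm_minus_cancel norm_mult using \<beta>_pos const_pos(1) \<delta>0
      by (intro mult_mono Y_lower Y_diff Q.norm_Hc_le[OF \<phi>_bm[OF \<phi> N] Nr]) auto
    show "norm (inverse ?yp * (A - C')) \<le> \<beta> * (cY * \<delta> * N)"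
      unfolding norm_mult A_def C'_def using \<beta>_pos by (intro mult_mono Y_lower K_half_diff[OF \<phi> N]) auto
  qed
  also have "\<dots> = cH * (\<delta> * N)" by (simp add: cH_def algebra_simps)
  finally show ?thesis .
qed

lemma Gc_bdd_borel:
  assumes "(\<lambda>y. \<phi> (cvec y)) \<in> bdd_borel"
  shows "(\<lambda>y. P.Gc \<phi> (cvec y)) \<in> bdd_borel" "(\<lambda>y. Q.Gc \<phi> (cvec y)) \<in> bdd_borel"
  by (intro Hinf_bdd_borel[OF L order_refl] P.Gc_Hinf Q.Gc_Hinf assms P.Uc_Hinf_0 Q.Uc_Hinf_0)+

section \<open>Errors of G and of the powers of H G on continuous functions\<close>

context
  fixes \<phi> :: "complex ^ 'd \<Rightarrow> complex" and N :: real
  assumes \<phi>: "(\<lambda>y. \<phi> (cvec y)) \<in> bdd_borel" and N: "\<And>y. norm (\<phi> (cvec y)) \<le> N"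
begin

lemma CY_bound:
  assumes w: "w \<in> strip \<zeta>" and Y: "(\<lambda>y. Y (cvec y)) \<in> bdd_borel" and c: "\<And>y. norm (Y (cvec y)) \<le> c"
  shows "norm (Ku L (cell_measure L) (\<epsilon> / 2) (\<lambda>y. Y (cvec y) * \<phi> (cvec y)) w) \<le> exp 1 * (c * N)"
proof (rule K_bound(2)[OF _ bdd_borel_mult[OF Y \<phi>] _ w])
  have "0 \<le> c" using c[of 0] norm_ge_zero order_trans by blast
  then show "norm (Y (cvec y) * \<phi> (cvec y)) \<le> c * N" for y unfolding norm_mult by (intro mult_mono c N) auto
qed simp

lemma G_bound: "w \<in> strip \<zeta> \<Longrightarrow> norm (P.Gc \<phi> w) \<le> 2 * \<beta> * (exp 1 * (R * (2 * \<beta>) * N))"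
  unfolding P.Gc_def norm_mult using \<beta>_pos by (intro mult_mono U_bounds CY_bound P.Yc_bdd_borel Y_upper) auto

lemma G_diff:
  assumes w: "w \<in> strip \<zeta>"
  shows "norm (Q.Gc \<phi> w - P.Gc \<phi> w) \<le> cG * (\<delta> * N)"
proof -
  have b: "(\<lambda>y. Q.Yc (cvec y) * \<phi> (cvec y)) \<in> bdd_borel" "(\<lambda>y. P.Yc (cvec y) * \<phi> (cvec y)) \<in> bdd_borel"
    by (intro bdd_borel_mult P.Yc_bdd_borel Q.Yc_bdd_borel \<phi>)+
  define A C' where "A = Ku L (cell_measure L) (\<epsilon> / 2) (\<lambda>y. Q.Yc (cvec y) * \<phi> (cvec y)) w"
    and "C' = Ku L (cell_measure L) (\<epsilon> / 2) (\<lambda>y. P.Yc (cvec y) * \<phi> (cvec y)) w"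
  have A: "norm A \<le> exp 1 * ((R * (2 * \<beta>) + 1) * N)"
    unfolding A_def by (rule CY_bound[OF w Q.Yc_bdd_borel Y_upper(2)])
  have AC: "norm (A - C') \<le> exp 1 * (cY * \<delta> * N)"
    unfolding A_def C'_def C.Ku_diff[OF e2 b, symmetric]
    using CY_bound[where Y="\<lambda>w. Q.Yc w - P.Yc w", OF w bdd_borel_diff[OF Q.Yc_bdd_borel P.Yc_bdd_borel] Y_diff] by (simp add: left_diff_distrib)
  have "Q.Gc \<phi> w - P.Gc \<phi> w = (Q.Uc w - P.Uc w) * A + P.Uc w * (A - C')"
    unfolding Q.Gc_def P.Gc_def A_def[symmetric] C'_def[symmetric] by (simp add: algebra_simps)
  also have "norm \<dots> \<le> 4 * \<beta> * \<kappa> * \<delta> * (exp 1 * ((R * (2 * \<beta>) + 1) * N)) + 2 * \<beta> * (exp 1 * (cY * \<delta> * N))"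
    by (intro norm_triangle_mono norm_mult_mono A AC U_bounds w)
  also have "\<dots> = cG * (\<delta> * N)" by (simp add: cG_def algebra_simps)
  finally show ?thesis .
qed

text \<open>The intermediate term is \<open>Q.Hc (P.Gc \<phi>)\<close>: the contraction
  \<open>Q.Hc\<close> acts on the error of G, and \<open>P.Gc \<phi>\<close> is analytic on the
  strip, as \<open>H_diff\<close> requires, although \<phi> is controlled at real points
  only.\<close>

lemma T_diff: "norm (Q.Hc (Q.Gc \<phi>) (cvec x) - P.Hc (P.Gc \<phi>) (cvec x)) \<le> cT * (\<delta> * N)"
proof -
  have bq: "(\<lambda>y. of_real (Q.sinkhorn_wt y) * Q.Gc \<phi> (cvec y)) \<in> bdd_borel" "(\<lambda>y. of_real (Q.sinkhorn_wt y) * P.Gc \<phi> (cvec y)) \<in> bdd_borel"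
    by (intro bdd_borel_mult Q.skc_bdd_borel Gc_bdd_borel \<phi>)+
  have "Q.Hc (Q.Gc \<phi>) (cvec x) - Q.Hc (P.Gc \<phi>) (cvec x) = Q.Hc (\<lambda>w. Q.Gc \<phi> w - P.Gc \<phi> w) (cvec x)"
    unfolding Q.Hc_def right_diff_distrib Q.Ku_diff[OF e2 bq] ..
  also have "norm \<dots> \<le> cG * (\<delta> * N)"
    by (rule Q.norm_Hc_le[OF bdd_borel_diff[OF Gc_bdd_borel(2)[OF \<phi>] Gc_bdd_borel(1)[OF \<phi>]] G_diff[OF cvec_in_strip[OF \<zeta>_nonneg]]])
  finally have 1: "norm (Q.Hc (Q.Gc \<phi>) (cvec x) - Q.Hc (P.Gc \<phi>) (cvec x)) \<le> cG * (\<delta> * N)" .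
  have 2: "norm (Q.Hc (P.Gc \<phi>) (cvec x) - P.Hc (P.Gc \<phi>) (cvec x)) \<le> cH * (\<delta> * (2 * \<beta> * (exp 1 * (R * (2 * \<beta>) * N))))"
    by (rule H_diff[OF P.Gc_Hinf[OF \<phi> U_Hinf(1)] G_bound])
  have "norm (Q.Hc (Q.Gc \<phi>) (cvec x) - P.Hc (P.Gc \<phi>) (cvec x)) =
    norm ((Q.Hc (Q.Gc \<phi>) (cvec x) - Q.Hc (P.Gc \<phi>) (cvec x)) + (Q.Hc (P.Gc \<phi>) (cvec x) - P.Hc (P.Gc \<phi>) (cvec x)))" by simp
  also have "\<dots> \<le> cG * (\<delta> * N) + cH * (\<delta> * (2 * \<beta> * (exp 1 * (R * (2 * \<beta>) * N))))"
    by (rule norm_triangle_mono[OF 1 2])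
  also have "\<dots> = cT * (\<delta> * N)" by (simp add: cT_def algebra_simps)
  finally show ?thesis .
qed

end

lemma PT_diff_le:
  assumes \<phi>: "(\<lambda>y. \<phi> (cvec y)) \<in> bdd_borel" and \<psi>: "(\<lambda>y. \<psi> (cvec y)) \<in> bdd_borel" and N: "\<And>y. norm (\<phi> (cvec y) - \<psi> (cvec y)) \<le> N"
  shows "norm (P.Hc (P.Gc \<phi>) (cvec x) - P.Hc (P.Gc \<psi>) (cvec x)) \<le> N"
proof -
  note g = Gc_bdd_borel(1)[OF \<phi>] Gc_bdd_borel(1)[OF \<psi>]
  have b: "(\<lambda>y. P.Yc (cvec y) * \<phi> (cvec y)) \<in> bdd_borel" "(\<lambda>y. P.Yc (cvec y) * \<psi> (cvec y)) \<in> bdd_borel"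
    by (intro bdd_borel_mult P.Yc_bdd_borel \<phi> \<psi>)+
  have bs: "(\<lambda>y. of_real (P.sinkhorn_wt y) * P.Gc \<phi> (cvec y)) \<in> bdd_borel" "(\<lambda>y. of_real (P.sinkhorn_wt y) * P.Gc \<psi> (cvec y)) \<in> bdd_borel"
    by (intro bdd_borel_mult P.skc_bdd_borel g)+
  have G: "P.Gc \<phi> w - P.Gc \<psi> w = P.Gc (\<lambda>w. \<phi> w - \<psi> w) w" for w
    unfolding P.Gc_def right_diff_distrib C.Ku_diff[OF e2 b] ..
  have "P.Hc (P.Gc \<phi>) (cvec x) - P.Hc (P.Gc \<psi>) (cvec x) = P.Hc (\<lambda>w. P.Gc \<phi> w - P.Gc \<psi> w) (cvec x)"
    unfolding P.Hc_def right_diff_distrib P.Ku_diff[OF e2 bs] ..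
  also have "norm \<dots> \<le> N"
    by (rule P.norm_Hc_le[OF bdd_borel_diff[OF g]]) (simp add: G P.norm_Gc_le[OF bdd_borel_diff[OF \<phi> \<psi>] N])
  finally show ?thesis .
qed

text \<open>The one-step error is taken at the iterate of the sampled operator, whose size never
  exceeds N, and earlier errors are not enlarged by the contraction
  \<open>P.Hc \<circ> P.Gc\<close>. Hence n errors simply add up.\<close>

lemma Q_diff:
  assumes \<phi>: "\<phi> \<in> Hinf L 0" and N: "\<And>y. norm (\<phi> (cvec y)) \<le> N"
  shows "norm (((Q.Hc \<circ> Q.Gc) ^^ n) \<phi> (cvec x) - ((P.Hc \<circ> P.Gc) ^^ n) \<phi> (cvec x)) \<le> cT * (\<delta> * N) * real n"
proof -
  have N0: "0 \<le> N" using N[of 0] norm_ge_zero order_trans by blast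
  have it: "(\<lambda>y. ((Q.Hc \<circ> Q.Gc) ^^ n) \<phi> (cvec y)) \<in> bdd_borel \<and> (\<lambda>y. ((P.Hc \<circ> P.Gc) ^^ n) \<phi> (cvec y)) \<in> bdd_borel \<and> (\<forall>y. norm (((Q.Hc \<circ> Q.Gc) ^^ n) \<phi> (cvec y)) \<le> N)" for n
  proof (induction n)
    case 0 then show ?case using Hinf_bdd_borel[OF L order_refl \<phi>] N by simp
  next
    case (Suc n)
    have q: "(\<lambda>y. ((Q.Hc \<circ> Q.Gc) ^^ n) \<phi> (cvec y)) \<in> bdd_borel" and p: "(\<lambda>y. ((P.Hc \<circ> P.Gc) ^^ n) \<phi> (cvec y)) \<in> bdd_borel"
      and b: "\<And>y. norm (((Q.Hc \<circ> Q.Gc) ^^ n) \<phi> (cvec y)) \<le> N" using Suc by blast+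
    show ?case
      unfolding funpow_comp_Suc
      using Hinf_bdd_borel[OF L order_refl Q.Hc_Hinf[OF Gc_bdd_borel(2)[OF q]]] Hinf_bdd_borel[OF L order_refl P.Hc_Hinf[OF Gc_bdd_borel(1)[OF p]]]
        Q.norm_Hc_le[OF Gc_bdd_borel(2)[OF q] Q.norm_Gc_le[OF q b]] by blast
  qed
  show ?thesis
  proof (induction n arbitrary: x)
    case 0 then show ?case by simp
  next
    case (Suc n)
    let ?q = "((Q.Hc \<circ> Q.Gc) ^^ n) \<phi>" and ?p = "((P.Hc \<circ> P.Gc) ^^ n) \<phi>"
    have q: "(\<lambda>y. ?q (cvec y)) \<in> bdd_borel" "\<And>y. norm (?q (cvec y)) \<le> N" and p: "(\<lambda>y. ?p (cvec y)) \<in> bdd_borel" using it[of n] by auto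
    have "((Q.Hc \<circ> Q.Gc) ^^ Suc n) \<phi> (cvec x) - ((P.Hc \<circ> P.Gc) ^^ Suc n) \<phi> (cvec x) =
      (Q.Hc (Q.Gc ?q) (cvec x) - P.Hc (P.Gc ?q) (cvec x)) + (P.Hc (P.Gc ?q) (cvec x) - P.Hc (P.Gc ?p) (cvec x))"
      unfolding funpow_comp_Suc by simp
    also have "norm \<dots> \<le> cT * (\<delta> * N) + cT * (\<delta> * N) * real n"
      by (rule norm_triangle_mono[OF T_diff[OF q] PT_diff_le[OF q(1) p Suc]])
    also have "\<dots> = cT * (\<delta> * N) * real (Suc n)" by (simp add: algebra_simps)
    finally show ?case .
  qed
qed

end

end

section \<open>Operator norms\<close>

lemma op_norm_leI:
  assumes mem: "\<And>\<phi>. \<phi> \<in> Hinf L a \<Longrightarrow> T \<phi> \<in> Hinf L b"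
    and le: "\<And>\<phi> w. \<phi> \<in> Hinf L a \<Longrightarrow> (\<And>w. w \<in> strip a \<Longrightarrow> norm (\<phi> w) \<le> 1) \<Longrightarrow> w \<in> strip b \<Longrightarrow> norm (T \<phi> w) \<le> c"
  shows "op_norm L a b T \<le> ennreal c"
proof -
  have "Hnorm b (T \<phi>) \<le> ennreal c" if \<phi>: "\<phi> \<in> Hinf L a" "Hnorm a \<phi> \<le> 1" for \<phi>
  proof -
    have "norm (\<phi> w) \<le> 1" if "w \<in> strip a" for w
      using \<phi>(2) that unfolding Hnorm_def SUP_le_iff by simp
    then show ?thesis unfolding Hnorm_def by (intro SUP_least ennreal_leI le \<phi>(1))
  qed
  then show ?thesis using mem by (auto simp: op_norm_def intro!: SUP_least)
qed

lemma Hinf_cmult: "\<phi> \<in> Hinf L z \<Longrightarrow> (\<lambda>w. c * \<phi> w) \<in> Hinf L z"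
  by (rule Hinf_mult) (auto simp: Hinf_def holo_at_def intro!: exI[of _ "\<lambda>_. 0"])

text \<open>\<open>op_norm\<close> is a supremum over the unit ball of an arbitrary map; with
  homogeneity, scaling \<phi> into the ball extends the bound to every size N.\<close>

lemma op_normD:
  assumes fin: "op_norm L a b T = ennreal d" and d: "0 \<le> d" and a: "0 \<le> a"
    and hom: "\<And>c \<phi> w. \<phi> \<in> Hinf L a \<Longrightarrow> T (\<lambda>w. of_real c * \<phi> w) w = of_real c * T \<phi> w"
    and \<phi>: "\<phi> \<in> Hinf L a" and N: "\<And>w. w \<in> strip a \<Longrightarrow> norm (\<phi> w) \<le> N" and w: "w \<in> strip b"
  shows "norm (T \<phi> w) \<le> d * N"
proof (rule field_le_epsilon)
  fix \<eta> :: real assume \<eta>: "0 < \<eta>"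
  have N0: "0 \<le> N" using N[OF cvec_in_strip[OF a, of 0]] norm_ge_zero order_trans by blast
  \<comment> \<open>N may be 0, so the scaling uses a slightly larger number; the summand makes
    \<open>d * K\<close> exceed \<open>d * N\<close> by at most \<eta>.\<close>
  define K where "K = N + \<eta> / (d + 1)"
  have K: "0 < K" "N \<le> K" using N0 \<eta> d by (auto simp: K_def add_nonneg_pos)
  let ?\<phi> = "\<lambda>w. of_real (1 / K) * \<phi> w"
  have "Hnorm a ?\<phi> \<le> 1"
    unfolding Hnorm_def
  proof (rule SUP_least)
    fix w :: "complex ^ 'a" assume "w \<in> strip a"
    from N[OF this] K have "norm (?\<phi> w) \<le> 1" by (simp add: norm_mult norm_divide pos_divide_le_eq)
    then show "ennreal (norm (?\<phi> w)) \<le> 1" by simp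
  qed
  then have "?\<phi> \<in> {\<phi> \<in> Hinf L a. Hnorm a \<phi> \<le> 1}" using Hinf_cmult[OF \<phi>] by blast
  then have "Hnorm b (T ?\<phi>) \<le> (SUP \<phi>\<in>{\<phi> \<in> Hinf L a. Hnorm a \<phi> \<le> 1}. Hnorm b (T \<phi>))" by (rule SUP_upper)
  also have "\<dots> \<le> op_norm L a b T" unfolding op_norm_def by simp
  finally have "Hnorm b (T ?\<phi>) \<le> op_norm L a b T" .
  moreover have "ennreal (norm (T ?\<phi> w)) \<le> Hnorm b (T ?\<phi>)" unfolding Hnorm_def by (rule SUP_upper[OF w])
  ultimately have "ennreal (norm (T ?\<phi> w)) \<le> ennreal d" unfolding fin by (rule order_trans[rotated])
  then have "norm (T ?\<phi> w) \<le> d" using d by (simp add: ennreal_le_iff)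
  then have "norm (T \<phi> w) \<le> d * K" unfolding hom[OF \<phi>] using K by (simp add: norm_mult norm_divide pos_divide_le_eq)
  also have "\<dots> \<le> d * N + \<eta>" using d \<eta> by (simp add: K_def distrib_left divide_le_eq mult.commute[of d])
  finally show "norm (T \<phi> w) \<le> d * N + \<eta>" .
qed

theorem theorem3p8:
  fixes L s B \<epsilon>\<^sub>0 :: real
  assumes "0 < L" and "2 < s" and "0 < \<epsilon>\<^sub>0" and "0 \<le> B"
  shows "\<exists>Z\<^sub>0 > 0. \<exists>C\<^sub>9 > 0. \<exists>C\<^sub>1\<^sub>0 > 0.
    \<forall>(\<rho> :: real ^ 'd::finite \<Rightarrow> real) (M :: nat) (x :: nat \<Rightarrow> real ^ 'd) (\<epsilon> :: real) (\<zeta> :: real) (\<delta> :: ennreal).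
      torus_density L \<rho> \<longrightarrow>
      (\<exists>c > 0. AE y in lborel. c \<le> \<rho> y) \<longrightarrow>
      (\<lambda>y. complex_of_real (\<rho> y)) \<in> W_space L s \<longrightarrow>
      W_norm L s (\<lambda>y. complex_of_real (ln (\<rho> y))) = ennreal B \<longrightarrow>
      1 \<le> M \<longrightarrow>
      0 < \<epsilon> \<longrightarrow> \<epsilon> \<le> \<epsilon>\<^sub>0 \<longrightarrow>
      \<zeta> = Z\<^sub>0 * sqrt \<epsilon> \<longrightarrow>
      \<delta> = op_norm L \<zeta> 0 (KM_op L M x (\<epsilon> / 2) - K_op L \<rho> (\<epsilon> / 2)) \<longrightarrow>
      \<delta> \<le> ennreal C\<^sub>9 \<longrightarrow>
        op_norm L \<zeta> \<zeta> (P_op L (KM_op L M x) \<epsilon> - P_op L (K_op L \<rho>) \<epsilon>) \<le> ennreal C\<^sub>1\<^sub>0 * \<delta> \<and>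
        op_norm L 0 \<zeta> (G_op L (KM_op L M x) \<epsilon> - G_op L (K_op L \<rho>) \<epsilon>) \<le> ennreal C\<^sub>1\<^sub>0 * \<delta> \<and>
        op_norm L \<zeta> 0 (H_op L (KM_op L M x) \<epsilon> - H_op L (K_op L \<rho>) \<epsilon>) \<le> ennreal C\<^sub>1\<^sub>0 * \<delta> \<and>
        (\<forall>n :: nat. op_norm L 0 0 (Q_op L (KM_op L M x) \<epsilon> n - Q_op L (K_op L \<rho>) \<epsilon> n)
                      \<le> ennreal C\<^sub>1\<^sub>0 * \<delta> * of_nat n)"
proof -
  \<comment> \<open>Outside their locales the constants are functions of the dimension, L,
    \<open>B + 1\<close> and \<open>\<epsilon>\<^sub>0\<close> alone, so they can be fixed before
    \<rho>, M, x and \<epsilon>.\<close>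
  let ?\<beta> = "log_density.weight_bound TYPE('d) L (B + 1) \<epsilon>\<^sub>0"
  let ?\<kappa> = "sink_pair.\<kappa> TYPE('d) ?\<beta>" and ?cY = "sink_pair.cY TYPE('d) (B + 1) ?\<beta>"
    and ?cP = "sink_pair.cP TYPE('d) (B + 1) ?\<beta>" and ?cG = "sink_pair.cG TYPE('d) (B + 1) ?\<beta>"
    and ?cH = "sink_pair.cH TYPE('d) (B + 1) ?\<beta>" and ?cT = "sink_pair.cT TYPE('d) (B + 1) ?\<beta>"
  \<comment> \<open>Enforces \<open>?\<kappa> * d \<le> 1 / 4\<close> and
    \<open>?cY * d \<le> 1\<close>. Absolute values stand in for positivity, which is proved inside
    the locale only.\<close>
  define C9 where "C9 = 1 / (4 + 4 * \<bar>?\<kappa>\<bar> + \<bar>?cY\<bar>)"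
  define C10 where "C10 = 1 + \<bar>?cP\<bar> + \<bar>?cG\<bar> + \<bar>?cH\<bar> + \<bar>?cT\<bar>"
  have C9: "0 < C9" and C10: "0 < C10" "?cP \<le> C10" "?cG \<le> C10" "?cH \<le> C10" "?cT \<le> C10"
    by (auto simp: C9_def C10_def)
  \<comment> \<open>Z is chosen before any density is given, when positivity of
    \<open>?\<beta>\<close> is not yet available; the value 1 in the other case is a
    placeholder.\<close>
  obtain Z where Z: "0 < Z" "0 < ?\<beta> \<Longrightarrow> strip_const TYPE('d) ?\<beta> Z"
  proof (cases "0 < ?\<beta>")
    case True
    then obtain Z where "strip_const TYPE('d) ?\<beta> Z" using strip_const_exists by blast
    then show ?thesis using that by (auto simp: strip_const_def)
  next
    case False
    then show ?thesis using that[of 1] by simp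
  qed
  show ?thesis
  proof (rule exI[of _ Z], rule conjI[OF Z(1)], rule exI[of _ C9], rule conjI[OF C9], rule exI[of _ C10], rule conjI[OF C10(1)], intro allI impI)
    fix \<rho> :: "real ^ 'd \<Rightarrow> real" and M :: nat and x :: "nat \<Rightarrow> real ^ 'd" and \<epsilon> \<zeta> :: real and \<delta> :: ennreal
    assume \<rho>: "torus_density L \<rho>" "\<exists>c > 0. AE y in lborel. c \<le> \<rho> y" "W_norm L s (\<lambda>y. complex_of_real (ln (\<rho> y))) = ennreal B"
      and M: "1 \<le> M" and e: "0 < \<epsilon>" "\<epsilon> \<le> \<epsilon>\<^sub>0" and \<zeta>: "\<zeta> = Z * sqrt \<epsilon>"
      and \<delta>: "\<delta> = op_norm L \<zeta> 0 (KM_op L M x (\<epsilon> / 2) - K_op L \<rho> (\<epsilon> / 2))" and \<delta>C: "\<delta> \<le> ennreal C9"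
    have e2: "0 < \<epsilon> / 2" using e by simp
    obtain f where f: "log_density L (B + 1) f" and \<rho>f: "AE y in lborel. \<rho> y = exp (f y)"
      using density_log[OF assms(1,2,4) \<rho>] by blast
    interpret D: log_density L "B + 1" f by (rule f)
    have \<rho>m: "\<rho> \<in> borel_measurable borel" and \<rho>0: "AE y in lborel. 0 \<le> \<rho> y" using \<rho>(1) by (auto simp: torus_density_def)
    note KP = D.K_op_eq[OF \<rho>m \<rho>f] and KQ = KM_op_eq[OF assms(1) _ M]
    define d where "d = enn2real \<delta>"
    \<comment> \<open>The bound by \<open>C9\<close> makes \<delta> finite, which also rules out the
      value \<infinity> that \<open>op_norm\<close> takes when the image space is left.\<close>
    have \<delta>d: "\<delta> = ennreal d" and d0: "0 \<le> d"
      using \<delta>C by (auto simp: d_def ennreal_enn2real_if top_unique)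
    have dC: "d \<le> C9" using \<delta>C C9 unfolding \<delta>d by (subst (asm) ennreal_le_iff) auto
    have \<zeta>0: "0 \<le> \<zeta>" using Z e \<zeta> by simp
    have Hb: "(\<lambda>y. \<phi> (cvec y)) \<in> bdd_borel" if "\<phi> \<in> Hinf L z" "0 \<le> z" for \<phi> :: "complex ^ 'd \<Rightarrow> complex" and z
      by (rule Hinf_bdd_borel[OF assms(1) that(2,1)])
    have E: "norm (Ku L (empirical M x) (\<epsilon> / 2) (\<lambda>y. \<phi> (cvec y)) (cvec p) - Ku L D.\<mu> (\<epsilon> / 2) (\<lambda>y. \<phi> (cvec y)) (cvec p)) \<le> d * N"
      if \<phi>: "\<phi> \<in> Hinf L (Z * sqrt \<epsilon>)" and N: "\<And>w. w \<in> strip (Z * sqrt \<epsilon>) \<Longrightarrow> norm (\<phi> w) \<le> N" for \<phi> N p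
    proof -
      let ?T = "KM_op L M x (\<epsilon> / 2) - K_op L \<rho> (\<epsilon> / 2)"
      have T: "?T \<phi> w = Ku L (empirical M x) (\<epsilon> / 2) (\<lambda>y. \<phi> (cvec y)) w - Ku L D.\<mu> (\<epsilon> / 2) (\<lambda>y. \<phi> (cvec y)) w"
        if "\<phi> \<in> Hinf L \<zeta>" for \<phi> w
        using Hb[OF that \<zeta>0] by (simp add: KP[OF e2] KQ[OF e2])
      have "norm (?T \<phi> (cvec p)) \<le> d * N"
      proof (rule op_normD[OF \<delta>[symmetric, unfolded \<delta>d] d0 \<zeta>0])
        show "?T (\<lambda>w. of_real c * \<phi> w) w = of_real c * ?T \<phi> w" if "\<phi> \<in> Hinf L \<zeta>" for c \<phi> w
          unfolding T[OF that] T[OF Hinf_cmult[OF that]] by (simp add: Ku_cmult right_diff_distrib)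
      qed (use \<phi> N \<zeta> in \<open>auto simp: cvec_in_strip\<close>)
      then show ?thesis using T \<phi> \<zeta> by simp
    qed
    interpret S: sink_pair L "B + 1" f "empirical M x" \<epsilon> \<epsilon>\<^sub>0 ?\<beta> Z d
      by (intro sink_pair.intro[OF f] sink_pair_axioms.intro e d0 refl Z(2)[OF D.weight_bound_pos] torus_prob_empirical[OF assms(1) e(1)]) (rule E, assumption, blast)
    have "d * (4 + 4 * \<bar>?\<kappa>\<bar> + \<bar>?cY\<bar>) \<le> 1" using dC unfolding C9_def by (subst (asm) pos_le_divide_eq) auto
    then have "4 * d + 4 * (\<bar>?\<kappa>\<bar> * d) + \<bar>?cY\<bar> * d \<le> 1" by (simp add: algebra_simps)
    moreover have "?\<kappa> * d \<le> \<bar>?\<kappa>\<bar> * d" "?cY * d \<le> \<bar>?cY\<bar> * d" using d0 by (auto intro: mult_right_mono)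
    moreover have "0 \<le> \<bar>?\<kappa>\<bar> * d" "0 \<le> \<bar>?cY\<bar> * d" using d0 by auto
    ultimately have small: "?\<kappa> * d \<le> 1 / 4" "?cY * d \<le> 1" using d0 by linarith+
    have regP: "u \<in> bdd_borel" if "\<And>x. 0 < u x" "\<And>x. complex_of_real (u x) * K_op L \<rho> \<epsilon> (\<lambda>w. complex_of_real (u (re_vec w))) (cvec x) = 1" for u :: "real ^ 'd \<Rightarrow> real"
      by (rule K_op_regular[OF assms(1) e(1) \<rho>0 that])
    have regQ: "u \<in> bdd_borel" if "\<And>x. 0 < u x" "\<And>y. complex_of_real (u y) * KM_op L M x \<epsilon> (\<lambda>w. complex_of_real (u (re_vec w))) (cvec y) = 1" for u :: "real ^ 'd \<Rightarrow> real"
      by (rule KM_op_regular[OF assms(1) e(1) M that])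
    have P: "P_op L (K_op L \<rho>) \<epsilon> \<phi> = S.P.Pc \<phi>" if "(\<lambda>y. \<phi> (cvec y)) \<in> bdd_borel" for \<phi>
      by (rule S.P.P_op_eq, erule (1) KP, rule regP, blast, blast, rule that)
    have G: "G_op L (K_op L \<rho>) \<epsilon> \<phi> = S.P.Gc \<phi>" if "(\<lambda>y. \<phi> (cvec y)) \<in> bdd_borel" for \<phi>
      by (rule S.P.G_op_eq, erule (1) KP, rule regP, blast, blast, rule that)
    have H: "H_op L (K_op L \<rho>) \<epsilon> \<phi> = S.P.Hc \<phi>" if "(\<lambda>y. \<phi> (cvec y)) \<in> bdd_borel" for \<phi>
      by (rule S.P.H_op_eq, erule (1) KP, rule regP, blast, blast, rule that)
    have Q: "Q_op L (K_op L \<rho>) \<epsilon> n \<phi> = ((S.P.Hc \<circ> S.P.Gc) ^^ n) \<phi> \<and> ((S.P.Hc \<circ> S.P.Gc) ^^ n) \<phi> \<in> Hinf L 0"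
      if "\<phi> \<in> Hinf L 0" for \<phi> n
      by (rule S.P.Q_op_eq, erule (1) KP, rule regP, blast, blast, rule that)
    have P': "P_op L (KM_op L M x) \<epsilon> \<phi> = S.Q.Pc \<phi>" if "(\<lambda>y. \<phi> (cvec y)) \<in> bdd_borel" for \<phi>
      by (rule S.Q.P_op_eq, erule (1) KQ, rule regQ, blast, blast, rule that)
    have G': "G_op L (KM_op L M x) \<epsilon> \<phi> = S.Q.Gc \<phi>" if "(\<lambda>y. \<phi> (cvec y)) \<in> bdd_borel" for \<phi>
      by (rule S.Q.G_op_eq, erule (1) KQ, rule regQ, blast, blast, rule that)
    have H': "H_op L (KM_op L M x) \<epsilon> \<phi> = S.Q.Hc \<phi>" if "(\<lambda>y. \<phi> (cvec y)) \<in> bdd_borel" for \<phi>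
      by (rule S.Q.H_op_eq, erule (1) KQ, rule regQ, blast, blast, rule that)
    have Q': "Q_op L (KM_op L M x) \<epsilon> n \<phi> = ((S.Q.Hc \<circ> S.Q.Gc) ^^ n) \<phi> \<and> ((S.Q.Hc \<circ> S.Q.Gc) ^^ n) \<phi> \<in> Hinf L 0"
      if "\<phi> \<in> Hinf L 0" for \<phi> n
      by (rule S.Q.Q_op_eq, erule (1) KQ, rule regQ, blast, blast, rule that)
    note UH = S.U_Hinf[OF small, folded \<zeta>]
    have scale: "ennreal (c * d) \<le> ennreal C10 * \<delta>" if "c \<le> C10" for c
    proof -
      have "c * d \<le> C10 * d" using that d0 by (intro mult_right_mono)
      then show ?thesis unfolding \<delta>d using C10 d0 by (simp add: ennreal_leI flip: ennreal_mult)
    qed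
    show "op_norm L \<zeta> \<zeta> (P_op L (KM_op L M x) \<epsilon> - P_op L (K_op L \<rho>) \<epsilon>) \<le> ennreal C10 * \<delta> \<and>
        op_norm L 0 \<zeta> (G_op L (KM_op L M x) \<epsilon> - G_op L (K_op L \<rho>) \<epsilon>) \<le> ennreal C10 * \<delta> \<and>
        op_norm L \<zeta> 0 (H_op L (KM_op L M x) \<epsilon> - H_op L (K_op L \<rho>) \<epsilon>) \<le> ennreal C10 * \<delta> \<and>
        (\<forall>n :: nat. op_norm L 0 0 (Q_op L (KM_op L M x) \<epsilon> n - Q_op L (K_op L \<rho>) \<epsilon> n)
                      \<le> ennreal C10 * \<delta> * of_nat n)"
    proof (intro conjI allI)
      show "op_norm L \<zeta> \<zeta> (P_op L (KM_op L M x) \<epsilon> - P_op L (K_op L \<rho>) \<epsilon>) \<le> ennreal C10 * \<delta>"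
      proof (rule order_trans[OF op_norm_leI scale[OF C10(2)]])
        fix \<phi> :: "complex ^ 'd \<Rightarrow> complex" assume \<phi>: "\<phi> \<in> Hinf L \<zeta>"
        have D: "(P_op L (KM_op L M x) \<epsilon> - P_op L (K_op L \<rho>) \<epsilon>) \<phi> = (\<lambda>w. S.Q.Pc \<phi> w - S.P.Pc \<phi> w)"
          by (simp add: fun_eq_iff P[OF Hb[OF \<phi> \<zeta>0]] P'[OF Hb[OF \<phi> \<zeta>0]])
        show "(P_op L (KM_op L M x) \<epsilon> - P_op L (K_op L \<rho>) \<epsilon>) \<phi> \<in> Hinf L \<zeta>"
          unfolding D by (intro Hinf_diff S.Q.Pc_Hinf S.P.Pc_Hinf Hb[OF \<phi> \<zeta>0] UH)
        fix w :: "complex ^ 'd" assume "\<And>w. w \<in> strip \<zeta> \<Longrightarrow> norm (\<phi> w) \<le> 1" "w \<in> strip \<zeta>"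
        then show "norm ((P_op L (KM_op L M x) \<epsilon> - P_op L (K_op L \<rho>) \<epsilon>) \<phi> w) \<le> ?cP * d"
          unfolding D using S.P_diff[OF small \<phi>[unfolded \<zeta>], of 1 w] by (simp add: \<zeta>)
      qed
      show "op_norm L 0 \<zeta> (G_op L (KM_op L M x) \<epsilon> - G_op L (K_op L \<rho>) \<epsilon>) \<le> ennreal C10 * \<delta>"
      proof (rule order_trans[OF op_norm_leI scale[OF C10(3)]])
        fix \<phi> :: "complex ^ 'd \<Rightarrow> complex" assume \<phi>: "\<phi> \<in> Hinf L 0"
        note b = Hb[OF \<phi> order_refl]
        have D: "(G_op L (KM_op L M x) \<epsilon> - G_op L (K_op L \<rho>) \<epsilon>) \<phi> = (\<lambda>w. S.Q.Gc \<phi> w - S.P.Gc \<phi> w)"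
          by (simp add: fun_eq_iff G[OF b] G'[OF b])
        show "(G_op L (KM_op L M x) \<epsilon> - G_op L (K_op L \<rho>) \<epsilon>) \<phi> \<in> Hinf L \<zeta>"
          unfolding D by (intro Hinf_diff S.Q.Gc_Hinf S.P.Gc_Hinf b UH)
        fix w :: "complex ^ 'd" assume "\<And>w. w \<in> strip 0 \<Longrightarrow> norm (\<phi> w) \<le> 1" "w \<in> strip \<zeta>"
        then show "norm ((G_op L (KM_op L M x) \<epsilon> - G_op L (K_op L \<rho>) \<epsilon>) \<phi> w) \<le> ?cG * d"
          unfolding D using S.G_diff[OF small b, of 1 w] by (simp add: \<zeta> cvec_in_strip)
      qed
      show "op_norm L \<zeta> 0 (H_op L (KM_op L M x) \<epsilon> - H_op L (K_op L \<rho>) \<epsilon>) \<le> ennreal C10 * \<delta>"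
      proof (rule order_trans[OF op_norm_leI scale[OF C10(4)]])
        fix \<phi> :: "complex ^ 'd \<Rightarrow> complex" assume \<phi>: "\<phi> \<in> Hinf L \<zeta>"
        note b = Hb[OF \<phi> \<zeta>0]
        have D: "(H_op L (KM_op L M x) \<epsilon> - H_op L (K_op L \<rho>) \<epsilon>) \<phi> = (\<lambda>w. S.Q.Hc \<phi> w - S.P.Hc \<phi> w)"
          by (simp add: fun_eq_iff H[OF b] H'[OF b])
        show "(H_op L (KM_op L M x) \<epsilon> - H_op L (K_op L \<rho>) \<epsilon>) \<phi> \<in> Hinf L 0"
          unfolding D by (intro Hinf_diff S.Q.Hc_Hinf S.P.Hc_Hinf b)
        fix w :: "complex ^ 'd" assume a: "\<And>w. w \<in> strip \<zeta> \<Longrightarrow> norm (\<phi> w) \<le> 1" "w \<in> strip 0"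
        show "norm ((H_op L (KM_op L M x) \<epsilon> - H_op L (K_op L \<rho>) \<epsilon>) \<phi> w) \<le> ?cH * d"
          unfolding D using S.H_diff[OF small \<phi>[unfolded \<zeta>], of 1 "re_vec w"] a unfolding a(2)[unfolded strip_0, symmetric] by (simp add: \<zeta>)
      qed
      fix n
      have "op_norm L 0 0 (Q_op L (KM_op L M x) \<epsilon> n - Q_op L (K_op L \<rho>) \<epsilon> n) \<le> ennreal (?cT * d * real n)"
      proof (rule op_norm_leI)
        fix \<phi> :: "complex ^ 'd \<Rightarrow> complex" assume \<phi>: "\<phi> \<in> Hinf L 0"
        note q = Q[OF \<phi>, of n] Q'[OF \<phi>, of n]
        have D: "(Q_op L (KM_op L M x) \<epsilon> n - Q_op L (K_op L \<rho>) \<epsilon> n) \<phi> = (\<lambda>w. ((S.Q.Hc \<circ> S.Q.Gc) ^^ n) \<phi> w - ((S.P.Hc \<circ> S.P.Gc) ^^ n) \<phi> w)"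
          unfolding fun_diff_def q[THEN conjunct1] ..
        show "(Q_op L (KM_op L M x) \<epsilon> n - Q_op L (K_op L \<rho>) \<epsilon> n) \<phi> \<in> Hinf L 0"
          unfolding D by (intro Hinf_diff q[THEN conjunct2])
        fix w :: "complex ^ 'd" assume a: "\<And>w. w \<in> strip 0 \<Longrightarrow> norm (\<phi> w) \<le> 1" "w \<in> strip 0"
        have "norm (\<phi> (cvec y)) \<le> 1" for y by (rule a(1)) (simp add: cvec_in_strip)
        from S.Q_diff[OF small \<phi> this, of n "re_vec w"]
        show "norm ((Q_op L (KM_op L M x) \<epsilon> n - Q_op L (K_op L \<rho>) \<epsilon> n) \<phi> w) \<le> ?cT * d * real n"
          unfolding D using a(2)[unfolded strip_0, symmetric] by simp
      qed
      also have "\<dots> \<le> ennreal C10 * \<delta> * of_nat n"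
      proof -
        have "?cT * d * real n \<le> C10 * d * real n" using C10 d0 by (intro mult_right_mono) auto
        then show ?thesis unfolding \<delta>d using C10 d0 by (simp add: ennreal_leI ennreal_of_nat_eq_real_of_nat flip: ennreal_mult)
      qed
      finally show "op_norm L 0 0 (Q_op L (KM_op L M x) \<epsilon> n - Q_op L (K_op L \<rho>) \<epsilon> n) \<le> ennreal C10 * \<delta> * of_nat n" .
    qed
  qed
qed

end
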